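(* Let $A$ be a unital simple $C^*$-algebra with a unique normalized trace $\tau$. Then $$\mathcal{F}(A)=\{\tau\otimes \mathrm{Tr}(p)\in\mathbb{R}_+^\times \;:\; p \text{ is a projection in } M_n(A) \text{ for some } n\in\mathbb{N} \text{ such that } pM_n(A)p\cong A\},$$ where $\mathrm{Tr}$ is the usual unnormalized trace on $M_n(\mathbb{C})$.
   Context: $\mathbb{R}_+^\times$ is the multiplicative group of positive reals. $\mathbb{K}$ is the $C^*$-algebra of compact operators on a separable infinite-dimensional Hilbert space. A normalized trace is a tracial state. (On a unital $C^*$-algebra every densely defined trace is bounded, so $\tau$ is, up to scalar multiple, the unique nonzero densely defined lower semicontinuous trace on $A$.) Let $\hat\tau$ be the induced trace $\tau\otimes\mathrm{Tr}$ on $A\otimes\mathbb{K}$ (values in $[0,\infty]$ on positive elements), and for $h\in(A\otimes\mathbb{K})_+$ put $d_\tau(h)=\lim_{n\to\infty}\hat\tau(h^{1/n})$. The fundamental group of $A$ is $$\mathcal{F}(A)=\left\{\frac{d_\tau(h_1)}{d_\tau(h_2)}\in\mathbb{R}_+^\times : h_1,h_2\in (A\otimes\mathbb{K})_+\setminus\{0\},\ \overline{h_1(A\otimes\mathbb{K})h_1}\cong\overline{h_2(A\otimes\mathbb{K})h_2},\ d_\tau(h_2)<\infty\right\},$$ where $\cong$ is isomorphism of $C^*$-algebras. *)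

theory Defs
  imports
    Complex_Main
    "HOL-Library.Extended_Nonnegative_Real"
    "Jordan_Normal_Form.Matrix"
begin

section \<open>Unital C*-algebras and tracial states\<close>

class unital_cstar_algebra = real_normed_algebra_1 + banach +
  fixes scaleC :: "complex \<Rightarrow> 'a \<Rightarrow> 'a" (infixr \<open>*\<^sub>C\<close> 75)
    and star :: "'a \<Rightarrow> 'a"
  assumes scaleC_of_real: "complex_of_real r *\<^sub>C x = r *\<^sub>R x"
    and scaleC_add_right: "c *\<^sub>C (x + y) = c *\<^sub>C x + c *\<^sub>C y"
    and scaleC_add_left: "(c + d) *\<^sub>C x = c *\<^sub>C x + d *\<^sub>C x"
    and scaleC_scaleC: "c *\<^sub>C d *\<^sub>C x = (c * d) *\<^sub>C x"
    and mult_scaleC_left: "(c *\<^sub>C x) * y = c *\<^sub>C (x * y)"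
    and mult_scaleC_right: "x * (c *\<^sub>C y) = c *\<^sub>C (x * y)"
    and norm_scaleC: "norm (c *\<^sub>C x) = cmod c * norm x"
    and star_add: "star (x + y) = star x + star y"
    and star_scaleC: "star (c *\<^sub>C x) = cnj c *\<^sub>C star x"
    and star_mult: "star (x * y) = star y * star x"
    and star_star: "star (star x) = x"
    and cstar_identity: "norm (star x * x) = (norm x)\<^sup>2"

instantiation complex :: unital_cstar_algebra
begin

definition scaleC_complex :: "complex \<Rightarrow> complex \<Rightarrow> complex" where
  "scaleC_complex c x = c * x"

definition star_complex :: "complex \<Rightarrow> complex" where
  "star_complex x = cnj x"

instance
  by standard
    (simp_all add: scaleC_complex_def star_complex_def scaleR_conv_of_real algebra_simps
      norm_mult power2_eq_square)

end

definition closed_ideal :: "'a::unital_cstar_algebra set \<Rightarrow> bool" where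
  "closed_ideal I \<longleftrightarrow> closed I \<and> 0 \<in> I \<and> (\<forall>x\<in>I. \<forall>y\<in>I. x + y \<in> I) \<and>
     (\<forall>c. \<forall>x\<in>I. c *\<^sub>C x \<in> I) \<and> (\<forall>a. \<forall>x\<in>I. a * x \<in> I \<and> x * a \<in> I)"

definition simple_cstar :: "'a::unital_cstar_algebra itself \<Rightarrow> bool" where
  "simple_cstar _ \<longleftrightarrow> (\<forall>I::'a set. closed_ideal I \<longrightarrow> I = {0} \<or> I = UNIV)"

definition tracial_state :: "('a::unital_cstar_algebra \<Rightarrow> complex) \<Rightarrow> bool" where
  "tracial_state \<tau> \<longleftrightarrow>
     (\<forall>x y. \<tau> (x + y) = \<tau> x + \<tau> y) \<and> (\<forall>c x. \<tau> (c *\<^sub>C x) = c * \<tau> x) \<and>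
     (\<forall>x. Im (\<tau> (star x * x)) = 0 \<and> 0 \<le> Re (\<tau> (star x * x))) \<and>
     \<tau> 1 = 1 \<and> (\<forall>x y. \<tau> (x * y) = \<tau> (y * x))"


section \<open>Isomorphism of *-algebras given by carriers\<close>

record 'b star_algebra =
  elems :: "'b set"
  add_op :: "'b \<Rightarrow> 'b \<Rightarrow> 'b"
  scale_op :: "complex \<Rightarrow> 'b \<Rightarrow> 'b"
  mult_op :: "'b \<Rightarrow> 'b \<Rightarrow> 'b"
  star_op :: "'b \<Rightarrow> 'b"

text \<open>The isomorphisms of C*-algebras are the bijective *-homomorphisms; these are automatically
  isometric, so no norm is recorded.\<close>

definition star_isomorphic :: "'b star_algebra \<Rightarrow> 'c star_algebra \<Rightarrow> bool" where
  "star_isomorphic B C \<longleftrightarrow> (\<exists>\<phi>. bij_betw \<phi> (elems B) (elems C) \<and>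
     (\<forall>x\<in>elems B. \<forall>y\<in>elems B. \<phi> (add_op B x y) = add_op C (\<phi> x) (\<phi> y)) \<and>
     (\<forall>c. \<forall>x\<in>elems B. \<phi> (scale_op B c x) = scale_op C c (\<phi> x)) \<and>
     (\<forall>x\<in>elems B. \<forall>y\<in>elems B. \<phi> (mult_op B x y) = mult_op C (\<phi> x) (\<phi> y)) \<and>
     (\<forall>x\<in>elems B. \<phi> (star_op B x) = star_op C (\<phi> x)))"

definition whole_algebra :: "'a::unital_cstar_algebra star_algebra" where
  "whole_algebra = \<lparr>elems = UNIV, add_op = (+), scale_op = scaleC, mult_op = (*), star_op = star\<rparr>"


section \<open>Matrix algebras over A\<close>

definition mat_star :: "'a::unital_cstar_algebra mat \<Rightarrow> 'a mat" where
  "mat_star p = transpose_mat (map_mat star p)"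

definition mat_algebra :: "nat \<Rightarrow> 'a::unital_cstar_algebra mat star_algebra" where
  "mat_algebra n = \<lparr>elems = carrier_mat n n, add_op = (+), scale_op = (\<lambda>c. map_mat (scaleC c)),
     mult_op = (*), star_op = mat_star\<rparr>"

definition mat_projection :: "nat \<Rightarrow> 'a::unital_cstar_algebra mat \<Rightarrow> bool" where
  "mat_projection n p \<longleftrightarrow> p \<in> carrier_mat n n \<and> p * p = p \<and> mat_star p = p"

definition mat_corner :: "nat \<Rightarrow> 'a::unital_cstar_algebra mat \<Rightarrow> 'a mat star_algebra" where
  "mat_corner n p = (mat_algebra n)\<lparr>elems := {p * x * p | x. x \<in> carrier_mat n n}\<rparr>"

definition mat_trace :: "('a \<Rightarrow> complex) \<Rightarrow> 'a::unital_cstar_algebra mat \<Rightarrow> complex" where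
  "mat_trace \<tau> p = (\<Sum>i<dim_row p. \<tau> (p $$ (i, i)))"


section \<open>Compact operators on the Hilbert space of square-summable sequences\<close>

definition ell2 :: "(nat \<Rightarrow> complex) set" where
  "ell2 = {f. summable (\<lambda>i. (cmod (f i))\<^sup>2)}"

definition ell2_norm :: "(nat \<Rightarrow> complex) \<Rightarrow> real" where
  "ell2_norm f = sqrt (\<Sum>i. (cmod (f i))\<^sup>2)"

definition ell2_basis :: "nat \<Rightarrow> nat \<Rightarrow> complex" where
  "ell2_basis j = (\<lambda>i. if i = j then 1 else 0)"

definition compact_operator :: "((nat \<Rightarrow> complex) \<Rightarrow> nat \<Rightarrow> complex) \<Rightarrow> bool" where
  "compact_operator T \<longleftrightarrow>
     (\<forall>f\<in>ell2. T f \<in> ell2) \<and>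
     (\<forall>f\<in>ell2. \<forall>g\<in>ell2. T (\<lambda>i. f i + g i) = (\<lambda>i. T f i + T g i)) \<and>
     (\<forall>c. \<forall>f\<in>ell2. T (\<lambda>i. c * f i) = (\<lambda>i. c * T f i)) \<and>
     (\<forall>F :: nat \<Rightarrow> nat \<Rightarrow> complex. (\<forall>n. F n \<in> ell2 \<and> ell2_norm (F n) \<le> 1) \<longrightarrow>
        (\<exists>g\<in>ell2. \<exists>r. strict_mono r \<and> (\<lambda>n. ell2_norm (\<lambda>i. T (F (r n)) i - g i)) \<longlonglongrightarrow> 0))"


section \<open>The tensor product of A with the compact operators\<close>

text \<open>Elements are matrices over A indexed by all natural numbers, read as operators on the
  standard Hilbert A-module of square-summable sequences in A, i.e. the tensor product of A with
  the Hilbert space of square-summable complex sequences; its inner product is \<open>\<langle>v, u\<rangle> = \<Sum>i. star (v i) * u i\<close>.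
  The norm below is the operator norm, tested on the dense submodule of finitely supported
  vectors; it takes the value \<open>\<infinity>\<close> on matrices that define no bounded operator. Restricted to the
  algebraic tensor product with the compact operators it is the C*-tensor norm, which is unique
  because the compact operators are nuclear.\<close>

type_synonym 'a imat = "nat \<Rightarrow> nat \<Rightarrow> 'a"

definition imat_norm :: "'a::unital_cstar_algebra imat \<Rightarrow> ennreal" where
  "imat_norm x = (SUP (n, u, v) \<in> {(n :: nat, u :: nat \<Rightarrow> 'a, v :: nat \<Rightarrow> 'a).
        norm (\<Sum>i<n. star (u i) * u i) \<le> 1 \<and> norm (\<Sum>i<n. star (v i) * v i) \<le> 1}.
      ennreal (norm (\<Sum>i<n. \<Sum>j<n. star (v i) * x i j * u j)))"

definition imat_closure :: "'a::unital_cstar_algebra imat set \<Rightarrow> 'a imat set" where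
  "imat_closure S = {x. \<forall>\<epsilon>>0. \<exists>y\<in>S. imat_norm (\<lambda>i j. x i j - y i j) < ennreal \<epsilon>}"

definition elem_tensor ::
    "'a::unital_cstar_algebra \<Rightarrow> ((nat \<Rightarrow> complex) \<Rightarrow> nat \<Rightarrow> complex) \<Rightarrow> 'a imat" where
  "elem_tensor a T = (\<lambda>i j. T (ell2_basis j) i *\<^sub>C a)"

definition algebraic_tensor :: "'a::unital_cstar_algebra imat set" where
  "algebraic_tensor = {(\<lambda>i j. \<Sum>l<m. elem_tensor (a l) (T l) i j) | (m :: nat) a T.
     \<forall>l<m. compact_operator (T l)}"

definition imat_star :: "'a::unital_cstar_algebra imat \<Rightarrow> 'a imat" where
  "imat_star x = (\<lambda>i j. star (x j i))"

text \<open>For matrices in \<open>tensor_K\<close> the series converge in norm.\<close>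

definition imat_mult :: "'a::unital_cstar_algebra imat \<Rightarrow> 'a imat \<Rightarrow> 'a imat" where
  "imat_mult x y = (\<lambda>i j. \<Sum>k. x i k * y k j)"

definition imat_power :: "'a::unital_cstar_algebra imat \<Rightarrow> nat \<Rightarrow> 'a imat" where
  "imat_power x n = (imat_mult x ^^ n) (\<lambda>i j. if i = j then 1 else 0)"

definition tensor_K :: "'a::unital_cstar_algebra imat star_algebra" where
  "tensor_K = \<lparr>elems = imat_closure algebraic_tensor, add_op = (\<lambda>x y i j. x i j + y i j),
     scale_op = (\<lambda>c x i j. c *\<^sub>C x i j), mult_op = imat_mult, star_op = imat_star\<rparr>"

definition tensor_K_pos :: "'a::unital_cstar_algebra imat set" where
  "tensor_K_pos = {imat_mult (imat_star y) y | y. y \<in> elems tensor_K}"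

definition hereditary :: "'a::unital_cstar_algebra imat \<Rightarrow> 'a imat star_algebra" where
  "hereditary h = tensor_K
     \<lparr>elems := imat_closure {imat_mult (imat_mult h x) h | x. x \<in> elems tensor_K}\<rparr>"


section \<open>The dimension function and the fundamental group\<close>

text \<open>The trace \<open>\<tau> \<otimes> Tr\<close> on positive elements, whose diagonal entries are positive in A.\<close>

definition trace_hat :: "('a::unital_cstar_algebra \<Rightarrow> complex) \<Rightarrow> 'a imat \<Rightarrow> ennreal" where
  "trace_hat \<tau> h = (\<Sum>i. ennreal (Re (\<tau> (h i i))))"

text \<open>The root \<open>h\<^sup>1\<^sup>/\<^sup>n\<close> of the functional calculus is the only positive \<open>n\<close>-th root of \<open>h\<close>.\<close>

definition pos_root :: "nat \<Rightarrow> 'a::unital_cstar_algebra imat \<Rightarrow> 'a imat" where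
  "pos_root n h = (THE k. k \<in> tensor_K_pos \<and> imat_power k n = h)"

definition dim_fun :: "('a::unital_cstar_algebra \<Rightarrow> complex) \<Rightarrow> 'a imat \<Rightarrow> ennreal" where
  "dim_fun \<tau> h = lim (\<lambda>n. trace_hat \<tau> (pos_root n h))"

text \<open>Requiring the quotient to be \<open>ennreal r\<close> with \<open>r > 0\<close> restricts to quotients in the positive
  reals: division in \<^typ>\<open>ennreal\<close> by 0 only gives 0 or \<open>\<infinity>\<close>.\<close>

definition fundamental_group :: "('a::unital_cstar_algebra \<Rightarrow> complex) \<Rightarrow> real set" where
  "fundamental_group \<tau> = {r. 0 < r \<and> (\<exists>h\<^sub>1 h\<^sub>2.
     h\<^sub>1 \<in> tensor_K_pos - {\<lambda>i j. 0} \<and> h\<^sub>2 \<in> tensor_K_pos - {\<lambda>i j. 0} \<and>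
     star_isomorphic (hereditary h\<^sub>1) (hereditary h\<^sub>2) \<and>
     dim_fun \<tau> h\<^sub>2 < \<infinity> \<and> dim_fun \<tau> h\<^sub>1 / dim_fun \<tau> h\<^sub>2 = ennreal r)}"

end

theory Submission imports Defs "HOL-Analysis.Generalised_Binomial_Theorem" "HOL-Analysis.L2_Norm"
begin

text \<open>Write \<open>K\<close> for the compact operators, \<open>e\<close> for the unit of the corner \<open>A = e(A \<otimes> K)e\<close> at the matrix
  position \<open>(0, 0)\<close>, and \<open>her h\<close> for the closure of \<open>h(A \<otimes> K)h\<close>. Two facts about the trace carry the
  proof.

  First, \<open>d\<^sub>\<tau>(h)\<close> is determined by \<open>her h\<close>: it is the supremum of the trace over the positive
  contractions in \<open>her h\<close>. The normalized roots of \<open>h\<close> are such contractions; as they are also an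
  approximate unit of \<open>her h\<close> and the trace is lower semicontinuous, no other one has a trace beyond
  the limit of theirs (\<open>mtr_root_tendsto\<close>, \<open>dim_fun_eq_her_mass\<close>).

  Second, every *-isomorphism \<open>\<phi>\<close> of \<open>her h\<^sub>1\<close> onto \<open>her h\<^sub>2\<close> multiplies the trace by a constant \<open>\<lambda>\<close> if
  \<open>d\<^sub>\<tau>(h\<^sub>2)\<close> is finite. Simplicity of \<open>A\<close> yields finitely many \<open>v\<^sub>k \<in> h\<^sub>1(A \<otimes> K)e\<close> with
  \<open>\<Sum> v\<^sub>k\<^sup>*v\<^sub>k = e\<close> (\<open>frame_exists\<close>). The functional \<open>\<sigma>(a) = \<Sum> (\<tau> \<otimes> Tr)(\<phi>(v\<^sub>k a v\<^sub>k\<^sup>*))\<close> on \<open>A\<close> is positive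
  and tracial, so that \<open>\<sigma> = \<lambda>\<tau>\<close> by uniqueness of \<open>\<tau>\<close> (\<open>\<sigma>_eq\<close>), and the trace property carries this
  over to all of \<open>her h\<^sub>1\<close> (\<open>mtr_\<phi>\<close>). Hence \<open>\<lambda> = d\<^sub>\<tau>(h\<^sub>2)/d\<^sub>\<tau>(h\<^sub>1)\<close> (\<open>her_mass_scale\<close>).

  This number is the trace of a projection: the matrices \<open>(\<phi>(v\<^sub>k a v\<^sub>l\<^sup>*))\<^sub>k\<^sub>,\<^sub>l\<close> form a copy of \<open>A\<close> which is
  exactly the corner of the projection belonging to \<open>a = 1\<close>, and the trace of the latter is
  \<open>\<sigma>(1) = \<lambda>\<close>. The blocks are compact and in general not finite, but after cutting all of them down to a large
  finite size and correcting by the inverse square root of an element of \<open>A\<close> close to \<open>1\<close> the same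
  holds exactly, with an unchanged trace (\<open>projection_exists\<close>).

  The converse is the observation that \<open>p M\<^sub>n(A) p\<close> and \<open>A\<close> are the hereditary subalgebras generated by
  the positive elements \<open>p\<close> and \<open>e\<close>, for which \<open>d\<^sub>\<tau>\<close> is just the trace
  (\<open>projection_imp_fundamental_group\<close>).

  The operator algebra behind this is elementary. Positivity is expressed by norms, and roots of
  positive elements come from the binomial series, whose coefficients are absolutely summable; with
  Kaplansky's theorem (\<open>cpos_star_mult\<close>) this replaces spectral theory. To have roots in \<open>A \<otimes> K\<close>, it is
  realized as the closed ideal generated by the finite matrices in the unital C*-algebra of norm
  limits of scalar plus finite matrices (\<open>tensor_K_elems\<close>).\<close>

section \<open>Elementary consequences of the C*-identity\<close>

lemma star_zero [simp]: "star (0::'a::unital_cstar_algebra) = 0"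
  using star_add[of "0::'a" 0] by simp

lemma star_minus [simp]: "star (- x) = - star (x::'a::unital_cstar_algebra)"
  using star_add[of x "- x"] by (simp add: eq_neg_iff_add_eq_0 add.commute)

lemma star_diff [simp]: "star (x - y) = star x - star (y::'a::unital_cstar_algebra)"
  using star_add[of x "- y"] by simp

lemma star_one [simp]: "star (1::'a::unital_cstar_algebra) = 1"
proof -
  have "star (star (1::'a) * 1) = star 1 * star (star 1)" by (rule star_mult)
  then show ?thesis by (simp add: star_star)
qed

lemma star_scaleR [simp]: "star (r *\<^sub>R x) = r *\<^sub>R star (x::'a::unital_cstar_algebra)"
  using star_scaleC[of "complex_of_real r" x] by (simp add: scaleC_of_real)

lemma star_of_real [simp]: "star (of_real r :: 'a::unital_cstar_algebra) = of_real r"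
  by (simp add: of_real_def)

lemma star_sum: "star (sum f A) = (\<Sum>i\<in>A. star (f i :: 'a::unital_cstar_algebra))"
  by (induction A rule: infinite_finite_induct) (simp_all add: star_add)

lemma star_power: "star (x ^ n) = star (x::'a::unital_cstar_algebra) ^ n"
  by (induction n) (simp_all add: star_mult power_commutes)

lemma scaleC_zero_right [simp]: "c *\<^sub>C (0::'a::unital_cstar_algebra) = 0"
  using scaleC_add_right[of c "0::'a" 0] by simp

lemma scaleC_zero_left [simp]: "0 *\<^sub>C (x::'a::unital_cstar_algebra) = 0"
  using scaleC_of_real[of 0 x] by simp

lemma scaleC_one [simp]: "1 *\<^sub>C (x::'a::unital_cstar_algebra) = x"
  using scaleC_of_real[of 1 x] by simp

lemma scaleC_minus_right: "c *\<^sub>C (- x) = - (c *\<^sub>C (x::'a::unital_cstar_algebra))"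
  using scaleC_add_right[of c x "- x"] by (simp add: eq_neg_iff_add_eq_0 add.commute)

lemma scaleC_minus_one [simp]: "(-1) *\<^sub>C (x::'a::unital_cstar_algebra) = - x"
  using scaleC_of_real[of "-1" x] by simp

lemma scaleC_diff_right: "c *\<^sub>C (x - y) = c *\<^sub>C x - c *\<^sub>C (y::'a::unital_cstar_algebra)"
  using scaleC_add_right[of c x "- y"] by (simp add: scaleC_minus_right)

lemma scaleC_diff_left: "(c - d) *\<^sub>C x = c *\<^sub>C x - d *\<^sub>C (x::'a::unital_cstar_algebra)"
  using scaleC_add_left[of "c - d" d x] by simp

lemma scaleC_sum: "c *\<^sub>C (sum f A) = (\<Sum>i\<in>A. c *\<^sub>C (f i :: 'a::unital_cstar_algebra))"
  by (induction A rule: infinite_finite_induct) (simp_all add: scaleC_add_right)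

lemma star_in_norm [simp]: "norm (star x) = norm (x::'a::unital_cstar_algebra)"
proof -
  have le: "norm y \<le> norm (star y)" for y :: 'a
  proof (cases "norm y = 0")
    case False
    have "norm y * norm y \<le> norm (star y) * norm y"
      using cstar_identity[of y] norm_mult_ineq[of "star y" y] by (simp add: power2_eq_square)
    then show ?thesis using False by (simp add: mult_le_cancel_right)
  qed simp
  show ?thesis using le[of x] le[of "star x"] by (simp add: star_star)
qed

lemma star_mult_self_eq_0 [simp]: "star x * x = 0 \<longleftrightarrow> x = (0::'a::unital_cstar_algebra)"
  using cstar_identity[of x] by auto

lemma bounded_linear_star: "bounded_linear (star :: 'a::unital_cstar_algebra \<Rightarrow> 'a)"
  by (rule bounded_linear_intro[of _ 1]) (simp_all add: star_add)

lemma bounded_linear_scaleC: "bounded_linear (\<lambda>x::'a::unital_cstar_algebra. c *\<^sub>C x)"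
proof (rule bounded_linear_intro[of _ "cmod c"])
  fix r and x :: 'a
  show "c *\<^sub>C r *\<^sub>R x = r *\<^sub>R c *\<^sub>C x"
    by (metis scaleC_of_real scaleC_scaleC mult.commute)
qed (simp_all add: scaleC_add_right norm_scaleC mult.commute)

lemmas tendsto_star = bounded_linear.tendsto[OF bounded_linear_star]

lemma norm_selfadj_power2:
  "star a = a \<Longrightarrow> norm (a\<^sup>2) = (norm (a::'a::unital_cstar_algebra))\<^sup>2"
  using cstar_identity[of a] by (simp add: power2_eq_square)

lemma norm_selfadj_power_2_power:
  "star a = a \<Longrightarrow> norm (a ^ (2 ^ m)) = norm (a::'a::unital_cstar_algebra) ^ (2 ^ m)"
proof (induction m)
  case (Suc m)
  have "norm (a ^ 2 ^ Suc m) = norm ((a ^ 2 ^ m)\<^sup>2)"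
    by (simp add: power_mult [symmetric] mult.commute)
  also have "\<dots> = (norm (a ^ 2 ^ m))\<^sup>2"
    using Suc.prems by (intro norm_selfadj_power2) (simp add: star_power)
  finally show ?case using Suc by (simp add: power_mult [symmetric] mult.commute)
qed simp

text \<open>Squaring repeatedly controls the powers of the form \<open>2\<^sup>m\<close> by the C*-identity; every other
  power is squeezed between two of these.\<close>

lemma norm_selfadj_power:
  assumes "star a = (a::'a::unital_cstar_algebra)"
  shows "norm (a ^ n) = norm a ^ n"
proof (cases "a = 0 \<or> n = 0")
  case True
  then show ?thesis by (auto simp: power_0_left)
next
  case False
  have n: "n \<le> 2 ^ n" by simp
  have "norm a ^ n * norm a ^ (2^n - n) = norm (a ^ (2^n))"
    using n by (simp add: norm_selfadj_power_2_power assms power_add [symmetric])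
  also have "\<dots> = norm (a ^ n * a ^ (2^n - n))"
    using n by (simp add: power_add [symmetric])
  also have "\<dots> \<le> norm (a ^ n) * norm a ^ (2^n - n)"
    by (rule order_trans[OF norm_mult_ineq]) (intro mult_left_mono norm_power_ineq norm_ge_zero)
  finally have "norm a ^ n \<le> norm (a ^ n)" using False by simp
  then show ?thesis using norm_power_ineq[of a n] by linarith
qed

lemma selfadj_nilpotent: "star a = a \<Longrightarrow> a ^ n = 0 \<Longrightarrow> a = (0::'a::unital_cstar_algebra)"
  using norm_selfadj_power[of a n] by simp

section \<open>Roots by absolutely convergent power series\<close>

definition fps_summable :: "real fps \<Rightarrow> bool" where
  "fps_summable F \<longleftrightarrow> summable (\<lambda>j. \<bar>fps_nth F j\<bar>)"

text \<open>A power series with absolutely summable coefficients can be applied to every element of norm at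
  most one, the boundary included. For the series below this gives all the functional calculus that
  is used.\<close>

definition fps_apply :: "real fps \<Rightarrow> 'a::{real_normed_algebra_1,banach} \<Rightarrow> 'a" where
  "fps_apply F x = (\<Sum>j. fps_nth F j *\<^sub>R x ^ j)"

lemma norm_power_le_one: "norm (x::'a::real_normed_algebra_1) \<le> 1 \<Longrightarrow> norm (x ^ j) \<le> 1"
  by (rule order_trans[OF norm_power_ineq]) (simp add: power_le_one)

lemma fps_apply_summable_norm:
  fixes x :: "'a::{real_normed_algebra_1,banach}"
  assumes "fps_summable F" "norm x \<le> 1"
  shows "summable (\<lambda>j. norm (fps_nth F j *\<^sub>R x ^ j))"
proof (rule summable_comparison_test[OF _ assms(1)[unfolded fps_summable_def]], intro exI allI impI)
  fix j
  show "norm (norm (fps_nth F j *\<^sub>R x ^ j)) \<le> \<bar>fps_nth F j\<bar>"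
    using norm_power_le_one[OF assms(2), of j] by (simp add: mult_left_le)
qed

lemma fps_apply_sums:
  fixes x :: "'a::{real_normed_algebra_1,banach}"
  assumes "fps_summable F" "norm x \<le> 1"
  shows "(\<lambda>j. fps_nth F j *\<^sub>R x ^ j) sums fps_apply F x"
  unfolding fps_apply_def
  by (rule summable_sums[OF summable_norm_cancel[OF fps_apply_summable_norm[OF assms]]])

lemma fps_summable_mult:
  assumes "fps_summable F" "fps_summable G"
  shows "fps_summable (F * G)"
proof -
  have "summable (\<lambda>k. \<Sum>i\<le>k. \<bar>fps_nth F i\<bar> * \<bar>fps_nth G (k - i)\<bar>)"
    using assms by (intro summable_Cauchy_product) (simp_all add: fps_summable_def)
  then show ?thesis
    unfolding fps_summable_def
  proof (rule summable_comparison_test[rotated], intro exI allI impI)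
    fix k
    show "norm \<bar>fps_nth (F * G) k\<bar> \<le> (\<Sum>i\<le>k. \<bar>fps_nth F i\<bar> * \<bar>fps_nth G (k - i)\<bar>)"
      by (simp add: fps_mult_nth atMost_atLeast0 flip: abs_mult)
  qed
qed

lemma fps_apply_mult:
  fixes x :: "'a::{real_normed_algebra_1,banach}"
  assumes "fps_summable F" "fps_summable G" "norm x \<le> 1"
  shows "fps_apply (F * G) x = fps_apply F x * fps_apply G x"
proof -
  have *: "(\<Sum>i\<le>k. fps_nth F i *\<^sub>R x ^ i * fps_nth G (k - i) *\<^sub>R x ^ (k - i)) = fps_nth (F * G) k *\<^sub>R x ^ k" for k
    by (simp add: fps_mult_nth scaleR_sum_left atMost_atLeast0 power_add [symmetric] mult.commute)
  show ?thesis
    unfolding fps_apply_def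
    using Cauchy_product[OF fps_apply_summable_norm[OF assms(1,3)] fps_apply_summable_norm[OF assms(2,3)]]
    by (simp only: *)
qed

lemma fps_apply_finite:
  "(\<And>j. j \<ge> n \<Longrightarrow> fps_nth F j = 0) \<Longrightarrow> fps_apply F x = (\<Sum>j<n. fps_nth F j *\<^sub>R x ^ j)"
  unfolding fps_apply_def by (rule suminf_finite) auto

lemma fps_apply_power:
  fixes x :: "'a::{real_normed_algebra_1,banach}"
  assumes "fps_summable F" "norm x \<le> 1"
  shows "fps_summable (F ^ n) \<and> fps_apply (F ^ n) x = fps_apply F x ^ n"
proof (induction n)
  case 0
  have "fps_summable 1" unfolding fps_summable_def
    by (rule summable_finite[of "{0}"]) auto
  then show ?case using fps_apply_finite[of 1 "1::real fps" x] by simp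
next
  case (Suc n)
  then show ?case using fps_summable_mult[OF assms(1)] fps_apply_mult[OF assms(1) _ assms(2)] by simp
qed

text \<open>The binomial series of \<open>(1 - X)\<^sup>1\<^sup>/\<^sup>n\<close>.\<close>

definition fps_root :: "nat \<Rightarrow> real fps" where
  "fps_root n = Abs_fps (\<lambda>j. (-1) ^ j * ((1 / real n) gchoose j))"

lemma fps_root_power:
  assumes "n \<ge> 1"
  shows "fps_root n ^ n = 1 - fps_X"
proof -
  have eq: "fps_root n = fps_binomial (1 / real n) oo (fps_const (-1) * fps_X)"
    by (simp add: fps_root_def fps_compose_linear del: fps_const_neg)
  have "fps_root n ^ n = (fps_binomial (1 / real n) ^ n) oo (fps_const (-1) * fps_X)"
    unfolding eq by (rule fps_compose_power) simp
  also have "fps_binomial (1 / real n) ^ n = 1 + fps_X"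
    using assms by (simp add: fps_binomial_power fps_binomial_1)
  finally have "fps_root n ^ n = 1 + fps_const (-1) * fps_X" by (simp add: fps_compose_add_distrib)
  moreover have "fps_const (-1::real) = -1" by (metis fps_const_neg fps_const_1_eq_1)
  ultimately show ?thesis by simp
qed

lemma fps_root_nth_0 [simp]: "fps_nth (fps_root n) 0 = 1"
  by (simp add: fps_root_def)

lemma fps_root_nonpos:
  assumes "n \<ge> 1"
  shows "fps_nth (fps_root n) (Suc j) \<le> 0"
proof (induction j)
  case 0
  then show ?case by (simp add: fps_root_def)
next
  case (Suc j)
  have "real (Suc (Suc j)) * ((1 / real n) gchoose (Suc (Suc j))) = ((1 / real n) gchoose Suc j) * (1 / real n - real (Suc j))"
    using gbinomial_mult_1[of "1 / real n" "Suc j"] by (simp add: algebra_simps)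
  then have "(-1) ^ Suc (Suc j) * (real (Suc (Suc j)) * ((1 / real n) gchoose (Suc (Suc j)))) =
      (-1) ^ Suc (Suc j) * (((1 / real n) gchoose Suc j) * (1 / real n - real (Suc j)))"
    by (rule arg_cong)
  then have "real (Suc (Suc j)) * fps_nth (fps_root n) (Suc (Suc j)) = fps_nth (fps_root n) (Suc j) * (real (Suc j) - 1 / real n)"
    unfolding fps_root_def by (simp add: algebra_simps)
  moreover have "1 / real n \<le> 1" using assms by simp
  then have "fps_nth (fps_root n) (Suc j) * (real (Suc j) - 1 / real n) \<le> 0"
    using Suc by (intro mult_nonpos_nonneg) auto
  ultimately have "real (Suc (Suc j)) * fps_nth (fps_root n) (Suc (Suc j)) \<le> 0" by (simp only:)
  then show ?case by (simp add: mult_le_0_iff del: of_nat_Suc)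
qed

text \<open>All coefficients but the first are nonpositive, so at \<open>t < 1\<close> the sum of their absolute values
  is \<open>1 - (1 - t)\<^sup>1\<^sup>/\<^sup>n\<close>; then let \<open>t\<close> tend to \<open>1\<close>.\<close>

lemma fps_root_partial_sum:
  assumes "n \<ge> 1"
  shows "(\<Sum>j<J. \<bar>fps_nth (fps_root n) (Suc j)\<bar>) \<le> 1"
proof -
  have le: "(\<Sum>j<J. \<bar>fps_nth (fps_root n) (Suc j)\<bar> * t ^ Suc j) \<le> 1" if t: "0 < t" "t < 1" for t :: real
  proof -
    have "(\<lambda>j. ((1 / real n) gchoose j) * (- t) ^ j) sums (1 + (- t)) powr (1 / real n)"
      using t by (intro gen_binomial_real) auto
    then have s0: "(\<lambda>j. fps_nth (fps_root n) j * t ^ j) sums (1 - t) powr (1 / real n)"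
      by (simp add: fps_root_def power_minus[of t] mult_ac)
    then have "(\<lambda>j. fps_nth (fps_root n) (Suc j) * t ^ Suc j) sums ((1 - t) powr (1 / real n) - 1)"
      using sums_split_initial_segment[OF s0, of 1] by simp
    from sums_minus[OF this] have s: "(\<lambda>j. \<bar>fps_nth (fps_root n) (Suc j)\<bar> * t ^ Suc j) sums (1 - (1 - t) powr (1 / real n))"
      using fps_root_nonpos[OF assms] by simp
    have "(\<Sum>j<J. \<bar>fps_nth (fps_root n) (Suc j)\<bar> * t ^ Suc j) \<le> 1 - (1 - t) powr (1 / real n)"
      using s t by (intro sum_le_suminf[of _ "{..<J}", THEN order_trans] sums_summable[OF s]) (auto simp: sums_iff)
    then show ?thesis by (smt (verit) powr_ge_zero)
  qed
  have lim: "((\<lambda>t. \<Sum>j<J. \<bar>fps_nth (fps_root n) (Suc j)\<bar> * t ^ Suc j) \<longlongrightarrow>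
      (\<Sum>j<J. \<bar>fps_nth (fps_root n) (Suc j)\<bar> * 1 ^ Suc j)) (at_left (1::real))"
    by (intro tendsto_intros)
  have "eventually (\<lambda>t::real. t \<in> {0<..<1}) (at_left 1)"
    by (rule eventually_at_leftI[of 0]) auto
  then have "eventually (\<lambda>t. (\<Sum>j<J. \<bar>fps_nth (fps_root n) (Suc j)\<bar> * t ^ Suc j) \<le> 1) (at_left (1::real))"
    by eventually_elim (use le in auto)
  from tendsto_upperbound[OF lim this] show ?thesis by simp
qed

lemma fps_root_summable:
  assumes "n \<ge> 1"
  shows "fps_summable (fps_root n)" and "(\<Sum>j. \<bar>fps_nth (fps_root n) (Suc j)\<bar>) \<le> 1"
    and "summable (\<lambda>j. \<bar>fps_nth (fps_root n) (Suc j)\<bar>)"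
proof -
  show s: "summable (\<lambda>j. \<bar>fps_nth (fps_root n) (Suc j)\<bar>)"
    by (rule summableI_nonneg_bounded[of _ 1]) (use fps_root_partial_sum[OF assms] in auto)
  then show "fps_summable (fps_root n)"
    unfolding fps_summable_def using summable_Suc_iff[of "\<lambda>j. \<bar>fps_nth (fps_root n) j\<bar>"] by simp
  show "(\<Sum>j. \<bar>fps_nth (fps_root n) (Suc j)\<bar>) \<le> 1"
    by (rule suminf_le_const[OF s]) (use fps_root_partial_sum[OF assms] in auto)
qed

lemma fps_apply_root_power:
  fixes x :: "'a::{real_normed_algebra_1,banach}"
  assumes "n \<ge> 1" "norm x \<le> 1"
  shows "fps_apply (fps_root n) x ^ n = 1 - x"
proof -
  have "fps_apply (fps_root n) x ^ n = fps_apply (1 - fps_X) x"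
    using fps_apply_power[OF fps_root_summable(1)[OF assms(1)] assms(2), of n] fps_root_power[OF assms(1)] by simp
  also have "\<dots> = 1 - x"
    using fps_apply_finite[of 2 "1 - fps_X" x] by (simp add: numeral_2_eq_2)
  finally show ?thesis .
qed

lemma norm_one_minus_fps_apply_root:
  fixes x :: "'a::{real_normed_algebra_1,banach}"
  assumes "n \<ge> 1" "norm x \<le> 1"
  shows "norm (1 - fps_apply (fps_root n) x) \<le> 1"
proof -
  note s = fps_apply_sums[OF fps_root_summable(1)[OF assms(1)] assms(2)]
  have s1: "(\<lambda>j. fps_nth (fps_root n) (Suc j) *\<^sub>R x ^ Suc j) sums (fps_apply (fps_root n) x - 1)"
    using sums_split_initial_segment[OF s, of 1] by simp
  have le: "norm (fps_nth (fps_root n) (Suc j) *\<^sub>R x ^ Suc j) \<le> \<bar>fps_nth (fps_root n) (Suc j)\<bar>" for j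
    using norm_power_le_one[OF assms(2), of "Suc j"] by (simp add: mult_left_le del: power_Suc)
  have "norm (fps_apply (fps_root n) x - 1) \<le> (\<Sum>j. \<bar>fps_nth (fps_root n) (Suc j)\<bar>)"
    using norm_suminf_le[OF le fps_root_summable(3)[OF assms(1)]] s1 by (simp add: sums_iff)
  also have "\<dots> \<le> 1" by (rule fps_root_summable(2)[OF assms(1)])
  finally show ?thesis by (simp add: norm_minus_commute)
qed

lemma fps_apply_commute:
  fixes x :: "'a::{real_normed_algebra_1,banach}"
  assumes "fps_summable F" "norm x \<le> 1" "y * x = x * y"
  shows "y * fps_apply F x = fps_apply F x * y"
proof -
  note s = fps_apply_sums[OF assms(1,2)]
  have c: "y * x ^ j = x ^ j * y" for j using assms(3)
    by (rule power_commuting_commutes[of x y, symmetric, OF sym])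
  have "(\<lambda>j. y * (fps_nth F j *\<^sub>R x ^ j)) sums (y * fps_apply F x)" by (rule sums_mult[OF s])
  moreover have "(\<lambda>j. (fps_nth F j *\<^sub>R x ^ j) * y) sums (fps_apply F x * y)" by (rule sums_mult2[OF s])
  ultimately show ?thesis by (simp add: c sums_iff)
qed

lemma fps_apply_star:
  fixes x :: "'a::unital_cstar_algebra"
  assumes "fps_summable F" "norm x \<le> 1" "star x = x"
  shows "star (fps_apply F x) = fps_apply F x"
  using bounded_linear.sums[OF bounded_linear_star fps_apply_sums[OF assms(1,2)]]
    fps_apply_sums[OF assms(1,2)] by (simp add: star_power assms(3) sums_iff)

text \<open>The coefficients of \<open>(1 - X)\<^sup>1\<^sup>/\<^sup>n\<close> sum up to zero, so that in the variable \<open>a = 1 - x\<close> the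
  root has no constant term. It therefore stays in every closed subspace that contains \<open>a\<close> and is
  stable under multiplication by \<open>a\<close>, even if \<open>1\<close> is not in it.\<close>

lemma fps_apply_root_in_ideal:
  fixes a :: "'a::{real_normed_algebra_1,banach}"
  assumes "n \<ge> 1" "norm (1 - a) \<le> 1"
    and I: "subspace I" "closed I" "a \<in> I" "\<And>x. x \<in> I \<Longrightarrow> x * a \<in> I"
  shows "fps_apply (fps_root n) (1 - a) \<in> I"
proof -
  define c where "c = fps_nth (fps_root n)"
  have pow: "1 - (1 - a) ^ j \<in> I" for j
  proof (induction j)
    case 0
    then show ?case using subspace_0[OF I(1)] by simp
  next
    case (Suc j)
    have "1 - (1 - a) ^ Suc j = (1 - (1 - a) ^ j) + a - (1 - (1 - a) ^ j) * a"
      unfolding power_Suc2 by (simp add: algebra_simps)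
    moreover have "(1 - (1 - a) ^ j) + a - (1 - (1 - a) ^ j) * a \<in> I"
      by (intro subspace_diff[OF I(1) subspace_add[OF I(1) Suc I(3)]] I(4) Suc)
    ultimately show ?case by (simp only:)
  qed
  have "fps_apply (fps_root n) (1::real) ^ n = 0"
    using fps_apply_root_power[OF assms(1), of "1::real"] by simp
  then have "fps_apply (fps_root n) (1::real) = 0" by simp
  then have "c sums 0"
    using fps_apply_sums[OF fps_root_summable(1)[OF assms(1)], of "1::real"] by (simp add: c_def)
  then have "(\<lambda>j. c j *\<^sub>R (1::'a)) sums (0 *\<^sub>R 1)"
    by (rule bounded_linear.sums[OF bounded_linear_scaleR_left])
  from sums_diff[OF fps_apply_sums[OF fps_root_summable(1)[OF assms(1)] assms(2)] this]
  have "(\<lambda>j. - (c j *\<^sub>R (1 - (1 - a) ^ j))) sums fps_apply (fps_root n) (1 - a)"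
    by (simp add: c_def scaleR_diff_right)
  then have "(\<lambda>N. \<Sum>j<N. - (c j *\<^sub>R (1 - (1 - a) ^ j))) \<longlonglongrightarrow> fps_apply (fps_root n) (1 - a)"
    by (simp add: sums_def)
  moreover have "(\<Sum>j<N. - (c j *\<^sub>R (1 - (1 - a) ^ j))) \<in> I" for N
    by (intro subspace_sum[OF I(1)] subspace_neg[OF I(1)] subspace_scale[OF I(1)] pow)
  ultimately show ?thesis by (rule closed_sequentially[OF I(2), rotated])
qed

section \<open>Positive elements\<close>

text \<open>Positivity is a condition on norms here: it says that the spectrum lies within distance \<open>t\<close>
  of \<open>t\<close>. In this form positive elements are visibly closed under addition, and the binomial
  series provides their roots.\<close>

definition cpos :: "'a::unital_cstar_algebra \<Rightarrow> bool" where
  "cpos a \<longleftrightarrow> star a = a \<and> (\<exists>t\<ge>0. norm (of_real t - a) \<le> t)"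

lemma cposI: "star a = a \<Longrightarrow> 0 \<le> t \<Longrightarrow> norm (of_real t - a) \<le> t \<Longrightarrow> cpos a"
  by (auto simp: cpos_def)

lemma cpos_star: "cpos a \<Longrightarrow> star a = a"
  by (simp add: cpos_def)

lemma cpos_of_real: "0 \<le> r \<Longrightarrow> cpos (of_real r :: 'a::unital_cstar_algebra)"
  by (rule cposI[of _ r]) auto

lemma cpos_0 [simp]: "cpos (0 :: 'a::unital_cstar_algebra)"
  using cpos_of_real[of 0] by simp

lemma cpos_1 [simp]: "cpos (1 :: 'a::unital_cstar_algebra)"
  using cpos_of_real[of 1] by simp

lemma cpos_add:
  assumes "cpos a" "cpos (b::'a::unital_cstar_algebra)"
  shows "cpos (a + b)"
proof -
  obtain s t where "s \<ge> 0" "norm (of_real s - a) \<le> s" "t \<ge> 0" "norm (of_real t - b) \<le> t"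
    using assms by (auto simp: cpos_def)
  moreover have "of_real (s + t) - (a + b) = (of_real s - a) + (of_real t - b)" by simp
  ultimately have "norm (of_real (s + t) - (a + b)) \<le> s + t"
    using norm_triangle_ineq[of "of_real s - a" "of_real t - b"] by (simp only:)
  then show ?thesis
    using assms \<open>s \<ge> 0\<close> \<open>t \<ge> 0\<close> by (intro cposI[of _ "s + t"]) (auto simp: star_add cpos_star)
qed

lemma cpos_scaleR:
  assumes "cpos (a::'a::unital_cstar_algebra)" "0 \<le> r"
  shows "cpos (r *\<^sub>R a)"
proof -
  obtain t where t: "t \<ge> 0" "norm (of_real t - a) \<le> t" using assms by (auto simp: cpos_def)
  have "of_real (r * t) - r *\<^sub>R a = r *\<^sub>R (of_real t - a)"
    by (simp add: of_real_def scaleR_diff_right)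
  then have "norm (of_real (r * t) - r *\<^sub>R a) \<le> r * t"
    using t assms by (simp add: mult_left_mono)
  then show ?thesis using t assms by (intro cposI[of _ "r * t"]) (auto simp: cpos_star)
qed

lemma cpos_sum: "(\<And>i. i \<in> A \<Longrightarrow> cpos (f i :: 'a::unital_cstar_algebra)) \<Longrightarrow> cpos (sum f A)"
  by (induction A rule: infinite_finite_induct) (auto intro: cpos_add)

lemma cpos_one_minus: "star a = a \<Longrightarrow> norm a \<le> 1 \<Longrightarrow> cpos (1 - a :: 'a::unital_cstar_algebra)"
  by (rule cposI[of _ 1]) auto

lemma cpos_norm_minus: "star a = a \<Longrightarrow> cpos (of_real (norm a) - a :: 'a::unital_cstar_algebra)"
  by (rule cposI[of _ "norm a"]) auto

lemma one_minus_scaleR: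
  "t \<noteq> 0 \<Longrightarrow> 1 - (1 / t) *\<^sub>R a = (1 / t) *\<^sub>R (of_real t - a :: 'a::unital_cstar_algebra)"
  by (simp add: scaleR_diff_right of_real_def)

lemma norm_one_minus_scaleR:
  "t > 0 \<Longrightarrow> norm (1 - (1 / t) *\<^sub>R a) = norm (of_real t - a :: 'a::unital_cstar_algebra) / t"
  by (subst one_minus_scaleR) (simp_all add: divide_inverse mult.commute)

text \<open>The two closure properties of the root are recorded along with it: uniqueness of roots rests on
  the first one, and the second one keeps roots inside ideals and hereditary subalgebras.\<close>

lemma cpos_root:
  assumes "cpos (a::'a::unital_cstar_algebra)" "n \<ge> 1"
  obtains k where "cpos k" "k ^ n = a" "\<And>y. y * a = a * y \<Longrightarrow> y * k = k * y"
    "\<And>I. subspace I \<Longrightarrow> closed I \<Longrightarrow> a \<in> I \<Longrightarrow> (\<And>x. x \<in> I \<Longrightarrow> x * a \<in> I) \<Longrightarrow> k \<in> I"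
proof -
  obtain t0 where t0: "t0 \<ge> 0" "norm (of_real t0 - a) \<le> t0" using assms by (auto simp: cpos_def)
  \<comment> \<open>The bound may be enlarged at will; this choice makes it positive, so that \<open>a\<close> can be rescaled.\<close>
  define t where "t = t0 + 1"
  have t: "t > 0" using t0 by (simp add: t_def)
  have "norm (of_real t - a) \<le> t"
    using norm_triangle_ineq[of "of_real t0 - a" 1] t0 by (simp add: t_def algebra_simps)
  define b where "b = (1 / t) *\<^sub>R a"
  have nb: "norm (1 - b) \<le> 1"
    using t \<open>norm (of_real t - a) \<le> t\<close> by (simp add: b_def norm_one_minus_scaleR)
  have sb: "star b = b" using assms by (simp add: b_def cpos_star)
  define k0 where "k0 = fps_apply (fps_root n) (1 - b)"
  define k where "k = (t powr (1 / n)) *\<^sub>R k0"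
  have sm: "fps_summable (fps_root n)" by (rule fps_root_summable(1)[OF assms(2)])
  have "star k0 = k0" unfolding k0_def by (rule fps_apply_star[OF sm nb]) (simp add: sb)
  moreover have "norm (1 - k0) \<le> 1"
    unfolding k0_def by (rule norm_one_minus_fps_apply_root[OF assms(2) nb])
  ultimately have "cpos k0" by (intro cposI[of _ 1]) auto
  then have "cpos k" unfolding k_def by (intro cpos_scaleR) auto
  moreover have "k ^ n = a"
  proof -
    have "(t powr (1 / n)) ^ n = t"
      using t assms(2) by (simp flip: powr_realpow add: powr_powr)
    then have "k ^ n = t *\<^sub>R (k0 ^ n)" by (simp add: k_def scaleR_power)
    also have "k0 ^ n = b" unfolding k0_def using fps_apply_root_power[OF assms(2) nb] by simp
    finally show ?thesis using t by (simp add: b_def)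
  qed
  moreover have "y * k = k * y" if "y * a = a * y" for y
  proof -
    have "y * (1 - b) = (1 - b) * y" using that by (simp add: b_def algebra_simps)
    then have "y * k0 = k0 * y" unfolding k0_def by (rule fps_apply_commute[OF sm nb])
    then show ?thesis by (simp add: k_def)
  qed
  moreover have "k \<in> I" if I: "subspace I" "closed I" "a \<in> I" "\<And>x. x \<in> I \<Longrightarrow> x * a \<in> I" for I
  proof -
    have "k0 \<in> I"
      unfolding k0_def
    proof (rule fps_apply_root_in_ideal[OF assms(2) nb I(1,2)])
      show "b \<in> I" unfolding b_def by (rule subspace_scale[OF I(1,3)])
      fix x assume "x \<in> I"
      then show "x * b \<in> I" unfolding b_def by (simp add: subspace_scale[OF I(1)] I(4))
    qed
    then show ?thesis unfolding k_def by (rule subspace_scale[OF I(1)])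
  qed
  ultimately show ?thesis using that by blast
qed

lemma cpos_sqrt:
  assumes "cpos (a::'a::unital_cstar_algebra)"
  obtains k where "cpos k" "k * k = a" "\<And>y. y * a = a * y \<Longrightarrow> y * k = k * y"
  using cpos_root[OF assms, of 2] by (metis one_le_numeral power2_eq_square)

text \<open>If \<open>b\<^sup>2 + c\<^sup>2 = t\<close> for commuting self-adjoint \<open>b\<close>, \<open>c\<close>, then \<open>b\<close> is the real part of \<open>b + ic\<close>,
  which is \<open>\<surd>t\<close> times a unitary. This elementary remark replaces the spectral radius formula.\<close>

lemma norm_square_le:
  fixes b c :: "'a::unital_cstar_algebra"
  assumes "star b = b" "star c = c" "b * c = c * b" "b * b + c * c = of_real t" "0 \<le> t"
  shows "norm (b * b) \<le> t"
proof -
  define u where "u = b + \<i> *\<^sub>C c"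
  have su: "star u = b - \<i> *\<^sub>C c"
    using assms scaleC_minus_right[of \<i> c] scaleC_scaleC[of "-1" \<i> c]
    by (simp add: u_def star_add star_scaleC)
  have "star u * u = b * b + c * c"
    unfolding su unfolding u_def
    by (simp add: algebra_simps mult_scaleC_left mult_scaleC_right scaleC_scaleC scaleC_diff_right
        scaleC_add_right assms)
  then have "(norm u)\<^sup>2 = t" using cstar_identity[of u] assms by simp
  moreover have "norm b \<le> norm u"
  proof -
    have "b = (1/2) *\<^sub>R (u + star u)" unfolding su by (simp add: u_def flip: scaleR_2)
    then have "norm b \<le> 1/2 * norm (u + star u)" by (metis norm_scaleR abs_of_nonneg zero_le_divide_1_iff zero_le_numeral order_refl)
    also have "\<dots> \<le> norm u" using norm_triangle_ineq[of u "star u"] by simp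
    finally show ?thesis .
  qed
  moreover have "norm (b * b) = (norm b)\<^sup>2" using cstar_identity[of b] assms by simp
  ultimately show ?thesis using power_mono[of "norm b" "norm u" 2] by simp
qed

lemma cpos_square:
  assumes "star b = (b::'a::unital_cstar_algebra)"
  shows "cpos (b * b)"
proof -
  define t where "t = (norm b)\<^sup>2 + 1"
  have t: "t > 0" by (simp add: t_def add_nonneg_pos)
  define x where "x = (1 / t) *\<^sub>R (b * b)"
  have sx: "star x = x" by (simp add: x_def star_mult assms)
  have "norm (b * b) \<le> t" using cstar_identity[of b] assms by (simp add: t_def)
  \<comment> \<open>With \<open>c = (1 - x)\<^sup>1\<^sup>/\<^sup>2\<close>, the pair \<open>c\<close>, \<open>b/\<surd>t\<close> is subject to the preceding lemma, and \<open>c\<^sup>2 = 1 - x\<close>.\<close>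
  then have nx: "norm x \<le> 1" using t by (simp add: x_def field_simps)
  define c where "c = fps_apply (fps_root 2) x"
  have sm: "fps_summable (fps_root 2)" by (rule fps_root_summable(1)) simp
  have c2: "c * c = 1 - x"
    using fps_apply_root_power[of 2 x] nx by (simp add: c_def power2_eq_square)
  have sc: "star c = c" unfolding c_def by (rule fps_apply_star[OF sm nx sx])
  have "b * c = c * b"
    unfolding c_def by (rule fps_apply_commute[OF sm nx]) (simp add: x_def mult.assoc)
  then have "norm (c * c) \<le> 1"
  proof (intro norm_square_le[of c "(1 / sqrt t) *\<^sub>R b"])
    show "c * c + (1 / sqrt t) *\<^sub>R b * (1 / sqrt t) *\<^sub>R b = of_real 1"
      using t by (simp add: c2 x_def)
  qed (simp_all add: sc assms)
  then have "norm (1 - x) \<le> 1" by (simp add: c2)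
  then have "norm (of_real t - b * b) \<le> t"
    using t by (simp add: x_def norm_one_minus_scaleR)
  then show ?thesis using t by (intro cposI[of _ t]) (auto simp: star_mult assms)
qed

lemma cpos_norm_le:
  assumes "cpos (a::'a::unital_cstar_algebra)" "cpos (of_real t - a)" "0 \<le> t"
  shows "norm a \<le> t"
proof -
  obtain b where b: "cpos b" "b * b = a" "\<And>y. y * a = a * y \<Longrightarrow> y * b = b * y"
    using cpos_sqrt[OF assms(1)] by blast
  obtain c where c: "cpos c" "c * c = of_real t - a"
    "\<And>y. y * (of_real t - a) = (of_real t - a) * y \<Longrightarrow> y * c = c * y"
    using cpos_sqrt[OF assms(2)] by blast
  have "b * (of_real t - a) = (of_real t - a) * b"
    by (simp add: algebra_simps flip: b(2)) (simp add: of_real_def)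
  then have "b * c = c * b" by (rule c(3))
  then have "norm (b * b) \<le> t"
    by (rule norm_square_le[OF cpos_star[OF b(1)] cpos_star[OF c(1)] _ _ assms(3)]) (simp add: b(2) c(2))
  then show ?thesis by (simp add: b)
qed

lemma cpos_antisym:
  assumes "cpos (a::'a::unital_cstar_algebra)" "cpos (- a)"
  shows "a = 0"
  using cpos_norm_le[of a 0] assms by simp

lemma cpos_add_eq_0:
  assumes "cpos (a::'a::unital_cstar_algebra)" "cpos b" "a + b = 0"
  shows "a = 0"
  using cpos_antisym[of a] assms by (metis minus_unique)

lemma cpos_sum_eq_0:
  assumes "finite A" "\<And>i. i \<in> A \<Longrightarrow> cpos (f i :: 'a::unital_cstar_algebra)" "sum f A = 0" "i \<in> A"
  shows "f i = 0"
proof (rule cpos_add_eq_0)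
  show "f i + sum f (A - {i}) = 0" using assms by (simp add: sum.remove)
qed (use assms in \<open>auto intro!: cpos_sum\<close>)

text \<open>With \<open>f = (-w\<^sup>*w)\<^sup>1\<^sup>/\<^sup>2\<close> and \<open>v = wf\<close>, both \<open>v\<^sup>*v = -f\<^sup>4\<close> and \<open>vv\<^sup>* = -(ww\<^sup>*)\<^sup>2\<close> are negative, whereas
  \<open>2(v\<^sup>*v + vv\<^sup>*) = X\<^sup>2 + Y\<^sup>2\<close> for the self-adjoint \<open>X = v + v\<^sup>*\<close>, \<open>Y = i(v - v\<^sup>*)\<close>. So all these squares
  vanish.\<close>

lemma cpos_neg_star_mult:
  assumes "cpos (- (star w * w :: 'a::unital_cstar_algebra))"
  shows "w = 0"
proof -
  obtain f where f: "cpos f" "f * f = - (star w * w)" using cpos_sqrt[OF assms] by blast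
  have sf: "star f = f" by (rule cpos_star[OF f(1)])
  define v where "v = w * f"
  define X where "X = v + star v"
  define Y where "Y = \<i> *\<^sub>C (v - star v)"
  have sX: "star X = X" by (simp add: X_def star_add star_star add.commute)
  have sY: "star Y = Y"
    using scaleC_scaleC[of "-1" \<i> "star v - v"]
    by (simp add: Y_def star_scaleC star_star flip: scaleC_minus_right)
  have YY: "Y * Y = - ((v - star v) * (v - star v))"
    by (simp add: Y_def mult_scaleC_left mult_scaleC_right scaleC_scaleC)
  have "star v * v = f * (star w * w) * f" by (simp add: v_def star_mult sf mult.assoc)
  also have "\<dots> = - (f * f * (f * f))" using f(2) by (metis minus_minus mult_minus_left mult_minus_right mult.assoc)
  finally have 1: "star v * v = - (f * f * (f * f))" .
  have "v * star v = w * (f * f) * star w" by (simp add: v_def star_mult sf mult.assoc)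
  also have "\<dots> = - (w * star w * (w * star w))" unfolding f(2) by (simp add: mult.assoc)
  finally have 2: "v * star v = - (w * star w * (w * star w))" .
  have "X * X + Y * Y = 2 *\<^sub>R (v * star v + star v * v)"
    unfolding YY unfolding X_def by (simp add: algebra_simps scaleR_2)
  then have *: "2 *\<^sub>R (f * f * (f * f)) + (2 *\<^sub>R (w * star w * (w * star w)) + (X * X + Y * Y)) = 0"
    unfolding 1 2 by (simp add: algebra_simps)
  have "2 *\<^sub>R (f * f * (f * f)) = 0"
    by (rule cpos_add_eq_0[OF _ _ *])
      (intro cpos_scaleR cpos_add cpos_square; simp add: star_mult star_star sf sX sY)+
  then have "f ^ 4 = 0" by (simp add: numeral_eq_Suc mult.assoc)
  from selfadj_nilpotent[OF sf this] f(2) show ?thesis by simp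
qed

text \<open>Kaplansky's theorem. For \<open>a = z\<^sup>*z\<close> the element \<open>n = |a| - a\<close> satisfies \<open>an = -|a|n\<close>, so that
  \<open>(zn)\<^sup>*(zn) = -n|a|n\<close> is negative. By the preceding lemma this only happens if \<open>zn = 0\<close>; then
  \<open>n\<^sup>2 = |a|n - an = 0\<close>, and \<open>a = |a|\<close>.\<close>

theorem cpos_star_mult: "cpos (star z * z :: 'a::unital_cstar_algebra)"
proof -
  define a where "a = star z * z"
  have sa: "star a = a" by (simp add: a_def star_mult star_star)
  obtain m where m: "cpos m" "m * m = a * a" "\<And>y. y * (a * a) = (a * a) * y \<Longrightarrow> y * m = m * y"
    using cpos_sqrt[OF cpos_square[OF sa]] by blast
  have am: "a * m = m * a" by (rule m(3)) (simp add: mult.assoc)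
  obtain l where l: "cpos l" "l * l = m" "\<And>y. y * m = m * y \<Longrightarrow> y * l = l * y"
    using cpos_sqrt[OF m(1)] by blast
  define n where "n = m - a"
  have sn: "star n = n" by (simp add: n_def sa cpos_star[OF m(1)])
  have an: "a * n = - (m * n)" by (simp add: n_def algebra_simps am m(2))
  have nl: "n * l = l * n" by (rule l(3)) (simp add: n_def algebra_simps am)
  have nmn: "n * m * n = l * n * (l * n)"
    by (metis l(2) nl mult.assoc)
  have sln: "star (l * n) = l * n" by (simp add: star_mult sn cpos_star[OF l(1)] nl)
  have "star (z * n) * (z * n) = n * (a * n)"
    by (simp add: star_mult sn a_def mult.assoc)
  also have "\<dots> = - (l * n * (l * n))" by (simp only: an nmn mult_minus_right mult.assoc[symmetric])
  finally have neg: "star (z * n) * (z * n) = - (l * n * (l * n))" .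
  have "z * n = 0"
    by (rule cpos_neg_star_mult) (simp add: neg cpos_square[OF sln])
  with neg have "(l * n) ^ 2 = 0" by (simp add: power2_eq_square)
  from selfadj_nilpotent[OF sln this] have "m * n = 0" by (metis l(2) mult.assoc mult_zero_right)
  with an have "a * n = 0" by simp
  with \<open>m * n = 0\<close> have "n ^ 2 = 0"
    unfolding power2_eq_square by (metis n_def left_diff_distrib diff_self)
  from selfadj_nilpotent[OF sn this] have "m = a" by (simp add: n_def)
  with m(1) show ?thesis by (simp add: a_def)
qed

lemma cpos_mult_star: "cpos (z * star z :: 'a::unital_cstar_algebra)"
  using cpos_star_mult[of "star z"] by (simp add: star_star)

lemma cpos_conj:
  assumes "cpos (a::'a::unital_cstar_algebra)"
  shows "cpos (star c * a * c)"
proof -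
  obtain b where b: "cpos b" "b * b = a" using cpos_sqrt[OF assms] by blast
  have "star c * a * c = star (b * c) * (b * c)"
    by (simp add: star_mult cpos_star[OF b(1)] mult.assoc flip: b(2))
  then show ?thesis using cpos_star_mult by metis
qed

lemma cpos_norm_mono:
  assumes "cpos (a::'a::unital_cstar_algebra)" "cpos (b - a)"
  shows "norm a \<le> norm b"
proof (rule cpos_norm_le[OF assms(1)])
  have "star b = b" using cpos_star[OF cpos_add[OF assms]] by simp
  from cpos_add[OF cpos_norm_minus[OF this] assms(2)] show "cpos (of_real (norm b) - a)" by simp
qed simp

lemma cpos_power:
  assumes "cpos (a::'a::unital_cstar_algebra)"
  shows "cpos (a ^ n)"
proof -
  obtain b where b: "cpos b" "b * b = a" using cpos_sqrt[OF assms] by blast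
  have "a ^ n = b ^ n * b ^ n" by (metis b(2) power2_eq_square power_mult mult.commute power_add mult_2)
  then show ?thesis using cpos_square[of "b ^ n"] by (simp add: star_power cpos_star[OF b(1)])
qed

lemma cpos_mult_commuting:
  assumes "cpos (a::'a::unital_cstar_algebra)" "cpos b" "a * b = b * a"
  shows "cpos (a * b)"
proof -
  obtain r where r: "cpos r" "r * r = a" "\<And>y. y * a = a * y \<Longrightarrow> y * r = r * y"
    using cpos_sqrt[OF assms(1)] by blast
  have "b * r = r * b" using r(3) assms(3) by simp
  then have "a * b = star r * b * r" by (metis r(2) cpos_star[OF r(1)] mult.assoc)
  then show ?thesis using cpos_conj[OF assms(2)] by simp
qed

lemma commuting_power: "x * y = y * x \<Longrightarrow> x ^ n * y = y * (x::'a::monoid_mult) ^ n"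
  by (induction n) (simp_all add: mult.assoc, metis mult.assoc)

lemma commuting_diff_telescope:
  fixes x y :: "'a::ring_1"
  assumes "x * y = y * x"
  shows "(x - y) * (\<Sum>i<n. x ^ i * y ^ (n - Suc i)) = x ^ n - y ^ n"
proof -
  have "(x - y) * (\<Sum>i<n. x ^ i * y ^ (n - Suc i)) = (\<Sum>i<n. x ^ Suc i * y ^ (n - Suc i) - x ^ i * y ^ (n - i))"
  proof (subst sum_distrib_left, rule sum.cong[OF refl])
    fix i assume "i \<in> {..<n}"
    then have "y ^ (n - i) = y * y ^ (n - Suc i)" by (metis Suc_diff_Suc lessThan_iff power_Suc)
    then show "(x - y) * (x ^ i * y ^ (n - Suc i)) = x ^ Suc i * y ^ (n - Suc i) - x ^ i * y ^ (n - i)"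
      using commuting_power[OF assms, of i] by (simp add: left_diff_distrib flip: mult.assoc)
  qed
  also have "\<dots> = x ^ n - y ^ n"
    using sum_lessThan_telescope[of "\<lambda>i. x ^ i * y ^ (n - i)" n] by simp
  finally show ?thesis .
qed

text \<open>Commuting positive \<open>n\<close>-th roots \<open>k\<close>, \<open>r\<close> of the same element coincide: with \<open>d = k - r\<close> all the
  positive elements \<open>d k\<^sup>i r\<^sup>j d\<close> for \<open>i + j = n - 1\<close> vanish, since their sum does, whence \<open>d\<^sup>n\<^sup>+\<^sup>1 = 0\<close>.\<close>

lemma cpos_power_eq_imp_eq:
  assumes "cpos (k::'a::unital_cstar_algebra)" "cpos r" "n \<ge> 1" "k ^ n = r ^ n" "k * r = r * k"
  shows "k = r"
proof -
  define d where "d = k - r"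
  have sd: "star d = d" using assms by (simp add: d_def cpos_star)
  have "d * (\<Sum>i<n. k ^ i * r ^ (n - Suc i)) = 0"
    unfolding d_def commuting_diff_telescope[OF assms(5)] using assms(4) by simp
  then have s0: "(\<Sum>i<n. d * (k ^ i * r ^ (n - Suc i)) * d) = 0"
    by (metis mult_zero_left sum_distrib_left sum_distrib_right)
  have cp: "cpos (d * (k ^ i * r ^ j) * d)" for i j
  proof -
    have "k ^ i * r ^ j = r ^ j * k ^ i"
      by (intro commuting_power commuting_power[symmetric] assms sym[OF assms(5)])
    then have "cpos (k ^ i * r ^ j)" using assms by (intro cpos_mult_commuting cpos_power)
    from cpos_conj[OF this, of d] show ?thesis by (simp add: sd)
  qed
  have z: "d * (k ^ i * r ^ j * d ^ p) * d = 0" if "Suc (i + j + p) = n" for i j p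
    using that
  proof (induction p arbitrary: i j)
    case 0
    have "d * (k ^ i * r ^ (n - Suc i)) * d = 0"
      by (rule cpos_sum_eq_0[OF _ _ s0]) (use 0 cp in auto)
    moreover have "n - Suc i = j" using 0 by simp
    ultimately show ?case by simp
  next
    case (Suc p)
    have "k ^ i * r ^ j * k = k ^ Suc i * r ^ j"
      by (metis assms(5) commuting_power mult.assoc power_Suc2)
    moreover have "k ^ i * r ^ j * r = k ^ i * r ^ Suc j" by (simp add: mult.assoc power_Suc2 del: power_Suc)
    moreover have "d ^ Suc p = k * d ^ p - r * d ^ p"
      by (simp only: d_def left_diff_distrib power_Suc)
    then have "k ^ i * r ^ j * d ^ Suc p = (k ^ i * r ^ j * k) * d ^ p - (k ^ i * r ^ j * r) * d ^ p"
      by (simp only: right_diff_distrib mult.assoc)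
    ultimately have "k ^ i * r ^ j * d ^ Suc p = k ^ Suc i * r ^ j * d ^ p - k ^ i * r ^ Suc j * d ^ p"
      by (simp only:)
    then show ?case using Suc.IH[of "Suc i" j] Suc.IH[of i "Suc j"] Suc.prems
      by (simp add: left_diff_distrib right_diff_distrib)
  qed
  obtain m where m: "n = Suc m" using assms(3) by (metis Suc_le_D One_nat_def)
  have "d ^ (n + 1) = d * (k ^ 0 * r ^ 0 * d ^ m) * d"
    by (simp add: m mult.assoc power_commutes)
  also have "\<dots> = 0" by (rule z) (simp add: m)
  finally have "d ^ (n + 1) = 0" .
  from selfadj_nilpotent[OF sd this] show ?thesis by (simp add: d_def)
qed

text \<open>Both roots commute with the root that is constructed from their common power.\<close>

lemma cpos_root_unique:
  assumes "cpos (k::'a::unital_cstar_algebra)" "cpos r" "n \<ge> 1" "k ^ n = r ^ n"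
  shows "k = r"
proof -
  show ?thesis
  proof (rule cpos_root[OF cpos_power[OF assms(2), of n] assms(3)])
    fix q assume q: "cpos q" "q ^ n = r ^ n" "\<And>y. y * r ^ n = r ^ n * y \<Longrightarrow> y * q = q * y"
    have "k * r ^ n = r ^ n * k" by (simp only: assms(4)[symmetric] power_commutes)
    then have "k = q"
      by (intro cpos_power_eq_imp_eq[OF assms(1) q(1) assms(3)] q(3)) (simp_all only: assms(4) q(2))
    moreover have "r = q"
      by (intro cpos_power_eq_imp_eq[OF assms(2) q(1) assms(3)] q(3)) (simp_all only: power_commutes q(2))
    ultimately show ?thesis by simp
  qed
qed

text \<open>On \<open>[0, 1]\<close> the function \<open>y\<^sup>n(1 - y)\<close> is at most \<open>1/(n + 1)\<close>, being the least of the \<open>n + 1\<close>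
  functions \<open>y\<^sup>i(1 - y)\<close>, whose sum is \<open>1 - y\<^sup>n\<^sup>+\<^sup>1\<close>.\<close>

lemma norm_power_mult_one_minus:
  assumes "cpos (y::'a::unital_cstar_algebra)" "norm y \<le> 1"
  shows "norm (y ^ n * (1 - y)) \<le> 1 / (real n + 1)"
proof -
  define A where "A i = y ^ i * (1 - y)" for i
  have sy: "star (y ^ i) = y ^ i" for i by (simp add: star_power cpos_star[OF assms(1)])
  have c1: "cpos (1 - y ^ i)" for i
    by (rule cpos_one_minus[OF sy norm_power_le_one[OF assms(2)]])
  have cA: "cpos (A i)" for i
    unfolding A_def using c1[of 1] assms(1)
    by (intro cpos_mult_commuting cpos_power) (auto simp: algebra_simps power_commutes)
  have cd: "cpos (A i - A n)" if "i \<le> n" for i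
  proof -
    have e: "y ^ n = y ^ (n - i) * y ^ i" using that by (simp flip: power_add)
    have "A i - A n = (1 - y ^ (n - i)) * A i" unfolding A_def e by (simp add: algebra_simps)
    moreover have "(1 - y ^ (n - i)) * A i = A i * (1 - y ^ (n - i))"
      unfolding A_def by (simp add: algebra_simps power_commutes flip: power_add power_Suc power_Suc2)
    ultimately show ?thesis using cpos_mult_commuting[OF c1 cA] by simp
  qed
  have "(\<Sum>i\<le>n. A i) = 1 - y ^ Suc n"
    by (induction n) (simp_all add: A_def algebra_simps power_commutes)
  then have "1 - (real n + 1) *\<^sub>R A n = (\<Sum>i\<le>n. A i - A n) + y ^ Suc n"
    by (simp add: sum_subtractf scaleR_conv_of_real algebra_simps)
  moreover have "cpos ((\<Sum>i\<le>n. A i - A n) + y ^ Suc n)"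
    by (intro cpos_add cpos_sum cpos_power assms) (use cd in auto)
  ultimately have "cpos (of_real 1 - (real n + 1) *\<^sub>R A n)" by simp
  from cpos_norm_le[OF cpos_scaleR[OF cA] this] have "(real n + 1) * norm (A n) \<le> 1" by simp
  then show ?thesis by (simp add: A_def field_simps)
qed

text \<open>Neumann series.\<close>

lemma inverse_near_scalar:
  assumes "norm (of_real t - g) < t"
  shows "\<exists>h. g * h = 1 \<and> h * g = (1::'a::unital_cstar_algebra)"
proof -
  have t: "t > 0" using assms norm_ge_zero less_le_trans[of 0] by (metis not_le order_le_less_trans)
  define x where "x = 1 - (1 / t) *\<^sub>R g"
  have nx: "norm x < 1" using assms t by (simp add: x_def norm_one_minus_scaleR)
  have "summable (\<lambda>j. norm x ^ j)" using nx by simp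
  then have sm: "summable (\<lambda>j. x ^ j)"
    by (rule summable_comparison_test[rotated]) (auto simp: norm_power_ineq)
  have "(\<lambda>j. x ^ j - x ^ Suc j) sums (1 - 0)"
    using telescope_sums'[OF summable_LIMSEQ_zero[OF sm]] by simp
  moreover have "(\<lambda>j. (1 - x) * x ^ j) sums ((1 - x) * (\<Sum>j. x ^ j))"
    by (rule sums_mult[OF summable_sums[OF sm]])
  moreover have "(\<lambda>j. x ^ j * (1 - x)) sums ((\<Sum>j. x ^ j) * (1 - x))"
    by (rule sums_mult2[OF summable_sums[OF sm]])
  ultimately have "(1 - x) * (\<Sum>j. x ^ j) = 1 \<and> (\<Sum>j. x ^ j) * (1 - x) = 1"
    by (simp add: algebra_simps power_commutes sums_iff)
  then show ?thesis
    using t by (intro exI[of _ "(1 / t) *\<^sub>R (\<Sum>j. x ^ j)"]) (simp add: x_def)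
qed

text \<open>The normalization used twice below: to turn \<open>\<Sum> a\<^sub>k\<^sup>* b a\<^sub>k = g\<close> into \<open>1\<close>, and to make a projection
  again out of a truncated one.\<close>

lemma inverse_sqrt_near_scalar:
  fixes g :: "'a::unital_cstar_algebra"
  assumes "star g = g" "norm (of_real t - g) < t"
  obtains s where "star s = s" "s * g = g * s" "s * g * s = 1"
proof -
  have "t \<ge> 0" using assms(2) norm_ge_zero[of "of_real t - g"] by linarith
  then have "cpos g" using assms by (intro cposI[of _ t]) auto
  then obtain k where k: "cpos k" "k * k = g" "\<And>y. y * g = g * y \<Longrightarrow> y * k = k * y"
    using cpos_sqrt by blast
  obtain h where h: "g * h = 1" "h * g = 1" using inverse_near_scalar[OF assms(2)] by blast
  have "star h * g = 1" using arg_cong[OF h(1), of star] by (simp add: star_mult assms(1))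
  then have sh: "star h = h" by (metis h(1) mult.assoc mult_1_left mult_1_right)
  have hk: "h * k = k * h" by (rule k(3)) (simp add: h)
  show ?thesis
  proof (rule that[of "k * h"])
    show "star (k * h) = k * h" by (simp add: star_mult sh cpos_star[OF k(1)] hk)
    show "k * h * g = g * (k * h)" by (metis h k(2) mult.assoc mult_1_right mult_1_left)
    have "k * h * g * (k * h) = k * (h * g) * (k * h)" by (simp add: mult.assoc)
    also have "\<dots> = k * k * h" by (simp add: h mult.assoc)
    finally show "k * h * g * (k * h) = 1" by (simp add: k h)
  qed
qed

lemma norm_norm_minus_cpos:
  assumes "cpos (a::'a::unital_cstar_algebra)"
  shows "norm (of_real (norm a) - a) \<le> norm a"
  by (rule cpos_norm_le[OF cpos_norm_minus[OF cpos_star[OF assms]]]) (use assms in simp_all)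

text \<open>For positive \<open>a\<close> the radius \<open>t\<close> can be taken to be \<open>\<parallel>a\<parallel>\<close>, and in this form the defining condition
  passes to limits.\<close>

lemma cpos_lim:
  fixes a :: "'a::unital_cstar_algebra"
  assumes "X \<longlonglongrightarrow> a" "\<And>n. cpos (X n)"
  shows "cpos a"
proof (rule cposI)
  have "(\<lambda>n. star (X n)) \<longlonglongrightarrow> star a" by (rule tendsto_star[OF assms(1)])
  then have "X \<longlonglongrightarrow> star a" by (simp add: cpos_star[OF assms(2)])
  then show "star a = a" by (rule LIMSEQ_unique[OF _ assms(1)])
  have "(\<lambda>n. norm (of_real (norm (X n)) - X n)) \<longlonglongrightarrow> norm (of_real (norm a) - a)"
    by (intro tendsto_intros assms)
  moreover have "(\<lambda>n. norm (X n)) \<longlonglongrightarrow> norm a" by (intro tendsto_intros assms)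
  ultimately show "norm (of_real (norm a) - a) \<le> norm a"
    by (rule LIMSEQ_le) (use norm_norm_minus_cpos[OF assms(2)] in auto)
qed simp

lemma cpos_eq_star_mult:
  assumes "cpos (a::'a::unital_cstar_algebra)"
  obtains b where "star b * b = a"
  using cpos_sqrt[OF assms] cpos_star by metis

section \<open>Tracial states\<close>

context
  fixes \<tau> :: "'a::unital_cstar_algebra \<Rightarrow> complex"
  assumes tr: "tracial_state \<tau>"
begin

lemma trace_add: "\<tau> (x + y) = \<tau> x + \<tau> y"
  and trace_scaleC: "\<tau> (c *\<^sub>C x) = c * \<tau> x"
  and trace_commute: "\<tau> (x * y) = \<tau> (y * x)"
  and trace_one: "\<tau> 1 = 1"
  using tr by (auto simp: tracial_state_def)

lemma trace_scaleR: "\<tau> (r *\<^sub>R x) = r *\<^sub>R \<tau> x"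
  using trace_scaleC[of "complex_of_real r" x] by (simp add: scaleC_of_real scaleR_conv_of_real)

lemma trace_zero: "\<tau> 0 = 0"
  using trace_scaleR[of 0 0] by simp

lemma trace_diff: "\<tau> (x - y) = \<tau> x - \<tau> y"
  using trace_add[of "x - y" y] by simp

lemma trace_sum: "\<tau> (sum f A) = (\<Sum>i\<in>A. \<tau> (f i))"
  by (induction A rule: infinite_finite_induct) (simp_all add: trace_zero trace_add)

lemma trace_of_real: "\<tau> (of_real r) = of_real r"
  using trace_scaleR[of r 1] by (simp add: of_real_def trace_one)

lemma trace_cpos:
  assumes "cpos a"
  shows "Im (\<tau> a) = 0" "0 \<le> Re (\<tau> a)"
proof -
  obtain b where b: "cpos b" "b * b = a" using cpos_sqrt[OF assms] by blast
  then have "star b * b = a" by (simp add: cpos_star)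
  then show "Im (\<tau> a) = 0" "0 \<le> Re (\<tau> a)" using tr unfolding tracial_state_def by metis+
qed

lemma trace_selfadj:
  assumes "star a = a"
  shows "Im (\<tau> a) = 0"
  using trace_cpos(1)[OF cpos_norm_minus[OF assms]] by (simp add: trace_diff trace_of_real)

lemma trace_star: "\<tau> (star x) = cnj (\<tau> x)"
proof -
  have "Im (\<tau> (x + star x)) = 0" by (rule trace_selfadj) (simp add: star_add star_star add.commute)
  moreover have "Im (\<tau> (\<i> *\<^sub>C (x - star x))) = 0"
  proof (rule trace_selfadj)
    show "star (\<i> *\<^sub>C (x - star x)) = \<i> *\<^sub>C (x - star x)"
      using scaleC_scaleC[of "-1" \<i> "star x - x"]
      by (simp add: star_scaleC star_star flip: scaleC_minus_right)
  qed
  ultimately show ?thesis by (simp add: trace_add trace_diff trace_scaleC complex_eq_iff)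
qed

lemma trace_mono: "cpos (b - a) \<Longrightarrow> Re (\<tau> a) \<le> Re (\<tau> b)"
  using trace_cpos(2)[of "b - a"] by (simp add: trace_diff)

text \<open>The Cauchy-Schwarz inequality for \<open>x\<close> and \<open>1\<close>, in the form \<open>0 \<le> \<tau>(y\<^sup>*y)\<close> for the component
  \<open>y = x - \<tau>(x)\<close> orthogonal to \<open>1\<close>.\<close>

lemma trace_norm_le: "cmod (\<tau> x) \<le> norm x"
proof -
  define y where "y = x - \<tau> x *\<^sub>C 1"
  have yy: "star y * y = star x * x - \<tau> x *\<^sub>C star x - cnj (\<tau> x) *\<^sub>C x + (cnj (\<tau> x) * \<tau> x) *\<^sub>C 1"
    by (simp add: y_def star_scaleC algebra_simps mult_scaleC_left mult_scaleC_right scaleC_scaleC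
        scaleC_diff_right)
  have "\<tau> (star y * y) = \<tau> (star x * x) - cnj (\<tau> x) * \<tau> x"
    unfolding yy by (simp add: trace_add trace_diff trace_scaleC trace_star trace_one algebra_simps)
  then have "Re (cnj (\<tau> x) * \<tau> x) \<le> Re (\<tau> (star x * x))"
    using trace_cpos(2)[OF cpos_star_mult[of y]] by simp
  also have "\<dots> \<le> Re (\<tau> (of_real (norm (star x * x))))"
    by (intro trace_mono cpos_norm_minus) (simp add: star_mult star_star)
  also have "\<dots> = (norm x)\<^sup>2" by (simp only: trace_of_real cstar_identity Re_complex_of_real)
  also have "Re (cnj (\<tau> x) * \<tau> x) = (cmod (\<tau> x))\<^sup>2" by (simp only: cmod_power2) (simp add: power2_eq_square)
  finally have "(cmod (\<tau> x))\<^sup>2 \<le> (norm x)\<^sup>2" .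
  then show ?thesis by (rule power2_le_imp_le) simp
qed

lemma bounded_linear_trace: "bounded_linear \<tau>"
  by (rule bounded_linear_intro[of _ 1]) (simp_all add: trace_add trace_scaleR trace_norm_le)

text \<open>The elements \<open>x\<close> with \<open>\<tau>(x\<^sup>*x) = 0\<close> form a closed two-sided ideal, which does not contain \<open>1\<close>.\<close>

lemma trace_faithful:
  assumes "simple_cstar TYPE('a)" "\<tau> (star x * x) = 0"
  shows "x = 0"
proof -
  define I where "I = {x. \<tau> (star x * x) = 0}"
  have I_iff: "x \<in> I \<longleftrightarrow> Re (\<tau> (star x * x)) \<le> 0" for x
    using trace_cpos[OF cpos_star_mult[of x]] by (auto simp: I_def complex_eq_iff)
  have lmult: "a * x \<in> I" if "x \<in> I" for a x
  proof -
    have "star x * (of_real (norm (star a * a)) - star a * a) * x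
        = norm (star a * a) *\<^sub>R (star x * x) - star (a * x) * (a * x)"
      by (simp add: algebra_simps star_mult of_real_def)
    moreover have "cpos (star x * (of_real (norm (star a * a)) - star a * a) * x)"
      by (intro cpos_conj cpos_norm_minus) (simp add: star_mult star_star)
    ultimately have "Re (\<tau> (star (a * x) * (a * x))) \<le> Re (\<tau> (norm (star a * a) *\<^sub>R (star x * x)))"
      by (intro trace_mono) simp
    also have "\<dots> = 0" using that by (simp add: I_def trace_scaleR)
    finally show ?thesis by (simp add: I_iff)
  qed
  have starI: "star x \<in> I" if "x \<in> I" for x
    using that trace_commute[of "star x" x] by (simp add: I_def star_star)
  have "closed_ideal I"
    unfolding closed_ideal_def
  proof (intro conjI allI ballI)
    have "continuous_on UNIV (\<lambda>x. \<tau> (star x * x))"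
      by (intro bounded_linear.continuous_on[OF bounded_linear_trace] continuous_on_mult
          bounded_linear.continuous_on[OF bounded_linear_star] continuous_on_id)
    then show "closed I" unfolding I_def by (rule closed_Collect_eq[OF _ continuous_on_const])
    show "0 \<in> I" by (simp add: I_def trace_zero)
  next
    fix x y assume xy: "x \<in> I" "y \<in> I"
    have "2 *\<^sub>R (star x * x + star y * y) - star (x + y) * (x + y) = star (x - y) * (x - y)"
      by (simp add: star_add algebra_simps scaleR_2)
    then have "Re (\<tau> (star (x + y) * (x + y))) \<le> Re (\<tau> (2 *\<^sub>R (star x * x + star y * y)))"
      using cpos_star_mult[of "x - y"] by (intro trace_mono) simp
    also have "\<dots> = 0" using xy by (simp add: I_def trace_scaleR trace_add)
    finally show "x + y \<in> I" by (simp add: I_iff)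
  next
    fix c x assume "x \<in> I"
    then show "c *\<^sub>C x \<in> I" using lmult[of x "c *\<^sub>C 1"] by (simp add: mult_scaleC_left)
  next
    fix a x assume x: "x \<in> I"
    show "a * x \<in> I" by (rule lmult[OF x])
    show "x * a \<in> I" using starI[OF lmult[OF starI[OF x], of "star a"]] by (simp add: star_mult star_star)
  qed
  then have "I = {0} \<or> I = UNIV" using assms(1) by (auto simp: simple_cstar_def)
  moreover have "1 \<notin> I" by (simp add: I_def trace_one)
  ultimately have "I = {0}" by blast
  moreover have "x \<in> I" using assms(2) by (simp add: I_def)
  ultimately show ?thesis by blast
qed

lemma trace_cpos_eq_0:
  assumes "simple_cstar TYPE('a)" "cpos a" "Re (\<tau> a) = 0"
  shows "a = 0"
proof -
  obtain b where b: "cpos b" "b * b = a" using cpos_sqrt[OF assms(2)] by blast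
  have "star b * b = a" using b by (simp add: cpos_star)
  moreover have "\<tau> a = 0" using assms trace_cpos(1)[OF assms(2)] by (simp add: complex_eq_iff)
  ultimately have "b = 0" using trace_faithful[OF assms(1), of b] by simp
  then show ?thesis using b by simp
qed

end

section \<open>Fullness of positive elements in a simple algebra\<close>

lemma closure_image_subset:
  fixes f :: "'a::real_normed_vector \<Rightarrow> 'a"
  assumes "bounded_linear f" "f ` S \<subseteq> S"
  shows "f ` closure S \<subseteq> closure S"
  using assms closure_subset
  by (intro image_closure_subset bounded_linear.continuous_on[OF assms(1)] continuous_on_id closed_closure) blast+

lemma subspace_closure:
  fixes S :: "'a::real_normed_vector set"
  assumes "subspace S"
  shows "subspace (closure S)"
proof (rule subspaceI)
  show "0 \<in> closure S" using subspace_0[OF assms] closure_subset by blast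
next
  fix x y assume "x \<in> closure S" "y \<in> closure S"
  then obtain f g where "\<And>n::nat. f n \<in> S" "f \<longlonglongrightarrow> x" "\<And>n::nat. g n \<in> S" "g \<longlonglongrightarrow> y"
    unfolding closure_sequential by blast
  then have "(\<lambda>n. f n + g n) \<longlonglongrightarrow> x + y" "\<And>n. f n + g n \<in> S"
    by (auto intro: tendsto_add subspace_add[OF assms])
  then show "x + y \<in> closure S" unfolding closure_sequential by (intro exI[of _ "\<lambda>n. f n + g n"]) simp
next
  fix c x assume "x \<in> closure S"
  then obtain f where "\<And>n::nat. f n \<in> S" "f \<longlonglongrightarrow> x" unfolding closure_sequential by blast
  then have "(\<lambda>n. c *\<^sub>R f n) \<longlonglongrightarrow> c *\<^sub>R x" "\<And>n. c *\<^sub>R f n \<in> S"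
    by (auto intro: tendsto_intros subspace_scale[OF assms])
  then show "c *\<^sub>R x \<in> closure S" unfolding closure_sequential by (intro exI[of _ "\<lambda>n. c *\<^sub>R f n"]) simp
qed

text \<open>The ideal generated by \<open>b\<close> is dense, so that some \<open>\<Sum> x\<^sub>i b y\<^sub>i\<close> is close to \<open>1\<close>. Its double real
  part is dominated by \<open>\<Sum> x\<^sub>i b x\<^sub>i\<^sup>* + y\<^sub>i\<^sup>* b y\<^sub>i\<close>, which is therefore invertible and can be normalized.\<close>

lemma simple_full:
  fixes b :: "'a::unital_cstar_algebra"
  assumes "simple_cstar TYPE('a)" "cpos b" "b \<noteq> 0"
  obtains m :: nat and a where "(\<Sum>k<m. star (a k) * b * a k) = 1"
proof -
  define S where "S = span (range (\<lambda>(x, y). x * b * y))"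
  have subS: "subspace (closure S)" unfolding S_def by (intro subspace_closure subspace_span)
  have lS: "a * s \<in> S" if "s \<in> S" for a s
    using that unfolding S_def
  proof (induction s rule: span_induct_alt)
    case base
    show ?case by (simp add: span_zero)
  next
    case (step c x y)
    then obtain p q where "x = p * b * q" by auto
    then have "a * x \<in> range (\<lambda>(x, y). x * b * y)"
      by (intro range_eqI[of _ _ "(a * p, q)"]) (simp add: mult.assoc)
    then show ?case using step.IH by (simp add: distrib_left span_add span_scale span_base)
  qed
  have rS: "s * a \<in> S" if "s \<in> S" for a s
    using that unfolding S_def
  proof (induction s rule: span_induct_alt)
    case base
    show ?case by (simp add: span_zero)
  next
    case (step c x y)
    then obtain p q where "x = p * b * q" by auto
    then have "x * a \<in> range (\<lambda>(x, y). x * b * y)"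
      by (intro range_eqI[of _ _ "(p, q * a)"]) (simp add: mult.assoc)
    then show ?case using step.IH by (simp add: distrib_right span_add span_scale span_base)
  qed
  have l: "a * x \<in> closure S" if "x \<in> closure S" for a x
    using closure_image_subset[OF bounded_linear_mult_right[of a], of S] lS that by blast
  have r: "x * a \<in> closure S" if "x \<in> closure S" for a x
    using closure_image_subset[OF bounded_linear_mult_left[of a], of S] rS that by blast
  have "closed_ideal (closure S)"
    unfolding closed_ideal_def
  proof (intro conjI allI ballI)
    fix c x assume "x \<in> closure S"
    then show "c *\<^sub>C x \<in> closure S" using l[of x "c *\<^sub>C 1"] by (simp add: mult_scaleC_left)
  qed (use l r subS in \<open>auto simp: subspace_add subspace_0\<close>)
  moreover have "b \<in> closure S"
    unfolding S_def by (intro subsetD[OF closure_subset] span_base range_eqI[of _ _ "(1, 1)"]) simp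
  ultimately have "closure S = UNIV" using assms(1,3) unfolding simple_cstar_def by blast
  then have "1 \<in> closure S" by simp
  then obtain s where s: "s \<in> S" "norm (s - 1) < 1 / 2"
    unfolding closure_approachable by (metis dist_norm zero_less_divide_1_iff zero_less_numeral)
  \<comment> \<open>Each summand \<open>pbq\<close> is handled by \<open>0 \<le> (p\<^sup>* - q)\<^sup>* b (p\<^sup>* - q)\<close>.\<close>
  have dom: "\<exists>(m::nat) a. cpos ((\<Sum>k<m. star (a k) * b * a k) - (s + star s))"
    using s(1) unfolding S_def
  proof (induction s rule: span_induct_alt)
    case base
    show ?case by (rule exI[of _ 0]) simp
  next
    case (step c x y)
    obtain p0 q where pq: "x = p0 * b * q" using step by auto
    define p where "p = c *\<^sub>R p0"
    have x: "c *\<^sub>R x = p * b * q" by (simp add: p_def pq)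
    obtain m :: nat and a where ma: "cpos ((\<Sum>k<m. star (a k) * b * a k) - (y + star y))"
      using step.IH by blast
    define a' where "a' = a(m := star p, Suc m := q)"
    have "cpos (star (star p - q) * b * (star p - q))" by (rule cpos_conj[OF assms(2)])
    from cpos_add[OF ma this]
    have "cpos ((\<Sum>k<Suc (Suc m). star (a' k) * b * a' k) - ((c *\<^sub>R x + y) + star (c *\<^sub>R x + y)))"
      unfolding x by (simp add: a'_def star_add star_mult star_star algebra_simps cpos_star[OF assms(2)])
    then show ?case by blast
  qed
  then obtain m :: nat and a where ma: "cpos ((\<Sum>k<m. star (a k) * b * a k) - (s + star s))" by blast
  define g where "g = (\<Sum>k<m. star (a k) * b * a k)"
  have "cpos (1 - ((1 - s) + star (1 - s)))"
  proof (rule cpos_one_minus)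
    have "norm (1 - s + star (1 - s)) \<le> norm (1 - s) + norm (star (1 - s))" by (rule norm_triangle_ineq)
    then show "norm (1 - s + star (1 - s)) \<le> 1" using s(2) by (simp only: star_in_norm norm_minus_commute)
  qed (simp add: star_add star_star)
  moreover have "1 - ((1 - s) + star (1 - s)) = (s + star s) - 1" by (simp add: algebra_simps)
  ultimately have "cpos ((s + star s) - 1)" by (simp only:)
  from cpos_add[OF ma this] have g1: "cpos (g - 1)" by (simp add: g_def)
  define t where "t = norm g"
  have t1: "t \<ge> 1" using cpos_norm_mono[OF cpos_1 g1] by (simp add: t_def)
  have sg: "star g = g" using cpos_star[OF g1] by simp
  have "norm (of_real t - g) \<le> t - 1"
  proof (rule cpos_norm_le)
    show "cpos (of_real t - g)" unfolding t_def by (rule cpos_norm_minus[OF sg])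
    show "cpos (of_real (t - 1) - (of_real t - g))" using g1 by simp
  qed (use t1 in simp)
  then have "norm (of_real t - g) < t" by simp
  from inverse_sqrt_near_scalar[OF sg this] obtain h where h: "star h = h" "h * g * h = 1" by metis
  have "(\<Sum>k<m. star (a k * h) * b * (a k * h)) = h * g * h"
    unfolding g_def by (simp add: star_mult h sum_distrib_left sum_distrib_right mult.assoc)
  then show ?thesis using that[of "\<lambda>k. a k * h" m] h by simp
qed

section \<open>The norm of infinite matrices\<close>

text \<open>The norm of the Hilbert module of sequences over \<open>A\<close>, on the coordinates in \<open>I\<close>.\<close>

definition hnorm :: "nat set \<Rightarrow> (nat \<Rightarrow> 'a::unital_cstar_algebra) \<Rightarrow> real" where
  "hnorm I u = sqrt (norm (\<Sum>i\<in>I. star (u i) * u i))"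

lemma hnorm_nonneg [simp]: "0 \<le> hnorm I u"
  by (simp add: hnorm_def)

lemma hnorm_power2: "(hnorm I u)\<^sup>2 = norm (\<Sum>i\<in>I. star (u i) * u i)"
  by (simp add: hnorm_def)

lemma hnorm_cong: "(\<And>i. i \<in> I \<Longrightarrow> u i = v i) \<Longrightarrow> hnorm I u = hnorm I v"
  unfolding hnorm_def by (intro arg_cong[where f = "\<lambda>x. sqrt (norm x)"] sum.cong) auto

lemma cpos_hsum: "cpos (\<Sum>i\<in>I. star (u i) * u i)"
  by (intro cpos_sum cpos_star_mult)

lemma hnorm_mono:
  assumes "finite J" "I \<subseteq> J"
  shows "hnorm I u \<le> hnorm J u"
proof -
  have "(\<Sum>i\<in>J. star (u i) * u i) - (\<Sum>i\<in>I. star (u i) * u i) = (\<Sum>i\<in>J - I. star (u i) * u i)"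
    using assms by (simp add: sum_diff)
  then have "norm (\<Sum>i\<in>I. star (u i) * u i) \<le> norm (\<Sum>i\<in>J. star (u i) * u i)"
    by (intro cpos_norm_mono cpos_hsum) (simp only: cpos_hsum)
  then show ?thesis by (simp add: hnorm_def)
qed

lemma hnorm_restrict:
  assumes "finite J" "I \<subseteq> J"
  shows "hnorm J (\<lambda>i. if i \<in> I then u i else 0) = hnorm I u"
proof -
  have "(\<Sum>i\<in>J. star (if i \<in> I then u i else 0) * (if i \<in> I then u i else 0)) = (\<Sum>i\<in>I. star (u i) * u i)"
    using assms by (intro sum.mono_neutral_cong_right) auto
  then show ?thesis by (simp add: hnorm_def)
qed

lemma hnorm_scaleR: "0 \<le> r \<Longrightarrow> hnorm I (\<lambda>i. r *\<^sub>R u i) = r * hnorm I u"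
proof -
  assume r: "0 \<le> r"
  have "(\<Sum>i\<in>I. star (r *\<^sub>R u i) * (r *\<^sub>R u i)) = (r * r) *\<^sub>R (\<Sum>i\<in>I. star (u i) * u i)"
    by (simp add: scaleR_sum_right)
  then show ?thesis using r by (simp add: hnorm_def real_sqrt_mult)
qed

lemma hnorm_eq_0:
  assumes "finite I" "hnorm I u = 0" "i \<in> I"
  shows "u i = 0"
proof -
  have "(\<Sum>i\<in>I. star (u i) * u i) = 0" using assms(2) by (simp add: hnorm_def)
  from cpos_sum_eq_0[OF assms(1) _ this assms(3)] show ?thesis by (simp add: cpos_star_mult)
qed

lemma norm_le_hnorm:
  assumes "finite I" "i \<in> I"
  shows "norm (u i) \<le> hnorm I u"
proof -
  have "hnorm {i} u \<le> hnorm I u" using assms by (intro hnorm_mono) auto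
  then show ?thesis by (simp add: hnorm_def cstar_identity)
qed

text \<open>With \<open>c = \<langle>v, u\<rangle>\<close> and \<open>\<parallel>v\<parallel> \<le> 1\<close>, expanding \<open>0 \<le> \<langle>u - vc, u - vc\<rangle>\<close> gives \<open>c\<^sup>*c \<le> \<langle>u, u\<rangle>\<close>.\<close>

lemma hnorm_Cauchy_Schwarz:
  assumes "finite I"
  shows "norm (\<Sum>i\<in>I. star (v i) * u i) \<le> hnorm I v * hnorm I u"
proof -
  have norm1: "norm (\<Sum>i\<in>I. star (v i) * u i) \<le> hnorm I u" if "hnorm I v \<le> 1" for v
  proof -
    define c where "c = (\<Sum>i\<in>I. star (v i) * u i)"
    define V where "V = (\<Sum>i\<in>I. star (v i) * v i)"
    define U where "U = (\<Sum>i\<in>I. star (u i) * u i)"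
    have sc: "star c = (\<Sum>i\<in>I. star (u i) * v i)" by (simp add: c_def star_sum star_mult star_star)
    have "(\<Sum>i\<in>I. star (u i - v i * c) * (u i - v i * c))
        = U - (\<Sum>i\<in>I. star (u i) * v i) * c - star c * (\<Sum>i\<in>I. star (v i) * u i) + star c * V * c"
      unfolding U_def V_def
      by (simp add: star_mult algebra_simps sum.distrib sum_subtractf sum_distrib_left sum_distrib_right)
    then have "(\<Sum>i\<in>I. star (u i - v i * c) * (u i - v i * c)) = U - star c * c - star c * c + star c * V * c"
      unfolding sc[symmetric] c_def[symmetric] .
    then have c1: "cpos (U - star c * c - star c * c + star c * V * c)"
      using cpos_hsum[of "\<lambda>i. u i - v i * c" I] by (simp only:)
    have "norm V \<le> 1" using that power_le_one[of "hnorm I v" 2] by (simp add: V_def hnorm_power2)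
    moreover have "star V = V" unfolding V_def by (intro cpos_star cpos_hsum)
    ultimately have "cpos (star c * (1 - V) * c)" by (intro cpos_conj cpos_one_minus)
    from cpos_add[OF c1 this] have "cpos (U - star c * c)" by (simp add: algebra_simps)
    then have "norm (star c * c) \<le> norm U" by (intro cpos_norm_mono cpos_star_mult)
    then have "(norm c)\<^sup>2 \<le> (hnorm I u)\<^sup>2" by (simp add: cstar_identity U_def hnorm_power2)
    then show ?thesis unfolding c_def by (rule power2_le_imp_le) simp
  qed
  show ?thesis
  proof (cases "hnorm I v = 0")
    case True
    then show ?thesis using hnorm_eq_0[OF assms True] by simp
  next
    case False
    define r where "r = hnorm I v"
    have r: "r > 0" using False hnorm_nonneg[of I v] by (simp add: r_def less_eq_real_def)
    have "norm (\<Sum>i\<in>I. star ((1 / r) *\<^sub>R v i) * u i) \<le> hnorm I u"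
      using r by (intro norm1) (simp add: hnorm_scaleR r_def)
    moreover have "(\<Sum>i\<in>I. star ((1 / r) *\<^sub>R v i) * u i) = (1 / r) *\<^sub>R (\<Sum>i\<in>I. star (v i) * u i)"
      by (simp add: scaleR_sum_right)
    ultimately show ?thesis using r by (simp add: r_def field_simps)
  qed
qed

text \<open>A bound for the sesquilinear form of a matrix that may be infinite. Working with bounds avoids the
  value \<open>\<infinity>\<close> of the operator norm.\<close>

definition bdd_mat :: "'a::unital_cstar_algebra imat \<Rightarrow> real \<Rightarrow> bool" where
  "bdd_mat x M \<longleftrightarrow> (\<forall>n u v. norm (\<Sum>i<n. \<Sum>j<n. star (v i) * x i j * u j) \<le> M * hnorm {..<n} v * hnorm {..<n} u)"

lemma imat_norm_le_iff:
  assumes "0 \<le> M"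
  shows "imat_norm x \<le> ennreal M \<longleftrightarrow> bdd_mat x M"
proof
  assume le: "imat_norm x \<le> ennreal M"
  show "bdd_mat x M"
    unfolding bdd_mat_def
  proof (intro allI)
    fix n :: nat and u v :: "nat \<Rightarrow> 'a"
    define a where "a = hnorm {..<n} v"
    define b where "b = hnorm {..<n} u"
    define s where "s = (\<Sum>i<n. \<Sum>j<n. star (v i) * x i j * u j)"
    show "norm s \<le> M * a * b"
    proof (cases "a = 0 \<or> b = 0")
      case True
      then have "s = 0"
        using hnorm_eq_0[of "{..<n}" v] hnorm_eq_0[of "{..<n}" u] unfolding s_def a_def b_def
        by (intro sum.neutral ballI) auto
      then show ?thesis using assms by (simp add: a_def b_def)
    next
      case False
      then have ab: "a > 0" "b > 0" using hnorm_nonneg by (auto simp: a_def b_def less_eq_real_def)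
      define u' where "u' i = (1 / b) *\<^sub>R u i" for i
      define v' where "v' i = (1 / a) *\<^sub>R v i" for i
      have "(hnorm {..<n} u')\<^sup>2 = 1" "(hnorm {..<n} v')\<^sup>2 = 1"
        using ab unfolding u'_def v'_def by (simp_all add: hnorm_scaleR a_def b_def)
      then have n1: "norm (\<Sum>i<n. star (u' i) * u' i) \<le> 1" "norm (\<Sum>i<n. star (v' i) * v' i) \<le> 1"
        unfolding hnorm_power2 by simp_all
      have "ennreal (norm (\<Sum>i<n. \<Sum>j<n. star (v' i) * x i j * u' j)) \<le> imat_norm x"
        unfolding imat_norm_def by (rule SUP_upper2[of "(n, u', v')"]) (use n1 in auto)
      also note le
      finally have "norm (\<Sum>i<n. \<Sum>j<n. star (v' i) * x i j * u' j) \<le> M" using assms by simp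
      moreover have "(\<Sum>i<n. \<Sum>j<n. star (v' i) * x i j * u' j) = (1 / (a * b)) *\<^sub>R s"
        by (simp add: u'_def v'_def s_def scaleR_sum_right mult.commute)
      ultimately show ?thesis using ab by (simp add: field_simps)
    qed
  qed
next
  assume b: "bdd_mat x M"
  show "imat_norm x \<le> ennreal M"
    unfolding imat_norm_def
  proof (rule SUP_least, clarify)
    fix n :: nat and u v :: "nat \<Rightarrow> 'a"
    assume "norm (\<Sum>i<n. star (u i) * u i) \<le> 1" "norm (\<Sum>i<n. star (v i) * v i) \<le> 1"
    then have uv: "hnorm {..<n} u \<le> 1" "hnorm {..<n} v \<le> 1" by (simp_all add: hnorm_def)
    have "norm (\<Sum>i<n. \<Sum>j<n. star (v i) * x i j * u j) \<le> M * hnorm {..<n} v * hnorm {..<n} u"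
      using b by (simp add: bdd_mat_def)
    also have "\<dots> \<le> M * 1 * 1" using uv assms by (intro mult_mono) auto
    finally show "ennreal (norm (\<Sum>i<n. \<Sum>j<n. star (v i) * x i j * u j)) \<le> ennreal M"
      by (simp add: ennreal_leI)
  qed
qed

lemma imat_closure_iff:
  "x \<in> imat_closure S \<longleftrightarrow> (\<forall>\<epsilon>>0. \<exists>y\<in>S. bdd_mat (\<lambda>i j. x i j - y i j) \<epsilon>)"
proof
  assume x: "x \<in> imat_closure S"
  show "\<forall>\<epsilon>>0. \<exists>y\<in>S. bdd_mat (\<lambda>i j. x i j - y i j) \<epsilon>"
  proof (intro allI impI)
    fix \<epsilon> :: real assume e: "\<epsilon> > 0"
    then obtain y where "y \<in> S" "imat_norm (\<lambda>i j. x i j - y i j) < ennreal \<epsilon>"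
      using x by (auto simp: imat_closure_def)
    then show "\<exists>y\<in>S. bdd_mat (\<lambda>i j. x i j - y i j) \<epsilon>"
      using e imat_norm_le_iff[of \<epsilon> "\<lambda>i j. x i j - y i j"] by (intro bexI[of _ y]) auto
  qed
next
  assume *: "\<forall>\<epsilon>>0. \<exists>y\<in>S. bdd_mat (\<lambda>i j. x i j - y i j) \<epsilon>"
  show "x \<in> imat_closure S"
    unfolding imat_closure_def
  proof (intro CollectI allI impI)
    fix \<epsilon> :: real assume e: "\<epsilon> > 0"
    then obtain y where y: "y \<in> S" "bdd_mat (\<lambda>i j. x i j - y i j) (\<epsilon> / 2)" using * half_gt_zero by blast
    then have "imat_norm (\<lambda>i j. x i j - y i j) \<le> ennreal (\<epsilon> / 2)" using e by (subst imat_norm_le_iff) auto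
    also have "\<dots> < ennreal \<epsilon>" using e by (intro ennreal_lessI) auto
    finally show "\<exists>y\<in>S. imat_norm (\<lambda>i j. x i j - y i j) < ennreal \<epsilon>" using y(1) by blast
  qed
qed

lemma bdd_mat_add:
  assumes "bdd_mat x M" "bdd_mat y N"
  shows "bdd_mat (\<lambda>i j. x i j + y i j) (M + N)"
  unfolding bdd_mat_def
proof (intro allI)
  fix n :: nat and u v :: "nat \<Rightarrow> 'a"
  have eq: "(\<Sum>i<n. \<Sum>j<n. star (v i) * (x i j + y i j) * u j)
      = (\<Sum>i<n. \<Sum>j<n. star (v i) * x i j * u j) + (\<Sum>i<n. \<Sum>j<n. star (v i) * y i j * u j)"
    by (simp add: algebra_simps sum.distrib)
  have "norm (\<Sum>i<n. \<Sum>j<n. star (v i) * (x i j + y i j) * u j)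
      \<le> norm (\<Sum>i<n. \<Sum>j<n. star (v i) * x i j * u j) + norm (\<Sum>i<n. \<Sum>j<n. star (v i) * y i j * u j)"
    unfolding eq by (rule norm_triangle_ineq)
  also have "\<dots> \<le> M * hnorm {..<n} v * hnorm {..<n} u + N * hnorm {..<n} v * hnorm {..<n} u"
    using assms unfolding bdd_mat_def by (intro add_mono) auto
  finally show "norm (\<Sum>i<n. \<Sum>j<n. star (v i) * (x i j + y i j) * u j) \<le> (M + N) * hnorm {..<n} v * hnorm {..<n} u"
    by (simp add: algebra_simps)
qed

lemma bdd_mat_scaleC:
  assumes "bdd_mat x M"
  shows "bdd_mat (\<lambda>i j. c *\<^sub>C x i j) (cmod c * M)"
  unfolding bdd_mat_def
proof (intro allI)
  fix n :: nat and u v :: "nat \<Rightarrow> 'a"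
  have "(\<Sum>i<n. \<Sum>j<n. star (v i) * (c *\<^sub>C x i j) * u j) = c *\<^sub>C (\<Sum>i<n. \<Sum>j<n. star (v i) * x i j * u j)"
    by (simp add: scaleC_sum mult_scaleC_left mult_scaleC_right)
  moreover have "cmod c * norm (\<Sum>i<n. \<Sum>j<n. star (v i) * x i j * u j) \<le> cmod c * (M * hnorm {..<n} v * hnorm {..<n} u)"
    using assms unfolding bdd_mat_def by (intro mult_left_mono) auto
  ultimately show "norm (\<Sum>i<n. \<Sum>j<n. star (v i) * (c *\<^sub>C x i j) * u j) \<le> cmod c * M * hnorm {..<n} v * hnorm {..<n} u"
    by (simp add: norm_scaleC mult.assoc)
qed

lemma bdd_mat_minus: "bdd_mat x M \<Longrightarrow> bdd_mat (\<lambda>i j. - x i j) M"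
  using bdd_mat_scaleC[of x M "-1"] by simp

lemma bdd_mat_diff: "bdd_mat x M \<Longrightarrow> bdd_mat y N \<Longrightarrow> bdd_mat (\<lambda>i j. x i j - y i j) (M + N)"
  using bdd_mat_add[OF _ bdd_mat_minus, of x M y N] by simp

lemma bdd_mat_mono: "bdd_mat x M \<Longrightarrow> M \<le> N \<Longrightarrow> bdd_mat x N"
  unfolding bdd_mat_def by (meson order_trans mult_right_mono hnorm_nonneg)

lemma bdd_mat_star:
  assumes "bdd_mat x M"
  shows "bdd_mat (imat_star x) M"
  unfolding bdd_mat_def
proof (intro allI)
  fix n :: nat and u v :: "nat \<Rightarrow> 'a"
  have "star (\<Sum>i<n. \<Sum>j<n. star (v i) * imat_star x i j * u j) = (\<Sum>i<n. \<Sum>j<n. star (u j) * x j i * v i)"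
    by (simp add: star_sum star_mult star_star imat_star_def mult.assoc)
  also have "\<dots> = (\<Sum>j<n. \<Sum>i<n. star (u j) * x j i * v i)" by (rule sum.swap)
  finally have eq: "star (\<Sum>i<n. \<Sum>j<n. star (v i) * imat_star x i j * u j) = (\<Sum>j<n. \<Sum>i<n. star (u j) * x j i * v i)" .
  have "norm (\<Sum>i<n. \<Sum>j<n. star (v i) * imat_star x i j * u j) = norm (\<Sum>j<n. \<Sum>i<n. star (u j) * x j i * v i)"
    unfolding eq[symmetric] by (rule star_in_norm[symmetric])
  also have "\<dots> \<le> M * hnorm {..<n} u * hnorm {..<n} v" using assms by (simp add: bdd_mat_def)
  finally show "norm (\<Sum>i<n. \<Sum>j<n. star (v i) * imat_star x i j * u j) \<le> M * hnorm {..<n} v * hnorm {..<n} u"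
    by (simp add: mult_ac)
qed

lemma bdd_matD:
  assumes "bdd_mat x M" "finite I" "finite J"
  shows "norm (\<Sum>i\<in>I. \<Sum>j\<in>J. star (v i) * x i j * u j) \<le> M * hnorm I v * hnorm J u"
proof -
  obtain n where n: "I \<union> J \<subseteq> {..<n}" using assms by (metis finite_UnI finite_nat_iff_bounded)
  define u' where "u' j = (if j \<in> J then u j else 0)" for j
  define v' where "v' i = (if i \<in> I then v i else 0)" for i
  have "(\<Sum>i\<in>I. \<Sum>j\<in>J. star (v i) * x i j * u j) = (\<Sum>i<n. \<Sum>j\<in>J. star (v' i) * x i j * u j)"
    using n assms(3) by (intro sum.mono_neutral_cong_left) (auto simp: v'_def)
  also have "\<dots> = (\<Sum>i<n. \<Sum>j<n. star (v' i) * x i j * u' j)"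
    using n assms(3) by (intro sum.cong refl sum.mono_neutral_cong_left) (auto simp: u'_def)
  finally have "norm (\<Sum>i\<in>I. \<Sum>j\<in>J. star (v i) * x i j * u j) \<le> M * hnorm {..<n} v' * hnorm {..<n} u'"
    using assms(1) by (simp add: bdd_mat_def)
  then show ?thesis using n unfolding u'_def v'_def by (simp add: hnorm_restrict)
qed

text \<open>Apply the form to the pair \<open>(w, u)\<close>, where \<open>w = xu\<close>.\<close>

lemma bdd_mat_hnorm:
  assumes "bdd_mat x M" "finite I" "finite J" "0 \<le> M"
  shows "hnorm I (\<lambda>i. \<Sum>j\<in>J. x i j * u j) \<le> M * hnorm J u"
proof -
  define w where "w i = (\<Sum>j\<in>J. x i j * u j)" for i
  have "(hnorm I w)\<^sup>2 = norm (\<Sum>i\<in>I. star (w i) * w i)" by (rule hnorm_power2)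
  also have "(\<Sum>i\<in>I. star (w i) * w i) = (\<Sum>i\<in>I. \<Sum>j\<in>J. star (w i) * x i j * u j)"
    by (intro sum.cong refl) (simp add: w_def sum_distrib_left mult.assoc)
  also have "norm \<dots> \<le> M * hnorm I w * hnorm J u" by (rule bdd_matD[OF assms(1-3)])
  finally have "hnorm I w * hnorm I w \<le> hnorm I w * (M * hnorm J u)" by (simp add: power2_eq_square mult_ac)
  then have "hnorm I w \<le> M * hnorm J u"
    using assms(4) hnorm_nonneg[of I w] by (cases "hnorm I w = 0") (auto simp: mult_le_cancel_left)
  then show ?thesis unfolding w_def[abs_def] .
qed

lemma hnorm_single [simp]: "hnorm {i} (\<lambda>_. 1) = 1"
  by (simp add: hnorm_def)

lemma bdd_mat_col: "bdd_mat x M \<Longrightarrow> finite I \<Longrightarrow> 0 \<le> M \<Longrightarrow> hnorm I (\<lambda>i. x i j) \<le> M"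
  using bdd_mat_hnorm[of x M I "{j}" "\<lambda>_. 1"] by simp

lemma bdd_mat_row: "bdd_mat x M \<Longrightarrow> finite J \<Longrightarrow> 0 \<le> M \<Longrightarrow> hnorm J (\<lambda>j. star (x i j)) \<le> M"
  using bdd_mat_col[OF bdd_mat_star, of x M J i] by (simp add: imat_star_def)

lemma bdd_mat_entry: "bdd_mat x M \<Longrightarrow> norm (x i j) \<le> M"
  using bdd_matD[of x M "{i}" "{j}" "\<lambda>_. 1" "\<lambda>_. 1"] by simp

lemma bdd_mat_nonneg: "bdd_mat x M \<Longrightarrow> 0 \<le> M"
  using bdd_mat_entry order_trans norm_ge_zero by metis

lemma bdd_mat_lim:
  assumes "\<And>i j. (\<lambda>n. X n i j) \<longlonglongrightarrow> x i j" "\<And>n. n \<ge> N \<Longrightarrow> bdd_mat (X n) M"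
  shows "bdd_mat x M"
  unfolding bdd_mat_def
proof (intro allI)
  fix n :: nat and u v :: "nat \<Rightarrow> 'a"
  have "(\<lambda>m. norm (\<Sum>i<n. \<Sum>j<n. star (v i) * X m i j * u j)) \<longlonglongrightarrow> norm (\<Sum>i<n. \<Sum>j<n. star (v i) * x i j * u j)"
    by (intro tendsto_intros assms)
  then show "norm (\<Sum>i<n. \<Sum>j<n. star (v i) * x i j * u j) \<le> M * hnorm {..<n} v * hnorm {..<n} u"
    by (rule LIMSEQ_le_const2) (intro exI[of _ N] allI impI, use assms(2) in \<open>simp add: bdd_mat_def\<close>)
qed

section \<open>Norm limits of scalar plus finite matrices\<close>

definition fin_mat :: "'a::unital_cstar_algebra imat \<Rightarrow> bool" where
  "fin_mat x \<longleftrightarrow> (\<exists>n. \<forall>i j. i \<ge> n \<or> j \<ge> n \<longrightarrow> x i j = 0)"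

definition scalar_mat :: "complex \<Rightarrow> 'a::unital_cstar_algebra imat" where
  "scalar_mat c = (\<lambda>i j. if i = j then c *\<^sub>C 1 else 0)"

text \<open>Adding the scalars to the finite matrices provides a unit for the C*-algebra to be constructed.
  Without a unit the definition of positivity above makes no sense.\<close>

definition sfin_mat :: "'a::unital_cstar_algebra imat \<Rightarrow> bool" where
  "sfin_mat x \<longleftrightarrow> (\<exists>c n. \<forall>i j. i \<ge> n \<or> j \<ge> n \<longrightarrow> x i j = scalar_mat c i j)"

lemma fin_mat_imp_sfin_mat: "fin_mat x \<Longrightarrow> sfin_mat x"
  unfolding fin_mat_def sfin_mat_def scalar_mat_def
  by (elim exE, rule exI[of _ "0::complex"], rule exI) auto

lemma bdd_mat_scalar: "bdd_mat (scalar_mat c) (cmod c)"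
proof -
  have "bdd_mat (\<lambda>i j. if i = j then 1 else (0::'a)) 1"
    unfolding bdd_mat_def
  proof (intro allI)
    fix n :: nat and u v :: "nat \<Rightarrow> 'a"
    have "(\<Sum>i<n. \<Sum>j<n. star (v i) * (if i = j then 1 else 0) * u j) = (\<Sum>i<n. \<Sum>j<n. if j = i then star (v i) * u i else 0)"
      by (intro sum.cong refl) auto
    also have "\<dots> = (\<Sum>i<n. star (v i) * u i)" by (simp add: sum.delta)
    finally show "norm (\<Sum>i<n. \<Sum>j<n. star (v i) * (if i = j then 1 else 0) * u j) \<le> 1 * hnorm {..<n} v * hnorm {..<n} u"
      using hnorm_Cauchy_Schwarz[of "{..<n}" v u] by simp
  qed
  from bdd_mat_scaleC[OF this, of c] show ?thesis by (simp add: scalar_mat_def if_distrib cong: if_cong)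
qed

lemma fin_mat_bdd:
  assumes "fin_mat x"
  shows "\<exists>M. bdd_mat x M"
proof -
  obtain n where n: "\<And>i j. i \<ge> n \<or> j \<ge> n \<Longrightarrow> x i j = 0" using assms by (auto simp: fin_mat_def)
  define M where "M = (\<Sum>(i, j)\<in>{..<n} \<times> {..<n}. norm (x i j))"
  have "bdd_mat x M"
    unfolding bdd_mat_def
  proof (intro allI)
    fix m :: nat and u v :: "nat \<Rightarrow> 'a"
    let ?I = "{..<m} \<times> {..<m} :: (nat \<times> nat) set" and ?N = "{..<n} \<times> {..<n} :: (nat \<times> nat) set"
    let ?h = "hnorm {..<m} v * hnorm {..<m} u"
    have "norm (\<Sum>i<m. \<Sum>j<m. star (v i) * x i j * u j) = norm (\<Sum>(i, j)\<in>?I. star (v i) * x i j * u j)"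
      by (simp add: sum.cartesian_product)
    also have "\<dots> \<le> (\<Sum>(i, j)\<in>?I. norm (star (v i) * x i j * u j))"
      by (rule order_trans[OF norm_sum]) (simp add: case_prod_unfold)
    also have "\<dots> \<le> (\<Sum>(i, j)\<in>?I. norm (x i j) * ?h)"
    proof (rule sum_mono, clarify)
      fix i j assume "i < m" "j < m"
      then have h: "norm (v i) \<le> hnorm {..<m} v" "norm (u j) \<le> hnorm {..<m} u"
        by (simp_all add: norm_le_hnorm)
      have "norm (star (v i) * x i j * u j) \<le> norm (star (v i)) * norm (x i j) * norm (u j)"
        by (rule order_trans[OF norm_mult_ineq mult_right_mono[OF norm_mult_ineq]]) simp
      also have "\<dots> = norm (x i j) * (norm (v i) * norm (u j))" by simp
      also have "\<dots> \<le> norm (x i j) * ?h" using h by (intro mult_left_mono mult_mono) auto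
      finally show "norm (star (v i) * x i j * u j) \<le> norm (x i j) * ?h" .
    qed
    also have "\<dots> = (\<Sum>(i, j)\<in>?I. norm (x i j)) * ?h" by (simp add: sum_distrib_right case_prod_unfold)
    also have "(\<Sum>(i, j)\<in>?I. norm (x i j)) = (\<Sum>(i, j)\<in>?I \<inter> ?N. norm (x i j))"
    proof (rule sum.mono_neutral_right)
      show "\<forall>p\<in>?I - ?I \<inter> ?N. (case p of (i, j) \<Rightarrow> norm (x i j)) = 0"
      proof
        fix p assume "p \<in> ?I - ?I \<inter> ?N"
        then have "fst p \<ge> n \<or> snd p \<ge> n" by (auto simp: not_less)
        then show "(case p of (i, j) \<Rightarrow> norm (x i j)) = 0" using n by (simp add: case_prod_unfold)
      qed
    qed auto
    also have "(\<Sum>(i, j)\<in>?I \<inter> ?N. norm (x i j)) \<le> M"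
      unfolding M_def by (rule sum_mono2) auto
    finally show "norm (\<Sum>i<m. \<Sum>j<m. star (v i) * x i j * u j) \<le> M * hnorm {..<m} v * hnorm {..<m} u"
      by (simp add: mult_right_mono mult.assoc)
  qed
  then show ?thesis ..
qed

lemma sfin_mat_decomp:
  assumes "sfin_mat x"
  obtains c f where "fin_mat f" "x = (\<lambda>i j. scalar_mat c i j + f i j)"
proof -
  obtain c n where *: "\<And>i j. i \<ge> n \<or> j \<ge> n \<Longrightarrow> x i j = scalar_mat c i j"
    using assms by (auto simp: sfin_mat_def)
  show ?thesis
  proof (rule that[of "\<lambda>i j. x i j - scalar_mat c i j" c])
    show "fin_mat (\<lambda>i j. x i j - scalar_mat c i j)"
      unfolding fin_mat_def by (rule exI[of _ n]) (simp add: *)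
  qed auto
qed

lemma sfin_mat_bdd:
  assumes "sfin_mat x"
  shows "\<exists>M. bdd_mat x M"
proof -
  obtain c f where f: "fin_mat f" "x = (\<lambda>i j. scalar_mat c i j + f i j)"
    using assms by (rule sfin_mat_decomp)
  then obtain M where "bdd_mat f M" using fin_mat_bdd by blast
  from bdd_mat_add[OF bdd_mat_scalar this] show ?thesis unfolding f(2) by blast
qed

lemma sfin_matI: "(\<And>i j. i \<ge> n \<or> j \<ge> n \<Longrightarrow> x i j = scalar_mat c i j) \<Longrightarrow> sfin_mat x"
  unfolding sfin_mat_def by blast

lemma sfin_mat_scalar: "sfin_mat (scalar_mat c)"
  by (rule sfin_matI[of 0]) simp

lemma sfin_mat_add:
  assumes "sfin_mat x" "sfin_mat y"
  shows "sfin_mat (\<lambda>i j. x i j + y i j)"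
proof -
  obtain c m where x: "\<And>i j. i \<ge> m \<or> j \<ge> m \<Longrightarrow> x i j = scalar_mat c i j" using assms(1) by (auto simp: sfin_mat_def)
  obtain d n where y: "\<And>i j. i \<ge> n \<or> j \<ge> n \<Longrightarrow> y i j = scalar_mat d i j" using assms(2) by (auto simp: sfin_mat_def)
  have "x i j + y i j = scalar_mat (c + d) i j" if "i \<ge> max m n \<or> j \<ge> max m n" for i j
    using x[of i j] y[of i j] that by (auto simp: scalar_mat_def scaleC_add_left)
  then show ?thesis by (rule sfin_matI)
qed

lemma sfin_mat_scaleC:
  assumes "sfin_mat x"
  shows "sfin_mat (\<lambda>i j. a *\<^sub>C x i j)"
proof -
  obtain c m where x: "\<And>i j. i \<ge> m \<or> j \<ge> m \<Longrightarrow> x i j = scalar_mat c i j" using assms(1) by (auto simp: sfin_mat_def)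
  have "a *\<^sub>C x i j = scalar_mat (a * c) i j" if "i \<ge> m \<or> j \<ge> m" for i j
    using x[OF that] by (auto simp: scalar_mat_def scaleC_scaleC)
  then show ?thesis by (rule sfin_matI)
qed

lemma sfin_mat_star:
  assumes "sfin_mat x"
  shows "sfin_mat (imat_star x)"
proof -
  obtain c m where x: "\<And>i j. i \<ge> m \<or> j \<ge> m \<Longrightarrow> x i j = scalar_mat c i j" using assms(1) by (auto simp: sfin_mat_def)
  have "imat_star x i j = scalar_mat (cnj c) i j" if "i \<ge> m \<or> j \<ge> m" for i j
    using x[of j i] that by (auto simp: scalar_mat_def imat_star_def star_scaleC)
  then show ?thesis by (rule sfin_matI)
qed

lemma sfin_mat_row:
  assumes "sfin_mat x"
  shows "\<exists>K. \<forall>k\<ge>K. x i k = 0 \<and> x k i = 0"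
proof -
  obtain c m where x: "\<And>i j. i \<ge> m \<or> j \<ge> m \<Longrightarrow> x i j = scalar_mat c i j" using assms(1) by (auto simp: sfin_mat_def)
  then show ?thesis by (intro exI[of _ "max m (Suc i)"]) (auto simp: scalar_mat_def)
qed

lemma sfin_mat_mult:
  assumes "sfin_mat x" "sfin_mat y"
  shows "sfin_mat (imat_mult x y)"
proof -
  obtain c m where x: "\<And>i j. i \<ge> m \<or> j \<ge> m \<Longrightarrow> x i j = scalar_mat c i j" using assms(1) by (auto simp: sfin_mat_def)
  obtain d n where y: "\<And>i j. i \<ge> n \<or> j \<ge> n \<Longrightarrow> y i j = scalar_mat d i j" using assms(2) by (auto simp: sfin_mat_def)
  have "imat_mult x y i j = scalar_mat (c * d) i j" if ij: "i \<ge> max m n \<or> j \<ge> max m n" for i j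
  proof (cases "i \<ge> max m n")
    case True
    have "imat_mult x y i j = (\<Sum>k\<in>{i}. x i k * y k j)"
      unfolding imat_mult_def by (rule suminf_finite) (use x True in \<open>auto simp: scalar_mat_def\<close>)
    then show ?thesis using x[of i i] y[of i j] True
      by (auto simp: scalar_mat_def mult_scaleC_left scaleC_scaleC)
  next
    case False
    then have j: "j \<ge> max m n" using ij by blast
    have "imat_mult x y i j = (\<Sum>k\<in>{j}. x i k * y k j)"
      unfolding imat_mult_def by (rule suminf_finite) (use y j in \<open>auto simp: scalar_mat_def\<close>)
    then show ?thesis using x[of i j] y[of j j] j
      by (auto simp: scalar_mat_def mult_scaleC_left scaleC_scaleC)
  qed
  then show ?thesis by (rule sfin_matI)
qed

abbreviation stab_set :: "'a::unital_cstar_algebra imat set" where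
  "stab_set \<equiv> imat_closure (Collect sfin_mat)"

lemma stab_setD:
  assumes "x \<in> stab_set" "\<epsilon> > 0"
  obtains y where "sfin_mat y" "bdd_mat (\<lambda>i j. x i j - y i j) \<epsilon>"
  using assms unfolding imat_closure_iff by blast

lemma bdd_mat_zero: "bdd_mat (\<lambda>i j. 0) 0"
  by (simp add: bdd_mat_def)

lemma imat_closure_superset: "x \<in> S \<Longrightarrow> x \<in> imat_closure S"
  unfolding imat_closure_iff
  by (intro allI impI bexI[of _ x]) (auto intro: bdd_mat_mono[OF bdd_mat_zero])

lemma imat_closure_mono: "S \<subseteq> T \<Longrightarrow> imat_closure S \<subseteq> imat_closure T"
  unfolding imat_closure_iff subset_iff by blast

text \<open>Closures are closed; \<open>x\<close> is arbitrary here and might have an infinite norm.\<close>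

lemma imat_closure_closure:
  assumes "\<And>\<epsilon>. \<epsilon> > 0 \<Longrightarrow> \<exists>y\<in>imat_closure S. bdd_mat (\<lambda>i j. x i j - y i j) \<epsilon>"
  shows "x \<in> imat_closure S"
  unfolding imat_closure_iff
proof (intro allI impI)
  fix \<epsilon> :: real assume e: "\<epsilon> > 0"
  obtain y where y: "y \<in> imat_closure S" "bdd_mat (\<lambda>i j. x i j - y i j) (\<epsilon> / 2)" using assms e half_gt_zero by blast
  then obtain z where z: "z \<in> S" "bdd_mat (\<lambda>i j. y i j - z i j) (\<epsilon> / 2)"
    using e half_gt_zero unfolding imat_closure_iff by blast
  from bdd_mat_add[OF y(2) z(2)] show "\<exists>y\<in>S. bdd_mat (\<lambda>i j. x i j - y i j) \<epsilon>"
    using z(1) by auto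
qed

lemma stab_set_bdd:
  assumes "x \<in> stab_set"
  shows "\<exists>M. bdd_mat x M"
proof -
  obtain y where y: "sfin_mat y" "bdd_mat (\<lambda>i j. x i j - y i j) 1" using stab_setD[OF assms, of 1] by auto
  then obtain M where "bdd_mat y M" using sfin_mat_bdd by blast
  from bdd_mat_add[OF y(2) this] show ?thesis by auto
qed

lemma stab_set_sfin: "sfin_mat x \<Longrightarrow> x \<in> stab_set"
  by (rule imat_closure_superset) simp

lemma stab_set_add:
  assumes "x \<in> stab_set" "y \<in> stab_set"
  shows "(\<lambda>i j. x i j + y i j) \<in> stab_set"
  unfolding imat_closure_iff
proof (intro allI impI)
  fix \<epsilon> :: real assume e: "\<epsilon> > 0"
  obtain x' where x': "sfin_mat x'" "bdd_mat (\<lambda>i j. x i j - x' i j) (\<epsilon> / 2)" using stab_setD[OF assms(1), of "\<epsilon> / 2"] e by auto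
  obtain y' where y': "sfin_mat y'" "bdd_mat (\<lambda>i j. y i j - y' i j) (\<epsilon> / 2)" using stab_setD[OF assms(2), of "\<epsilon> / 2"] e by auto
  from bdd_mat_add[OF x'(2) y'(2)] have "bdd_mat (\<lambda>i j. (x i j + y i j) - (x' i j + y' i j)) \<epsilon>"
    by (simp add: algebra_simps)
  then show "\<exists>z\<in>Collect sfin_mat. bdd_mat (\<lambda>i j. (x i j + y i j) - z i j) \<epsilon>"
    using sfin_mat_add[OF x'(1) y'(1)] by (intro bexI[of _ "\<lambda>i j. x' i j + y' i j"]) auto
qed

lemma stab_set_scaleC:
  assumes "x \<in> stab_set"
  shows "(\<lambda>i j. c *\<^sub>C x i j) \<in> stab_set"
  unfolding imat_closure_iff
proof (intro allI impI)
  fix \<epsilon> :: real assume e: "\<epsilon> > 0"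
  define d where "d = \<epsilon> / (cmod c + 1)"
  have d: "d > 0" using e by (simp add: d_def add_nonneg_pos)
  obtain x' where x': "sfin_mat x'" "bdd_mat (\<lambda>i j. x i j - x' i j) d" using stab_setD[OF assms d] by auto
  have "(cmod c + 1) * d = \<epsilon>"
    unfolding d_def by (subst times_divide_eq_right)
      (rule nonzero_mult_div_cancel_left, use norm_ge_zero[of c] in linarith)
  then have "cmod c * d \<le> \<epsilon>" using d by (simp add: distrib_right)
  from bdd_mat_mono[OF bdd_mat_scaleC[OF x'(2)] this] have "bdd_mat (\<lambda>i j. c *\<^sub>C x i j - c *\<^sub>C x' i j) \<epsilon>"
    by (simp add: scaleC_diff_right)
  then show "\<exists>z\<in>Collect sfin_mat. bdd_mat (\<lambda>i j. c *\<^sub>C x i j - z i j) \<epsilon>"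
    using sfin_mat_scaleC[OF x'(1), of c] by (intro bexI[of _ "\<lambda>i j. c *\<^sub>C x' i j"]) auto
qed

lemma stab_set_minus: "x \<in> stab_set \<Longrightarrow> (\<lambda>i j. - x i j) \<in> stab_set"
  using stab_set_scaleC[of x "-1"] by simp

lemma stab_set_diff: "x \<in> stab_set \<Longrightarrow> y \<in> stab_set \<Longrightarrow> (\<lambda>i j. x i j - y i j) \<in> stab_set"
  using stab_set_add[OF _ stab_set_minus, of x y] by simp

lemma stab_set_star:
  assumes "x \<in> stab_set"
  shows "imat_star x \<in> stab_set"
  unfolding imat_closure_iff
proof (intro allI impI)
  fix \<epsilon> :: real assume e: "\<epsilon> > 0"
  obtain x' where x': "sfin_mat x'" "bdd_mat (\<lambda>i j. x i j - x' i j) \<epsilon>" using stab_setD[OF assms e] by auto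
  from bdd_mat_star[OF x'(2)] have "bdd_mat (\<lambda>i j. imat_star x i j - imat_star x' i j) \<epsilon>"
    by (simp add: imat_star_def)
  then show "\<exists>z\<in>Collect sfin_mat. bdd_mat (\<lambda>i j. imat_star x i j - z i j) \<epsilon>"
    using sfin_mat_star[OF x'(1)] by blast
qed

section \<open>Products of infinite matrices\<close>

text \<open>Columns of norm limits of scalar plus finite matrices belong to the Hilbert module, although a
  bounded matrix in general need not have this property. It is the reason why the products below
  converge in norm.\<close>

lemma stab_set_col_tail:
  assumes "x \<in> stab_set" "\<epsilon> > 0"
  obtains K where "\<And>I. finite I \<Longrightarrow> (\<And>k. k \<in> I \<Longrightarrow> K \<le> k) \<Longrightarrow> hnorm I (\<lambda>k. x k j) \<le> \<epsilon>"
proof -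
  obtain y where y: "sfin_mat y" "bdd_mat (\<lambda>i j. x i j - y i j) \<epsilon>" using stab_setD[OF assms] by auto
  obtain K where K: "\<And>k. k \<ge> K \<Longrightarrow> y k j = 0" using sfin_mat_row[OF y(1)] by blast
  show ?thesis
  proof (rule that[of K])
    fix I assume I: "finite I" "\<And>k. k \<in> I \<Longrightarrow> K \<le> k"
    have "hnorm I (\<lambda>k. x k j) = hnorm I (\<lambda>k. x k j - y k j)"
      by (rule hnorm_cong) (simp add: K I)
    also have "\<dots> \<le> \<epsilon>" using bdd_mat_col[OF y(2) I(1), of j] assms(2) by simp
    finally show "hnorm I (\<lambda>k. x k j) \<le> \<epsilon>" .
  qed
qed

lemma stab_set_summable:
  assumes "x \<in> stab_set" "y \<in> stab_set"
  shows "summable (\<lambda>k. x i k * y k j)"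
  unfolding summable_Cauchy
proof (intro allI impI)
  fix e :: real assume e: "e > 0"
  obtain M where M: "bdd_mat x M" using stab_set_bdd[OF assms(1)] by blast
  have M0: "0 \<le> M" by (rule bdd_mat_nonneg[OF M])
  define d where "d = e / 2 / (M + 1)"
  have d: "d > 0" using e M0 by (simp add: d_def)
  obtain K where K: "\<And>I. finite I \<Longrightarrow> (\<And>k. k \<in> I \<Longrightarrow> K \<le> k) \<Longrightarrow> hnorm I (\<lambda>k. y k j) \<le> d"
    using stab_set_col_tail[OF assms(2) d] by metis
  show "\<exists>N. \<forall>m\<ge>N. \<forall>n. norm (\<Sum>k = m..<n. x i k * y k j) < e"
  proof (intro exI[of _ K] allI impI)
    fix m n assume "m \<ge> K"
    then have y: "hnorm {m..<n} (\<lambda>k. y k j) \<le> d" by (intro K) auto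
    have "norm (\<Sum>k = m..<n. x i k * y k j) \<le> hnorm {m..<n} (\<lambda>k. star (x i k)) * hnorm {m..<n} (\<lambda>k. y k j)"
      using hnorm_Cauchy_Schwarz[of "{m..<n}" "\<lambda>k. star (x i k)" "\<lambda>k. y k j"] by (simp add: star_star)
    also have "\<dots> \<le> M * d" using bdd_mat_row[OF M _ M0] y M0 d by (intro mult_mono) auto
    also have "\<dots> < e"
    proof -
      have "(M + 1) * d = e / 2"
        unfolding d_def by (subst times_divide_eq_right) (rule nonzero_mult_div_cancel_left, use M0 in simp)
      then show ?thesis using d e by (simp add: distrib_right)
    qed
    finally show "norm (\<Sum>k = m..<n. x i k * y k j) < e" .
  qed
qed

lemma imat_mult_sums:
  "x \<in> stab_set \<Longrightarrow> y \<in> stab_set \<Longrightarrow> (\<lambda>k. x i k * y k j) sums imat_mult x y i j"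
  unfolding imat_mult_def by (rule summable_sums[OF stab_set_summable])

lemma imat_mult_diff_left:
  assumes "x \<in> stab_set" "x' \<in> stab_set" "y \<in> stab_set"
  shows "imat_mult (\<lambda>i j. x i j - x' i j) y = (\<lambda>i j. imat_mult x y i j - imat_mult x' y i j)"
  using sums_diff[OF imat_mult_sums[OF assms(1,3)] imat_mult_sums[OF assms(2,3)]]
    imat_mult_sums[OF stab_set_diff[OF assms(1,2)] assms(3)]
  by (intro ext) (simp add: left_diff_distrib sums_iff)

lemma imat_mult_diff_right:
  assumes "x \<in> stab_set" "x' \<in> stab_set" "y \<in> stab_set"
  shows "imat_mult y (\<lambda>i j. x i j - x' i j) = (\<lambda>i j. imat_mult y x i j - imat_mult y x' i j)"
  using sums_diff[OF imat_mult_sums[OF assms(3,1)] imat_mult_sums[OF assms(3,2)]]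
    imat_mult_sums[OF assms(3) stab_set_diff[OF assms(1,2)]]
  by (intro ext) (simp add: right_diff_distrib sums_iff)

text \<open>Expanding the product, \<open>\<langle>v, xyu\<rangle> = \<langle>x\<^sup>*v, yu\<rangle>\<close>.\<close>

lemma bdd_mat_mult:
  assumes "x \<in> stab_set" "y \<in> stab_set" "bdd_mat x a" "bdd_mat y b"
  shows "bdd_mat (imat_mult x y) (a * b)"
  unfolding bdd_mat_def
proof (intro allI)
  fix n :: nat and u v :: "nat \<Rightarrow> 'a"
  define p where "p k = (\<Sum>i<n. star (v i) * x i k)" for k
  define w where "w k = (\<Sum>j<n. y k j * u j)" for k
  have ab: "0 \<le> a" "0 \<le> b" using assms bdd_mat_nonneg by auto
  have "(\<lambda>k. \<Sum>i<n. \<Sum>j<n. star (v i) * (x i k * y k j) * u j) sums (\<Sum>i<n. \<Sum>j<n. star (v i) * imat_mult x y i j * u j)"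
    by (intro sums_sum sums_mult sums_mult2 imat_mult_sums assms)
  moreover have "(\<Sum>i<n. \<Sum>j<n. star (v i) * (x i k * y k j) * u j) = p k * w k" for k
    by (simp add: p_def w_def sum_product mult.assoc)
  ultimately have "(\<lambda>K. norm (\<Sum>k<K. p k * w k)) \<longlonglongrightarrow> norm (\<Sum>i<n. \<Sum>j<n. star (v i) * imat_mult x y i j * u j)"
    unfolding sums_def by (auto intro: tendsto_norm)
  moreover have "norm (\<Sum>k<K. p k * w k) \<le> a * b * hnorm {..<n} v * hnorm {..<n} u" for K
  proof -
    have "star (p k) = (\<Sum>i<n. imat_star x k i * v i)" for k
      by (simp add: p_def star_sum star_mult star_star imat_star_def)
    then have p: "hnorm {..<K} (\<lambda>k. star (p k)) \<le> a * hnorm {..<n} v"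
      using bdd_mat_hnorm[OF bdd_mat_star[OF assms(3)], of "{..<K}" "{..<n}" v] ab by simp
    have w: "hnorm {..<K} w \<le> b * hnorm {..<n} u"
      unfolding w_def using bdd_mat_hnorm[OF assms(4), of "{..<K}" "{..<n}" u] ab by simp
    have "norm (\<Sum>k<K. p k * w k) \<le> hnorm {..<K} (\<lambda>k. star (p k)) * hnorm {..<K} w"
      using hnorm_Cauchy_Schwarz[of "{..<K}" "\<lambda>k. star (p k)" w] by (simp add: star_star)
    also have "\<dots> \<le> (a * hnorm {..<n} v) * (b * hnorm {..<n} u)"
      using p w ab by (intro mult_mono) auto
    finally show ?thesis by (simp add: mult_ac)
  qed
  ultimately show "norm (\<Sum>i<n. \<Sum>j<n. star (v i) * imat_mult x y i j * u j) \<le> a * b * hnorm {..<n} v * hnorm {..<n} u"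
    by (intro LIMSEQ_le_const2) auto
qed

text \<open>This is applied with the finite and with the scalar plus finite matrices for \<open>P\<close> and \<open>Q\<close>: it
  makes the closure of the latter an algebra and that of the former an ideal in it.\<close>

lemma imat_mult_closure:
  assumes P: "Collect P \<subseteq> stab_set" and Q: "Collect Q \<subseteq> stab_set"
    and R: "\<And>x y. P x \<Longrightarrow> Q y \<Longrightarrow> R (imat_mult x y)"
    and x: "x \<in> imat_closure (Collect P)" "x \<in> stab_set"
    and y: "y \<in> imat_closure (Collect Q)" "y \<in> stab_set"
  shows "imat_mult x y \<in> imat_closure (Collect R)"
  unfolding imat_closure_iff
proof (intro allI impI)
  fix \<epsilon> :: real assume e: "\<epsilon> > 0"
  obtain a b where ab: "bdd_mat x a" "bdd_mat y b" using stab_set_bdd x y by blast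
  have ab0: "a \<ge> 0" "b \<ge> 0" using ab bdd_mat_nonneg by auto
  define d where "d = min 1 (\<epsilon> / (a + b + 1))"
  have "0 < \<epsilon> / (a + b + 1)" using e ab0 by (intro divide_pos_pos) auto
  then have d: "0 < d" "d \<le> 1" "d \<le> \<epsilon> / (a + b + 1)" unfolding d_def by auto
  have de: "d * b + (a + d) * d \<le> \<epsilon>"
  proof -
    have "d * b + (a + d) * d = d * (a + b + d)" by (simp add: algebra_simps)
    also have "\<dots> \<le> d * (a + b + 1)" using d by (intro mult_left_mono) auto
    also have "\<dots> \<le> \<epsilon> / (a + b + 1) * (a + b + 1)" using d ab0 by (intro mult_right_mono) auto
    also have "\<dots> = \<epsilon>" using ab0 by simp
    finally show ?thesis .
  qed
  obtain x' where x': "P x'" "bdd_mat (\<lambda>i j. x i j - x' i j) d"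
    using x(1) d(1) unfolding imat_closure_iff by blast
  obtain y' where y': "Q y'" "bdd_mat (\<lambda>i j. y i j - y' i j) d"
    using y(1) d(1) unfolding imat_closure_iff by blast
  have st: "x' \<in> stab_set" "y' \<in> stab_set" using P Q x' y' by auto
  have bx': "bdd_mat x' (a + d)" using bdd_mat_diff[OF ab(1) x'(2)] by simp
  have "bdd_mat (imat_mult (\<lambda>i j. x i j - x' i j) y) (d * b)"
    by (intro bdd_mat_mult stab_set_diff x y st x' ab)
  moreover have "bdd_mat (imat_mult x' (\<lambda>i j. y i j - y' i j)) ((a + d) * d)"
    by (intro bdd_mat_mult stab_set_diff x y st y' bx')
  ultimately have "bdd_mat (\<lambda>i j. imat_mult x y i j - imat_mult x' y' i j) (d * b + (a + d) * d)"
    using bdd_mat_add[of "imat_mult (\<lambda>i j. x i j - x' i j) y" _ "imat_mult x' (\<lambda>i j. y i j - y' i j)"]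
    by (simp add: imat_mult_diff_left[OF x(2) st(1) y(2)] imat_mult_diff_right[OF y(2) st(2) st(1)])
  from bdd_mat_mono[OF this de] show "\<exists>z\<in>Collect R. bdd_mat (\<lambda>i j. imat_mult x y i j - z i j) \<epsilon>"
    using R[OF x'(1) y'(1)] by blast
qed

lemma stab_set_mult: "x \<in> stab_set \<Longrightarrow> y \<in> stab_set \<Longrightarrow> imat_mult x y \<in> stab_set"
  by (rule imat_mult_closure[of sfin_mat sfin_mat]) (auto intro: sfin_mat_mult stab_set_sfin)

lemma bdd_mat_all_eq_0:
  assumes "\<And>\<epsilon>. \<epsilon> > 0 \<Longrightarrow> bdd_mat x \<epsilon>"
  shows "x i j = 0"
proof -
  have "norm (x i j) \<le> 0 + \<epsilon>" if "\<epsilon> > 0" for \<epsilon> using bdd_mat_entry[OF assms[OF that]] by simp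
  then have "norm (x i j) \<le> 0" by (rule field_le_epsilon)
  then show ?thesis by simp
qed

text \<open>If the left factor is scalar plus finite, only finite sums have to be interchanged with a limit;
  both sides are continuous in this factor.\<close>

lemma imat_mult_assoc:
  assumes "x \<in> stab_set" "y \<in> stab_set" "z \<in> stab_set"
  shows "imat_mult (imat_mult x y) z = imat_mult x (imat_mult y z)"
proof -
  have fin: "imat_mult (imat_mult w y) z = imat_mult w (imat_mult y z)" if w: "sfin_mat w" for w
  proof (intro ext)
    fix i j
    obtain L where L: "\<And>l. l \<ge> L \<Longrightarrow> w i l = 0" using sfin_mat_row[OF w] by blast
    have row: "imat_mult w q i k = (\<Sum>l<L. w i l * q l k)" for q k
      unfolding imat_mult_def by (rule suminf_finite) (auto simp: L not_less)
    have "(\<lambda>k. (\<Sum>l<L. w i l * (y l k * z k j))) sums (\<Sum>l<L. w i l * imat_mult y z l j)"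
      by (intro sums_sum sums_mult imat_mult_sums assms)
    then have "(\<lambda>k. imat_mult w y i k * z k j) sums (\<Sum>l<L. w i l * imat_mult y z l j)"
      by (simp add: row sum_distrib_right mult.assoc)
    then show "imat_mult (imat_mult w y) z i j = imat_mult w (imat_mult y z) i j"
      unfolding row[of "imat_mult y z"] using sums_unique by (simp add: imat_mult_def[of "imat_mult w y" z] sums_iff)
  qed
  obtain b c where bc: "bdd_mat y b" "bdd_mat z c" using assms stab_set_bdd by blast
  have bc0: "b \<ge> 0" "c \<ge> 0" using bc bdd_mat_nonneg by auto
  note st = assms stab_set_mult
  have "imat_mult (imat_mult x y) z i j - imat_mult x (imat_mult y z) i j = 0" for i j
  proof (rule bdd_mat_all_eq_0[where x = "\<lambda>i j. imat_mult (imat_mult x y) z i j - imat_mult x (imat_mult y z) i j"])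
    fix \<epsilon> :: real assume e: "\<epsilon> > 0"
    define d where "d = \<epsilon> / (2 * (b * c) + 1)"
    have pos: "0 < 2 * (b * c) + 1" using bc0 by (simp add: add_nonneg_pos)
    then have d: "d > 0" using e by (simp add: d_def)
    obtain w where w: "sfin_mat w" "bdd_mat (\<lambda>i j. x i j - w i j) d" using stab_setD[OF assms(1) d] by blast
    have ws: "w \<in> stab_set" by (rule stab_set_sfin[OF w(1)])
    define q where "q i j = x i j - w i j" for i j
    have qs: "q \<in> stab_set" using stab_set_diff[OF assms(1) ws] by (simp add: q_def[abs_def])
    have qb: "bdd_mat q d" using w(2) by (simp add: q_def[abs_def])
    have 1: "bdd_mat (imat_mult (imat_mult q y) z) (d * b * c)"
      by (intro bdd_mat_mult st qs qb bc)
    have 2: "bdd_mat (imat_mult q (imat_mult y z)) (d * (b * c))"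
      by (intro bdd_mat_mult st qs qb bc)
    have "imat_mult q y = (\<lambda>i j. imat_mult x y i j - imat_mult w y i j)"
      unfolding q_def[abs_def] by (intro imat_mult_diff_left assms ws)
    then have 3: "imat_mult (imat_mult q y) z = (\<lambda>i j. imat_mult (imat_mult x y) z i j - imat_mult (imat_mult w y) z i j)"
      by (simp add: imat_mult_diff_left st ws)
    have 4: "imat_mult q (imat_mult y z) = (\<lambda>i j. imat_mult x (imat_mult y z) i j - imat_mult w (imat_mult y z) i j)"
      unfolding q_def[abs_def] by (intro imat_mult_diff_left st ws)
    have "bdd_mat (\<lambda>i j. imat_mult (imat_mult x y) z i j - imat_mult x (imat_mult y z) i j) (d * b * c + d * (b * c))"
      using bdd_mat_diff[OF 1 2] by (simp add: 3 4 fin[OF w(1)])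
    moreover have "d * b * c + d * (b * c) \<le> \<epsilon>"
    proof -
      have "d * b * c + d * (b * c) = d * (2 * (b * c))" by (simp add: algebra_simps)
      also have "\<dots> \<le> d * (2 * (b * c) + 1)" using d by (intro mult_left_mono) auto
      also have "\<dots> = \<epsilon>" using pos by (simp add: d_def)
      finally show ?thesis .
    qed
    ultimately show "bdd_mat (\<lambda>i j. imat_mult (imat_mult x y) z i j - imat_mult x (imat_mult y z) i j) \<epsilon>"
      by (rule bdd_mat_mono)
  qed
  then show ?thesis by (intro ext) simp
qed

lemma imat_star_mult:
  assumes "x \<in> stab_set" "y \<in> stab_set"
  shows "imat_star (imat_mult x y) = imat_mult (imat_star y) (imat_star x)"
proof (intro ext)
  fix i j
  have "(\<lambda>k. star (x j k * y k i)) sums star (imat_mult x y j i)"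
    by (rule bounded_linear.sums[OF bounded_linear_star imat_mult_sums[OF assms]])
  then show "imat_star (imat_mult x y) i j = imat_mult (imat_star y) (imat_star x) i j"
    unfolding imat_mult_def[of "imat_star y"] by (simp add: imat_star_def star_mult sums_iff)
qed

text \<open>The nontrivial half of the C*-identity: \<open>\<parallel>xu\<parallel>\<^sup>2 = \<langle>u, x\<^sup>*xu\<rangle>\<close>.\<close>

lemma bdd_mat_of_star_mult:
  assumes "x \<in> stab_set" "bdd_mat (imat_mult (imat_star x) x) M"
  shows "bdd_mat x (sqrt M)"
  unfolding bdd_mat_def
proof (intro allI)
  fix n :: nat and u v :: "nat \<Rightarrow> 'a"
  have M0: "0 \<le> M" by (rule bdd_mat_nonneg[OF assms(2)])
  define w where "w k = (\<Sum>j<n. x k j * u j)" for k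
  define h where "h = hnorm {..<n} u"
  have "(\<lambda>k. \<Sum>i<n. \<Sum>j<n. star (u i) * (imat_star x i k * x k j) * u j) sums
      (\<Sum>i<n. \<Sum>j<n. star (u i) * imat_mult (imat_star x) x i j * u j)"
    by (intro sums_sum sums_mult sums_mult2 imat_mult_sums stab_set_star assms)
  moreover have "(\<Sum>i<n. \<Sum>j<n. star (u i) * (imat_star x i k * x k j) * u j) = star (w k) * w k" for k
    by (simp add: w_def star_sum star_mult sum_product imat_star_def mult.assoc)
  ultimately have lim: "(\<lambda>K. norm (\<Sum>k<K. star (w k) * w k)) \<longlonglongrightarrow> norm (\<Sum>i<n. \<Sum>j<n. star (u i) * imat_mult (imat_star x) x i j * u j)"
    unfolding sums_def by (auto intro: tendsto_norm)
  have "(hnorm {..<n} w)\<^sup>2 \<le> norm (\<Sum>i<n. \<Sum>j<n. star (u i) * imat_mult (imat_star x) x i j * u j)"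
  proof (rule LIMSEQ_le_const[OF lim], intro exI allI impI)
    fix K assume "n \<le> K"
    then have "hnorm {..<n} w \<le> hnorm {..<K} w" by (intro hnorm_mono) auto
    then show "(hnorm {..<n} w)\<^sup>2 \<le> norm (\<Sum>k<K. star (w k) * w k)"
      unfolding hnorm_power2[symmetric] by (rule power_mono) simp
  qed
  also have "\<dots> \<le> M * h * h" using assms(2) by (simp add: bdd_mat_def h_def)
  also have "\<dots> = (sqrt M * h)\<^sup>2" using M0 by (simp add: power2_eq_square mult_ac)
  finally have w: "hnorm {..<n} w \<le> sqrt M * h"
    by (rule power2_le_imp_le) (simp add: h_def M0)
  have "norm (\<Sum>i<n. \<Sum>j<n. star (v i) * x i j * u j) = norm (\<Sum>i<n. star (v i) * w i)"
    by (simp add: w_def sum_distrib_left mult.assoc)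
  also have "\<dots> \<le> hnorm {..<n} v * hnorm {..<n} w" by (rule hnorm_Cauchy_Schwarz) simp
  also have "\<dots> \<le> hnorm {..<n} v * (sqrt M * h)" by (intro mult_left_mono w hnorm_nonneg)
  finally show "norm (\<Sum>i<n. \<Sum>j<n. star (v i) * x i j * u j) \<le> sqrt M * hnorm {..<n} v * hnorm {..<n} u"
    by (simp add: h_def mult_ac)
qed

section \<open>The C*-algebra of scalar plus compact matrices\<close>

definition mat_bound :: "'a::unital_cstar_algebra imat \<Rightarrow> real" where
  "mat_bound x = enn2real (imat_norm x)"

lemma mat_bound_le_iff:
  assumes "x \<in> stab_set" "0 \<le> M"
  shows "mat_bound x \<le> M \<longleftrightarrow> bdd_mat x M"
proof -
  obtain N where N: "bdd_mat x N" using stab_set_bdd[OF assms(1)] by blast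
  have "imat_norm x \<le> ennreal N" using N bdd_mat_nonneg[OF N] by (simp add: imat_norm_le_iff)
  also have "\<dots> < \<infinity>" by simp
  finally have "imat_norm x = ennreal (mat_bound x)" by (simp add: mat_bound_def)
  then show ?thesis
    using imat_norm_le_iff[OF assms(2), of x] assms(2) by simp
qed

lemma mat_bound_nonneg [simp]: "0 \<le> mat_bound x"
  by (simp add: mat_bound_def)

lemma mat_bound_bdd: "x \<in> stab_set \<Longrightarrow> bdd_mat x (mat_bound x)"
  using mat_bound_le_iff[of x "mat_bound x"] by simp

lemma mat_bound_le: "x \<in> stab_set \<Longrightarrow> bdd_mat x M \<Longrightarrow> mat_bound x \<le> M"
  using mat_bound_le_iff bdd_mat_nonneg by blast

lemma mat_bound_scaleC:
  assumes "x \<in> stab_set"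
  shows "mat_bound (\<lambda>i j. c *\<^sub>C x i j) = cmod c * mat_bound x"
proof -
  have le: "mat_bound (\<lambda>i j. d *\<^sub>C y i j) \<le> cmod d * mat_bound y" if "y \<in> stab_set" for d and y :: "'a imat"
    by (intro mat_bound_le stab_set_scaleC that bdd_mat_scaleC mat_bound_bdd)
  show ?thesis
  proof (cases "c = 0")
    case True
    then show ?thesis using le[OF assms, of 0] by (intro antisym) simp_all
  next
    case False
    have "mat_bound x \<le> cmod (inverse c) * mat_bound (\<lambda>i j. c *\<^sub>C x i j)"
      using le[OF stab_set_scaleC[OF assms, of c], of "inverse c"] False by (simp add: scaleC_scaleC)
    then have "cmod c * mat_bound x \<le> cmod c * (cmod (inverse c) * mat_bound (\<lambda>i j. c *\<^sub>C x i j))"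
      by (rule mult_left_mono) simp
    also have "\<dots> = mat_bound (\<lambda>i j. c *\<^sub>C x i j)"
      using False by (simp add: norm_inverse flip: mult.assoc)
    finally have "cmod c * mat_bound x \<le> mat_bound (\<lambda>i j. c *\<^sub>C x i j)" .
    then show ?thesis using le[OF assms, of c] by simp
  qed
qed

text \<open>The unitization of \<open>A \<otimes> K\<close> inside the bounded matrices, as a type of the class of unital C*-algebras,
  so that everything proved for \<open>A\<close> is also available for its matrices.\<close>

typedef (overloaded) 'a stab = "stab_set :: 'a::unital_cstar_algebra imat set"
  morphisms ent Abs_stab
  by (rule exI[of _ "scalar_mat 1"]) (rule stab_set_sfin[OF sfin_mat_scalar])

setup_lifting type_definition_stab

lemma ent_in [simp]: "ent x \<in> stab_set"
  using ent by blast

lemma stab_eqI: "(\<And>i j. ent x i j = ent y i j) \<Longrightarrow> x = y"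
  by (metis ent_inject ext)

instantiation stab :: (unital_cstar_algebra) real_normed_algebra_1
begin

lift_definition zero_stab :: "'a stab" is "\<lambda>i j. 0"
  by (rule stab_set_sfin) (simp add: fin_mat_imp_sfin_mat fin_mat_def)

lift_definition one_stab :: "'a stab" is "scalar_mat 1"
  by (rule stab_set_sfin[OF sfin_mat_scalar])

lift_definition plus_stab :: "'a stab \<Rightarrow> 'a stab \<Rightarrow> 'a stab" is "\<lambda>x y i j. x i j + y i j"
  by (rule stab_set_add)

lift_definition minus_stab :: "'a stab \<Rightarrow> 'a stab \<Rightarrow> 'a stab" is "\<lambda>x y i j. x i j - y i j"
  by (rule stab_set_diff)

lift_definition uminus_stab :: "'a stab \<Rightarrow> 'a stab" is "\<lambda>x i j. - x i j"
  by (rule stab_set_minus)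

lift_definition times_stab :: "'a stab \<Rightarrow> 'a stab \<Rightarrow> 'a stab" is imat_mult
  by (rule stab_set_mult)

lift_definition scaleR_stab :: "real \<Rightarrow> 'a stab \<Rightarrow> 'a stab" is "\<lambda>r x i j. complex_of_real r *\<^sub>C x i j"
  by (rule stab_set_scaleC)

lift_definition norm_stab :: "'a stab \<Rightarrow> real" is mat_bound .

definition dist_stab :: "'a stab \<Rightarrow> 'a stab \<Rightarrow> real" where
  "dist_stab x y = norm (x - y)"

definition sgn_stab :: "'a stab \<Rightarrow> 'a stab" where
  "sgn_stab x = inverse (norm x) *\<^sub>R x"

definition uniformity_stab :: "('a stab \<times> 'a stab) filter" where
  "uniformity_stab = (INF e\<in>{0<..}. principal {(x, y). dist x y < e})"

definition open_stab :: "'a stab set \<Rightarrow> bool" where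
  "open_stab U \<longleftrightarrow> (\<forall>x\<in>U. eventually (\<lambda>(x', y). x' = x \<longrightarrow> y \<in> U) uniformity)"

lemma scalar_mat_1: "scalar_mat 1 i j = (if i = j then 1 else (0::'a))"
  by (simp add: scalar_mat_def)

lemma imat_mult_scalar_1 [simp]:
  "imat_mult (scalar_mat 1) x = (x :: 'a imat)" "imat_mult x (scalar_mat 1) = x"
proof -
  show "imat_mult (scalar_mat 1) x = x"
  proof (intro ext)
    fix i j
    have "imat_mult (scalar_mat 1) x i j = (\<Sum>k\<in>{i}. scalar_mat 1 i k * x k j)"
      unfolding imat_mult_def by (rule suminf_finite) (auto simp: scalar_mat_1)
    then show "imat_mult (scalar_mat 1) x i j = x i j" by (simp add: scalar_mat_1)
  qed
  show "imat_mult x (scalar_mat 1) = x"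
  proof (intro ext)
    fix i j
    have "imat_mult x (scalar_mat 1) i j = (\<Sum>k\<in>{j}. x i k * scalar_mat 1 k j)"
      unfolding imat_mult_def by (rule suminf_finite) (auto simp: scalar_mat_1)
    then show "imat_mult x (scalar_mat 1) i j = x i j" by (simp add: scalar_mat_1)
  qed
qed

lemma imat_mult_add_left:
  assumes "x \<in> stab_set" "x' \<in> stab_set" "y \<in> (stab_set :: 'a imat set)"
  shows "imat_mult (\<lambda>i j. x i j + x' i j) y = (\<lambda>i j. imat_mult x y i j + imat_mult x' y i j)"
  using sums_add[OF imat_mult_sums[OF assms(1,3)] imat_mult_sums[OF assms(2,3)]]
    imat_mult_sums[OF stab_set_add[OF assms(1,2)] assms(3)]
  by (intro ext) (simp add: distrib_right sums_iff)

lemma imat_mult_add_right: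
  assumes "x \<in> stab_set" "x' \<in> stab_set" "y \<in> (stab_set :: 'a imat set)"
  shows "imat_mult y (\<lambda>i j. x i j + x' i j) = (\<lambda>i j. imat_mult y x i j + imat_mult y x' i j)"
  using sums_add[OF imat_mult_sums[OF assms(3,1)] imat_mult_sums[OF assms(3,2)]]
    imat_mult_sums[OF assms(3) stab_set_add[OF assms(1,2)]]
  by (intro ext) (simp add: distrib_left sums_iff)

lemma imat_mult_scaleC_left:
  assumes "x \<in> stab_set" "y \<in> (stab_set :: 'a imat set)"
  shows "imat_mult (\<lambda>i j. c *\<^sub>C x i j) y = (\<lambda>i j. c *\<^sub>C imat_mult x y i j)"
  using bounded_linear.sums[OF bounded_linear_scaleC imat_mult_sums[OF assms]]
    imat_mult_sums[OF stab_set_scaleC[OF assms(1)] assms(2)]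
  by (intro ext) (simp add: mult_scaleC_left sums_iff)

lemma imat_mult_scaleC_right:
  assumes "x \<in> stab_set" "y \<in> (stab_set :: 'a imat set)"
  shows "imat_mult x (\<lambda>i j. c *\<^sub>C y i j) = (\<lambda>i j. c *\<^sub>C imat_mult x y i j)"
  using bounded_linear.sums[OF bounded_linear_scaleC imat_mult_sums[OF assms]]
    imat_mult_sums[OF assms(1) stab_set_scaleC[OF assms(2)]]
  by (intro ext) (simp add: mult_scaleC_right sums_iff)

instance
proof
  fix x y z :: "'a stab" and r s :: real
  show "x + y + z = x + (y + z)" by transfer (simp add: add.assoc)
  show "x + y = y + x" by transfer (simp add: add.commute)
  show "0 + x = x" by transfer simp
  show "- x + x = 0" by transfer simp
  show "x - y = x + - y" by transfer simp
  show "r *\<^sub>R (x + y) = r *\<^sub>R x + r *\<^sub>R y" by transfer (simp add: scaleC_add_right)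
  show "(r + s) *\<^sub>R x = r *\<^sub>R x + s *\<^sub>R x" by transfer (simp add: scaleC_add_left)
  show "r *\<^sub>R s *\<^sub>R x = (r * s) *\<^sub>R x" by transfer (simp add: scaleC_scaleC)
  show "1 *\<^sub>R x = x" by transfer simp
  show "x * y * z = x * (y * z)" by transfer (rule imat_mult_assoc)
  show "1 * x = x" by transfer simp
  show "x * 1 = x" by transfer simp
  show "(x + y) * z = x * z + y * z" by transfer (rule imat_mult_add_left)
  show "x * (y + z) = x * y + x * z" by transfer (rule imat_mult_add_right)
  show "r *\<^sub>R x * y = r *\<^sub>R (x * y)" by transfer (rule imat_mult_scaleC_left)
  show "x * r *\<^sub>R y = r *\<^sub>R (x * y)" by transfer (rule imat_mult_scaleC_right)
  show "(0::'a stab) \<noteq> 1"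
  proof
    assume "(0::'a stab) = 1"
    then have "(\<lambda>i j. 0 :: 'a) = scalar_mat 1" by transfer
    then have "(0::'a) = scalar_mat 1 (0::nat) (0::nat)" by metis
    then show False by (simp add: scalar_mat_1)
  qed
  show "dist x y = norm (x - y)" by (rule dist_stab_def)
  show "sgn x = inverse (norm x) *\<^sub>R x" by (rule sgn_stab_def)
  show "uniformity = (INF e\<in>{0<..}. principal {(x, y :: 'a stab). dist x y < e})" by (rule uniformity_stab_def)
  show "open U \<longleftrightarrow> (\<forall>x\<in>U. eventually (\<lambda>(x', y). x' = x \<longrightarrow> y \<in> U) uniformity)" for U :: "'a stab set"
    by (rule open_stab_def)
  show "norm x = 0 \<longleftrightarrow> x = 0"
  proof transfer
    fix x :: "'a imat" assume x: "x \<in> stab_set"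
    show "mat_bound x = 0 \<longleftrightarrow> x = (\<lambda>i j. 0)"
    proof
      assume "mat_bound x = 0"
      then have "bdd_mat x 0" using mat_bound_bdd[OF x] by simp
      then show "x = (\<lambda>i j. 0)" using bdd_mat_entry[of x 0] by (intro ext) simp
    next
      assume "x = (\<lambda>i j. 0)"
      then have "mat_bound x \<le> 0" using bdd_mat_zero by (intro mat_bound_le[OF x]) simp
      then show "mat_bound x = 0" by (intro antisym) simp_all
    qed
  qed
  show "norm (x + y) \<le> norm x + norm y"
    by transfer (intro mat_bound_le stab_set_add bdd_mat_add mat_bound_bdd)
  show "norm (r *\<^sub>R x) = \<bar>r\<bar> * norm x"
    by transfer (simp add: mat_bound_scaleC)
  show "norm (x * y) \<le> norm x * norm y"
    by transfer (intro mat_bound_le stab_set_mult bdd_mat_mult mat_bound_bdd)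
  show "norm (1::'a stab) = 1"
  proof transfer
    have s: "scalar_mat 1 \<in> (stab_set :: 'a imat set)" by (rule stab_set_sfin[OF sfin_mat_scalar])
    have "mat_bound (scalar_mat 1 :: 'a imat) \<le> 1"
      using mat_bound_le[OF s bdd_mat_scalar] by simp
    moreover have "1 \<le> mat_bound (scalar_mat 1 :: 'a imat)"
      using bdd_mat_entry[OF mat_bound_bdd[OF s], of 0 0] by (simp add: scalar_mat_1)
    ultimately show "mat_bound (scalar_mat 1 :: 'a imat) = 1" by simp
  qed
qed

end

lemma norm_stab_le_iff: "0 \<le> M \<Longrightarrow> norm x \<le> M \<longleftrightarrow> bdd_mat (ent x) M"
  by (simp add: norm_stab.rep_eq mat_bound_le_iff)

lemma norm_ent_le: "norm (ent x i j) \<le> norm x"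
  using bdd_mat_entry[of "ent x" "norm x"] norm_stab_le_iff[of "norm x" x] by simp

instance stab :: (unital_cstar_algebra) banach
proof
  fix X :: "nat \<Rightarrow> 'a stab" assume X: "Cauchy X"
  have "Cauchy (\<lambda>n. ent (X n) i j)" for i j
  proof (rule CauchyI)
    fix e :: real assume "e > 0"
    then obtain M where "\<forall>m\<ge>M. \<forall>n\<ge>M. norm (X m - X n) < e" using CauchyD[OF X] by blast
    moreover have "norm (ent (X m) i j - ent (X n) i j) \<le> norm (X m - X n)" for m n
      using norm_ent_le[of "X m - X n" i j] by (simp add: minus_stab.rep_eq)
    ultimately show "\<exists>M. \<forall>m\<ge>M. \<forall>n\<ge>M. norm (ent (X m) i j - ent (X n) i j) < e"
      by (meson le_less_trans)
  qed
  then have "\<forall>i j. \<exists>l. (\<lambda>n. ent (X n) i j) \<longlonglongrightarrow> l" by (meson Cauchy_convergent convergentD)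
  then obtain x where x: "\<And>i j. (\<lambda>n. ent (X n) i j) \<longlonglongrightarrow> x i j" by metis
  have lim: "\<exists>N. \<forall>n\<ge>N. bdd_mat (\<lambda>i j. ent (X n) i j - x i j) e" if e: "e > 0" for e
  proof -
    obtain N where N: "\<forall>m\<ge>N. \<forall>n\<ge>N. norm (X m - X n) < e" using CauchyD[OF X e] by blast
    have "bdd_mat (\<lambda>i j. ent (X n) i j - x i j) e" if n: "n \<ge> N" for n
    proof (rule bdd_mat_lim)
      show "(\<lambda>m. ent (X n) i j - ent (X m) i j) \<longlonglongrightarrow> ent (X n) i j - x i j" for i j
        by (intro tendsto_intros x)
      show "bdd_mat (\<lambda>i j. ent (X n) i j - ent (X m) i j) e" if "m \<ge> N" for m
      proof -
        have "norm (X n - X m) \<le> e" using N n that by (simp add: less_imp_le)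
        then show ?thesis using norm_stab_le_iff[of e "X n - X m"] e by (simp add: minus_stab.rep_eq)
      qed
    qed
    then show ?thesis by blast
  qed
  have "x \<in> stab_set"
  proof (rule imat_closure_closure)
    fix e :: real assume "e > 0"
    then obtain N where "bdd_mat (\<lambda>i j. ent (X N) i j - x i j) e" using lim by blast
    from bdd_mat_minus[OF this] have "bdd_mat (\<lambda>i j. x i j - ent (X N) i j) e" by simp
    then show "\<exists>y\<in>stab_set. bdd_mat (\<lambda>i j. x i j - y i j) e" by (intro bexI[of _ "ent (X N)"]) auto
  qed
  then have ex: "ent (Abs_stab x) = x" by (simp add: Abs_stab_inverse)
  have "X \<longlonglongrightarrow> Abs_stab x"
  proof (rule LIMSEQ_I)
    fix r :: real assume "r > 0"
    then obtain N where N: "\<forall>n\<ge>N. bdd_mat (\<lambda>i j. ent (X n) i j - x i j) (r / 2)" using lim[of "r / 2"] by auto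
    have "norm (X n - Abs_stab x) < r" if "n \<ge> N" for n
    proof -
      have "norm (X n - Abs_stab x) \<le> r / 2"
        using N that \<open>r > 0\<close> by (subst norm_stab_le_iff) (simp_all add: minus_stab.rep_eq ex)
      then show ?thesis using \<open>r > 0\<close> by simp
    qed
    then show "\<exists>N. \<forall>n\<ge>N. norm (X n - Abs_stab x) < r" by blast
  qed
  then show "convergent X" by (rule convergentI)
qed

instantiation stab :: (unital_cstar_algebra) unital_cstar_algebra
begin

lift_definition scaleC_stab :: "complex \<Rightarrow> 'a stab \<Rightarrow> 'a stab" is "\<lambda>c x i j. c *\<^sub>C x i j"
  by (rule stab_set_scaleC)

lift_definition star_stab :: "'a stab \<Rightarrow> 'a stab" is imat_star
  by (rule stab_set_star)

instance
proof
  fix x y :: "'a stab" and c d :: complex and r :: real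
  show "complex_of_real r *\<^sub>C x = r *\<^sub>R x" by transfer simp
  show "c *\<^sub>C (x + y) = c *\<^sub>C x + c *\<^sub>C y" by transfer (simp add: scaleC_add_right)
  show "(c + d) *\<^sub>C x = c *\<^sub>C x + d *\<^sub>C x" by transfer (simp add: scaleC_add_left)
  show "c *\<^sub>C d *\<^sub>C x = (c * d) *\<^sub>C x" by transfer (simp add: scaleC_scaleC)
  show "(c *\<^sub>C x) * y = c *\<^sub>C (x * y)" by transfer (rule imat_mult_scaleC_left)
  show "x * (c *\<^sub>C y) = c *\<^sub>C (x * y)" by transfer (rule imat_mult_scaleC_right)
  show "norm (c *\<^sub>C x) = cmod c * norm x" by transfer (rule mat_bound_scaleC)
  show "star (x + y) = star x + star y" by transfer (simp add: imat_star_def star_add)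
  show "star (c *\<^sub>C x) = cnj c *\<^sub>C star x" by transfer (simp add: imat_star_def star_scaleC)
  show "star (x * y) = star y * star x" by transfer (rule imat_star_mult)
  show "star (star x) = x" by transfer (simp add: imat_star_def star_star)
  show "norm (star x * x) = (norm x)\<^sup>2"
  proof transfer
    fix x :: "'a imat" assume x: "x \<in> stab_set"
    note xx = stab_set_mult[OF stab_set_star[OF x] x]
    have "mat_bound (imat_mult (imat_star x) x) \<le> mat_bound x * mat_bound x"
      by (intro mat_bound_le xx bdd_mat_mult stab_set_star x bdd_mat_star mat_bound_bdd)
    moreover have "mat_bound x \<le> sqrt (mat_bound (imat_mult (imat_star x) x))"
      by (intro mat_bound_le x bdd_mat_of_star_mult mat_bound_bdd xx)
    then have "(mat_bound x)\<^sup>2 \<le> (sqrt (mat_bound (imat_mult (imat_star x) x)))\<^sup>2"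
      by (intro power_mono) auto
    ultimately show "mat_bound (imat_mult (imat_star x) x) = (mat_bound x)\<^sup>2"
      by (simp add: power2_eq_square)
  qed
qed

end

lemmas ent_simps = plus_stab.rep_eq minus_stab.rep_eq uminus_stab.rep_eq scaleC_stab.rep_eq
  zero_stab.rep_eq

lemma ent_scaleR: "ent (r *\<^sub>R x) i j = r *\<^sub>R ent x i j"
  by (simp add: scaleR_stab.rep_eq scaleC_of_real)

lemma ent_one: "ent 1 i j = (if i = j then 1 else 0)"
  by (simp add: one_stab.rep_eq scalar_mat_1)

lemma ent_star: "ent (star x) i j = star (ent x j i)"
  by (simp add: star_stab.rep_eq imat_star_def)

lemma ent_sum: "ent (sum f A) i j = (\<Sum>k\<in>A. ent (f k) i j)"
  by (induction A rule: infinite_finite_induct) (simp_all add: ent_simps)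

lemma ent_mult_sums: "(\<lambda>k. ent x i k * ent y k j) sums ent (x * y) i j"
  unfolding times_stab.rep_eq by (rule imat_mult_sums) simp_all

lemma bounded_linear_ent: "bounded_linear (\<lambda>x. ent x i j)"
  by (rule bounded_linear_intro[of _ 1]) (simp_all add: ent_simps ent_scaleR norm_ent_le)

lemmas tendsto_ent = bounded_linear.tendsto[OF bounded_linear_ent]

text \<open>The closure of sets of matrices, which refers to a norm with values in the extended nonnegative reals, is the
  topological closure in \<open>stab\<close>.\<close>

lemma imat_closure_ent: "imat_closure (ent ` S) = ent ` closure S"
proof (intro equalityI subsetI)
  fix x assume x: "x \<in> imat_closure (ent ` S)"
  have "x \<in> stab_set"
  proof (rule imat_closure_closure)
    fix e :: real assume "e > 0"
    with x obtain y where "bdd_mat (\<lambda>i j. x i j - ent y i j) e" unfolding imat_closure_iff by blast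
    then show "\<exists>y\<in>stab_set. bdd_mat (\<lambda>i j. x i j - y i j) e" by (intro bexI[of _ "ent y"]) auto
  qed
  then obtain z where z: "x = ent z" by (metis Abs_stab_inverse)
  have "z \<in> closure S"
    unfolding closure_approachable
  proof (intro allI impI)
    fix e :: real assume e: "e > 0"
    obtain y where y: "y \<in> S" "bdd_mat (\<lambda>i j. x i j - ent y i j) (e / 2)"
      using x half_gt_zero[OF e] unfolding imat_closure_iff by blast
    have "norm (z - y) \<le> e / 2" using y(2) e by (subst norm_stab_le_iff) (auto simp: ent_simps z)
    then show "\<exists>y\<in>S. dist y z < e" using y(1) e by (intro bexI[of _ y]) (auto simp: dist_norm norm_minus_commute)
  qed
  then show "x \<in> ent ` closure S" using z by blast
next
  fix x assume "x \<in> ent ` closure S"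
  then obtain z where z: "x = ent z" "z \<in> closure S" by blast
  show "x \<in> imat_closure (ent ` S)"
    unfolding imat_closure_iff
  proof (intro allI impI)
    fix e :: real assume e: "e > 0"
    then obtain y where y: "y \<in> S" "dist y z < e" using z(2) unfolding closure_approachable by blast
    then have "bdd_mat (ent (z - y)) e"
      using e by (subst norm_stab_le_iff[symmetric]) (auto simp: dist_norm norm_minus_commute)
    then show "\<exists>y\<in>ent ` S. bdd_mat (\<lambda>i j. x i j - y i j) e"
      using y(1) by (intro bexI[of _ "ent y"]) (auto simp: z ent_simps)
  qed
qed

lemma ent_Abs_fin: "fin_mat x \<Longrightarrow> ent (Abs_stab x) = x"
  by (simp add: Abs_stab_inverse stab_set_sfin fin_mat_imp_sfin_mat)

section \<open>The ideal of compact matrices\<close>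

definition finset :: "'a::unital_cstar_algebra stab set" where
  "finset = {x. fin_mat (ent x)}"

text \<open>This will turn out to be \<open>A \<otimes> K\<close>.\<close>

definition kset :: "'a::unital_cstar_algebra stab set" where
  "kset = closure finset"

lemma finset_subset_kset: "finset \<subseteq> kset"
  by (simp add: kset_def closure_subset)

lemma imat_closure_fin_mat: "imat_closure (Collect fin_mat) = ent ` kset"
proof -
  have "Collect fin_mat = ent ` (finset :: 'a stab set)"
  proof (intro equalityI subsetI)
    fix x :: "'a imat" assume "x \<in> Collect fin_mat"
    then show "x \<in> ent ` finset" using ent_Abs_fin[of x] by (intro image_eqI[of _ _ "Abs_stab x"]) (simp_all add: finset_def)
  qed (auto simp: finset_def)
  then show ?thesis by (simp add: kset_def imat_closure_ent)
qed

lemma fin_matI: "(\<And>i j. i \<ge> n \<or> j \<ge> n \<Longrightarrow> x i j = 0) \<Longrightarrow> fin_mat x"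
  unfolding fin_mat_def by blast

lemma subspace_finset: "subspace (finset :: 'a::unital_cstar_algebra stab set)"
proof (rule subspaceI)
  fix x y :: "'a stab" assume "x \<in> finset" "y \<in> finset"
  then obtain m n where "\<forall>i j. i \<ge> m \<or> j \<ge> m \<longrightarrow> ent x i j = 0" "\<forall>i j. i \<ge> n \<or> j \<ge> n \<longrightarrow> ent y i j = 0"
    by (auto simp: finset_def fin_mat_def)
  then show "x + y \<in> finset"
    unfolding finset_def mem_Collect_eq by (intro fin_matI[of "max m n"]) (auto simp: ent_simps)
next
  fix c and x :: "'a stab" assume "x \<in> finset"
  then show "c *\<^sub>R x \<in> finset" by (auto simp: finset_def fin_mat_def ent_scaleR)
qed (simp add: finset_def fin_mat_def ent_simps)

lemma subspace_kset: "subspace (kset :: 'a::unital_cstar_algebra stab set)"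
  unfolding kset_def by (rule subspace_closure[OF subspace_finset])

lemma closed_kset [simp]: "closed kset"
  by (simp add: kset_def)

lemma kset_star: "x \<in> kset \<Longrightarrow> star x \<in> kset"
proof -
  have "star ` finset \<subseteq> (finset :: 'a stab set)"
  proof clarify
    fix x :: "'a stab" assume "x \<in> finset"
    then obtain n where "\<forall>i j. i \<ge> n \<or> j \<ge> n \<longrightarrow> ent x i j = 0" by (auto simp: finset_def fin_mat_def)
    then show "star x \<in> finset" unfolding finset_def mem_Collect_eq
      by (intro fin_matI[of n]) (auto simp: ent_star)
  qed
  from closure_image_subset[OF bounded_linear_star this] show "x \<in> kset \<Longrightarrow> star x \<in> kset"
    unfolding kset_def by blast
qed

lemma kset_scaleC: "x \<in> kset \<Longrightarrow> c *\<^sub>C x \<in> kset"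
proof -
  have "(*\<^sub>C) c ` finset \<subseteq> (finset :: 'a stab set)"
    by (auto simp: finset_def fin_mat_def ent_simps) (metis scaleC_zero_right)
  from closure_image_subset[OF bounded_linear_scaleC this] show "x \<in> kset \<Longrightarrow> c *\<^sub>C x \<in> kset"
    unfolding kset_def by blast
qed

lemma fin_mat_mult_sfin:
  assumes "fin_mat x" "sfin_mat y"
  shows "fin_mat (imat_mult x y)"
proof -
  obtain m where x: "\<And>i j. i \<ge> m \<or> j \<ge> m \<Longrightarrow> x i j = 0" using assms(1) by (auto simp: fin_mat_def)
  obtain d n where y: "\<And>i j. i \<ge> n \<or> j \<ge> n \<Longrightarrow> y i j = scalar_mat d i j"
    using assms(2) by (auto simp: sfin_mat_def)
  show ?thesis
  proof (rule fin_matI[of "max m n"])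
    fix i j assume ij: "i \<ge> max m n \<or> j \<ge> max m n"
    have "x i k * y k j = 0" for k
    proof (cases "i \<ge> m \<or> k \<ge> m")
      case False
      then have "y k j = 0" using ij y[of k j] by (auto simp: scalar_mat_def)
      then show ?thesis by simp
    qed (use x in auto)
    then show "imat_mult x y i j = 0" by (simp add: imat_mult_def)
  qed
qed

lemma kset_mult_right:
  assumes "x \<in> kset"
  shows "x * y \<in> kset"
proof -
  have "imat_mult (ent x) (ent y) \<in> imat_closure (Collect fin_mat)"
  proof (rule imat_mult_closure[of fin_mat sfin_mat])
    show "Collect fin_mat \<subseteq> (stab_set :: 'a imat set)" "Collect sfin_mat \<subseteq> (stab_set :: 'a imat set)"
      by (auto intro: stab_set_sfin fin_mat_imp_sfin_mat)
    show "ent x \<in> imat_closure (Collect fin_mat)" using assms by (simp add: imat_closure_fin_mat)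
  qed (simp_all add: fin_mat_mult_sfin)
  then have "ent (x * y) \<in> ent ` kset" by (simp add: imat_closure_fin_mat times_stab.rep_eq)
  then show ?thesis by (auto simp: ent_inject)
qed

lemma kset_mult_left: "y \<in> kset \<Longrightarrow> x * y \<in> kset"
  using kset_star[OF kset_mult_right[OF kset_star, of y "star x"]] by (simp add: star_mult star_star)

text \<open>The elementary tensor of \<open>a\<close> and a matrix unit.\<close>

definition unit :: "nat \<Rightarrow> nat \<Rightarrow> 'a::unital_cstar_algebra \<Rightarrow> 'a stab" where
  "unit i j a = Abs_stab (\<lambda>k l. if k = i \<and> l = j then a else 0)"

lemma unit_fin: "fin_mat (\<lambda>k l. if k = i \<and> l = j then a else (0 :: 'a::unital_cstar_algebra))"
  by (rule fin_matI[of "Suc (max i j)"]) auto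

lemma ent_unit: "ent (unit i j a) k l = (if k = i \<and> l = j then a else 0)"
  by (simp add: unit_def ent_Abs_fin[OF unit_fin])

lemma unit_kset: "unit i j a \<in> kset"
  by (rule subsetD[OF finset_subset_kset]) (simp add: finset_def unit_def ent_Abs_fin[OF unit_fin] unit_fin)

lemma ent_mult_finite:
  assumes "\<And>k. k \<notin> A \<Longrightarrow> ent x i k * ent y k j = 0" "finite A"
  shows "ent (x * y) i j = (\<Sum>k\<in>A. ent x i k * ent y k j)"
  unfolding times_stab.rep_eq imat_mult_def by (rule suminf_finite) (use assms in auto)

lemma ent_unit_mult: "ent (unit i j a * x) k l = (if k = i then a * ent x j l else 0)"
  using ent_mult_finite[of "{j}" "unit i j a" k x l] by (auto simp: ent_unit)

lemma ent_mult_unit: "ent (x * unit i j a) k l = (if l = j then ent x k i * a else 0)"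
  using ent_mult_finite[of "{i}" x k "unit i j a" l] by (auto simp: ent_unit)

lemma unit_mult: "unit i j a * unit k l b = (if j = k then unit i l (a * b) else 0)"
  by (rule stab_eqI) (auto simp: ent_unit_mult ent_unit ent_simps)

lemma unit_star: "star (unit i j a) = unit j i (star a)"
  by (rule stab_eqI) (auto simp: ent_star ent_unit)

lemma unit_compress: "unit i j 1 * x * unit k l 1 = unit i l (ent x j k)"
  by (rule stab_eqI) (auto simp: ent_mult_unit ent_unit_mult ent_unit)

lemma unit_add: "unit i j (a + b) = unit i j a + unit i j b"
  by (rule stab_eqI) (auto simp: ent_unit ent_simps)

lemma unit_scaleC: "unit i j (c *\<^sub>C a) = c *\<^sub>C unit i j a"
  by (rule stab_eqI) (auto simp: ent_unit ent_simps)

lemma unit_sum: "unit i j (sum f A) = (\<Sum>k\<in>A. unit i j (f k))"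
  by (rule stab_eqI) (auto simp: ent_unit ent_sum)

lemma unit_inject: "unit i j a = unit i j b \<longleftrightarrow> a = b"
  by (metis ent_unit)

definition proj :: "nat \<Rightarrow> 'a::unital_cstar_algebra stab" where
  "proj n = Abs_stab (\<lambda>i j. if i = j \<and> i < n then 1 else 0)"

lemma proj_fin: "fin_mat (\<lambda>i j. if i = j \<and> i < n then 1 else (0 :: 'a::unital_cstar_algebra))"
  by (rule fin_matI[of n]) auto

lemma ent_proj: "ent (proj n) i j = (if i = j \<and> i < n then 1 else 0)"
  by (simp add: proj_def ent_Abs_fin[OF proj_fin])

lemma ent_proj_mult: "ent (proj n * x) i j = (if i < n then ent x i j else 0)"
  using ent_mult_finite[of "{i}" "proj n" i x j] by (auto simp: ent_proj)

lemma ent_mult_proj: "ent (x * proj n) i j = (if j < n then ent x i j else 0)"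
  using ent_mult_finite[of "{j}" x i "proj n" j] by (auto simp: ent_proj)

lemma proj_star [simp]: "star (proj n) = proj n"
  by (rule stab_eqI) (auto simp: ent_star ent_proj)

lemma proj_idem [simp]: "proj n * proj n = proj n"
  by (rule stab_eqI) (auto simp: ent_proj_mult ent_proj)

lemma proj_mult_idem: "proj n * (proj n * x) = proj n * x"
  by (simp flip: mult.assoc)

lemma norm_projection_le: "star p = p \<Longrightarrow> p * p = p \<Longrightarrow> norm (p::'a::unital_cstar_algebra) \<le> 1"
  using cstar_identity[of p] by (cases "norm p = 0") (auto simp: power2_eq_square)

lemma norm_proj: "norm (proj n) \<le> 1"
  by (rule norm_projection_le) simp_all

lemma cpos_one_minus_proj: "cpos (1 - proj n)"
  by (rule cpos_one_minus[OF proj_star norm_proj])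

lemma proj_eq_sum_unit: "proj n = (\<Sum>i<n. unit i i 1)"
proof (rule stab_eqI)
  fix i j
  have "ent (\<Sum>i<n. unit i i 1) i j = (\<Sum>k<n. if k = i then (if i = j then 1 else (0::'a)) else 0)"
    unfolding ent_sum by (intro sum.cong refl) (auto simp: ent_unit)
  then show "ent (proj n) i j = ent (\<Sum>i<n. unit i i (1::'a)) i j" by (simp add: ent_proj sum.delta)
qed

text \<open>True for finite matrices, and \<open>\<parallel>proj n\<parallel> \<le> 1\<close>.\<close>

lemma kset_mult_proj_tendsto:
  assumes "x \<in> kset"
  shows "(\<lambda>n. x * proj n) \<longlonglongrightarrow> x"
proof (rule LIMSEQ_I)
  fix e :: real assume e: "e > 0"
  then obtain f where f: "f \<in> finset" "norm (f - x) < e / 2"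
    using assms half_gt_zero[OF e] unfolding kset_def closure_approachable dist_norm by blast
  obtain N where N: "\<And>i j. i \<ge> N \<or> j \<ge> N \<Longrightarrow> ent f i j = 0" using f(1) by (auto simp: finset_def fin_mat_def)
  have "norm (x * proj n - x) < e" if n: "n \<ge> N" for n
  proof -
    have "f * proj n = f" using N n by (intro stab_eqI) (auto simp: ent_mult_proj)
    then have eq: "x * proj n - x = (f - x) - (f - x) * proj n" by (simp add: algebra_simps)
    have "norm (x * proj n - x) \<le> norm (f - x) + norm ((f - x) * proj n)"
      unfolding eq by (rule norm_triangle_ineq4)
    also have "norm ((f - x) * proj n) \<le> norm (f - x) * 1"
      by (rule order_trans[OF norm_mult_ineq]) (intro mult_left_mono norm_proj norm_ge_zero)
    finally show ?thesis using f(2) by simp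
  qed
  then show "\<exists>N. \<forall>n\<ge>N. norm (x * proj n - x) < e" by blast
qed

section \<open>Hereditary subalgebras\<close>

definition her :: "'a::unital_cstar_algebra stab \<Rightarrow> 'a stab set" where
  "her h = closure ((\<lambda>x. h * x * h) ` kset)"

lemma closed_her [simp]: "closed (her h)"
  by (simp add: her_def)

lemma subspace_her: "subspace (her h)"
  unfolding her_def
proof (rule subspace_closure, rule subspaceI)
  show "0 \<in> (\<lambda>x. h * x * h) ` kset" using subspace_0[OF subspace_kset] by (intro image_eqI[of _ _ 0]) auto
next
  fix x y assume "x \<in> (\<lambda>x. h * x * h) ` kset" "y \<in> (\<lambda>x. h * x * h) ` kset"
  then obtain a b where "a \<in> kset" "x = h * a * h" "b \<in> kset" "y = h * b * h" by auto
  then show "x + y \<in> (\<lambda>x. h * x * h) ` kset"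
    by (intro image_eqI[of _ _ "a + b"]) (auto simp: algebra_simps subspace_add[OF subspace_kset])
next
  fix c x assume "x \<in> (\<lambda>x. h * x * h) ` kset"
  then obtain a where "a \<in> kset" "x = h * a * h" by auto
  then show "c *\<^sub>R x \<in> (\<lambda>x. h * x * h) ` kset"
    by (intro image_eqI[of _ _ "c *\<^sub>R a"]) (auto simp: subspace_scale[OF subspace_kset])
qed

lemma her_subset_kset: "h \<in> kset \<Longrightarrow> her h \<subseteq> kset"
  unfolding her_def by (intro closure_minimal) (auto intro: kset_mult_left)

lemma her_hxh: "x \<in> kset \<Longrightarrow> h * x * h \<in> her h"
  unfolding her_def by (intro subsetD[OF closure_subset] imageI)

lemma her_scaleC:
  assumes "x \<in> her h"
  shows "c *\<^sub>C x \<in> her h"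
proof -
  have "(*\<^sub>C) c ` ((\<lambda>x. h * x * h) ` kset) \<subseteq> (\<lambda>x. h * x * h) ` kset"
  proof clarify
    fix x :: "'a stab" assume "x \<in> kset"
    then show "c *\<^sub>C (h * x * h) \<in> (\<lambda>x. h * x * h) ` kset"
      by (intro image_eqI[of _ _ "c *\<^sub>C x"]) (auto simp: mult_scaleC_left mult_scaleC_right kset_scaleC)
  qed
  from closure_image_subset[OF bounded_linear_scaleC this] assms show ?thesis
    unfolding her_def by blast
qed

lemma her_star:
  assumes "star h = h" "x \<in> her h"
  shows "star x \<in> her h"
proof -
  have "star ` ((\<lambda>x. h * x * h) ` kset) \<subseteq> (\<lambda>x. h * x * h) ` kset"
  proof clarify
    fix x :: "'a stab" assume "x \<in> kset"
    then show "star (h * x * h) \<in> (\<lambda>x. h * x * h) ` kset"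
      by (intro image_eqI[of _ _ "star x"]) (auto simp: star_mult assms(1) kset_star mult.assoc)
  qed
  from closure_image_subset[OF bounded_linear_star this] assms(2) show ?thesis
    unfolding her_def by blast
qed

text \<open>This is what hereditary means: the middle factor \<open>k\<close> is arbitrary, as \<open>(hah)k(hbh) = h(ahkhb)h\<close>.\<close>

lemma her_mult3:
  assumes "h \<in> kset" "x \<in> her h" "y \<in> her h"
  shows "x * k * y \<in> her h"
proof -
  let ?S = "(\<lambda>x. h * x * h) ` kset"
  have 1: "x * k * (h * b * h) \<in> closure ?S" if b: "b \<in> kset" for b
  proof -
    have "(\<lambda>x. x * (k * (h * b * h))) ` ?S \<subseteq> ?S"
    proof clarify
      fix a :: "'a stab" assume a: "a \<in> kset"
      then show "h * a * h * (k * (h * b * h)) \<in> ?S"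
        by (intro image_eqI[of _ _ "a * (h * k * h * b)"]) (auto simp: mult.assoc kset_mult_right)
    qed
    from closure_image_subset[OF bounded_linear_mult_left this] assms(2)
    have "x * (k * (h * b * h)) \<in> closure ?S" unfolding her_def by blast
    then show ?thesis by (simp add: mult.assoc)
  qed
  have "(\<lambda>y. (x * k) * y) ` closure ?S \<subseteq> closure ?S"
    using 1 by (intro image_closure_subset bounded_linear.continuous_on[OF bounded_linear_mult_right] continuous_on_id) auto
  then show ?thesis using assms(3) unfolding her_def by blast
qed

lemma her_mult: "h \<in> kset \<Longrightarrow> x \<in> her h \<Longrightarrow> y \<in> her h \<Longrightarrow> x * y \<in> her h"
  using her_mult3[of h x y 1] by simp

text \<open>The roots of \<open>h\<close> are limits of polynomials in \<open>h\<close> without constant term. Such a limit \<open>q\<close> is also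
  a limit of elements \<open>hs\<close>, so that \<open>q\<^sup>4 = q q\<^sup>2 q\<^sup>*\<close> is a limit of elements \<open>h (s q\<^sup>2 s\<^sup>*) h\<close>.\<close>

lemma her_root:
  assumes h: "h \<in> kset" "cpos h" and k: "cpos k" "k ^ n = h" "n \<ge> 1"
  shows "k \<in> her h"
proof (rule cpos_root[OF h(2), of "4 * n"])
  show "1 \<le> 4 * n" using k(3) by simp
next
  fix q assume q: "cpos q" "q ^ (4 * n) = h" 
    and qI: "\<And>I. subspace I \<Longrightarrow> closed I \<Longrightarrow> h \<in> I \<Longrightarrow> (\<And>x. x \<in> I \<Longrightarrow> x * h \<in> I) \<Longrightarrow> q \<in> I"
  have sq: "star q = q" by (rule cpos_star[OF q(1)])
  have "(q ^ 4) ^ n = k ^ n" by (simp add: k(2) q(2) flip: power_mult)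
  then have qk: "q ^ 4 = k" by (rule cpos_root_unique[OF cpos_power[OF q(1)] k(1,3)])
  have qK: "q \<in> kset" by (rule qI[OF subspace_kset closed_kset h(1)]) (rule kset_mult_right)
  let ?R = "range (\<lambda>s. h * s)"
  have "q \<in> closure ?R"
  proof (rule qI)
    have "subspace ?R"
    proof (rule subspaceI)
      fix x y assume "x \<in> ?R" "y \<in> ?R"
      then obtain a b where "x = h * a" "y = h * b" by auto
      then show "x + y \<in> ?R" by (intro range_eqI[of _ _ "a + b"]) (simp add: distrib_left)
    next
      fix c x assume "x \<in> ?R"
      then obtain a where "x = h * a" by auto
      then show "c *\<^sub>R x \<in> ?R" by (intro range_eqI[of _ _ "c *\<^sub>R a"]) simp
    qed (auto intro: range_eqI[of _ _ 0])
    then show "subspace (closure ?R)" by (rule subspace_closure)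
    show "h \<in> closure ?R" by (intro subsetD[OF closure_subset] range_eqI[of _ _ 1]) simp
    fix x assume x: "x \<in> closure ?R"
    have "(\<lambda>x. x * h) ` ?R \<subseteq> ?R" by (auto simp: mult.assoc)
    from closure_image_subset[OF bounded_linear_mult_left this] x show "x * h \<in> closure ?R" by blast
  qed simp
  then obtain X where X: "\<And>m::nat. X m \<in> ?R" "X \<longlonglongrightarrow> q" unfolding closure_sequential by blast
  have "\<forall>m. \<exists>s. X m = h * s" using X(1) by auto
  then obtain s where s: "\<And>m. X m = h * s m" by metis
  have "(\<lambda>m. X m * (q * q) * star (X m)) \<longlonglongrightarrow> q * (q * q) * star q"
    by (intro tendsto_mult tendsto_star X(2) tendsto_const)
  moreover have "X m * (q * q) * star (X m) \<in> her h" for m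
  proof -
    have "X m * (q * q) * star (X m) = h * (s m * (q * q * star (s m))) * h"
      by (simp add: s star_mult cpos_star[OF h(2)] mult.assoc)
    moreover have "s m * (q * q * star (s m)) \<in> kset"
      by (intro kset_mult_left kset_mult_right qK)
    ultimately show ?thesis by (simp only: her_hxh)
  qed
  ultimately have "q * (q * q) * star q \<in> her h" by (rule closed_sequentially[OF closed_her, rotated])
  moreover have "q * (q * q) * star q = q ^ 4" by (simp add: sq numeral_eq_Suc mult.assoc)
  ultimately show ?thesis by (simp add: qk)
qed

lemma her_self: "h \<in> kset \<Longrightarrow> cpos h \<Longrightarrow> h \<in> her h"
  using her_root[of h h 1] by simp

lemma her_sqrt:
  assumes "h \<in> kset" "cpos b" "b \<in> her h"
  obtains c where "cpos c" "c * c = b" "c \<in> her h"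
proof (rule cpos_root[OF assms(2), of 2])
  fix c assume c: "cpos c" "c\<^sup>2 = b"
    and cI: "\<And>I. subspace I \<Longrightarrow> closed I \<Longrightarrow> b \<in> I \<Longrightarrow> (\<And>x. x \<in> I \<Longrightarrow> x * b \<in> I) \<Longrightarrow> c \<in> I"
  have "c \<in> her h"
    by (rule cI[OF subspace_her closed_her assms(3)]) (rule her_mult[OF assms(1) _ assms(3)])
  then show ?thesis using that c by (simp add: power2_eq_square)
qed simp

lemma norm_mult3_le: "norm (x * y * z) \<le> norm x * norm y * norm (z::'a::real_normed_algebra)"
  by (rule order_trans[OF norm_mult_ineq mult_right_mono[OF norm_mult_ineq]]) simp

text \<open>The elements \<open>y\<^sub>n\<close> are normalized roots of \<open>h\<close>. That they are an approximate unit is clear on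
  elements \<open>hxh\<close> once \<open>hy\<^sub>n\<close> tends to \<open>h\<close>, which is the estimate of \<open>y\<^sup>2\<^sup>n(1 - y)\<close> for \<open>y = y\<^sub>n\<close>; as all
  \<open>y\<^sub>n\<close> are contractions, the general case follows by approximation.\<close>

lemma her_approx_unit:
  assumes h: "h \<in> kset" "h \<noteq> 0"
    and y: "\<And>n. cpos (y n)" "\<And>n. norm (y n) \<le> 1"
      "\<And>n. n \<ge> 1 \<Longrightarrow> y n ^ (2 * n) = (1 / norm h) *\<^sub>R h"
    and b: "b \<in> her h"
  shows "(\<lambda>n. y n * b * y n) \<longlonglongrightarrow> b"
proof -
  have sh: "star h = h"
  proof -
    have "star ((1 / norm h) *\<^sub>R h) = (1 / norm h) *\<^sub>R h"
      using cpos_star[OF cpos_power[OF y(1)[of 1], of "2 * 1"]] y(3)[of 1] by simp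
    then show ?thesis using h(2) by simp
  qed
  have hy: "(\<lambda>n. h * y n) \<longlonglongrightarrow> h"
  proof (rule LIM_zero_cancel, rule tendsto_norm_zero_cancel, rule tendsto_sandwich[of "\<lambda>_. 0"])
    show "\<forall>\<^sub>F n in sequentially. norm (h * y n - h) \<le> norm h * (1 / (real n + 1))"
    proof (rule eventually_sequentiallyI[of 1])
      fix n :: nat assume n: "n \<ge> 1"
      have "h = norm h *\<^sub>R y n ^ (2 * n)" using y(3)[OF n] h(2) by simp
      then have "h * y n - h = - (norm h *\<^sub>R (y n ^ (2 * n) * (1 - y n)))"
        by (metis mult_scaleR_left right_diff_distrib mult_1_right minus_diff_eq scaleR_diff_right)
      then have "norm (h * y n - h) = norm h * norm (y n ^ (2 * n) * (1 - y n))" by simp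
      also have "\<dots> \<le> norm h * (1 / (real (2 * n) + 1))"
        by (intro mult_left_mono norm_power_mult_one_minus y) simp
      also have "\<dots> \<le> norm h * (1 / (real n + 1))" by (intro mult_left_mono divide_left_mono) auto
      finally show "norm (h * y n - h) \<le> norm h * (1 / (real n + 1))" .
    qed
    have "(\<lambda>n. 1 / (real n + 1)) \<longlonglongrightarrow> 0"
      using LIMSEQ_inverse_real_of_nat by (simp add: inverse_eq_divide add.commute)
    from tendsto_mult_left[OF this, of "norm h"]
    show "(\<lambda>n. norm h * (1 / (real n + 1))) \<longlonglongrightarrow> 0" by simp
  qed (auto intro: tendsto_const)
  have yh: "(\<lambda>n. y n * h) \<longlonglongrightarrow> h"
    using tendsto_star[OF hy] by (simp add: star_mult sh cpos_star[OF y(1)])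
  have small: "norm (y n * z * y n) \<le> norm z" for n z
  proof -
    have "norm (y n * z * y n) \<le> 1 * norm z * 1"
      by (rule order_trans[OF norm_mult3_le]) (intro mult_mono y mult_nonneg_nonneg norm_ge_zero order_refl; simp)
    then show ?thesis by simp
  qed
  show ?thesis
  proof (rule LIMSEQ_I)
    fix e :: real assume e: "e > 0"
    then have "e / 3 > 0" by simp
    with b have "\<exists>c\<in>(\<lambda>x. h * x * h) ` kset. norm (c - b) < e / 3"
      unfolding her_def closure_approachable dist_norm by blast
    then obtain c where c: "c \<in> (\<lambda>x. h * x * h) ` kset" "norm (c - b) < e / 3" by blast
    then obtain x where x: "c = h * x * h" by auto
    have "(\<lambda>n. (y n * h) * x * (h * y n)) \<longlonglongrightarrow> h * x * h"
      by (intro tendsto_mult yh hy tendsto_const)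
    then have "(\<lambda>n. y n * c * y n) \<longlonglongrightarrow> c" by (simp add: x mult.assoc)
    then obtain N where N: "\<forall>n\<ge>N. norm (y n * c * y n - c) < e / 3"
      using LIMSEQ_D[of _ c "e / 3"] e by auto
    have "norm (y n * b * y n - b) < e" if "n \<ge> N" for n
    proof -
      have eq: "y n * b * y n - b = (y n * c * y n - c) + ((c - b) - y n * (c - b) * y n)"
        by (simp add: algebra_simps)
      have "norm (y n * b * y n - b) \<le> norm (y n * c * y n - c) + (norm (c - b) + norm (y n * (c - b) * y n))"
        unfolding eq by (rule order_trans[OF norm_triangle_ineq add_left_mono[OF norm_triangle_ineq4]])
      also have "\<dots> < e" using N that c(2) small[of n "c - b"] by auto
      finally show ?thesis .
    qed
    then show "\<exists>N. \<forall>n\<ge>N. norm (y n * b * y n - b) < e" by blast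
  qed
qed

section \<open>The trace on positive matrices\<close>

lemma cpos_diag:
  assumes "cpos a"
  shows "cpos (ent a i i)"
proof -
  obtain b where b: "star b * b = a" using cpos_eq_star_mult[OF assms] by blast
  have "(\<lambda>K. \<Sum>k<K. ent (star b) i k * ent b k i) \<longlonglongrightarrow> ent a i i"
    using ent_mult_sums[of "star b" i b i] by (simp add: sums_def b)
  then show ?thesis by (rule cpos_lim) (simp add: ent_star cpos_sum cpos_star_mult)
qed

lemma suminf_ennreal_swap: "(\<Sum>i. \<Sum>j. f i j) = (\<Sum>j. \<Sum>i. (f i j :: ennreal))"
proof -
  have le: "(\<Sum>i. \<Sum>j. f i j) \<le> (\<Sum>j. \<Sum>i. (f i j :: ennreal))" for f :: "nat \<Rightarrow> nat \<Rightarrow> ennreal"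
  proof (rule suminf_le_const[OF summableI])
    fix n
    have "(\<Sum>i<n. \<Sum>j. f i j) = (\<Sum>j. \<Sum>i<n. f i j)" by (rule suminf_sum[symmetric]) (rule summableI)
    also have "\<dots> \<le> (\<Sum>j. \<Sum>i. f i j)" by (intro suminf_le summableI sum_le_suminf) auto
    finally show "(\<Sum>i<n. \<Sum>j. f i j) \<le> (\<Sum>j. \<Sum>i. f i j)" .
  qed
  show ?thesis by (intro antisym le)
qed

context
  fixes \<tau> :: "'a::unital_cstar_algebra \<Rightarrow> complex"
  assumes tr: "tracial_state \<tau>"
begin

definition mtr :: "'a stab \<Rightarrow> ennreal" where
  "mtr x = trace_hat \<tau> (ent x)"

lemma mtr_eq: "mtr x = (\<Sum>i. ennreal (Re (\<tau> (ent x i i))))"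
  by (simp add: mtr_def trace_hat_def)

lemma diag_star_mult_sums:
  "(\<lambda>k. Re (\<tau> (star (ent x k i) * ent x k i))) sums Re (\<tau> (ent (star x * x) i i))"
  using bounded_linear.sums[OF bounded_linear_compose[OF bounded_linear_Re bounded_linear_trace[OF tr]] ent_mult_sums[of "star x" i x i]]
  by (simp add: ent_star)

lemma mtr_star_mult: "mtr (star x * x) = (\<Sum>i. \<Sum>k. ennreal (Re (\<tau> (star (ent x k i) * ent x k i))))"
proof -
  have "ennreal (Re (\<tau> (ent (star x * x) i i))) = (\<Sum>k. ennreal (Re (\<tau> (star (ent x k i) * ent x k i))))" for i
    by (rule suminf_ennreal_eq[OF _ diag_star_mult_sums, symmetric]) (rule trace_cpos(2)[OF tr cpos_star_mult])
  then show ?thesis by (simp add: mtr_eq)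
qed

text \<open>The trace property of \<open>\<tau>\<close>, applied entrywise, interchanges the order of summation.\<close>

lemma mtr_commute: "mtr (star x * x) = mtr (x * star x)"
proof -
  have "mtr (x * star x) = (\<Sum>i. \<Sum>k. ennreal (Re (\<tau> (ent x i k * star (ent x i k)))))"
    using mtr_star_mult[of "star x"] by (simp add: star_star ent_star)
  also have "\<dots> = (\<Sum>i. \<Sum>k. ennreal (Re (\<tau> (star (ent x i k) * ent x i k))))"
    by (subst trace_commute[OF tr]) (rule refl)
  also have "\<dots> = mtr (star x * x)"
    unfolding mtr_star_mult by (rule suminf_ennreal_swap)
  finally show ?thesis by simp
qed

lemma diag_nonneg:
  assumes "cpos a"
  shows "0 \<le> Re (\<tau> (ent a i i))" "Im (\<tau> (ent a i i)) = 0"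
proof -
  obtain b where b: "star b * b = a" using cpos_eq_star_mult[OF assms] by blast
  show "0 \<le> Re (\<tau> (ent a i i))"
    unfolding b[symmetric] sums_unique[OF diag_star_mult_sums]
    by (rule suminf_nonneg[OF sums_summable[OF diag_star_mult_sums]]) (rule trace_cpos(2)[OF tr cpos_star_mult])
  have "star (ent a i i) = ent a i i"
    using ent_star[of a i i] cpos_star[OF assms] by simp
  then show "Im (\<tau> (ent a i i)) = 0" by (rule trace_selfadj[OF tr])
qed

lemma mtr_add: "cpos a \<Longrightarrow> cpos b \<Longrightarrow> mtr (a + b) = mtr a + mtr b"
  unfolding mtr_eq by (simp add: ent_simps trace_add[OF tr] ennreal_plus diag_nonneg suminf_add summableI)

lemma mtr_zero [simp]: "mtr 0 = 0"
  by (simp add: mtr_eq ent_simps trace_zero[OF tr])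

lemma mtr_sum: "(\<And>i. i \<in> A \<Longrightarrow> cpos (f i)) \<Longrightarrow> mtr (sum f A) = (\<Sum>i\<in>A. mtr (f i))"
  by (induction A rule: infinite_finite_induct) (simp_all add: mtr_add cpos_sum)

lemma mtr_scaleR: "0 \<le> r \<Longrightarrow> mtr (r *\<^sub>R a) = ennreal r * mtr a"
  by (simp add: mtr_eq ent_scaleR trace_scaleR[OF tr] ennreal_mult')

lemma mtr_mono:
  assumes "cpos a" "cpos (b - a)"
  shows "mtr a \<le> mtr b"
  using mtr_add[OF assms] by simp

text \<open>The trace is a supremum of the continuous functions given by its partial sums.\<close>

lemma mtr_liminf:
  assumes "X \<longlonglongrightarrow> x"
  shows "mtr x \<le> liminf (\<lambda>n. mtr (X n))"
proof -
  have "mtr x = (\<Sum>i. ennreal (Re (\<tau> (ent x i i))))" by (rule mtr_eq)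
  also have "\<dots> \<le> liminf (\<lambda>n. mtr (X n))"
  proof (rule suminf_le_const[OF summableI])
    fix N
    have "(\<lambda>n. \<Sum>i<N. ennreal (Re (\<tau> (ent (X n) i i)))) \<longlonglongrightarrow> (\<Sum>i<N. ennreal (Re (\<tau> (ent x i i))))"
      by (intro tendsto_sum tendsto_ennrealI tendsto_Re bounded_linear.tendsto[OF bounded_linear_trace[OF tr]]
          tendsto_ent assms)
    then have "(\<Sum>i<N. ennreal (Re (\<tau> (ent x i i)))) = liminf (\<lambda>n. \<Sum>i<N. ennreal (Re (\<tau> (ent (X n) i i))))"
      by (intro lim_imp_Liminf[symmetric]) simp_all
    also have "\<dots> \<le> liminf (\<lambda>n. mtr (X n))"
      unfolding mtr_eq by (intro Liminf_mono always_eventually allI sum_le_suminf summableI) auto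
    finally show "(\<Sum>i<N. ennreal (Re (\<tau> (ent x i i)))) \<le> liminf (\<lambda>n. mtr (X n))" .
  qed
  finally show ?thesis .
qed

text \<open>A trace on a simple algebra is faithful, so \<open>\<tau>(b\<^sub>k\<^sub>i\<^sup>*b\<^sub>k\<^sub>i) = 0\<close> forces all entries of \<open>b = a\<^sup>1\<^sup>/\<^sup>2\<close> to vanish.\<close>

lemma mtr_eq_0:
  assumes "simple_cstar TYPE('a)" "cpos a" "mtr a = 0"
  shows "a = 0"
proof -
  obtain b where b: "star b * b = a" using cpos_eq_star_mult[OF assms(2)] by blast
  have "ent b k i = 0" for k i
  proof -
    have "(\<Sum>i. \<Sum>k. ennreal (Re (\<tau> (star (ent b k i) * ent b k i)))) = 0"
      using assms(3) mtr_star_mult[of b] by (simp add: b)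
    then have "ennreal (Re (\<tau> (star (ent b k i) * ent b k i))) = 0"
      by (simp add: suminf_eq_zero_iff)
    then have "Re (\<tau> (star (ent b k i) * ent b k i)) = 0"
      using trace_cpos(2)[OF tr cpos_star_mult[of "ent b k i"]] by simp
    from trace_cpos_eq_0[OF tr assms(1) cpos_star_mult this] show ?thesis by simp
  qed
  then have "b = 0" by (intro stab_eqI) (simp add: ent_simps)
  then show ?thesis using b by simp
qed

section \<open>The dimension function as a supremum\<close>

text \<open>The norm of the restriction of the trace to \<open>B\<close>. It is stated for the subalgebra and not for a
  generator, so that isomorphisms of subalgebras can be applied to it.\<close>

definition her_mass :: "'a stab set \<Rightarrow> ennreal" where
  "her_mass B = (SUP b\<in>{b \<in> B. cpos b \<and> norm b \<le> 1}. mtr b)"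

lemma mtr_le_her_mass:
  assumes "subspace B" "b \<in> B" "cpos b"
  shows "mtr b \<le> ennreal (norm b) * her_mass B"
proof (cases "b = 0")
  case False
  have "mtr ((1 / norm b) *\<^sub>R b) \<le> her_mass B"
    unfolding her_mass_def using assms False
    by (intro SUP_upper) (auto intro: subspace_scale cpos_scaleR)
  then have "ennreal (norm b) * mtr ((1 / norm b) *\<^sub>R b) \<le> ennreal (norm b) * her_mass B"
    by (rule mult_left_mono) simp
  then show ?thesis using False by (simp flip: mtr_scaleR)
qed simp

text \<open>The normalized roots are positive contractions in \<open>her h\<close>, which bounds their traces from above.
  Conversely, every positive contraction \<open>b\<close> is the limit of the \<open>y\<^sub>n b y\<^sub>n \<le> y\<^sub>n\<^sup>2\<close>, where \<open>y\<^sub>n\<^sup>2\<close> is the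
  normalized \<open>n\<close>-th root, so that semicontinuity of the trace bounds its trace by their limit. The
  normalizing factors \<open>\<parallel>h\<parallel>\<^sup>1\<^sup>/\<^sup>n\<close> tend to \<open>1\<close>.\<close>

theorem mtr_root_tendsto:
  assumes h: "h \<in> kset" "cpos h" "h \<noteq> 0"
    and k: "\<And>n. n \<ge> 1 \<Longrightarrow> cpos (k n) \<and> k n ^ n = h"
  shows "(\<lambda>n. mtr (k n)) \<longlonglongrightarrow> her_mass (her h)"
proof -
  define L where "L = her_mass (her h)"
  define c where "c = norm h"
  have c: "c > 0" using h(3) by (simp add: c_def)
  have nk: "norm (k n) = c powr (1 / real n)" if n: "n \<ge> 1" for n
  proof -
    have "norm (k n) ^ n = c"
      using norm_selfadj_power[of "k n" n] k[OF n] by (simp add: cpos_star c_def)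
    moreover have "norm (k n) > 0" using calculation c n by (cases "norm (k n) = 0") (auto simp: power_0_left)
    ultimately have "norm (k n) = root n c" using n real_root_pos2[of n "norm (k n)"] by auto
    then show ?thesis using n c by (simp add: root_powr_inverse)
  qed
  have "\<exists>r. cpos r \<and> r ^ (2 * n) = h" if "n \<ge> 1" for n
  proof (rule cpos_root[OF h(2), of "2 * n"])
    fix r assume "cpos r" "r ^ (2 * n) = h"
    then show ?thesis by blast
  qed (use that in simp)
  then obtain r where r: "\<And>n. n \<ge> 1 \<Longrightarrow> cpos (r n) \<and> r n ^ (2 * n) = h" by metis
  have rr: "r n * r n = k n" if n: "n \<ge> 1" for n
  proof (rule cpos_root_unique[OF _ _ n])
    show "cpos (r n * r n)" using r[OF n] by (intro cpos_square cpos_star) simp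
    show "(r n * r n) ^ n = k n ^ n" using r[OF n] k[OF n] by (simp add: power_mult power2_eq_square)
  qed (use k n in simp)
  define y where "y n = (if n \<ge> 1 then (1 / norm (r n)) *\<^sub>R r n else 0)" for n
  have r0: "norm (r n) > 0" if n: "n \<ge> 1" for n
    using r[OF n] h(3) n by (auto simp: power_0_left)
  have y: "cpos (y n)" "norm (y n) \<le> 1" for n
    unfolding y_def using r by (auto intro!: cpos_scaleR)
  have rn: "norm (r n) ^ (2 * n) = c" if n: "n \<ge> 1" for n
    using norm_selfadj_power[of "r n" "2 * n"] r[OF n] by (simp add: cpos_star c_def)
  have y2: "y n ^ (2 * n) = (1 / norm h) *\<^sub>R h" if n: "n \<ge> 1" for n
    using n rn[OF n] r[OF n] by (simp add: y_def scaleR_power c_def power_divide)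
  have yy: "y n * y n = (1 / norm (k n)) *\<^sub>R k n" if n: "n \<ge> 1" for n
  proof -
    have "norm (k n) = norm (r n) * norm (r n)"
      using cstar_identity[of "r n"] rr[OF n] r[OF n] by (simp add: cpos_star power2_eq_square)
    then show ?thesis using n by (simp add: y_def rr)
  qed
  define t where "t n = mtr ((1 / norm (k n)) *\<^sub>R k n)" for n
  have tL: "t n \<le> L" if n: "n \<ge> 1" for n
    unfolding t_def L_def her_mass_def
  proof (rule SUP_upper)
    have kn: "k n \<in> her h" "cpos (k n)" using her_root[OF h(1,2)] k[OF n] n by blast+
    show "(1 / norm (k n)) *\<^sub>R k n \<in> {b \<in> her h. cpos b \<and> norm b \<le> 1}"
      by (auto intro!: cpos_scaleR subspace_scale[OF subspace_her] subspace_0[OF subspace_her] kn)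
  qed
  have "mtr b \<le> liminf t" if b: "b \<in> her h" "cpos b" "norm b \<le> 1" for b
  proof -
    have "mtr b \<le> liminf (\<lambda>n. mtr (y n * b * y n))"
      by (intro mtr_liminf her_approx_unit[OF h(1,3) y y2 b(1)]) auto
    also have "\<dots> \<le> liminf t"
    proof (rule Liminf_mono, rule eventually_sequentiallyI[of 1])
      fix n :: nat assume n: "n \<ge> 1"
      have sy: "star (y n) = y n" by (rule cpos_star[OF y(1)])
      have "mtr (y n * b * y n) \<le> mtr (y n * y n)"
      proof (rule mtr_mono)
        show "cpos (y n * b * y n)" using cpos_conj[OF b(2), of "y n"] by (simp add: sy)
        have "cpos (star (y n) * (1 - b) * y n)"
          by (intro cpos_conj cpos_one_minus b cpos_star)
        then show "cpos (y n * y n - y n * b * y n)" by (simp add: sy algebra_simps)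
      qed
      then show "mtr (y n * b * y n) \<le> t n" by (simp add: t_def yy[OF n])
    qed
    finally show ?thesis .
  qed
  then have 1: "L \<le> liminf t" unfolding L_def her_mass_def by (intro SUP_least) auto
  have 2: "limsup t \<le> L" by (intro Limsup_bounded eventually_sequentiallyI[of 1] tL)
  have 3: "liminf t \<le> limsup t" by (rule Liminf_le_Limsup) simp
  have t: "t \<longlonglongrightarrow> L"
    using 1 2 3 by (intro Liminf_eq_Limsup) (auto intro: antisym order_trans)
  have "(\<lambda>n. c powr (1 / real n)) \<longlonglongrightarrow> c powr 0"
    using c by (intro tendsto_powr tendsto_const lim_1_over_n) auto
  then have "(\<lambda>n. ennreal (c powr (1 / real n))) \<longlonglongrightarrow> ennreal 1" using c by (intro tendsto_ennrealI) simp
  from tendsto_mult_ennreal[OF this t] have "(\<lambda>n. ennreal (c powr (1 / real n)) * t n) \<longlonglongrightarrow> L" by simp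
  moreover have "\<forall>\<^sub>F n in sequentially. ennreal (c powr (1 / real n)) * t n = mtr (k n)"
  proof (rule eventually_sequentiallyI[of 1])
    fix n :: nat assume n: "n \<ge> 1"
    have "norm (k n) > 0" using nk[OF n] c by simp
    then show "ennreal (c powr (1 / real n)) * t n = mtr (k n)"
      unfolding t_def nk[OF n, symmetric] by (simp flip: mtr_scaleR)
  qed
  ultimately show ?thesis unfolding L_def by (rule Lim_transform_eventually)
qed

section \<open>The trace on products of Hilbert-Schmidt matrices\<close>

definition hilbert_schmidt :: "'a stab set" where
  "hilbert_schmidt = {x. mtr (star x * x) < \<infinity>}"

text \<open>For positive matrices of finite trace the extended nonnegative sum is a convergent complex series.\<close>

lemma mtr_cpos_sums:
  assumes "cpos a" "mtr a < \<infinity>"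
  shows "(\<lambda>i. \<tau> (ent a i i)) sums complex_of_real (enn2real (mtr a))"
proof -
  have "summable (\<lambda>i. Re (\<tau> (ent a i i)))"
    by (rule summable_suminf_not_top) (use assms in \<open>auto simp: diag_nonneg mtr_eq\<close>)
  then have s: "(\<lambda>i. Re (\<tau> (ent a i i))) sums (\<Sum>i. Re (\<tau> (ent a i i)))" by (rule summable_sums)
  have "mtr a = ennreal (\<Sum>i. Re (\<tau> (ent a i i)))"
    unfolding mtr_eq by (rule suminf_ennreal_eq[OF diag_nonneg(1)[OF assms(1)] s])
  moreover have "0 \<le> (\<Sum>i. Re (\<tau> (ent a i i)))"
    by (rule suminf_nonneg[OF sums_summable[OF s] diag_nonneg(1)[OF assms(1)]])
  ultimately have "(\<lambda>i. Re (\<tau> (ent a i i))) sums enn2real (mtr a)" using s by simp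
  then have "(\<lambda>i. complex_of_real (Re (\<tau> (ent a i i)))) sums complex_of_real (enn2real (mtr a))"
    by (rule sums_of_real)
  moreover have "complex_of_real (Re (\<tau> (ent a i i))) = \<tau> (ent a i i)" for i
    using diag_nonneg(2)[OF assms(1), of i] by (simp add: complex_eq_iff)
  ultimately show ?thesis by simp
qed

lemma hilbert_schmidt_add:
  assumes "x \<in> hilbert_schmidt" "y \<in> hilbert_schmidt"
  shows "x + y \<in> hilbert_schmidt"
proof -
  have "mtr (star (x + y) * (x + y)) \<le> mtr (2 *\<^sub>R (star x * x + star y * y))"
  proof (rule mtr_mono[OF cpos_star_mult])
    have "2 *\<^sub>R (star x * x + star y * y) - star (x + y) * (x + y) = star (x - y) * (x - y)"
      by (simp add: star_add algebra_simps scaleR_2)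
    then show "cpos (2 *\<^sub>R (star x * x + star y * y) - star (x + y) * (x + y))" by (simp only: cpos_star_mult)
  qed
  also have "\<dots> = ennreal 2 * (mtr (star x * x) + mtr (star y * y))"
    by (subst mtr_scaleR) (simp_all add: mtr_add cpos_star_mult)
  also have "\<dots> < \<infinity>" using assms by (simp add: hilbert_schmidt_def ennreal_mult_less_top)
  finally show ?thesis by (simp add: hilbert_schmidt_def)
qed

lemma hilbert_schmidt_scaleC:
  assumes "x \<in> hilbert_schmidt"
  shows "c *\<^sub>C x \<in> hilbert_schmidt"
proof -
  have "star (c *\<^sub>C x) * (c *\<^sub>C x) = complex_of_real ((cmod c)\<^sup>2) *\<^sub>C (star x * x)"
    by (simp only: star_scaleC mult_scaleC_left mult_scaleC_right scaleC_scaleC mult.commute[of "cnj c"] complex_norm_square)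
  then have "mtr (star (c *\<^sub>C x) * (c *\<^sub>C x)) = ennreal ((cmod c)\<^sup>2) * mtr (star x * x)"
    by (simp only: scaleC_of_real) (simp add: mtr_scaleR)
  also have "\<dots> < \<infinity>" using assms by (simp add: hilbert_schmidt_def ennreal_mult_less_top)
  finally show ?thesis by (simp add: hilbert_schmidt_def)
qed

text \<open>By polarization the trace property passes from the elements \<open>z\<^sup>*z\<close> to products.\<close>

lemma hilbert_schmidt_trace_commute:
  assumes "x \<in> hilbert_schmidt" "y \<in> hilbert_schmidt"
  shows "\<exists>t. (\<lambda>i. \<tau> (ent (star x * y) i i)) sums t \<and> (\<lambda>i. \<tau> (ent (y * star x) i i)) sums t"
proof -
  define z where "z w = x + w *\<^sub>C y" for w
  define t where "t w = complex_of_real (enn2real (mtr (star (z w) * z w)))" for w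
  have z: "z w \<in> hilbert_schmidt" for w
    unfolding z_def by (intro hilbert_schmidt_add hilbert_schmidt_scaleC assms)
  have s1: "(\<lambda>i. \<tau> (ent (star (z w) * z w) i i)) sums t w" for w
    unfolding t_def by (rule mtr_cpos_sums[OF cpos_star_mult]) (use z in \<open>simp add: hilbert_schmidt_def\<close>)
  have s2: "(\<lambda>i. \<tau> (ent (z w * star (z w)) i i)) sums t w" for w
    unfolding t_def mtr_commute
    by (rule mtr_cpos_sums[OF cpos_mult_star]) (use z in \<open>simp add: hilbert_schmidt_def mtr_commute\<close>)
  \<comment> \<open>The polarization identity isolates the coefficient of \<open>w\<close> in the form \<open>A + wB + w\<^sup>*C + |w|\<^sup>2D\<close>.\<close>
  define T where "T = (1/4) * (t 1 - \<i> * t \<i> - t (-1) + \<i> * t (-\<i>))"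
  have polar: "(\<lambda>i. B i) sums T"
    if "\<And>w. (\<lambda>i. A i + w * B i + cnj w * C i + cnj w * w * D i) sums t w" for A B C D :: "nat \<Rightarrow> complex"
  proof -
    let ?f = "\<lambda>w i. A i + w * B i + cnj w * C i + cnj w * w * D i"
    have "(\<lambda>i. (1/4) * (?f 1 i - \<i> * ?f \<i> i - ?f (-1) i + \<i> * ?f (-\<i>) i)) sums T"
      unfolding T_def by (intro sums_mult sums_add sums_diff that)
    moreover have "(1/4) * (?f 1 i - \<i> * ?f \<i> i - ?f (-1) i + \<i> * ?f (-\<i>) i) = B i" for i
      by (simp add: algebra_simps)
    ultimately show ?thesis by (simp only:)
  qed
  have e1: "\<tau> (ent (star (z w) * z w) i i) = \<tau> (ent (star x * x) i i) + w * \<tau> (ent (star x * y) i i)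
      + cnj w * \<tau> (ent (star y * x) i i) + cnj w * w * \<tau> (ent (star y * y) i i)" for w i
    by (simp add: z_def star_add star_scaleC distrib_left distrib_right mult_scaleC_left mult_scaleC_right
        scaleC_scaleC ent_simps trace_add[OF tr] trace_scaleC[OF tr] mult_ac add_ac)
  have e2: "\<tau> (ent (z w * star (z w)) i i) = \<tau> (ent (x * star x) i i) + w * \<tau> (ent (y * star x) i i)
      + cnj w * \<tau> (ent (x * star y) i i) + cnj w * w * \<tau> (ent (y * star y) i i)" for w i
    by (simp add: z_def star_add star_scaleC distrib_left distrib_right mult_scaleC_left mult_scaleC_right
        scaleC_scaleC ent_simps trace_add[OF tr] trace_scaleC[OF tr] mult_ac add_ac)
  have "(\<lambda>i. \<tau> (ent (star x * y) i i)) sums T" by (rule polar[OF s1[unfolded e1]])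
  moreover have "(\<lambda>i. \<tau> (ent (y * star x) i i)) sums T" by (rule polar[OF s2[unfolded e2]])
  ultimately show ?thesis by blast
qed

end

section \<open>Homomorphisms are contractive\<close>

definition cstar_sub :: "'a::unital_cstar_algebra set \<Rightarrow> bool" where
  "cstar_sub B \<longleftrightarrow> subspace B \<and> closed B \<and> (\<forall>x\<in>B. \<forall>y\<in>B. x * y \<in> B) \<and> (\<forall>x\<in>B. star x \<in> B) \<and>
     (\<forall>c. \<forall>x\<in>B. c *\<^sub>C x \<in> B)"

lemma cstar_sub_her: "h \<in> kset \<Longrightarrow> star h = h \<Longrightarrow> cstar_sub (her h)"
  by (simp add: cstar_sub_def subspace_her her_mult her_star her_scaleC)

lemma cstar_subD:
  assumes "cstar_sub B"
  shows "subspace B" "closed B" "x \<in> B \<Longrightarrow> y \<in> B \<Longrightarrow> x * y \<in> B" "x \<in> B \<Longrightarrow> star x \<in> B"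
    "x \<in> B \<Longrightarrow> c *\<^sub>C x \<in> B" "x \<in> B \<Longrightarrow> y \<in> B \<Longrightarrow> x + y \<in> B" "x \<in> B \<Longrightarrow> y \<in> B \<Longrightarrow> x - y \<in> B"
    "x \<in> B \<Longrightarrow> r *\<^sub>R x \<in> B" "0 \<in> B" "(\<And>i. i \<in> A \<Longrightarrow> f i \<in> B) \<Longrightarrow> sum f A \<in> B"
  using assms by (auto simp: cstar_sub_def subspace_add subspace_diff subspace_scale subspace_0 subspace_sum)

text \<open>The subalgebra \<open>B\<close> has no unit in general, and \<open>\<phi>\<close> need not extend to the surrounding algebra.\<close>

definition star_hom_on :: "'a::unital_cstar_algebra set \<Rightarrow> ('a \<Rightarrow> 'b::unital_cstar_algebra) \<Rightarrow> bool" where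
  "star_hom_on B \<phi> \<longleftrightarrow> (\<forall>x\<in>B. \<forall>y\<in>B. \<phi> (x + y) = \<phi> x + \<phi> y) \<and> (\<forall>c. \<forall>x\<in>B. \<phi> (c *\<^sub>C x) = c *\<^sub>C \<phi> x) \<and>
     (\<forall>x\<in>B. \<forall>y\<in>B. \<phi> (x * y) = \<phi> x * \<phi> y) \<and> (\<forall>x\<in>B. \<phi> (star x) = star (\<phi> x))"

lemma star_hom_onD:
  assumes "star_hom_on B \<phi>"
  shows "x \<in> B \<Longrightarrow> y \<in> B \<Longrightarrow> \<phi> (x + y) = \<phi> x + \<phi> y" "x \<in> B \<Longrightarrow> \<phi> (c *\<^sub>C x) = c *\<^sub>C \<phi> x"
    "x \<in> B \<Longrightarrow> y \<in> B \<Longrightarrow> \<phi> (x * y) = \<phi> x * \<phi> y" "x \<in> B \<Longrightarrow> \<phi> (star x) = star (\<phi> x)"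
    "x \<in> B \<Longrightarrow> \<phi> (r *\<^sub>R x) = r *\<^sub>R \<phi> x"
  using assms unfolding star_hom_on_def by (auto simp flip: scaleC_of_real)

lemma star_hom_on_zero:
  assumes "star_hom_on B \<phi>" "cstar_sub B"
  shows "\<phi> 0 = 0"
  using star_hom_onD(2)[OF assms(1) cstar_subD(9)[OF assms(2)], of 0] by simp

lemma star_hom_on_diff:
  assumes "star_hom_on B \<phi>" "cstar_sub B" "x \<in> B" "y \<in> B"
  shows "\<phi> (x - y) = \<phi> x - \<phi> y"
  using star_hom_onD(1)[OF assms(1) cstar_subD(7)[OF assms(2-4)] assms(4)] by simp

lemma star_hom_on_sum:
  assumes "star_hom_on B \<phi>" "cstar_sub B"
  shows "(\<And>i. i \<in> A \<Longrightarrow> f i \<in> B) \<Longrightarrow> \<phi> (sum f A) = (\<Sum>i\<in>A. \<phi> (f i))"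
  by (induction A rule: infinite_finite_induct)
    (simp_all add: star_hom_on_zero[OF assms] star_hom_onD(1)[OF assms(1)] cstar_subD(10)[OF assms(2)])

text \<open>For self-adjoint \<open>a\<close> with \<open>\<parallel>a\<parallel> \<le> 1\<close> there is \<open>b\<close> in the subalgebra with \<open>a\<^sup>2 + (1 - b)\<^sup>2 = 1\<close>. This
  equation passes to the images under a homomorphism and bounds \<open>\<phi>(a)\<^sup>2\<close>.\<close>

lemma cstar_sub_quasi_sqrt:
  assumes B: "cstar_sub B" and a: "a \<in> B" "star a = (a::'a::unital_cstar_algebra)" "norm a \<le> 1"
  obtains b where "b \<in> B" "star b = b" "a * b = b * a" "a * a = 2 *\<^sub>R b - b * b"
proof -
  define x where "x = a * a"
  have xB: "x \<in> B" unfolding x_def by (rule cstar_subD(3)[OF B a(1) a(1)])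
  have nx: "norm x \<le> 1" using cstar_identity[of a] a by (simp add: x_def power_le_one)
  define c where "c = fps_apply (fps_root 2) x"
  have sm: "fps_summable (fps_root 2)" by (rule fps_root_summable(1)) simp
  have c2: "c * c = 1 - x" using fps_apply_root_power[of 2 x] nx by (simp add: c_def power2_eq_square)
  have sc: "star c = c"
    unfolding c_def by (rule fps_apply_star[OF sm nx]) (simp add: x_def star_mult a)
  have ac: "a * c = c * a"
    unfolding c_def by (rule fps_apply_commute[OF sm nx]) (simp add: x_def mult.assoc)
  have pow: "x ^ Suc j \<in> B" for j
    by (induction j) (use xB cstar_subD(3)[OF B xB] in auto)
  have "(\<lambda>j. fps_nth (fps_root 2) (Suc j) *\<^sub>R x ^ Suc j) sums (c - 1)"
    using sums_split_initial_segment[OF fps_apply_sums[OF sm nx], of 1] by (simp add: c_def)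
  then have "(\<lambda>n. \<Sum>j<n. fps_nth (fps_root 2) (Suc j) *\<^sub>R x ^ Suc j) \<longlonglongrightarrow> c - 1" by (simp add: sums_def)
  then have "c - 1 \<in> B"
    by (rule closed_sequentially[OF cstar_subD(2)[OF B], rotated])
      (intro cstar_subD(10)[OF B] cstar_subD(8)[OF B] pow)
  then have "1 - c \<in> B" using subspace_neg[OF cstar_subD(1)[OF B], of "c - 1"] by simp
  moreover have "a * a = 2 *\<^sub>R (1 - c) - (1 - c) * (1 - c)"
    using c2 by (simp add: x_def algebra_simps scaleR_2)
  ultimately show ?thesis using sc ac by (intro that[of "1 - c"]) (auto simp: algebra_simps)
qed

text \<open>By the C*-identity it suffices to consider self-adjoint elements of norm at most one.\<close>

lemma star_hom_on_contractive:
  fixes \<phi> :: "'a::unital_cstar_algebra \<Rightarrow> 'b::unital_cstar_algebra"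
  assumes \<phi>: "star_hom_on B \<phi>" and B: "cstar_sub B" and x: "x \<in> B"
  shows "norm (\<phi> x) \<le> norm x"
proof -
  have unit_ball: "norm (\<phi> a) \<le> 1" if a: "a \<in> B" "star a = a" "norm a \<le> 1" for a
  proof -
    obtain b where b: "b \<in> B" "star b = b" "a * b = b * a" "a * a = 2 *\<^sub>R b - b * b"
      using cstar_sub_quasi_sqrt[OF B a] by blast
    have sa: "star (\<phi> a) = \<phi> a" "star (\<phi> b) = \<phi> b"
      using star_hom_onD(4)[OF \<phi>, of a] star_hom_onD(4)[OF \<phi>, of b] a b by simp_all
    have "\<phi> a * \<phi> b = \<phi> b * \<phi> a"
      using star_hom_onD(3)[OF \<phi> a(1) b(1)] star_hom_onD(3)[OF \<phi> b(1) a(1)] b(3) by simp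
    moreover have "\<phi> a * \<phi> a = 2 *\<^sub>R \<phi> b - \<phi> b * \<phi> b"
      using star_hom_onD(3)[OF \<phi> a(1) a(1)] b star_hom_onD(3)[OF \<phi> b(1) b(1)] star_hom_onD(5)[OF \<phi> b(1)]
        star_hom_on_diff[OF \<phi> B cstar_subD(8)[OF B b(1)] cstar_subD(3)[OF B b(1) b(1)]] by simp
    then have "\<phi> a * \<phi> a + (1 - \<phi> b) * (1 - \<phi> b) = of_real 1" by (simp add: algebra_simps scaleR_2)
    ultimately have "norm (\<phi> a * \<phi> a) \<le> 1"
      by (intro norm_square_le[of "\<phi> a" "1 - \<phi> b"]) (auto simp: sa algebra_simps)
    then have "(norm (\<phi> a))\<^sup>2 \<le> 1" using cstar_identity[of "\<phi> a"] sa by simp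
    then show ?thesis by (simp add: power2_le_iff_abs_le[of 1, simplified] abs_square_le_1)
  qed
  have selfadj: "norm (\<phi> a) \<le> norm a" if a: "a \<in> B" "star a = a" for a
  proof (cases "a = 0")
    case False
    have "norm (\<phi> ((1 / norm a) *\<^sub>R a)) \<le> 1"
      using False a by (intro unit_ball cstar_subD(8)[OF B]) auto
    then show ?thesis using False a(1) by (simp add: star_hom_onD(5)[OF \<phi>] field_simps)
  qed (simp add: star_hom_on_zero[OF \<phi> B])
  have "(norm (\<phi> x))\<^sup>2 = norm (\<phi> (star x * x))"
    using x by (simp add: star_hom_onD[OF \<phi>] cstar_subD[OF B] cstar_identity)
  also have "\<dots> \<le> norm (star x * x)"
    using x by (intro selfadj cstar_subD(3)[OF B] cstar_subD(4)[OF B]) (simp_all add: star_mult star_star)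
  also have "\<dots> = (norm x)\<^sup>2" by (rule cstar_identity)
  finally show ?thesis by (rule power2_le_imp_le) simp
qed

lemma star_hom_on_tendsto:
  assumes "star_hom_on B \<phi>" "cstar_sub B" "\<And>n. X n \<in> B" "x \<in> B" "X \<longlonglongrightarrow> x"
  shows "(\<lambda>n. \<phi> (X n)) \<longlonglongrightarrow> \<phi> x"
proof (rule LIMSEQ_I)
  fix r :: real assume "r > 0"
  then obtain N where N: "\<forall>n\<ge>N. norm (X n - x) < r" using LIMSEQ_D[OF assms(5)] by blast
  have "norm (\<phi> (X n) - \<phi> x) \<le> norm (X n - x)" for n
    using star_hom_on_contractive[OF assms(1,2) cstar_subD(7)[OF assms(2-4)], of n]
    by (simp add: star_hom_on_diff[OF assms(1,2) assms(3,4)])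
  then show "\<exists>N. \<forall>n\<ge>N. norm (\<phi> (X n) - \<phi> x) < r" using N by (meson le_less_trans)
qed

lemma star_hom_on_inv:
  assumes \<phi>: "star_hom_on B \<phi>" and bij: "bij_betw \<phi> B C" and B: "cstar_sub B"
  shows "star_hom_on C (inv_into B \<phi>)"
proof -
  let ?\<psi> = "inv_into B \<phi>"
  have \<psi>: "?\<psi> y \<in> B" "\<phi> (?\<psi> y) = y" if "y \<in> C" for y
    using that bij by (auto simp: bij_betw_def inv_into_into f_inv_into_f)
  have \<psi>I: "?\<psi> y = x" if "x \<in> B" "\<phi> x = y" for x y
    using that bij by (auto simp: bij_betw_def)
  show ?thesis
    unfolding star_hom_on_def
    by (intro conjI ballI allI \<psi>I) (simp_all add: \<psi> star_hom_onD[OF \<phi>] cstar_subD[OF B])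
qed

section \<open>Isomorphisms of hereditary subalgebras scale the trace\<close>

text \<open>Finiteness of the mass of \<open>her h\<^sub>2\<close> has the effect that all elements of \<open>her h\<^sub>2\<close> are
  Hilbert-Schmidt, so that their products have a complex trace, which is symmetric.\<close>

locale her_iso =
  fixes \<tau> :: "'a::unital_cstar_algebra \<Rightarrow> complex" and h\<^sub>1 h\<^sub>2 :: "'a stab" and \<phi> :: "'a stab \<Rightarrow> 'a stab"
  assumes simple: "simple_cstar TYPE('a)"
    and tr: "tracial_state \<tau>"
    and unique: "\<And>\<sigma> :: 'a \<Rightarrow> complex. tracial_state \<sigma> \<Longrightarrow> \<sigma> = \<tau>"
    and h1: "h\<^sub>1 \<in> kset" "cpos h\<^sub>1" "h\<^sub>1 \<noteq> 0"
    and h2: "h\<^sub>2 \<in> kset" "cpos h\<^sub>2"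
    and bij: "bij_betw \<phi> (her h\<^sub>1) (her h\<^sub>2)"
    and hom: "star_hom_on (her h\<^sub>1) \<phi>"
    and fin: "her_mass \<tau> (her h\<^sub>2) < \<infinity>"
begin

abbreviation "\<psi> \<equiv> inv_into (her h\<^sub>1) \<phi>"

lemma B1: "cstar_sub (her h\<^sub>1)" and B2: "cstar_sub (her h\<^sub>2)"
  using h1 h2 by (simp_all add: cstar_sub_her cpos_star)

lemma \<phi>_in: "x \<in> her h\<^sub>1 \<Longrightarrow> \<phi> x \<in> her h\<^sub>2"
  using bij by (auto simp: bij_betw_def)

lemma \<psi>_in: "y \<in> her h\<^sub>2 \<Longrightarrow> \<psi> y \<in> her h\<^sub>1"
  using bij by (auto simp: bij_betw_def inv_into_into)

lemma \<phi>_\<psi>: "y \<in> her h\<^sub>2 \<Longrightarrow> \<phi> (\<psi> y) = y"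
  using bij by (auto simp: bij_betw_def f_inv_into_f)

lemma \<psi>_\<phi>: "x \<in> her h\<^sub>1 \<Longrightarrow> \<psi> (\<phi> x) = x"
  using bij by (auto simp: bij_betw_def)

lemma hom_inv: "star_hom_on (her h\<^sub>2) \<psi>"
  by (rule star_hom_on_inv[OF hom bij B1])

lemma \<phi>_cpos:
  assumes "b \<in> her h\<^sub>1" "cpos b"
  shows "cpos (\<phi> b)"
proof -
  obtain c where c: "cpos c" "c * c = b" "c \<in> her h\<^sub>1" using her_sqrt[OF h1(1) assms(2,1)] by blast
  have "star (\<phi> c) * \<phi> c = \<phi> b"
    using star_hom_onD(3)[OF hom c(3) c(3)] star_hom_onD(4)[OF hom c(3)] c(1,2) by (simp add: cpos_star)
  then show ?thesis using cpos_star_mult by metis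
qed

lemma \<psi>_cpos:
  assumes "b \<in> her h\<^sub>2" "cpos b"
  shows "cpos (\<psi> b)"
proof -
  obtain c where c: "cpos c" "c * c = b" "c \<in> her h\<^sub>2" using her_sqrt[OF h2(1) assms(2,1)] by blast
  have "star (\<psi> c) * \<psi> c = \<psi> b"
    using star_hom_onD(3)[OF hom_inv c(3) c(3)] star_hom_onD(4)[OF hom_inv c(3)] c(1,2) by (simp add: cpos_star)
  then show ?thesis using cpos_star_mult by metis
qed

lemma mtr_her2_finite:
  assumes "b \<in> her h\<^sub>2" "cpos b"
  shows "mtr \<tau> b < \<infinity>"
proof -
  have "mtr \<tau> b \<le> ennreal (norm b) * her_mass \<tau> (her h\<^sub>2)"
    by (rule mtr_le_her_mass[OF tr subspace_her assms])
  also have "\<dots> < \<infinity>" using fin by (simp add: ennreal_mult_less_top)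
  finally show ?thesis .
qed

lemma her2_hilbert_schmidt: "x \<in> her h\<^sub>2 \<Longrightarrow> x \<in> hilbert_schmidt \<tau>"
  unfolding hilbert_schmidt_def[OF tr] mem_Collect_eq
  by (intro mtr_her2_finite cpos_star_mult cstar_subD(3,4)[OF B2])

definition e :: "'a stab" where "e = unit 0 0 1"

lemma e_compress: "e * x * e = unit 0 0 (ent x 0 0)"
  by (simp add: e_def unit_compress)

lemma e_unit: "e * unit 0 0 a = unit 0 0 a" "unit 0 0 a * e = unit 0 0 a"
  by (simp_all add: e_def unit_mult)

lemma e_idem: "e * e = e" and e_star: "star e = e" and e_nonzero: "e \<noteq> 0"
proof -
  show "e \<noteq> 0" unfolding e_def using ent_unit[of 0 0 1 0 0] by (metis zero_stab.rep_eq zero_neq_one)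
  show "e * e = e" "star e = e" by (simp_all add: e_def unit_mult unit_star)
qed

text \<open>The elements \<open>v\<^sub>k = h\<^sub>1c\<^sub>k\<close> of \<open>h\<^sub>1(A \<otimes> K)e\<close> form a frame: they let the corner \<open>A = e(A \<otimes> K)e\<close> act inside
  \<open>her h\<^sub>1\<close> by means of the elements \<open>v\<^sub>k a v\<^sub>l\<^sup>*\<close>. They arise from a nonzero diagonal entry \<open>b\<close> of \<open>h\<^sub>1\<^sup>2\<close>,
  since \<open>1 = \<Sum> a\<^sub>k\<^sup>* b a\<^sub>k\<close> in the simple algebra \<open>A\<close>.\<close>

lemma frame_exists:
  "\<exists>(m::nat) c. (\<forall>k<m. c k \<in> kset \<and> c k * e = c k) \<and> (\<Sum>k<m. star (h\<^sub>1 * c k) * (h\<^sub>1 * c k)) = e"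
proof -
  have sh: "star h\<^sub>1 = h\<^sub>1" by (rule cpos_star[OF h1(2)])
  have "\<exists>j. ent (h\<^sub>1 * h\<^sub>1) j j \<noteq> 0"
  proof (rule ccontr)
    assume "\<not> (\<exists>j. ent (h\<^sub>1 * h\<^sub>1) j j \<noteq> 0)"
    then have "mtr \<tau> (h\<^sub>1 * h\<^sub>1) = 0" by (simp add: mtr_eq[OF tr] trace_zero[OF tr])
    from mtr_eq_0[OF tr simple cpos_square[OF sh] this] have "star h\<^sub>1 * h\<^sub>1 = 0" by (simp add: sh)
    then show False using h1(3) by simp
  qed
  then obtain j where j: "ent (h\<^sub>1 * h\<^sub>1) j j \<noteq> 0" by blast
  define b where "b = ent (h\<^sub>1 * h\<^sub>1) j j"
  have "cpos b" unfolding b_def by (intro cpos_diag cpos_square sh)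
  from simple_full[OF simple this] j
  obtain m :: nat and a where ma: "(\<Sum>k<m. star (a k) * b * a k) = 1" unfolding b_def by metis
  define c where "c k = unit j 0 (a k)" for k
  have "star (h\<^sub>1 * c k) * (h\<^sub>1 * c k) = unit 0 0 (star (a k) * b * a k)" for k
  proof -
    have "star (h\<^sub>1 * c k) * (h\<^sub>1 * c k) = unit 0 j (star (a k)) * (h\<^sub>1 * h\<^sub>1) * unit j 0 (a k)"
      by (simp add: c_def star_mult unit_star sh mult.assoc)
    also have "\<dots> = unit 0 0 (star (a k) * b * a k)"
      by (rule stab_eqI) (auto simp: ent_mult_unit ent_unit_mult ent_unit b_def)
    finally show ?thesis .
  qed
  then have "(\<Sum>k<m. star (h\<^sub>1 * c k) * (h\<^sub>1 * c k)) = e"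
    by (simp add: ma e_def flip: unit_sum)
  moreover have "c k \<in> kset \<and> c k * e = c k" for k
    by (simp add: c_def unit_kset e_def unit_mult)
  ultimately show ?thesis by blast
qed

end

locale her_iso_frame = her_iso +
  fixes m :: nat and c :: "nat \<Rightarrow> 'a stab"
  assumes c: "\<And>k. k < m \<Longrightarrow> c k \<in> kset" "\<And>k. k < m \<Longrightarrow> c k * e = c k"
    and frame: "(\<Sum>k<m. star (h\<^sub>1 * c k) * (h\<^sub>1 * c k)) = e"
begin

definition v :: "nat \<Rightarrow> 'a stab" where "v k = h\<^sub>1 * c k"

text \<open>For \<open>x = a\<close> in the corner \<open>A\<close> these are the entries of a matrix over \<open>her h\<^sub>1\<close> that represents \<open>a\<close>.
  By \<open>\<Sum> v\<^sub>l\<^sup>*v\<^sub>l = e\<close> the representation is multiplicative (\<open>sum_V\<close>).\<close>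

definition V :: "nat \<Rightarrow> 'a stab \<Rightarrow> nat \<Rightarrow> 'a stab" where "V k x l = v k * x * star (v l)"

lemma v_frame: "(\<Sum>k<m. star (v k) * v k) = e"
  using frame by (simp add: v_def)

lemma v_e: "k < m \<Longrightarrow> v k * e = v k"
  using c(2) by (simp add: v_def mult.assoc)

lemma e_v: "k < m \<Longrightarrow> e * star (v k) = star (v k)"
  using arg_cong[OF v_e, of k star] by (simp add: star_mult e_star)

lemma V_in: "k < m \<Longrightarrow> l < m \<Longrightarrow> V k x l \<in> her h\<^sub>1"
  using her_hxh[of "c k * x * star (c l)" h\<^sub>1]
  by (simp add: V_def v_def star_mult cpos_star[OF h1(2)] mult.assoc kset_mult_right c(1))

lemma y_v_in:
  assumes "y \<in> her h\<^sub>1" "k < m"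
  shows "y * x * star (v k) \<in> her h\<^sub>1"
proof -
  have "y * (x * star (c k)) * h\<^sub>1 \<in> her h\<^sub>1"
    by (intro her_mult3 h1(1) assms(1) her_self h1(2))
  then show ?thesis by (simp add: v_def star_mult cpos_star[OF h1(2)] mult.assoc)
qed

lemma sum_v: "(\<Sum>k<m. x * star (v k) * (v k * y)) = x * e * y"
  by (simp add: v_frame mult.assoc flip: sum_distrib_left sum_distrib_right)
    (simp add: v_frame flip: mult.assoc sum_distrib_right)

lemma sum_V: "(\<Sum>l<m. V k x l * V l y n) = V k (x * e * y) n"
proof -
  have "(\<Sum>l<m. V k x l * V l y n) = (\<Sum>l<m. (v k * x) * star (v l) * (v l * (y * star (v n))))"
    by (simp add: V_def mult.assoc)
  also have "\<dots> = v k * x * e * (y * star (v n))" by (rule sum_v)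
  finally show ?thesis by (simp add: V_def mult.assoc)
qed

lemma V_star: "star (V k x l) = V l (star x) k"
  by (simp add: V_def star_mult star_star mult.assoc)

lemma V_add: "V k (x + y) l = V k x l + V k y l"
  by (simp add: V_def algebra_simps)

lemma V_scaleC: "V k (a *\<^sub>C x) l = a *\<^sub>C V k x l"
  by (simp add: V_def mult_scaleC_left mult_scaleC_right)

text \<open>The complex trace. The series need not converge; \<open>Tsummable\<close> records where it does.\<close>

definition Tc :: "'a stab \<Rightarrow> complex" where "Tc z = (\<Sum>i. \<tau> (ent z i i))"

definition Tsummable :: "'a stab \<Rightarrow> bool" where "Tsummable z \<longleftrightarrow> summable (\<lambda>i. \<tau> (ent z i i))"

lemma Tc_sum:
  assumes "\<And>i. i \<in> I \<Longrightarrow> Tsummable (f i)"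
  shows "Tsummable (sum f I)" "Tc (sum f I) = (\<Sum>i\<in>I. Tc (f i))"
proof -
  have s: "(\<lambda>i. \<Sum>k\<in>I. \<tau> (ent (f k) i i)) sums (\<Sum>k\<in>I. Tc (f k))"
    by (intro sums_sum) (use assms in \<open>auto simp: Tc_def Tsummable_def summable_sums\<close>)
  show "Tsummable (sum f I)"
    unfolding Tsummable_def ent_sum trace_sum[OF tr] by (rule sums_summable[OF s])
  show "Tc (sum f I) = (\<Sum>i\<in>I. Tc (f i))"
    unfolding Tc_def[of "sum f I"] ent_sum trace_sum[OF tr] by (rule sums_unique[OF s, symmetric])
qed

lemma Tc_mult:
  assumes "x \<in> her h\<^sub>2" "y \<in> her h\<^sub>2"
  shows "Tsummable (x * y)" "Tc (x * y) = Tc (y * x)"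
proof -
  have "star x \<in> hilbert_schmidt \<tau>" "y \<in> hilbert_schmidt \<tau>"
    using assms by (auto intro: her2_hilbert_schmidt cstar_subD(4)[OF B2])
  from hilbert_schmidt_trace_commute[OF tr this]
  obtain t where "(\<lambda>i. \<tau> (ent (x * y) i i)) sums t" "(\<lambda>i. \<tau> (ent (y * x) i i)) sums t"
    by (auto simp: star_star)
  then show "Tsummable (x * y)" "Tc (x * y) = Tc (y * x)"
    by (auto simp: Tc_def Tsummable_def sums_iff)
qed

abbreviation \<iota> :: "'a \<Rightarrow> 'a stab" where "\<iota> a \<equiv> unit 0 0 a"

text \<open>Writing an element of \<open>her h\<^sub>1\<close> as a sum of products makes its image a sum of products of
  Hilbert-Schmidt elements, on which the trace is defined and symmetric.\<close>

lemma \<phi>_V_sum: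
  assumes "k < m" "n < m"
  shows "\<phi> (V k (x * e * y) n) = (\<Sum>l<m. \<phi> (V k x l) * \<phi> (V l y n))"
proof -
  have "\<phi> (V k (x * e * y) n) = \<phi> (\<Sum>l<m. V k x l * V l y n)" by (simp add: sum_V)
  also have "\<dots> = (\<Sum>l<m. \<phi> (V k x l * V l y n))"
    by (rule star_hom_on_sum[OF hom B1]) (simp add: V_in assms cstar_subD[OF B1])
  also have "\<dots> = (\<Sum>l<m. \<phi> (V k x l) * \<phi> (V l y n))"
    by (intro sum.cong refl star_hom_onD(3)[OF hom] V_in) (use assms in auto)
  finally show ?thesis .
qed

lemma \<iota>_mult: "\<iota> a * e * \<iota> b = \<iota> (a * b)"
  by (simp add: e_def unit_mult)

text \<open>The trace of the matrix \<open>(\<phi>(v\<^sub>k a v\<^sub>l\<^sup>*))\<^sub>k\<^sub>,\<^sub>l\<close>.\<close>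

definition \<sigma> :: "'a \<Rightarrow> complex" where "\<sigma> a = (\<Sum>k<m. Tc (\<phi> (V k (\<iota> a) k)))"

lemma \<sigma>_mult: "\<sigma> (a * b) = (\<Sum>k<m. \<Sum>l<m. Tc (\<phi> (V k (\<iota> a) l) * \<phi> (V l (\<iota> b) k)))"
  unfolding \<sigma>_def
proof (rule sum.cong[OF refl])
  fix k assume k: "k \<in> {..<m}"
  have eq: "\<phi> (V k (\<iota> (a * b)) k) = (\<Sum>l<m. \<phi> (V k (\<iota> a) l) * \<phi> (V l (\<iota> b) k))"
    using \<phi>_V_sum[of k k "\<iota> a" "\<iota> b"] k by (simp add: \<iota>_mult)
  show "Tc (\<phi> (V k (\<iota> (a * b)) k)) = (\<Sum>l<m. Tc (\<phi> (V k (\<iota> a) l) * \<phi> (V l (\<iota> b) k)))"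
    unfolding eq using k by (intro Tc_sum(2) Tc_mult(1) \<phi>_in V_in) auto
qed

lemma V_Tsummable:
  assumes "k < m"
  shows "Tsummable (\<phi> (V k (\<iota> a) k))"
proof -
  have eq: "\<phi> (V k (\<iota> a) k) = (\<Sum>l<m. \<phi> (V k (\<iota> a) l) * \<phi> (V l (\<iota> 1) k))"
    using \<phi>_V_sum[of k k "\<iota> a" "\<iota> 1"] assms by (simp add: \<iota>_mult)
  show ?thesis
    unfolding eq using assms by (intro Tc_sum(1) Tc_mult(1) \<phi>_in V_in) auto
qed

lemma cpos_V: "cpos (V k (\<iota> (star a * a)) k)"
proof -
  have "V k (\<iota> (star a * a)) k = star (\<iota> a * star (v k)) * (\<iota> a * star (v k))"
    by (simp add: V_def star_mult star_star unit_star mult.assoc)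
      (simp add: unit_mult flip: mult.assoc)
  then show ?thesis by (simp only: cpos_star_mult)
qed

lemma \<sigma>_star_mult:
  "ennreal (Re (\<sigma> (star a * a))) = (\<Sum>k<m. mtr \<tau> (\<phi> (V k (\<iota> (star a * a)) k)))"
  "Im (\<sigma> (star a * a)) = 0" "0 \<le> Re (\<sigma> (star a * a))"
proof -
  let ?z = "\<lambda>k. \<phi> (V k (\<iota> (star a * a)) k)"
  have z: "Tc (?z k) = complex_of_real (enn2real (mtr \<tau> (?z k)))" "mtr \<tau> (?z k) < \<infinity>" if "k < m" for k
  proof -
    have c: "cpos (?z k)" by (intro \<phi>_cpos V_in cpos_V that)
    show f: "mtr \<tau> (?z k) < \<infinity>" by (intro mtr_her2_finite c \<phi>_in V_in that)
    show "Tc (?z k) = complex_of_real (enn2real (mtr \<tau> (?z k)))"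
      unfolding Tc_def using mtr_cpos_sums[OF tr c f] by (simp add: sums_iff)
  qed
  have s: "\<sigma> (star a * a) = complex_of_real (\<Sum>k<m. enn2real (mtr \<tau> (?z k)))"
    unfolding \<sigma>_def using z by simp
  show "Im (\<sigma> (star a * a)) = 0" "0 \<le> Re (\<sigma> (star a * a))"
    unfolding s by (simp_all add: sum_nonneg)
  have "ennreal (Re (\<sigma> (star a * a))) = (\<Sum>k<m. ennreal (enn2real (mtr \<tau> (?z k))))"
    unfolding s by (simp add: sum_ennreal)
  also have "\<dots> = (\<Sum>k<m. mtr \<tau> (?z k))" using z by (intro sum.cong refl) simp
  finally show "ennreal (Re (\<sigma> (star a * a))) = (\<Sum>k<m. mtr \<tau> (?z k))" .
qed

definition scl :: real where "scl = Re (\<sigma> 1)"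

text \<open>If \<open>\<sigma>(1) = 0\<close>, faithfulness of the trace makes all \<open>\<phi>(v\<^sub>kv\<^sub>k\<^sup>*)\<close> and hence all \<open>v\<^sub>k\<close> vanish.\<close>

lemma scl_pos: "scl > 0"
proof (rule ccontr)
  assume "\<not> scl > 0"
  then have "(\<Sum>k<m. mtr \<tau> (\<phi> (V k (\<iota> 1) k))) = 0"
    using \<sigma>_star_mult(1)[of 1] \<sigma>_star_mult(3)[of 1] by (simp add: scl_def ennreal_neg)
  then have z: "mtr \<tau> (\<phi> (V k (\<iota> 1) k)) = 0" if "k < m" for k using that by simp
  have "v k = 0" if k: "k < m" for k
  proof -
    have "\<phi> (V k (\<iota> 1) k) = 0"
      using cpos_V[of k 1] by (intro mtr_eq_0[OF tr simple _ z[OF k]] \<phi>_cpos V_in k) simp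
    then have "V k (\<iota> 1) k = 0"
      using \<psi>_\<phi>[OF V_in[OF k k, of "\<iota> 1"]] star_hom_on_zero[OF hom_inv B2] by simp
    then have "v k * star (v k) = 0" using v_e[OF k] by (simp add: V_def e_def)
    then show "v k = 0" using star_mult_self_eq_0[of "star (v k)"] by (metis star_star star_zero)
  qed
  then have "e = 0" by (simp flip: v_frame)
  then show False using e_nonzero by simp
qed

text \<open>\<open>\<sigma>\<close> is a trace on \<open>A\<close>, so it is a multiple of the only tracial state.\<close>

lemma \<sigma>_eq: "\<sigma> a = of_real scl * \<tau> a"
proof -
  have add: "\<sigma> (a + b) = \<sigma> a + \<sigma> b" for a b
  proof -
    have "Tc (\<phi> (V k (\<iota> (a + b)) k)) = Tc (\<phi> (V k (\<iota> a) k)) + Tc (\<phi> (V k (\<iota> b) k))" if k: "k < m" for k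
      using V_Tsummable[OF k, of a] V_Tsummable[OF k, of b]
      by (simp add: unit_add V_add star_hom_onD(1)[OF hom] V_in k Tc_def Tsummable_def ent_simps trace_add[OF tr] suminf_add)
    then show ?thesis unfolding \<sigma>_def sum.distrib[symmetric] by (intro sum.cong refl) simp
  qed
  have scale: "\<sigma> (c *\<^sub>C a) = c * \<sigma> a" for c a
  proof -
    have "Tc (\<phi> (V k (\<iota> (c *\<^sub>C a)) k)) = c * Tc (\<phi> (V k (\<iota> a) k))" if k: "k < m" for k
      using V_Tsummable[OF k, of a]
      by (simp add: unit_scaleC V_scaleC star_hom_onD(2)[OF hom] V_in k Tc_def Tsummable_def ent_simps trace_scaleC[OF tr] suminf_mult)
    then show ?thesis unfolding \<sigma>_def sum_distrib_left by (intro sum.cong refl) simp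
  qed
  have comm: "\<sigma> (a * b) = \<sigma> (b * a)" for a b
  proof -
    have "\<sigma> (a * b) = (\<Sum>k<m. \<Sum>l<m. Tc (\<phi> (V l (\<iota> b) k) * \<phi> (V k (\<iota> a) l)))"
      unfolding \<sigma>_mult by (intro sum.cong refl Tc_mult(2) \<phi>_in V_in) auto
    also have "\<dots> = \<sigma> (b * a)" unfolding \<sigma>_mult by (rule sum.swap)
    finally show ?thesis .
  qed
  have \<sigma>1: "\<sigma> 1 = of_real scl" using \<sigma>_star_mult(2)[of 1] by (simp add: scl_def complex_eq_iff)
  have "tracial_state (\<lambda>a. \<sigma> a / of_real scl)"
    unfolding tracial_state_def
    using scl_pos \<sigma>_star_mult(2,3) by (simp add: add scale comm \<sigma>1 add_divide_distrib)
  from unique[OF this] have "\<tau> a = \<sigma> a / of_real scl" by metis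
  then show ?thesis using scl_pos by simp
qed

text \<open>For \<open>b = y\<^sup>2\<close> write \<open>b\<close> as the series of the \<open>w\<^sub>jw\<^sub>j\<^sup>*\<close>, where \<open>w\<^sub>j\<close> is the \<open>j\<close>-th column of \<open>y\<close>. As
  \<open>w\<^sub>jw\<^sub>j\<^sup>* = \<Sum> (w\<^sub>jv\<^sub>k\<^sup>*)(w\<^sub>jv\<^sub>k\<^sup>*)\<^sup>*\<close> with \<open>w\<^sub>jv\<^sub>k\<^sup>*\<close> in \<open>her h\<^sub>1\<close>, reversing the factors under the trace turns the
  trace of \<open>\<phi>(w\<^sub>jw\<^sub>j\<^sup>*)\<close> into that of \<open>\<Sum> \<phi>(v\<^sub>k w\<^sub>j\<^sup>*w\<^sub>j v\<^sub>k\<^sup>*)\<close>, which is \<open>\<sigma>(w\<^sub>j\<^sup>*w\<^sub>j)\<close>.\<close>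

lemma mtr_\<phi>:
  assumes "b \<in> her h\<^sub>1" "cpos b"
  shows "mtr \<tau> (\<phi> b) = ennreal scl * mtr \<tau> b"
proof -
  obtain y where y: "cpos y" "y * y = b" "y \<in> her h\<^sub>1" using her_sqrt[OF h1(1) assms(2,1)] by blast
  have sy: "star y = y" by (rule cpos_star[OF y(1)])
  have yxy: "y * x * y \<in> her h\<^sub>1" for x by (rule her_mult3[OF h1(1) y(3) y(3)])
  have col: "mtr \<tau> (\<phi> (y * unit j j 1 * y)) = ennreal scl * ennreal (Re (\<tau> (ent b j j)))" for j
  proof -
    \<comment> \<open>The \<open>j\<close>-th column \<open>y * unit j 0 1\<close> itself does not belong to \<open>her h\<^sub>1\<close>; its product with \<open>v\<^sub>k\<^sup>*\<close> does.\<close>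
    define W where "W k = y * unit j 0 1 * star (v k)" for k
    have W: "W k \<in> her h\<^sub>1" if "k < m" for k unfolding W_def by (rule y_v_in[OF y(3) that])
    have sW: "star (W k) = v k * unit 0 j 1 * y" for k
      by (simp add: W_def star_mult star_star unit_star sy mult.assoc)
    have "(\<Sum>k<m. W k * star (W k)) = (\<Sum>k<m. (y * unit j 0 1) * star (v k) * (v k * (unit 0 j 1 * y)))"
      unfolding sW by (simp add: W_def mult.assoc)
    also have "\<dots> = y * unit j 0 1 * e * (unit 0 j 1 * y)" by (rule sum_v)
    also have "\<dots> = y * (unit j 0 1 * e * unit 0 j 1) * y" by (simp add: mult.assoc)
    also have "unit j 0 1 * e * unit 0 j 1 = unit j j 1" by (simp add: e_def unit_mult)
    finally have "\<phi> (y * unit j j 1 * y) = \<phi> (\<Sum>k<m. W k * star (W k))" by simp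
    also have "\<dots> = (\<Sum>k<m. \<phi> (W k * star (W k)))"
      by (rule star_hom_on_sum[OF hom B1]) (simp add: W cstar_subD[OF B1])
    also have "\<dots> = (\<Sum>k<m. \<phi> (W k) * star (\<phi> (W k)))"
      by (intro sum.cong refl) (simp add: W cstar_subD[OF B1] star_hom_onD[OF hom])
    finally have "mtr \<tau> (\<phi> (y * unit j j 1 * y)) = (\<Sum>k<m. mtr \<tau> (\<phi> (W k) * star (\<phi> (W k))))"
      by (simp add: mtr_sum[OF tr] cpos_mult_star)
    also have "\<dots> = (\<Sum>k<m. mtr \<tau> (\<phi> (star (W k) * W k)))"
      by (intro sum.cong refl) (simp add: W cstar_subD[OF B1] star_hom_onD[OF hom] mtr_commute[OF tr])
    also have "\<dots> = (\<Sum>k<m. mtr \<tau> (\<phi> (V k (\<iota> (ent b j j)) k)))"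
    proof (intro sum.cong refl)
      fix k
      have "star (W k) * W k = v k * (unit 0 j 1 * (y * y) * unit j 0 1) * star (v k)"
        unfolding sW by (simp add: W_def mult.assoc)
      then show "mtr \<tau> (\<phi> (star (W k) * W k)) = mtr \<tau> (\<phi> (V k (\<iota> (ent b j j)) k))"
        by (simp add: unit_compress V_def y(2))
    qed
    also have "\<dots> = ennreal (Re (\<sigma> (ent b j j)))"
    proof -
      obtain q where "star q * q = ent b j j" using cpos_eq_star_mult[OF cpos_diag[OF assms(2)]] by blast
      then show ?thesis using \<sigma>_star_mult(1)[of q] by simp
    qed
    also have "\<dots> = ennreal scl * ennreal (Re (\<tau> (ent b j j)))"
      using scl_pos by (simp add: \<sigma>_eq ennreal_mult')
    finally show ?thesis .
  qed
  have part: "mtr \<tau> (\<phi> (y * proj N * y)) = (\<Sum>j<N. ennreal scl * ennreal (Re (\<tau> (ent b j j))))" for N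
  proof -
    have "\<phi> (y * proj N * y) = (\<Sum>j<N. \<phi> (y * unit j j 1 * y))"
      unfolding proj_eq_sum_unit sum_distrib_left sum_distrib_right
      by (rule star_hom_on_sum[OF hom B1]) (rule yxy)
    moreover have "cpos (\<phi> (y * unit j j 1 * y))" for j
    proof (rule \<phi>_cpos[OF yxy])
      have "cpos (unit j j 1 :: 'a stab)"
        using cpos_star_mult[of "unit j j 1 :: 'a stab"] by (simp add: unit_star unit_mult)
      from cpos_conj[OF this, of y] show "cpos (y * unit j j 1 * y)" by (simp add: sy)
    qed
    ultimately show ?thesis by (simp add: mtr_sum[OF tr] col)
  qed
  have eq: "ennreal scl * mtr \<tau> b = (\<Sum>j. ennreal scl * ennreal (Re (\<tau> (ent b j j))))"
    by (simp add: mtr_eq[OF tr])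
  show ?thesis
  proof (rule antisym)
    have "(\<lambda>N. y * proj N * y) \<longlonglongrightarrow> y * y"
      using her_subset_kset[OF h1(1)] y(3) by (intro tendsto_mult kset_mult_proj_tendsto tendsto_const) auto
    then have "(\<lambda>N. \<phi> (y * proj N * y)) \<longlonglongrightarrow> \<phi> b"
      using assms(1) by (intro star_hom_on_tendsto[OF hom B1] yxy) (simp_all add: y(2))
    then have "mtr \<tau> (\<phi> b) \<le> liminf (\<lambda>N. mtr \<tau> (\<phi> (y * proj N * y)))" by (rule mtr_liminf[OF tr])
    also have "\<dots> \<le> limsup (\<lambda>N. mtr \<tau> (\<phi> (y * proj N * y)))" by (rule Liminf_le_Limsup) simp
    also have "\<dots> \<le> ennreal scl * mtr \<tau> b"
      unfolding part eq by (intro Limsup_bounded always_eventually allI sum_le_suminf summableI) auto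
    finally show "mtr \<tau> (\<phi> b) \<le> ennreal scl * mtr \<tau> b" .
    show "ennreal scl * mtr \<tau> b \<le> mtr \<tau> (\<phi> b)"
      unfolding eq
    proof (rule suminf_le_const[OF summableI])
      fix N
      have "mtr \<tau> (\<phi> (y * proj N * y)) \<le> mtr \<tau> (\<phi> b)"
      proof (rule mtr_mono[OF tr])
        have "cpos (proj N :: 'a stab)" using cpos_star_mult[of "proj N :: 'a stab"] by simp
        from cpos_conj[OF this, of y] show "cpos (\<phi> (y * proj N * y))"
          by (intro \<phi>_cpos yxy) (simp add: sy)
        have "b - y * proj N * y = y * (1 - proj N) * y" by (simp add: algebra_simps y(2))
        moreover have "cpos (y * (1 - proj N) * y)"
          using cpos_conj[OF cpos_one_minus_proj, of y N] by (simp add: sy)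
        ultimately have "cpos (\<phi> (b - y * proj N * y))" using \<phi>_cpos[OF yxy] by simp
        then show "cpos (\<phi> b - \<phi> (y * proj N * y))"
          by (simp add: star_hom_on_diff[OF hom B1 assms(1) yxy])
      qed
      then show "(\<Sum>j<N. ennreal scl * ennreal (Re (\<tau> (ent b j j)))) \<le> mtr \<tau> (\<phi> b)" by (simp add: part)
    qed
  qed
qed

text \<open>An isomorphism maps the positive contractions onto the positive contractions, being isometric.\<close>

lemma her_mass_scale: "her_mass \<tau> (her h\<^sub>2) = ennreal scl * her_mass \<tau> (her h\<^sub>1)"
proof -
  have im: "{b \<in> her h\<^sub>2. cpos b \<and> norm b \<le> 1} = \<phi> ` {b \<in> her h\<^sub>1. cpos b \<and> norm b \<le> 1}"
  proof (intro equalityI subsetI)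
    fix b assume b: "b \<in> {b \<in> her h\<^sub>2. cpos b \<and> norm b \<le> 1}"
    then have "norm (\<psi> b) \<le> 1" using star_hom_on_contractive[OF hom_inv B2, of b] by simp
    then show "b \<in> \<phi> ` {b \<in> her h\<^sub>1. cpos b \<and> norm b \<le> 1}"
      using b by (intro image_eqI[of _ _ "\<psi> b"]) (auto simp: \<phi>_\<psi> \<psi>_in \<psi>_cpos)
  next
    fix b assume "b \<in> \<phi> ` {b \<in> her h\<^sub>1. cpos b \<and> norm b \<le> 1}"
    then show "b \<in> {b \<in> her h\<^sub>2. cpos b \<and> norm b \<le> 1}"
      using star_hom_on_contractive[OF hom B1] by (auto simp: \<phi>_in \<phi>_cpos intro: order_trans)
  qed
  have "her_mass \<tau> (her h\<^sub>2) = (SUP b\<in>{b \<in> her h\<^sub>1. cpos b \<and> norm b \<le> 1}. ennreal scl * mtr \<tau> b)"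
    unfolding her_mass_def[OF tr] im image_image by (intro SUP_cong refl) (simp add: mtr_\<phi>)
  also have "\<dots> = ennreal scl * her_mass \<tau> (her h\<^sub>1)"
    unfolding her_mass_def[OF tr] by (rule SUP_mult_left_ennreal[symmetric])
  finally show ?thesis .
qed

end

section \<open>Matrices over the algebra\<close>

lemma mat_mult_entry:
  fixes A B :: "'a::semiring_0 mat"
  assumes "A \<in> carrier_mat n n" "B \<in> carrier_mat n n" "i < n" "j < n"
  shows "(A * B) $$ (i, j) = (\<Sum>k<n. A $$ (i, k) * B $$ (k, j))"
  using assms by (simp add: scalar_prod_def lessThan_atLeast0)

text \<open>An index below \<open>mN\<close> is split into the number of its block of length \<open>N\<close> and the position in it.\<close>

lemma sum_blocks: "(\<Sum>L<m * N. f L) = (\<Sum>k<m. \<Sum>i<N. f (k * N + i))" for f :: "nat \<Rightarrow> 'a::comm_monoid_add"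
proof -
  have "(\<Sum>L<m * N. f L) = (\<Sum>k<m. sum f {k * N..<k * N + N})" by (rule sum.nat_group[symmetric])
  moreover have "sum f {k * N..<k * N + N} = (\<Sum>i<N. f (k * N + i))" for k
    using sum.shift_bounds_nat_ivl[of f 0 "k * N" N] by (simp add: lessThan_atLeast0 add.commute)
  ultimately show ?thesis by simp
qed

lemma sum_mult_sum: "(\<Sum>p\<in>A. f p) * x * (\<Sum>q\<in>B. g q) = (\<Sum>p\<in>A. \<Sum>q\<in>B. f p * x * (g q :: 'a::semiring_0))"
  unfolding sum_distrib_right[of f] by (rule sum_product)

lemma star_isomorphic_wholeI:
  fixes \<theta> :: "'a::unital_cstar_algebra \<Rightarrow> 'b"
  assumes bij: "bij_betw \<theta> UNIV (elems C)"
    and "\<And>x y. \<theta> (x + y) = add_op C (\<theta> x) (\<theta> y)" "\<And>c x. \<theta> (c *\<^sub>C x) = scale_op C c (\<theta> x)"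
    and "\<And>x y. \<theta> (x * y) = mult_op C (\<theta> x) (\<theta> y)" "\<And>x. \<theta> (star x) = star_op C (\<theta> x)"
  shows "star_isomorphic C (whole_algebra :: 'a star_algebra)"
proof -
  let ?\<phi> = "inv_into UNIV \<theta>"
  have b: "bij_betw ?\<phi> (elems C) UNIV" by (rule bij_betw_inv_into[OF bij])
  have \<theta>: "\<theta> (?\<phi> x) = x" if "x \<in> elems C" for x
    using that bij by (auto simp: bij_betw_def f_inv_into_f)
  have I: "?\<phi> y = x" if "\<theta> x = y" for x y
    using that bij by (auto simp: bij_betw_def)
  show ?thesis
    unfolding star_isomorphic_def
    by (rule exI[of _ ?\<phi>]) (use b in \<open>auto simp: whole_algebra_def intro!: I simp: assms(2-5) \<theta>\<close>)
qed

lemma ent_triple_finite: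
  assumes "\<And>i j. i \<ge> N \<or> j \<ge> N \<Longrightarrow> ent R i j = 0"
  shows "ent (x * R * y) r q = (\<Sum>i<N. \<Sum>j<N. ent x r i * ent R i j * ent y j q)"
proof -
  have xR: "ent (x * R) r j = (\<Sum>i<N. ent x r i * ent R i j)" for j
    by (rule ent_mult_finite) (auto simp: assms)
  have "ent (x * R * y) r q = (\<Sum>j<N. ent (x * R) r j * ent y j q)"
    by (rule ent_mult_finite) (auto simp: assms xR)
  also have "\<dots> = (\<Sum>j<N. \<Sum>i<N. ent x r i * ent R i j * ent y j q)"
    by (simp add: xR sum_distrib_right)
  also have "\<dots> = (\<Sum>i<N. \<Sum>j<N. ent x r i * ent R i j * ent y j q)" by (rule sum.swap)
  finally show ?thesis .
qed

lemma ent_mult_proj_mult: "ent (x * proj N * y) r q = (\<Sum>i<N. ent x r i * ent y i q)"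
proof -
  have "ent (x * proj N * y) r q = (\<Sum>i<N. ent (x * proj N) r i * ent y i q)"
    by (rule ent_mult_finite) (auto simp: ent_mult_proj)
  then show ?thesis by (simp add: ent_mult_proj)
qed

section \<open>Transporting the unit of the algebra to a projection\<close>

context her_iso_frame
begin

text \<open>Think of the column \<open>w\<close> with entries \<open>\<phi>(v\<^sub>k)\<close>. It does not exist, since \<open>v\<^sub>k\<close> is outside the domain of
  \<open>\<phi>\<close>, but it would satisfy \<open>w\<^sup>*w = 1\<close> and \<open>w a w\<^sup>* = (\<phi>(v\<^sub>k a v\<^sub>l\<^sup>*))\<^sub>k\<^sub>,\<^sub>l\<close>. For a matrix that is zero
  except for the entry \<open>R\<close> at \<open>(k, l)\<close>, the element \<open>G1\<close> of the corner \<open>A\<close> is what \<open>w\<^sup>*Rw\<close> would be: by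
  the frame property the definition recovers it from \<open>w(w\<^sup>*Rw)w\<^sup>*\<close>, whose entries are meaningful.\<close>

definition G1 :: "nat \<Rightarrow> nat \<Rightarrow> 'a stab \<Rightarrow> 'a stab" where
  "G1 k l R = (\<Sum>p<m. \<Sum>q<m. star (v p) * \<psi> (\<phi> (V p e k) * R * \<phi> (V l e q)) * v q)"

lemma \<phi>R\<phi>_in: "p < m \<Longrightarrow> k < m \<Longrightarrow> l < m \<Longrightarrow> q < m \<Longrightarrow> \<phi> (V p x k) * R * \<phi> (V l y q) \<in> her h\<^sub>2"
  by (intro her_mult3 h2(1) \<phi>_in V_in)

lemma \<phi>_G1:
  assumes "a < m" "b < m" "k < m" "l < m"
  shows "\<phi> (V a (\<iota> x) k) * R * \<phi> (V l (\<iota> y) b) = \<phi> (V a (\<iota> x * G1 k l R * \<iota> y) b)"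
proof -
  define Q where "Q p q = \<phi> (V p e k) * R * \<phi> (V l e q)" for p q
  have Q: "Q p q \<in> her h\<^sub>2" if "p < m" "q < m" for p q
    unfolding Q_def using that assms by (intro \<phi>R\<phi>_in)
  have T: "V a (\<iota> x) p * \<psi> (Q p q) * V q (\<iota> y) b \<in> her h\<^sub>1" if "p < m" "q < m" for p q
    using that assms by (intro her_mult3 h1(1) V_in)
  have 1: "\<phi> (V a (\<iota> x) k) = (\<Sum>p<m. \<phi> (V a (\<iota> x) p) * \<phi> (V p e k))"
    using \<phi>_V_sum[of a k "\<iota> x" e] assms by (simp add: e_unit mult.assoc e_idem)
  have 2: "\<phi> (V l (\<iota> y) b) = (\<Sum>q<m. \<phi> (V l e q) * \<phi> (V q (\<iota> y) b))"
    using \<phi>_V_sum[of l b e "\<iota> y"] assms by (simp add: e_unit e_idem)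
  have "\<phi> (V a (\<iota> x) k) * R * \<phi> (V l (\<iota> y) b)
      = (\<Sum>p<m. \<Sum>q<m. \<phi> (V a (\<iota> x) p) * Q p q * \<phi> (V q (\<iota> y) b))"
    unfolding 1 2 sum_mult_sum Q_def by (simp add: mult.assoc)
  also have "\<dots> = (\<Sum>p<m. \<Sum>q<m. \<phi> (V a (\<iota> x) p * \<psi> (Q p q) * V q (\<iota> y) b))"
  proof (intro sum.cong refl)
    fix p q assume pq: "p \<in> {..<m}" "q \<in> {..<m}"
    have "\<phi> (V a (\<iota> x) p * \<psi> (Q p q) * V q (\<iota> y) b) = \<phi> (V a (\<iota> x) p) * \<phi> (\<psi> (Q p q)) * \<phi> (V q (\<iota> y) b)"
      using pq assms by (simp add: star_hom_onD(3)[OF hom] cstar_subD(3)[OF B1] V_in \<psi>_in Q)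
    then show "\<phi> (V a (\<iota> x) p) * Q p q * \<phi> (V q (\<iota> y) b) = \<phi> (V a (\<iota> x) p * \<psi> (Q p q) * V q (\<iota> y) b)"
      using pq by (simp add: \<phi>_\<psi> Q)
  qed
  also have "\<dots> = (\<Sum>p<m. \<phi> (\<Sum>q<m. V a (\<iota> x) p * \<psi> (Q p q) * V q (\<iota> y) b))"
    by (intro sum.cong refl star_hom_on_sum[OF hom B1, symmetric] T) auto
  also have "\<dots> = \<phi> (\<Sum>p<m. \<Sum>q<m. V a (\<iota> x) p * \<psi> (Q p q) * V q (\<iota> y) b)"
    by (intro star_hom_on_sum[OF hom B1, symmetric] cstar_subD(10)[OF B1] T) auto
  also have "(\<Sum>p<m. \<Sum>q<m. V a (\<iota> x) p * \<psi> (Q p q) * V q (\<iota> y) b) = V a (\<iota> x * G1 k l R * \<iota> y) b"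
    by (simp add: V_def G1_def Q_def sum_distrib_left sum_distrib_right mult.assoc)
  finally show ?thesis .
qed

lemma G1_compress: "e * G1 k l R * e = G1 k l R"
proof -
  have "e * G1 k l R * e = (\<Sum>p<m. \<Sum>q<m. (e * star (v p)) * \<psi> (\<phi> (V p e k) * R * \<phi> (V l e q)) * (v q * e))"
    by (simp add: G1_def sum_distrib_left sum_distrib_right mult.assoc)
  also have "\<dots> = G1 k l R" unfolding G1_def by (intro sum.cong refl) (simp add: e_v v_e)
  finally show ?thesis .
qed

text \<open>The compression \<open>w\<^sup>*Rw\<close> of a matrix of blocks to \<open>A\<close>, read as an element of \<open>A\<close>.\<close>

definition G :: "(nat \<Rightarrow> nat \<Rightarrow> 'a stab) \<Rightarrow> 'a" where
  "G R = ent (\<Sum>k<m. \<Sum>l<m. G1 k l (R k l)) 0 0"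

lemma \<iota>_G: "\<iota> (G R) = (\<Sum>k<m. \<Sum>l<m. G1 k l (R k l))"
proof -
  have "\<iota> (G R) = e * (\<Sum>k<m. \<Sum>l<m. G1 k l (R k l)) * e" by (simp add: G_def e_compress)
  also have "\<dots> = (\<Sum>k<m. \<Sum>l<m. e * G1 k l (R k l) * e)" by (simp add: sum_distrib_left sum_distrib_right)
  finally show ?thesis by (simp add: G1_compress)
qed

text \<open>In the notation above, \<open>(w x w\<^sup>*) R (w y w\<^sup>*) = w (x w\<^sup>*Rw y) w\<^sup>*\<close>.\<close>

lemma \<phi>_G:
  assumes "a < m" "b < m"
  shows "(\<Sum>k<m. \<Sum>l<m. \<phi> (V a (\<iota> x) k) * R k l * \<phi> (V l (\<iota> y) b)) = \<phi> (V a (\<iota> (x * G R * y)) b)"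
proof -
  have "(\<Sum>k<m. \<Sum>l<m. \<phi> (V a (\<iota> x) k) * R k l * \<phi> (V l (\<iota> y) b))
      = (\<Sum>k<m. \<Sum>l<m. \<phi> (V a (\<iota> x * G1 k l (R k l) * \<iota> y) b))"
    by (intro sum.cong refl \<phi>_G1) (use assms in auto)
  also have "\<dots> = (\<Sum>k<m. \<phi> (\<Sum>l<m. V a (\<iota> x * G1 k l (R k l) * \<iota> y) b))"
    by (intro sum.cong refl star_hom_on_sum[OF hom B1, symmetric] V_in assms)
  also have "\<dots> = \<phi> (\<Sum>k<m. \<Sum>l<m. V a (\<iota> x * G1 k l (R k l) * \<iota> y) b)"
    by (intro star_hom_on_sum[OF hom B1, symmetric] cstar_subD(10)[OF B1] V_in assms)
  also have "(\<Sum>k<m. \<Sum>l<m. V a (\<iota> x * G1 k l (R k l) * \<iota> y) b) = V a (\<iota> x * \<iota> (G R) * \<iota> y) b"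
    by (simp add: V_def \<iota>_G sum_distrib_left sum_distrib_right mult.assoc)
  also have "\<iota> x * \<iota> (G R) * \<iota> y = \<iota> (x * G R * y)" by (simp add: unit_mult)
  finally show ?thesis .
qed

text \<open>The compression of the diagonal matrix with all blocks equal to \<open>proj N\<close>. It tends to \<open>w\<^sup>*w = 1\<close>.\<close>

definition g :: "nat \<Rightarrow> 'a" where "g N = G (\<lambda>k l. if k = l then proj N else 0)"

lemma \<phi>_proj_\<phi>:
  assumes "a < m" "b < m"
  shows "(\<Sum>k<m. \<phi> (V a (\<iota> x) k) * proj N * \<phi> (V k (\<iota> y) b)) = \<phi> (V a (\<iota> (x * g N * y)) b)"
proof -
  have "(\<Sum>k<m. \<phi> (V a (\<iota> x) k) * proj N * \<phi> (V k (\<iota> y) b))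
      = (\<Sum>k<m. \<Sum>l<m. \<phi> (V a (\<iota> x) k) * (if k = l then proj N else 0) * \<phi> (V l (\<iota> y) b))"
  proof (intro sum.cong refl)
    fix k assume "k \<in> {..<m}"
    then have "(\<Sum>l<m. if k = l then \<phi> (V a (\<iota> x) k) * proj N * \<phi> (V l (\<iota> y) b) else 0)
        = \<phi> (V a (\<iota> x) k) * proj N * \<phi> (V k (\<iota> y) b)" by (simp add: sum.delta')
    moreover have "(\<Sum>l<m. \<phi> (V a (\<iota> x) k) * (if k = l then proj N else 0) * \<phi> (V l (\<iota> y) b))
        = (\<Sum>l<m. if k = l then \<phi> (V a (\<iota> x) k) * proj N * \<phi> (V l (\<iota> y) b) else 0)"
      by (intro sum.cong refl) auto
    ultimately show "\<phi> (V a (\<iota> x) k) * proj N * \<phi> (V k (\<iota> y) b)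
        = (\<Sum>l<m. \<phi> (V a (\<iota> x) k) * (if k = l then proj N else 0) * \<phi> (V l (\<iota> y) b))" by simp
  qed
  then show ?thesis using \<phi>_G[OF assms] by (simp add: g_def)
qed

lemma G1_0: "G1 k l 0 = 0"
  by (simp add: G1_def star_hom_on_zero[OF hom_inv B2])

lemma \<iota>_g: "\<iota> (g N) = (\<Sum>k<m. G1 k k (proj N))"
proof -
  have "(\<Sum>l<m. G1 k l (if k = l then proj N else 0)) = G1 k k (proj N)" if "k < m" for k
  proof -
    have "(\<Sum>l<m. G1 k l (if k = l then proj N else 0)) = (\<Sum>l<m. if k = l then G1 k l (proj N) else 0)"
      by (intro sum.cong refl) (auto simp: G1_0)
    then show ?thesis using that by (simp add: sum.delta')
  qed
  then show ?thesis by (simp add: g_def \<iota>_G)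
qed

lemma g_star: "star (g N) = g N"
proof -
  have "star (G1 k k (proj N)) = G1 k k (proj N)" if k: "k < m" for k
  proof -
    have "star (G1 k k (proj N)) = (\<Sum>p<m. \<Sum>q<m. star (v q) * \<psi> (\<phi> (V q e k) * proj N * \<phi> (V k e p)) * v p)"
      unfolding G1_def star_sum
    proof (intro sum.cong refl)
      fix p q assume pq: "p \<in> {..<m}" "q \<in> {..<m}"
      have "star (\<psi> (\<phi> (V p e k) * proj N * \<phi> (V k e q))) = \<psi> (star (\<phi> (V p e k) * proj N * \<phi> (V k e q)))"
        using pq k by (intro star_hom_onD(4)[OF hom_inv, symmetric] \<phi>R\<phi>_in) auto
      also have "star (\<phi> (V p e k) * proj N * \<phi> (V k e q)) = \<phi> (V q e k) * proj N * \<phi> (V k e p)"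
        using pq k by (simp add: star_mult mult.assoc V_in V_star e_star flip: star_hom_onD(4)[OF hom])
      finally show "star (star (v p) * \<psi> (\<phi> (V p e k) * proj N * \<phi> (V k e q)) * v q)
          = star (v q) * \<psi> (\<phi> (V q e k) * proj N * \<phi> (V k e p)) * v p"
        by (simp add: star_mult star_star mult.assoc)
    qed
    also have "\<dots> = G1 k k (proj N)" unfolding G1_def by (rule sum.swap)
    finally show ?thesis .
  qed
  then have "\<iota> (star (g N)) = \<iota> (g N)"
    by (simp add: \<iota>_g star_sum flip: unit_star)
  then show ?thesis by (simp add: unit_inject)
qed

lemma g_tendsto: "g \<longlonglongrightarrow> 1"
proof -
  have "(\<lambda>N. G1 k k (proj N)) \<longlonglongrightarrow> (\<Sum>p<m. \<Sum>q<m. star (v p) * (V p e k * V k e q) * v q)" if k: "k < m" for k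
    unfolding G1_def
  proof (intro tendsto_sum tendsto_mult tendsto_const)
    fix p q assume "p \<in> {..<m}" "q \<in> {..<m}"
    then have pq: "p < m" "q < m" by auto
    have in2: "\<phi> (V p e k) \<in> her h\<^sub>2" "\<phi> (V k e q) \<in> her h\<^sub>2" using pq k by (auto intro: \<phi>_in V_in)
    have "(\<lambda>N. \<phi> (V p e k) * proj N * \<phi> (V k e q)) \<longlonglongrightarrow> \<phi> (V p e k) * \<phi> (V k e q)"
      using her_subset_kset[OF h2(1)] in2 by (intro tendsto_mult kset_mult_proj_tendsto tendsto_const) auto
    then have "(\<lambda>N. \<psi> (\<phi> (V p e k) * proj N * \<phi> (V k e q))) \<longlonglongrightarrow> \<psi> (\<phi> (V p e k) * \<phi> (V k e q))"
      using pq k in2 by (intro star_hom_on_tendsto[OF hom_inv B2] \<phi>R\<phi>_in cstar_subD(3)[OF B2])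
    moreover have "\<psi> (\<phi> (V p e k) * \<phi> (V k e q)) = V p e k * V k e q"
      using pq k by (simp add: \<psi>_\<phi> V_in cstar_subD(3)[OF B1] flip: star_hom_onD(3)[OF hom])
    ultimately show "(\<lambda>N. \<psi> (\<phi> (V p e k) * proj N * \<phi> (V k e q))) \<longlonglongrightarrow> V p e k * V k e q" by simp
  qed
  then have "(\<lambda>N. \<iota> (g N)) \<longlonglongrightarrow> (\<Sum>k<m. \<Sum>p<m. \<Sum>q<m. star (v p) * (V p e k * V k e q) * v q)"
    unfolding \<iota>_g by (intro tendsto_sum) simp
  also have "(\<Sum>k<m. \<Sum>p<m. \<Sum>q<m. star (v p) * (V p e k * V k e q) * v q)
      = (\<Sum>p<m. \<Sum>k<m. \<Sum>q<m. star (v p) * (V p e k * V k e q) * v q)"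
    by (rule sum.swap)
  also have "\<dots> = (\<Sum>p<m. \<Sum>q<m. \<Sum>k<m. star (v p) * (V p e k * V k e q) * v q)"
    by (intro sum.cong refl sum.swap)
  also have "\<dots> = (\<Sum>p<m. \<Sum>q<m. star (v p) * V p (e * e * e) q * v q)"
    by (simp add: sum_V[symmetric] sum_distrib_left sum_distrib_right)
  also have "\<dots> = (\<Sum>p<m. star (v p) * v p) * e * (\<Sum>q<m. star (v q) * v q)"
    unfolding sum_mult_sum by (simp add: e_idem V_def mult.assoc)
  also have "\<dots> = e" by (simp add: v_frame e_idem)
  finally have "(\<lambda>N. \<iota> (g N)) \<longlonglongrightarrow> e" .
  from tendsto_ent[OF this, of 0 0] show ?thesis by (simp add: e_def ent_unit)
qed

text \<open>Let \<open>P\<close> be the diagonal matrix with blocks \<open>proj N\<close>, so that \<open>w\<^sup>*Pw = g N\<close> is close to \<open>1\<close>, and put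
  \<open>s = (g N)\<^sup>-\<^sup>1\<^sup>/\<^sup>2\<close>. Then \<open>u = Pws\<close> satisfies \<open>u\<^sup>*u = 1\<close>, so \<open>a \<mapsto> u a u\<^sup>*\<close> is an isomorphism of \<open>A\<close> onto the
  corner of the projection \<open>uu\<^sup>*\<close>, which is a finite matrix over \<open>A\<close>. The trace of \<open>uu\<^sup>*\<close> is that of the
  matrix \<open>w u\<^sup>*u w\<^sup>* = w w\<^sup>*\<close>, and this is \<open>\<sigma>(1)\<close>.\<close>

theorem projection_exists:
  "\<exists>(n::nat) (p :: 'a mat). 1 \<le> n \<and> mat_projection n p \<and>
     star_isomorphic (mat_corner n p) (whole_algebra :: 'a star_algebra) \<and>
     mat_trace \<tau> p = complex_of_real scl"
proof -
  obtain N0 where N0: "\<And>N. N \<ge> N0 \<Longrightarrow> norm (g N - 1) < 1"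
    using LIMSEQ_D[OF g_tendsto, of 1] by auto
  define N where "N = Suc N0"
  have N: "N > 0" "norm (of_real 1 - g N) < 1" using N0[of N] by (simp_all add: N_def norm_minus_commute)
  obtain s where s: "star s = s" "s * g N = g N * s" "s * g N * s = 1"
    using inverse_sqrt_near_scalar[OF g_star N(2)] by metis
  have ssg: "s * s * g N = 1" "g N * (s * s) = 1" using s by (metis mult.assoc)+
  have m0: "m > 0"
  proof (rule ccontr)
    assume "\<not> m > 0"
    then have "e = 0" using v_frame by simp
    then show False using e_nonzero by simp
  qed
  define n where "n = m * N"
  have n1: "1 \<le> n" using N(1) m0 by (simp add: n_def Suc_leI)
  have dv: "I div N < m" "I mod N < N" if "I < n" for I
    using that N(1) by (auto simp: n_def less_mult_imp_div_less)
  \<comment> \<open>The entries of \<open>w s x s w\<^sup>*\<close>; cut down to size \<open>N\<close> they are the blocks of \<open>\<theta> x = u x u\<^sup>*\<close>.\<close>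
  define D where "D x k l = \<phi> (V k (\<iota> (s * x * s)) l)" for x k l
  define \<theta> where "\<theta> x = Matrix.mat n n (\<lambda>(I, J). ent (D x (I div N) (J div N)) (I mod N) (J mod N))" for x
  have \<theta>c: "\<theta> x \<in> carrier_mat n n" for x by (simp add: \<theta>_def)
  have \<theta>e: "\<theta> x $$ (I, J) = ent (D x (I div N) (J div N)) (I mod N) (J mod N)" if "I < n" "J < n" for x I J
    using that by (simp add: \<theta>_def)
  have blk: "k * N + i < n" if "k < m" "i < N" for k i
  proof -
    have "k * N + i < Suc k * N" using that by simp
    also have "\<dots> \<le> m * N" using that by (intro mult_le_mono) auto
    finally show ?thesis by (simp add: n_def)
  qed
  have D_mult: "(\<Sum>k<m. D x a k * proj N * D y k b) = D (x * y) a b" if "a < m" "b < m" for x y a b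
  proof -
    have "s * x * s * g N * (s * y * s) = s * x * (s * g N * s) * (y * s)" by (simp only: mult.assoc)
    also have "\<dots> = s * (x * y) * s" unfolding s(3) by (simp add: mult.assoc)
    finally show ?thesis unfolding D_def using \<phi>_proj_\<phi>[OF that] by simp
  qed
  have D_star: "star (D x k l) = D (star x) l k" if "k < m" "l < m" for x k l
    using that by (simp add: D_def V_in V_star unit_star star_mult s(1) mult.assoc flip: star_hom_onD(4)[OF hom])
  have \<theta>_mult: "\<theta> x * \<theta> y = \<theta> (x * y)" for x y
  proof (rule eq_matI)
    fix I J assume "I < dim_row (\<theta> (x * y))" "J < dim_col (\<theta> (x * y))"
    then have IJ: "I < n" "J < n" by (auto simp: \<theta>_def)
    let ?a = "I div N" and ?b = "J div N" and ?r = "I mod N" and ?q = "J mod N"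
    have "(\<theta> x * \<theta> y) $$ (I, J) = (\<Sum>L<m * N. \<theta> x $$ (I, L) * \<theta> y $$ (L, J))"
      using mat_mult_entry[OF \<theta>c \<theta>c IJ] by (simp add: n_def)
    also have "\<dots> = (\<Sum>k<m. \<Sum>i<N. ent (D x ?a k) ?r i * ent (D y k ?b) i ?q)"
      unfolding sum_blocks by (intro sum.cong refl) (simp add: \<theta>e IJ blk)
    also have "\<dots> = ent (\<Sum>k<m. D x ?a k * proj N * D y k ?b) ?r ?q"
      by (simp add: ent_sum ent_mult_proj_mult)
    also have "\<dots> = \<theta> (x * y) $$ (I, J)" using IJ by (simp add: D_mult dv \<theta>e)
    finally show "(\<theta> x * \<theta> y) $$ (I, J) = \<theta> (x * y) $$ (I, J)" .
  qed (simp_all add: \<theta>_def)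
  have \<theta>_star: "mat_star (\<theta> x) = \<theta> (star x)" for x
    by (rule eq_matI) (auto simp: mat_star_def \<theta>_def dv D_star simp flip: ent_star)
  have \<theta>_add: "\<theta> (x + y) = \<theta> x + \<theta> y" for x y
  proof -
    have "D (x + y) k l = D x k l + D y k l" if "k < m" "l < m" for k l
      using that by (simp add: D_def algebra_simps unit_add V_add star_hom_onD(1)[OF hom] V_in)
    then show ?thesis by (intro eq_matI) (auto simp: \<theta>_def dv ent_simps)
  qed
  have \<theta>_scale: "\<theta> (c *\<^sub>C x) = map_mat ((*\<^sub>C) c) (\<theta> x)" for c x
  proof -
    have "D (c *\<^sub>C x) k l = c *\<^sub>C D x k l" if "k < m" "l < m" for k l
      using that by (simp add: D_def mult_scaleC_left mult_scaleC_right unit_scaleC V_scaleC star_hom_onD(2)[OF hom] V_in)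
    then show ?thesis by (intro eq_matI) (auto simp: \<theta>_def dv ent_simps)
  qed
  define p where "p = \<theta> 1"
  have p: "mat_projection n p"
    by (simp add: mat_projection_def p_def \<theta>c \<theta>_mult \<theta>_star)
  have inj: "inj \<theta>"
  proof (rule injI)
    fix x y assume xy: "\<theta> x = \<theta> y"
    have blocks: "ent (D x k l) i j = ent (D y k l) i j" if "k < m" "l < m" "i < N" "j < N" for k l i j
    proof -
      have "\<theta> x $$ (k * N + i, l * N + j) = \<theta> y $$ (k * N + i, l * N + j)" using xy by simp
      then show ?thesis using that by (simp add: \<theta>e blk)
    qed
    then have cut: "proj N * D x k l * proj N = proj N * D y k l * proj N" if "k < m" "l < m" for k l
      using that by (intro stab_eqI) (simp add: ent_mult_proj ent_proj_mult)
    \<comment> \<open>The truncated blocks determine the full ones, as \<open>w s z s w\<^sup>* = (w s\<^sup>2 w\<^sup>*) P (w s z s w\<^sup>*) P (w s\<^sup>2 w\<^sup>*)\<close>.\<close>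
    have full: "D z a b = (\<Sum>k<m. \<Sum>l<m. D 1 a k * (proj N * D z k l * proj N) * D 1 l b)" if "a < m" "b < m" for z a b
    proof -
      have "(\<Sum>k<m. \<Sum>l<m. D 1 a k * (proj N * D z k l * proj N) * D 1 l b)
          = (\<Sum>k<m. D 1 a k * proj N * (\<Sum>l<m. D z k l * proj N * D 1 l b))"
        by (simp add: sum_distrib_left mult.assoc)
      also have "\<dots> = (\<Sum>k<m. D 1 a k * proj N * D z k b)"
        by (intro sum.cong refl) (simp add: D_mult that)
      also have "\<dots> = D z a b" by (simp add: D_mult that)
      finally show ?thesis by simp
    qed
    have Dxy: "D x a b = D y a b" if "a < m" "b < m" for a b
      unfolding full[OF that, of x] full[OF that, of y] by (intro sum.cong refl) (simp add: cut)
    have Vxy: "V a (\<iota> (s * x * s)) b = V a (\<iota> (s * y * s)) b" if ab: "a < m" "b < m" for a b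
    proof -
      have "\<psi> (\<phi> (V a (\<iota> (s * x * s)) b)) = \<psi> (\<phi> (V a (\<iota> (s * y * s)) b))"
        using Dxy[OF ab] unfolding D_def by (rule arg_cong)
      then show ?thesis by (simp only: \<psi>_\<phi>[OF V_in[OF ab]])
    qed
    have rec: "(\<Sum>a<m. \<Sum>b<m. star (v a) * V a (\<iota> z) b * v b) = \<iota> z" for z
    proof -
      have "(\<Sum>a<m. \<Sum>b<m. star (v a) * V a (\<iota> z) b * v b)
          = (\<Sum>a<m. star (v a) * v a) * \<iota> z * (\<Sum>b<m. star (v b) * v b)"
        unfolding sum_mult_sum by (simp add: V_def mult.assoc)
      then show ?thesis by (simp add: v_frame e_unit)
    qed
    have "(\<Sum>a<m. \<Sum>b<m. star (v a) * V a (\<iota> (s * x * s)) b * v b)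
        = (\<Sum>a<m. \<Sum>b<m. star (v a) * V a (\<iota> (s * y * s)) b * v b)"
      by (intro sum.cong refl) (simp add: Vxy)
    then have "\<iota> (s * x * s) = \<iota> (s * y * s)" by (simp only: rec)
    then have sxs: "s * x * s = s * y * s" by (simp add: unit_inject)
    \<comment> \<open>\<open>g N * s\<close> is the inverse of \<open>s\<close>.\<close>
    have undo: "g N * s * (s * z * s) * (s * g N) = z" for z
    proof -
      have "g N * s * (s * z * s) * (s * g N) = (g N * (s * s)) * z * (s * s * g N)" by (simp add: mult.assoc)
      then show ?thesis by (simp add: ssg)
    qed
    have "g N * s * (s * x * s) * (s * g N) = g N * s * (s * y * s) * (s * g N)" by (simp only: sxs)
    then show "x = y" by (simp only: undo)
  qed
  have corner: "range \<theta> = {p * X * p | X. X \<in> carrier_mat n n}"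
  proof (intro equalityI subsetI)
    fix Z assume "Z \<in> range \<theta>"
    then obtain x where Z: "Z = \<theta> x" by auto
    have "Z = p * \<theta> x * p" by (simp add: Z p_def \<theta>_mult)
    then show "Z \<in> {p * X * p | X. X \<in> carrier_mat n n}" using \<theta>c by blast
  next
    fix Z assume "Z \<in> {p * X * p | X. X \<in> carrier_mat n n}"
    then obtain X where X: "X \<in> carrier_mat n n" "Z = p * X * p" by blast
    define R :: "nat \<Rightarrow> nat \<Rightarrow> 'a stab" where
      "R k l = Abs_stab (\<lambda>i j. if i < N \<and> j < N then X $$ (k * N + i, l * N + j) else 0)" for k l
    have eR: "ent (R k l) i j = (if i < N \<and> j < N then X $$ (k * N + i, l * N + j) else 0)" for k l i j
      unfolding R_def by (subst ent_Abs_fin) (auto intro: fin_matI[of N])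
    have pc: "p \<in> carrier_mat n n" by (simp add: p_def \<theta>c)
    have "Z = \<theta> (s * G R * s)"
    proof (rule eq_matI)
      fix I J assume "I < dim_row (\<theta> (s * G R * s))" "J < dim_col (\<theta> (s * G R * s))"
      then have IJ: "I < n" "J < n" by (auto simp: \<theta>_def)
      let ?a = "I div N" and ?b = "J div N" and ?r = "I mod N" and ?q = "J mod N"
      have "Z $$ (I, J) = (\<Sum>L<m * N. (p * X) $$ (I, L) * p $$ (L, J))"
        unfolding X(2) using mat_mult_entry[OF mult_carrier_mat[OF pc X(1)] pc IJ] by (simp add: n_def)
      also have "\<dots> = (\<Sum>l<m. \<Sum>j<N. (p * X) $$ (I, l * N + j) * ent (D 1 l ?b) j ?q)"
        unfolding sum_blocks p_def by (intro sum.cong refl) (simp add: \<theta>e IJ blk)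
      also have "\<dots> = (\<Sum>l<m. \<Sum>j<N. (\<Sum>k<m. \<Sum>i<N. ent (D 1 ?a k) ?r i * X $$ (k * N + i, l * N + j)) * ent (D 1 l ?b) j ?q)"
      proof (intro sum.cong refl)
        fix l j assume lj: "l \<in> {..<m}" "j \<in> {..<N}"
        have "(p * X) $$ (I, l * N + j) = (\<Sum>L<m * N. p $$ (I, L) * X $$ (L, l * N + j))"
          using mat_mult_entry[OF pc X(1) IJ(1) blk] lj by (simp add: n_def)
        also have "\<dots> = (\<Sum>k<m. \<Sum>i<N. ent (D 1 ?a k) ?r i * X $$ (k * N + i, l * N + j))"
          unfolding sum_blocks p_def by (intro sum.cong refl) (simp add: \<theta>e IJ blk)
        finally show "(p * X) $$ (I, l * N + j) * ent (D 1 l ?b) j ?q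
          = (\<Sum>k<m. \<Sum>i<N. ent (D 1 ?a k) ?r i * X $$ (k * N + i, l * N + j)) * ent (D 1 l ?b) j ?q" by simp
      qed
      also have "\<dots> = (\<Sum>l<m. \<Sum>j<N. \<Sum>k<m. \<Sum>i<N. ent (D 1 ?a k) ?r i * ent (R k l) i j * ent (D 1 l ?b) j ?q)"
        by (simp add: sum_distrib_right eR)
      also have "\<dots> = (\<Sum>l<m. \<Sum>k<m. \<Sum>j<N. \<Sum>i<N. ent (D 1 ?a k) ?r i * ent (R k l) i j * ent (D 1 l ?b) j ?q)"
        by (intro sum.cong refl sum.swap)
      also have "\<dots> = (\<Sum>k<m. \<Sum>l<m. \<Sum>j<N. \<Sum>i<N. ent (D 1 ?a k) ?r i * ent (R k l) i j * ent (D 1 l ?b) j ?q)"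
        by (rule sum.swap)
      also have "\<dots> = (\<Sum>k<m. \<Sum>l<m. \<Sum>i<N. \<Sum>j<N. ent (D 1 ?a k) ?r i * ent (R k l) i j * ent (D 1 l ?b) j ?q)"
        by (intro sum.cong refl sum.swap)
      also have "\<dots> = (\<Sum>k<m. \<Sum>l<m. ent (D 1 ?a k * R k l * D 1 l ?b) ?r ?q)"
        by (intro sum.cong refl ent_triple_finite[symmetric]) (auto simp: eR)
      also have "\<dots> = ent (\<Sum>k<m. \<Sum>l<m. D 1 ?a k * R k l * D 1 l ?b) ?r ?q"
        by (simp add: ent_sum)
      also have "(\<Sum>k<m. \<Sum>l<m. D 1 ?a k * R k l * D 1 l ?b) = D (s * G R * s) ?a ?b"
        unfolding D_def using \<phi>_G[OF dv(1)[OF IJ(1)] dv(1)[OF IJ(2)]] by (simp add: mult.assoc)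
      finally show "Z $$ (I, J) = \<theta> (s * G R * s) $$ (I, J)" using IJ by (simp add: \<theta>e)
    qed (use X(2) pc in \<open>auto simp: \<theta>_def\<close>)
    then show "Z \<in> range \<theta>" by blast
  qed
  have iso: "star_isomorphic (mat_corner n p) (whole_algebra :: 'a star_algebra)"
  proof (rule star_isomorphic_wholeI)
    show "bij_betw \<theta> UNIV (elems (mat_corner n p))"
      using inj corner by (simp add: bij_betw_def mat_corner_def)
  qed (simp_all add: mat_corner_def mat_algebra_def \<theta>_add \<theta>_scale \<theta>_mult \<theta>_star)
  have trace: "mat_trace \<tau> p = complex_of_real scl"
  proof -
    have cD: "cpos (D 1 k k)" if "k < m" for k
    proof -
      have "s * 1 * s = star s * s" by (simp add: s(1))
      then show ?thesis unfolding D_def using \<phi>_cpos[OF V_in cpos_V[of k s]] that by simp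
    qed
    \<comment> \<open>The entries of \<open>w s w\<^sup>*\<close>. The trace of \<open>P (w s w\<^sup>*)(w s w\<^sup>*) P\<close> is that of \<open>(w s w\<^sup>*) P (w s w\<^sup>*) = w w\<^sup>*\<close>.\<close>
    define E where "E l k = \<phi> (V l (\<iota> s) k)" for l k
    have E_star: "star (E l k) = E k l" if "k < m" "l < m" for k l
      using that by (simp add: E_def V_in V_star unit_star s(1) flip: star_hom_onD(4)[OF hom])
    have "ennreal (Re (mat_trace \<tau> p)) = ennreal scl"
    proof -
      have "mat_trace \<tau> p = (\<Sum>L<m * N. \<tau> (p $$ (L, L)))" by (simp add: mat_trace_def p_def \<theta>_def n_def)
      also have "\<dots> = (\<Sum>k<m. \<Sum>i<N. \<tau> (ent (D 1 k k) i i))"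
        unfolding sum_blocks p_def by (intro sum.cong refl) (simp add: \<theta>e blk)
      finally have "Re (mat_trace \<tau> p) = (\<Sum>k<m. \<Sum>i<N. Re (\<tau> (ent (D 1 k k) i i)))" by simp
      moreover have "(\<Sum>k<m. \<Sum>i<N. ennreal (Re (\<tau> (ent (D 1 k k) i i))))
          = (\<Sum>k<m. ennreal (\<Sum>i<N. Re (\<tau> (ent (D 1 k k) i i))))"
        by (intro sum.cong refl) (simp add: diag_nonneg(1)[OF tr cD])
      moreover have "(\<Sum>k<m. ennreal (\<Sum>i<N. Re (\<tau> (ent (D 1 k k) i i))))
          = ennreal (\<Sum>k<m. \<Sum>i<N. Re (\<tau> (ent (D 1 k k) i i)))"
        by (rule sum_ennreal) (intro sum_nonneg, simp add: diag_nonneg(1)[OF tr cD])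
      ultimately have "ennreal (Re (mat_trace \<tau> p)) = (\<Sum>k<m. \<Sum>i<N. ennreal (Re (\<tau> (ent (D 1 k k) i i))))"
        by (simp only:)
      also have "\<dots> = (\<Sum>k<m. mtr \<tau> (proj N * D 1 k k * proj N))"
      proof (intro sum.cong refl)
        fix k
        have "mtr \<tau> (proj N * D 1 k k * proj N)
            = (\<Sum>i. if i < N then ennreal (Re (\<tau> (ent (D 1 k k) i i))) else 0)"
          unfolding mtr_eq[OF tr]
          by (intro suminf_cong) (simp add: ent_mult_proj ent_proj_mult trace_zero[OF tr])
        also have "\<dots> = (\<Sum>i<N. if i < N then ennreal (Re (\<tau> (ent (D 1 k k) i i))) else 0)"
          by (rule suminf_finite) auto
        finally show "(\<Sum>i<N. ennreal (Re (\<tau> (ent (D 1 k k) i i)))) = mtr \<tau> (proj N * D 1 k k * proj N)" by simp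
      qed
      also have "\<dots> = (\<Sum>k<m. \<Sum>l<m. mtr \<tau> (star (E l k * proj N) * (E l k * proj N)))"
      proof (intro sum.cong refl)
        fix k assume k: "k \<in> {..<m}"
        have "D 1 k k = (\<Sum>l<m. E k l * E l k)"
          using \<phi>_V_sum[of k k "\<iota> s" "\<iota> s"] k by (simp add: \<iota>_mult D_def E_def)
        also have "\<dots> = (\<Sum>l<m. star (E l k) * E l k)"
          using k by (intro sum.cong refl) (simp add: E_star)
        finally have "proj N * D 1 k k * proj N = (\<Sum>l<m. star (E l k * proj N) * (E l k * proj N))"
          by (simp add: sum_distrib_left sum_distrib_right star_mult mult.assoc)
        then show "mtr \<tau> (proj N * D 1 k k * proj N) = (\<Sum>l<m. mtr \<tau> (star (E l k * proj N) * (E l k * proj N)))"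
          by (simp add: mtr_sum[OF tr] cpos_star_mult)
      qed
      also have "\<dots> = (\<Sum>k<m. \<Sum>l<m. mtr \<tau> (E l k * proj N * star (E l k)))"
        by (intro sum.cong refl, subst mtr_commute[OF tr]) (simp add: star_mult mult.assoc proj_mult_idem)
      also have "\<dots> = (\<Sum>l<m. \<Sum>k<m. mtr \<tau> (E l k * proj N * star (E l k)))"
        by (rule sum.swap)
      also have "\<dots> = (\<Sum>l<m. mtr \<tau> (\<phi> (V l (\<iota> (star 1 * 1)) l)))"
      proof (intro sum.cong refl)
        fix l assume l: "l \<in> {..<m}"
        have "\<phi> (V l (\<iota> (star 1 * 1)) l) = (\<Sum>k<m. E l k * proj N * E k l)"
          using \<phi>_proj_\<phi>[of l l s N s] l by (simp add: s(3) E_def)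
        also have "\<dots> = (\<Sum>k<m. E l k * proj N * star (E l k))"
          using l by (intro sum.cong refl) (simp add: E_star)
        finally have eq: "\<phi> (V l (\<iota> (star 1 * 1)) l) = (\<Sum>k<m. E l k * proj N * star (E l k))" .
        have "cpos (x * proj N * star x)" for x :: "'a stab"
          using cpos_mult_star[of "x * proj N"] by (simp add: star_mult mult.assoc proj_mult_idem)
        then show "(\<Sum>k<m. mtr \<tau> (E l k * proj N * star (E l k))) = mtr \<tau> (\<phi> (V l (\<iota> (star 1 * 1)) l))"
          unfolding eq by (simp add: mtr_sum[OF tr])
      qed
      also have "\<dots> = ennreal scl" using \<sigma>_star_mult(1)[of 1] by (simp add: scl_def)
      finally show ?thesis .
    qed
    moreover have "Re (mat_trace \<tau> p) \<ge> 0" "Im (mat_trace \<tau> p) = 0"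
    proof -
      have "p $$ (L, L) = ent (D 1 (L div N) (L div N)) (L mod N) (L mod N)" if "L < n" for L
        using that by (simp add: p_def \<theta>e)
      then have "0 \<le> Re (\<tau> (p $$ (L, L)))" "Im (\<tau> (p $$ (L, L))) = 0" if "L < n" for L
        using that by (simp_all add: diag_nonneg[OF tr cD] dv)
      then show "Re (mat_trace \<tau> p) \<ge> 0" "Im (mat_trace \<tau> p) = 0"
        unfolding mat_trace_def by (auto simp: p_def \<theta>_def[of 1] intro!: sum_nonneg sum.neutral)
    qed
    ultimately show ?thesis using scl_pos by (simp add: complex_eq_iff)
  qed
  show ?thesis using n1 p iso trace by blast
qed

end

section \<open>Compact operators and finite matrices\<close>

lemma hnorm_complex: "hnorm I (u :: nat \<Rightarrow> complex) = L2_set (\<lambda>i. cmod (u i)) I"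
proof -
  have "(\<Sum>i\<in>I. star (u i) * u i) = complex_of_real (\<Sum>i\<in>I. (cmod (u i))\<^sup>2)"
    by (simp add: star_complex_def mult.commute[of "cnj _"] flip: complex_norm_square)
  then show ?thesis by (simp only: hnorm_def L2_set_def norm_of_real) (simp add: sum_nonneg)
qed

lemma hnorm_complex_triangle: "hnorm I (\<lambda>i. u i + v i :: complex) \<le> hnorm I u + hnorm I v"
  unfolding hnorm_complex
  by (rule order_trans[OF L2_set_mono L2_set_triangle_ineq]) (auto intro: norm_triangle_ineq)

lemma ell2_finite: "finite I \<Longrightarrow> (\<And>i. i \<notin> I \<Longrightarrow> f i = 0) \<Longrightarrow> f \<in> ell2"
  unfolding ell2_def by (auto intro: summable_finite)

lemma ell2_add:
  assumes "f \<in> ell2" "g \<in> ell2"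
  shows "(\<lambda>i. f i + g i) \<in> ell2"
proof -
  have "summable (\<lambda>i. 2 * (cmod (f i))\<^sup>2 + 2 * (cmod (g i))\<^sup>2)"
    using assms by (intro summable_add summable_mult) (auto simp: ell2_def)
  then have "summable (\<lambda>i. (cmod (f i + g i))\<^sup>2)"
  proof (rule summable_comparison_test[rotated], intro exI allI impI)
    fix i
    have "(cmod (f i + g i))\<^sup>2 \<le> (cmod (f i) + cmod (g i))\<^sup>2"
      by (intro power_mono norm_triangle_ineq norm_ge_zero)
    also have "\<dots> \<le> 2 * (cmod (f i))\<^sup>2 + 2 * (cmod (g i))\<^sup>2"
      using sum_squares_bound[of "cmod (f i)" "cmod (g i)"] by (simp add: power2_sum)
    finally show "norm ((cmod (f i + g i))\<^sup>2) \<le> 2 * (cmod (f i))\<^sup>2 + 2 * (cmod (g i))\<^sup>2" by simp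
  qed
  then show ?thesis by (simp add: ell2_def)
qed

lemma ell2_diff: "f \<in> ell2 \<Longrightarrow> g \<in> ell2 \<Longrightarrow> (\<lambda>i. f i - g i) \<in> ell2"
  using ell2_add[of f "\<lambda>i. - g i"] by (simp add: ell2_def)

lemma hnorm_le_ell2_norm: "f \<in> ell2 \<Longrightarrow> finite I \<Longrightarrow> hnorm I f \<le> ell2_norm f"
  unfolding hnorm_complex L2_set_def ell2_norm_def ell2_def
  by (intro real_sqrt_le_mono sum_le_suminf) auto

lemma ell2_tail:
  assumes "f \<in> ell2" "\<epsilon> > 0"
  obtains n where "\<And>m K. m \<ge> n \<Longrightarrow> hnorm {m..<K} f \<le> \<epsilon>"
proof -
  have "\<epsilon>\<^sup>2 > 0" using assms by simp
  with assms(1) obtain n where n: "\<forall>m\<ge>n. \<forall>K. norm (\<Sum>i = m..<K. (cmod (f i))\<^sup>2) < \<epsilon>\<^sup>2"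
    unfolding ell2_def summable_Cauchy by blast
  show ?thesis
  proof (rule that[of n])
    fix m K assume "m \<ge> n"
    then have "(\<Sum>i = m..<K. (cmod (f i))\<^sup>2) \<le> \<epsilon>\<^sup>2" using n by (auto simp: less_imp_le abs_less_iff)
    then show "hnorm {m..<K} f \<le> \<epsilon>"
      unfolding hnorm_complex L2_set_def using assms(2) by (intro real_le_lsqrt) (auto intro: sum_nonneg)
  qed
qed

lemma bdd_mat_of_hnorm:
  assumes "\<And>N u. hnorm {..<N} (\<lambda>i. \<Sum>j<N. z i j * u j) \<le> M * hnorm {..<N} (u :: nat \<Rightarrow> 'a::unital_cstar_algebra)"
  shows "bdd_mat z M"
  unfolding bdd_mat_def
proof (intro allI)
  fix n :: nat and u v :: "nat \<Rightarrow> 'a"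
  have "(\<Sum>i<n. \<Sum>j<n. star (v i) * z i j * u j) = (\<Sum>i<n. star (v i) * (\<Sum>j<n. z i j * u j))"
    by (simp add: sum_distrib_left mult.assoc)
  then have "norm (\<Sum>i<n. \<Sum>j<n. star (v i) * z i j * u j) \<le> hnorm {..<n} v * hnorm {..<n} (\<lambda>i. \<Sum>j<n. z i j * u j)"
    using hnorm_Cauchy_Schwarz[of "{..<n}" v "\<lambda>i. \<Sum>j<n. z i j * u j"] by simp
  also have "\<dots> \<le> hnorm {..<n} v * (M * hnorm {..<n} u)" by (intro mult_left_mono assms hnorm_nonneg)
  finally show "norm (\<Sum>i<n. \<Sum>j<n. star (v i) * z i j * u j) \<le> M * hnorm {..<n} v * hnorm {..<n} u"
    by (simp add: mult_ac)
qed

context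
  fixes T :: "(nat \<Rightarrow> complex) \<Rightarrow> nat \<Rightarrow> complex"
  assumes T: "compact_operator T"
begin

definition opmat :: "nat \<Rightarrow> nat \<Rightarrow> complex" where "opmat i j = T (ell2_basis j) i"

lemma compact_operatorD:
  "f \<in> ell2 \<Longrightarrow> T f \<in> ell2"
  "f \<in> ell2 \<Longrightarrow> g \<in> ell2 \<Longrightarrow> T (\<lambda>i. f i + g i) = (\<lambda>i. T f i + T g i)"
  "f \<in> ell2 \<Longrightarrow> T (\<lambda>i. c * f i) = (\<lambda>i. c * T f i)"
  using T by (simp_all add: compact_operator_def)

lemma ell2_basis_in: "ell2_basis j \<in> ell2"
  by (rule ell2_finite[of "{j}"]) (auto simp: ell2_basis_def)

lemma opmat_vec:
  "(\<lambda>i. \<Sum>j<N. u j * ell2_basis j i) \<in> ell2"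
  "T (\<lambda>i. \<Sum>j<N. u j * ell2_basis j i) = (\<lambda>i. \<Sum>j<N. opmat i j * u j)"
proof -
  show in2: "(\<lambda>i. \<Sum>j<N. u j * ell2_basis j i) \<in> ell2" for N
    by (rule ell2_finite[of "{..<N}"]) (auto simp: ell2_basis_def)
  show "T (\<lambda>i. \<Sum>j<N. u j * ell2_basis j i) = (\<lambda>i. \<Sum>j<N. opmat i j * u j)"
  proof (induction N)
    case 0
    show ?case using compact_operatorD(3)[OF ell2_basis_in[of 0], of 0] by simp
  next
    case (Suc N)
    have s: "(\<lambda>i. c * ell2_basis N i) \<in> ell2" for c
      by (rule ell2_finite[of "{N}"]) (auto simp: ell2_basis_def)
    show ?case
      using compact_operatorD(2)[OF in2[of N] s[of "u N"]] Suc compact_operatorD(3)[OF ell2_basis_in[of N], of "u N"]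
      by (simp add: opmat_def mult.commute)
  qed
qed

text \<open>Compactness of the operator, for finitely supported vectors and in terms of its matrix.\<close>

lemma opmat_compact:
  assumes "\<And>n. hnorm {..<N n} (u n) \<le> 1"
  shows "\<exists>g\<in>ell2. \<exists>r::nat \<Rightarrow> nat. strict_mono r \<and>
    (\<forall>\<epsilon>>0. \<exists>n0. \<forall>n\<ge>n0. \<forall>I. finite I \<longrightarrow> hnorm I (\<lambda>i. (\<Sum>j<N (r n). opmat i j * u (r n) j) - g i) \<le> \<epsilon>)"
proof -
  define F where "F n = (\<lambda>i. \<Sum>j<N n. u n j * ell2_basis j i)" for n
  have F: "F n \<in> ell2" "T (F n) = (\<lambda>i. \<Sum>j<N n. opmat i j * u n j)" for n
    unfolding F_def by (rule opmat_vec)+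
  have Fi: "F n i = (if i < N n then u n i else 0)" for n i
  proof -
    have "F n i = (\<Sum>j<N n. if j = i then u n j else 0)"
      unfolding F_def by (intro sum.cong refl) (auto simp: ell2_basis_def)
    then show ?thesis by (simp add: sum.delta)
  qed
  have "ell2_norm (F n) \<le> 1" for n
  proof -
    have "(\<Sum>i. (cmod (F n i))\<^sup>2) = (\<Sum>i<N n. (cmod (F n i))\<^sup>2)"
      by (rule suminf_finite) (auto simp: Fi)
    then have "ell2_norm (F n) = hnorm {..<N n} (u n)"
      unfolding ell2_norm_def hnorm_complex L2_set_def by (simp add: Fi)
    then show ?thesis using assms by simp
  qed
  then obtain g and r :: "nat \<Rightarrow> nat" where g: "g \<in> ell2" and r: "strict_mono r" and lim: "(\<lambda>n. ell2_norm (\<lambda>i. T (F (r n)) i - g i)) \<longlonglongrightarrow> 0"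
    using T F(1) unfolding compact_operator_def by meson
  have "\<exists>n0. \<forall>n\<ge>n0. \<forall>I. finite I \<longrightarrow> hnorm I (\<lambda>i. (\<Sum>j<N (r n). opmat i j * u (r n) j) - g i) \<le> \<epsilon>" if "\<epsilon> > 0" for \<epsilon>
  proof -
    obtain n0 where n0: "\<forall>n\<ge>n0. norm (ell2_norm (\<lambda>i. T (F (r n)) i - g i) - 0) < \<epsilon>"
      using LIMSEQ_D[OF lim \<open>\<epsilon> > 0\<close>] by blast
    have "hnorm I (\<lambda>i. (\<Sum>j<N (r n). opmat i j * u (r n) j) - g i) \<le> \<epsilon>" if n: "n \<ge> n0" "finite I" for n I
    proof -
      have "hnorm I (\<lambda>i. T (F (r n)) i - g i) \<le> ell2_norm (\<lambda>i. T (F (r n)) i - g i)"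
        by (intro hnorm_le_ell2_norm ell2_diff compact_operatorD(1) F g n)
      also have "\<dots> \<le> \<epsilon>" using n0 n(1) by (auto simp: abs_less_iff less_imp_le)
      finally show ?thesis by (simp add: F)
    qed
    then show ?thesis by blast
  qed
  then show ?thesis using g r by blast
qed

lemma normalize_vec:
  assumes "hnorm I (\<lambda>i. \<Sum>j<N. opmat i j * u j) > M * hnorm {..<N} u" "0 \<le> M" "finite I"
  shows "\<exists>u'. hnorm {..<N} u' \<le> 1 \<and> hnorm I (\<lambda>i. \<Sum>j<N. opmat i j * u' j) > M"
proof -
  define h where "h = hnorm {..<N} u"
  have "h \<noteq> 0"
  proof
    assume h: "h = 0"
    then have "(\<Sum>j<N. opmat i j * u j) = 0" for i
      using hnorm_eq_0[of "{..<N}" u] by (simp add: h_def)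
    then show False using assms(1) h by (simp add: h_def hnorm_def)
  qed
  then have h: "h > 0" using hnorm_nonneg[of "{..<N}" u] by (simp add: h_def less_eq_real_def)
  have u1: "hnorm {..<N} (\<lambda>j. (1 / h) *\<^sub>R u j) \<le> 1" using h by (simp add: hnorm_scaleR h_def)
  have "(\<lambda>i. \<Sum>j<N. opmat i j * ((1 / h) *\<^sub>R u j)) = (\<lambda>i. (1 / h) *\<^sub>R (\<Sum>j<N. opmat i j * u j))"
    by (simp add: scaleR_sum_right)
  then have "hnorm I (\<lambda>i. \<Sum>j<N. opmat i j * ((1 / h) *\<^sub>R u j)) = (1 / h) * hnorm I (\<lambda>i. \<Sum>j<N. opmat i j * u j)"
    using h by (simp only: hnorm_scaleR zero_le_divide_1_iff less_imp_le)
  moreover have "(1 / h) * hnorm I (\<lambda>i. \<Sum>j<N. opmat i j * u j) > M"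
    using assms(1) h unfolding h_def[symmetric] by (simp add: pos_less_divide_eq)
  ultimately have "hnorm I (\<lambda>i. \<Sum>j<N. opmat i j * ((1 / h) *\<^sub>R u j)) > M" by (simp only:)
  with u1 show ?thesis by blast
qed

text \<open>Otherwise there are vectors \<open>u\<^sub>n\<close> in the unit ball whose images have a component of norm beyond \<open>\<epsilon>\<close> on the
  coordinates from \<open>n\<close> on. Such images have no convergent subsequence, since the tails of a limit in
  \<open>\<ell>\<^sup>2\<close> tend to zero.\<close>

lemma opmat_row_tail:
  assumes e: "\<epsilon> > 0"
  shows "\<exists>n. \<forall>N u K. hnorm {n..<K} (\<lambda>i. \<Sum>j<N. opmat i j * u j) \<le> \<epsilon> * hnorm {..<N} u"
proof (rule ccontr)
  assume "\<not> ?thesis"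
  then have "\<forall>n. \<exists>N u K. hnorm {n..<K} (\<lambda>i. \<Sum>j<N. opmat i j * u j) > \<epsilon> * hnorm {..<N} u"
    by (simp add: not_le)
  then have "\<forall>n. \<exists>N u K. hnorm {..<N} u \<le> 1 \<and> hnorm {n..<K} (\<lambda>i. \<Sum>j<N. opmat i j * u j) > \<epsilon>"
    using normalize_vec e by (meson finite_atLeastLessThan less_imp_le)
  then obtain N u K where u: "\<And>n. hnorm {..<N n} (u n) \<le> 1"
      "\<And>n. hnorm {n..<K n} (\<lambda>i. \<Sum>j<N n. opmat i j * u n j) > \<epsilon>"
    unfolding choice_iff by blast
  obtain g and r :: "nat \<Rightarrow> nat" where g: "g \<in> ell2" and r: "strict_mono r"
    and lim: "\<forall>\<epsilon>>0. \<exists>n0. \<forall>n\<ge>n0. \<forall>I. finite I \<longrightarrow> hnorm I (\<lambda>i. (\<Sum>j<N (r n). opmat i j * u (r n) j) - g i) \<le> \<epsilon>"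
    using opmat_compact[of N u, OF u(1)] by blast
  have e2: "\<epsilon> / 2 > 0" using e by simp
  obtain n0 where n0: "\<forall>n\<ge>n0. \<forall>I. finite I \<longrightarrow> hnorm I (\<lambda>i. (\<Sum>j<N (r n). opmat i j * u (r n) j) - g i) \<le> \<epsilon> / 2"
    by (rule exE[OF lim[THEN spec, THEN mp, OF e2]])
  obtain n1 where n1: "\<And>m K. m \<ge> n1 \<Longrightarrow> hnorm {m..<K} g \<le> \<epsilon> / 2" using ell2_tail[OF g e2] by blast
  define n where "n = max n0 n1"
  define w where "w i = (\<Sum>j<N (r n). opmat i j * u (r n) j)" for i
  have "r n \<ge> n1" using seq_suble[OF r, of n] by (simp add: n_def)
  have "hnorm {r n..<K (r n)} (\<lambda>i. (w i - g i) + g i) \<le> hnorm {r n..<K (r n)} (\<lambda>i. w i - g i) + hnorm {r n..<K (r n)} g"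
    by (rule hnorm_complex_triangle)
  also have "\<dots> \<le> \<epsilon> / 2 + \<epsilon> / 2"
    using n0 n1[OF \<open>r n \<ge> n1\<close>] by (intro add_mono) (auto simp: w_def n_def)
  finally show False using u(2)[of "r n"] by (simp add: w_def)
qed

text \<open>A compact operator is bounded: images of vectors in the unit ball that tend to infinity in one coordinate have
  no convergent subsequence.\<close>

lemma opmat_row_bounded: "\<exists>M\<ge>0. \<forall>N u. cmod (\<Sum>j<N. opmat i j * u j) \<le> M * hnorm {..<N} u"
proof (rule ccontr)
  assume neg: "\<not> ?thesis"
  have e1: "(1::real) > 0" by simp
  have single: "hnorm {i} w = cmod (w i)" for w :: "nat \<Rightarrow> complex"
    by (simp add: hnorm_complex)
  have "\<forall>n. \<exists>N u. hnorm {..<N} u \<le> 1 \<and> cmod (\<Sum>j<N. opmat i j * u j) > real n"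
  proof
    fix n :: nat
    obtain N u where "cmod (\<Sum>j<N. opmat i j * u j) > real n * hnorm {..<N} u"
      using neg by (meson not_le of_nat_0_le_iff)
    then show "\<exists>N u. hnorm {..<N} u \<le> 1 \<and> cmod (\<Sum>j<N. opmat i j * u j) > real n"
      using normalize_vec[of "real n" N u "{i}"] unfolding single by auto
  qed
  then obtain N u where u: "\<And>n. hnorm {..<N n} (u n) \<le> 1" "\<And>n. cmod (\<Sum>j<N n. opmat i j * u n j) > real n"
    unfolding choice_iff by blast
  obtain g and r :: "nat \<Rightarrow> nat" where g: "g \<in> ell2" and r: "strict_mono r"
    and lim: "\<forall>\<epsilon>>0. \<exists>n0. \<forall>n\<ge>n0. \<forall>I. finite I \<longrightarrow> hnorm I (\<lambda>i. (\<Sum>j<N (r n). opmat i j * u (r n) j) - g i) \<le> \<epsilon>"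
    using opmat_compact[of N u, OF u(1)] by blast
  obtain n0 where n0: "\<forall>n\<ge>n0. \<forall>I. finite I \<longrightarrow> hnorm I (\<lambda>i. (\<Sum>j<N (r n). opmat i j * u (r n) j) - g i) \<le> 1"
    by (rule exE[OF lim[THEN spec, THEN mp, OF e1]])
  obtain n1 where n1: "real n1 \<ge> 1 + cmod (g i)" using real_arch_simple by blast
  define n where "n = max n0 n1"
  have "hnorm {i} (\<lambda>i. (\<Sum>j<N (r n). opmat i j * u (r n) j) - g i) \<le> 1" using n0 by (simp add: n_def)
  then have "cmod ((\<Sum>j<N (r n). opmat i j * u (r n) j) - g i) \<le> 1" unfolding single .
  then have "cmod (\<Sum>j<N (r n). opmat i j * u (r n) j) \<le> 1 + cmod (g i)"
    using norm_triangle_sub[of "\<Sum>j<N (r n). opmat i j * u (r n) j" "g i"] by simp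
  also have "\<dots> \<le> real n1" by (rule n1)
  also have "\<dots> \<le> real (r n)" using seq_suble[OF r, of n] by (simp add: n_def)
  finally show False using u(2)[of "r n"] by simp
qed

lemma opmat_row_ell2: "opmat i \<in> ell2"
proof -
  obtain M where M: "M \<ge> 0" "\<And>N u. cmod (\<Sum>j<N. opmat i j * u j) \<le> M * hnorm {..<N} u"
    using opmat_row_bounded by blast
  have "(\<Sum>j<N. (cmod (opmat i j))\<^sup>2) \<le> M\<^sup>2" for N
  proof -
    define h where "h = hnorm {..<N} (\<lambda>j. cnj (opmat i j))"
    have h2: "h\<^sup>2 = (\<Sum>j<N. (cmod (opmat i j))\<^sup>2)"
      by (simp add: h_def hnorm_complex L2_set_def sum_nonneg)
    have "(\<Sum>j<N. opmat i j * cnj (opmat i j)) = complex_of_real (h\<^sup>2)"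
      unfolding h2 by (simp flip: complex_norm_square)
    then have "h\<^sup>2 \<le> M * h" using M(2)[of "\<lambda>j. cnj (opmat i j)" N] by (simp add: h_def norm_power)
    then have "h \<le> M" using M(1) hnorm_nonneg[of "{..<N}" "\<lambda>j. cnj (opmat i j)"]
      by (cases "h = 0") (auto simp: h_def power2_eq_square mult_le_cancel_right)
    then show ?thesis unfolding h2[symmetric] by (intro power_mono) (simp_all add: h_def)
  qed
  then have "summable (\<lambda>j. (cmod (opmat i j))\<^sup>2)" by (intro summableI_nonneg_bounded) auto
  then show ?thesis by (simp add: ell2_def)
qed

text \<open>A compact operator is approximated in norm by the finite sections of its matrix: the image of
  the unit ball is almost contained in the first \<open>n\<close> coordinates, and these are given by finitely
  many square-summable rows.\<close>

lemma opmat_approx: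
  assumes e: "\<epsilon> > 0"
  shows "\<exists>n q. bdd_mat (\<lambda>i j. opmat i j - (if i < n \<and> j < q then opmat i j else 0)) \<epsilon>"
proof -
  have e2: "\<epsilon> / 2 > 0" using e by simp
  obtain n where n: "\<And>N u K. hnorm {n..<K} (\<lambda>i. \<Sum>j<N. opmat i j * u j) \<le> \<epsilon> / 2 * hnorm {..<N} u"
    using opmat_row_tail[OF e2] by blast
  define d where "d = \<epsilon> / 2 / (real n + 1)"
  have d: "d > 0" using e by (simp add: d_def)
  have "\<exists>q. \<forall>m K. m \<ge> q \<longrightarrow> hnorm {m..<K} (opmat i) \<le> d" for i
    using ell2_tail[OF opmat_row_ell2 d] by metis
  then obtain qq where qq: "\<And>i m K. m \<ge> qq i \<Longrightarrow> hnorm {m..<K} (opmat i) \<le> d" by metis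
  define q where "q = Max (insert 0 (qq ` {..<n}))"
  have q: "hnorm {q..<K} (opmat i) \<le> d" if "i < n" for i K
    by (rule qq) (simp add: q_def that)
  have 1: "bdd_mat (\<lambda>i j. if i \<ge> n then opmat i j else 0) (\<epsilon> / 2)"
  proof (rule bdd_mat_of_hnorm)
    fix N and u :: "nat \<Rightarrow> complex"
    have "hnorm {..<N} (\<lambda>i. \<Sum>j<N. (if i \<ge> n then opmat i j else 0) * u j)
        = hnorm {..<N} (\<lambda>i. if i \<in> {n..<N} then (\<Sum>j<N. opmat i j * u j) else 0)"
      by (rule hnorm_cong) auto
    also have "\<dots> = hnorm {n..<N} (\<lambda>i. \<Sum>j<N. opmat i j * u j)"
      by (rule hnorm_restrict) auto
    also have "\<dots> \<le> \<epsilon> / 2 * hnorm {..<N} u" by (rule n)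
    finally show "hnorm {..<N} (\<lambda>i. \<Sum>j<N. (if i \<ge> n then opmat i j else 0) * u j) \<le> \<epsilon> / 2 * hnorm {..<N} u" .
  qed
  have 2: "bdd_mat (\<lambda>i j. if i < n \<and> j \<ge> q then opmat i j else 0) (\<epsilon> / 2)"
  proof (rule bdd_mat_of_hnorm)
    fix N and u :: "nat \<Rightarrow> complex"
    define w where "w i = (\<Sum>j<N. (if i < n \<and> j \<ge> q then opmat i j else 0) * u j)" for i
    have w0: "w i = 0" if "i \<ge> n" for i using that by (simp add: w_def)
    have wd: "cmod (w i) \<le> d * hnorm {..<N} u" if "i < n" for i
    proof -
      have "w i = (\<Sum>j\<in>{q..<N}. star (cnj (opmat i j)) * u j)"
        unfolding w_def using that by (intro sum.mono_neutral_cong_right) (auto simp: star_complex_def)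
      then have "cmod (w i) \<le> hnorm {q..<N} (\<lambda>j. cnj (opmat i j)) * hnorm {q..<N} u"
        using hnorm_Cauchy_Schwarz[of "{q..<N}" "\<lambda>j. cnj (opmat i j)" u] by simp
      also have "hnorm {q..<N} (\<lambda>j. cnj (opmat i j)) = hnorm {q..<N} (opmat i)" by (simp add: hnorm_complex)
      also have "\<dots> * hnorm {q..<N} u \<le> d * hnorm {..<N} u"
        using d by (intro mult_mono q that hnorm_mono) auto
      finally show ?thesis .
    qed
    have "hnorm {..<N} w \<le> (\<Sum>i<N. cmod (w i))" unfolding hnorm_complex by (rule L2_set_le_sum) simp
    also have "\<dots> \<le> (\<Sum>i<n. cmod (w i))"
    proof -
      have "(\<Sum>i<N. cmod (w i)) = (\<Sum>i\<in>{..<N} \<inter> {..<n}. cmod (w i))"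
      proof (rule sum.mono_neutral_right)
        show "\<forall>i\<in>{..<N} - {..<N} \<inter> {..<n}. cmod (w i) = 0"
        proof
          fix i assume "i \<in> {..<N} - {..<N} \<inter> {..<n}"
          then have "i \<ge> n" by auto
          then show "cmod (w i) = 0" by (simp add: w0)
        qed
      qed auto
      also have "\<dots> \<le> (\<Sum>i<n. cmod (w i))" by (rule sum_mono2) auto
      finally show ?thesis .
    qed
    also have "\<dots> \<le> real n * (d * hnorm {..<N} u)"
      using sum_mono[of "{..<n}" "\<lambda>i. cmod (w i)" "\<lambda>_. d * hnorm {..<N} u"] wd by simp
    also have "\<dots> \<le> \<epsilon> / 2 * hnorm {..<N} u"
    proof -
      have "(real n + 1) * d = \<epsilon> / 2"
        unfolding d_def by (subst times_divide_eq_right) (rule nonzero_mult_div_cancel_left, linarith)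
      then have "real n * d \<le> \<epsilon> / 2" using d by (simp add: distrib_right)
      from mult_right_mono[OF this hnorm_nonneg] show ?thesis by (simp add: mult.assoc)
    qed
    finally show "hnorm {..<N} (\<lambda>i. \<Sum>j<N. (if i < n \<and> j \<ge> q then opmat i j else 0) * u j) \<le> \<epsilon> / 2 * hnorm {..<N} u"
      unfolding w_def[abs_def] .
  qed
  have "(\<lambda>i j. opmat i j - (if i < n \<and> j < q then opmat i j else 0))
      = (\<lambda>i j. (if i \<ge> n then opmat i j else 0) + (if i < n \<and> j \<ge> q then opmat i j else 0))"
    by (intro ext) auto
  then have "bdd_mat (\<lambda>i j. opmat i j - (if i < n \<and> j < q then opmat i j else 0)) (\<epsilon> / 2 + \<epsilon> / 2)"
    using bdd_mat_add[OF 1 2] by (simp only:)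
  then show ?thesis by (intro exI[of _ n] exI[of _ q]) simp
qed

end

text \<open>A scalar matrix \<open>z\<close> of norm at most \<open>M\<close> acts on \<open>A\<close>-valued vectors with the same bound: the
  positive matrix \<open>M\<^sup>2 - z\<^sup>*z\<close> is \<open>c\<^sup>*c\<close> for a scalar matrix \<open>c\<close>, and this factorization makes sense
  over \<open>A\<close>. It suffices to treat finite sections.\<close>

lemma bdd_mat_scalar_hnorm:
  fixes z :: "nat \<Rightarrow> nat \<Rightarrow> complex" and u :: "nat \<Rightarrow> 'a::unital_cstar_algebra"
  assumes z: "bdd_mat z M"
  shows "hnorm {..<n} (\<lambda>i. \<Sum>j<n. z i j *\<^sub>C u j) \<le> M * hnorm {..<n} u"
proof -
  have M0: "0 \<le> M" by (rule bdd_mat_nonneg[OF z])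
  define y where "y i j = (if i < n \<and> j < n then z i j else 0)" for i j
  have fy: "fin_mat y" by (rule fin_matI[of n]) (auto simp: y_def)
  have yb: "bdd_mat y M"
    unfolding bdd_mat_def
  proof (intro allI)
    fix N and p v :: "nat \<Rightarrow> complex"
    let ?I = "{..<N} \<inter> {..<n}"
    have "(\<Sum>i<N. \<Sum>j<N. star (v i) * y i j * p j) = (\<Sum>i\<in>?I. \<Sum>j<N. star (v i) * y i j * p j)"
      by (rule sum.mono_neutral_right) (auto simp: y_def)
    also have "\<dots> = (\<Sum>i\<in>?I. \<Sum>j\<in>?I. star (v i) * z i j * p j)"
      by (intro sum.cong refl sum.mono_neutral_cong_right) (auto simp: y_def)
    also have "norm \<dots> \<le> M * hnorm ?I v * hnorm ?I p" by (rule bdd_matD[OF z]) auto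
    also have "\<dots> \<le> M * hnorm {..<N} v * hnorm {..<N} p"
      using M0 by (intro mult_mono mult_left_mono hnorm_mono mult_nonneg_nonneg) auto
    finally show "norm (\<Sum>i<N. \<Sum>j<N. star (v i) * y i j * p j) \<le> M * hnorm {..<N} v * hnorm {..<N} p" .
  qed
  define Y where "Y = Abs_stab y"
  have eY: "ent Y = y" unfolding Y_def by (rule ent_Abs_fin[OF fy])
  have nY: "norm Y \<le> M" using M0 by (simp add: norm_stab_le_iff eY yb)
  have "norm (star Y * Y) \<le> M\<^sup>2" using nY by (simp add: cstar_identity power_mono)
  then have "cpos (of_real (M\<^sup>2) - star Y * Y)"
  proof -
    have "of_real (M\<^sup>2) - star Y * Y = of_real (M\<^sup>2 - norm (star Y * Y)) + (of_real (norm (star Y * Y)) - star Y * Y)"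
      by simp
    moreover have "cpos (of_real (M\<^sup>2 - norm (star Y * Y)) + (of_real (norm (star Y * Y)) - star Y * Y) :: complex stab)"
      using \<open>norm (star Y * Y) \<le> M\<^sup>2\<close>
      by (intro cpos_add cpos_of_real cpos_norm_minus) (simp_all add: star_mult star_star)
    ultimately show ?thesis by (simp only:)
  qed
  then obtain C where C: "star C * C = of_real (M\<^sup>2) - star Y * Y" by (rule cpos_eq_star_mult)
  define w where "w i = (\<Sum>j<n. z i j *\<^sub>C u j)" for i
  define U where "U = (\<Sum>j<n. star (u j) * u j)"
  define S where "S X = (\<Sum>i<n. \<Sum>j<n. ent X i j *\<^sub>C (star (u i) * u j))" for X :: "complex stab"
  have S_sums: "(\<lambda>k. star (\<Sum>i<n. ent X k i *\<^sub>C u i) * (\<Sum>j<n. ent X k j *\<^sub>C u j)) sums S (star X * X)" for X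
  proof -
    have bl: "bounded_linear (\<lambda>c. c *\<^sub>C (star (u i) * u j))" for i j
      by (rule bounded_linear_intro[of _ "norm (star (u i) * u j)"])
        (simp_all add: scaleC_add_left norm_scaleC scaleR_conv_of_real scaleC_of_real flip: scaleC_scaleC)
    have "(\<lambda>k. \<Sum>i<n. \<Sum>j<n. (ent (star X) i k * ent X k j) *\<^sub>C (star (u i) * u j)) sums S (star X * X)"
      unfolding S_def by (intro sums_sum bounded_linear.sums[OF bl] ent_mult_sums)
    moreover have "(\<Sum>i<n. \<Sum>j<n. (ent (star X) i k * ent X k j) *\<^sub>C (star (u i) * u j))
        = star (\<Sum>i<n. ent X k i *\<^sub>C u i) * (\<Sum>j<n. ent X k j *\<^sub>C u j)" for k
      by (simp add: ent_star star_complex_def star_sum star_scaleC sum_product mult_scaleC_left mult_scaleC_right scaleC_scaleC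
          mult.commute[of "cnj _"])
    ultimately show ?thesis by simp
  qed
  have "cpos (S (star C * C))"
    using S_sums[of C] unfolding sums_def by (rule cpos_lim) (intro cpos_sum cpos_star_mult)
  moreover have "S (star C * C) = M\<^sup>2 *\<^sub>R U - S (star Y * Y)"
  proof -
    have e: "ent (of_real (M\<^sup>2)) i j = (if i = j then complex_of_real (M\<^sup>2) else 0)" for i j
      by (simp add: of_real_def ent_scaleR ent_one)
    have "S (of_real (M\<^sup>2)) = (\<Sum>i<n. \<Sum>j<n. if i = j then M\<^sup>2 *\<^sub>R (star (u i) * u j) else 0)"
      unfolding S_def e by (intro sum.cong refl) (auto simp: scaleC_of_real simp del: of_real_power)
    also have "\<dots> = M\<^sup>2 *\<^sub>R U" by (simp add: U_def scaleR_sum_right sum.delta')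
    finally show ?thesis
      unfolding C by (simp add: S_def ent_simps sum_subtractf scaleC_diff_left)
  qed
  moreover have "S (star Y * Y) = (\<Sum>k<n. star (w k) * w k)"
  proof -
    have "S (star Y * Y) = (\<Sum>k. star (\<Sum>i<n. y k i *\<^sub>C u i) * (\<Sum>j<n. y k j *\<^sub>C u j))"
      using S_sums[of Y] by (simp add: sums_iff eY)
    also have "\<dots> = (\<Sum>k<n. star (\<Sum>i<n. y k i *\<^sub>C u i) * (\<Sum>j<n. y k j *\<^sub>C u j))"
      by (rule suminf_finite) (auto simp: y_def)
    also have "\<dots> = (\<Sum>k<n. star (w k) * w k)" unfolding w_def by (intro sum.cong refl) (simp add: y_def)
    finally show ?thesis .
  qed
  ultimately have "cpos (M\<^sup>2 *\<^sub>R U - (\<Sum>k<n. star (w k) * w k))" by simp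
  then have "norm (\<Sum>k<n. star (w k) * w k) \<le> norm (M\<^sup>2 *\<^sub>R U)" by (intro cpos_norm_mono cpos_hsum)
  then have "(hnorm {..<n} w)\<^sup>2 \<le> (M * hnorm {..<n} u)\<^sup>2"
    by (simp add: hnorm_power2 U_def power_mult_distrib)
  then show ?thesis unfolding w_def[abs_def] by (rule power2_le_imp_le) (simp add: M0)
qed

lemma hnorm_mult_left: "hnorm I (\<lambda>i. a * u i) \<le> norm a * hnorm I u"
proof -
  have "norm (\<Sum>i\<in>I. star (a * u i) * (a * u i)) \<le> norm ((norm a)\<^sup>2 *\<^sub>R (\<Sum>i\<in>I. star (u i) * u i))"
  proof (intro cpos_norm_mono cpos_hsum)
    have "(norm a)\<^sup>2 *\<^sub>R (\<Sum>i\<in>I. star (u i) * u i) - (\<Sum>i\<in>I. star (a * u i) * (a * u i))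
        = (\<Sum>i\<in>I. star (u i) * (of_real (norm (star a * a)) - star a * a) * u i)"
      by (simp add: cstar_identity scaleR_sum_right of_real_def star_mult algebra_simps sum_subtractf)
    moreover have "cpos (\<Sum>i\<in>I. star (u i) * (of_real (norm (star a * a)) - star a * a) * u i)"
      by (intro cpos_sum cpos_conj cpos_norm_minus) (simp add: star_mult star_star)
    ultimately show "cpos ((norm a)\<^sup>2 *\<^sub>R (\<Sum>i\<in>I. star (u i) * u i) - (\<Sum>i\<in>I. star (a * u i) * (a * u i)))"
      by (simp only:)
  qed
  then have "(hnorm I (\<lambda>i. a * u i))\<^sup>2 \<le> (norm a * hnorm I u)\<^sup>2"
    by (simp add: hnorm_power2 power_mult_distrib)
  then show ?thesis by (rule power2_le_imp_le) simp
qed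

lemma bdd_mat_tensor:
  fixes z :: "nat \<Rightarrow> nat \<Rightarrow> complex" and a :: "'a::unital_cstar_algebra"
  assumes z: "bdd_mat z M"
  shows "bdd_mat (\<lambda>i j. z i j *\<^sub>C a) (M * norm a)"
proof (rule bdd_mat_of_hnorm)
  fix N and u :: "nat \<Rightarrow> 'a"
  have "hnorm {..<N} (\<lambda>i. \<Sum>j<N. (z i j *\<^sub>C a) * u j) = hnorm {..<N} (\<lambda>i. \<Sum>j<N. z i j *\<^sub>C (a * u j))"
    by (simp add: mult_scaleC_left)
  also have "\<dots> \<le> M * hnorm {..<N} (\<lambda>j. a * u j)" by (rule bdd_mat_scalar_hnorm[OF z])
  also have "\<dots> \<le> M * (norm a * hnorm {..<N} u)"
    using bdd_mat_nonneg[OF z] by (intro mult_left_mono hnorm_mult_left)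
  finally show "hnorm {..<N} (\<lambda>i. \<Sum>j<N. (z i j *\<^sub>C a) * u j) \<le> M * norm a * hnorm {..<N} u"
    by (simp add: mult.assoc)
qed

text \<open>This is the point where compactness of the operators enters: their matrices are norm limits of
  finite ones, and tensoring with \<open>a\<close> multiplies norms by at most \<open>\<parallel>a\<parallel>\<close>.\<close>

lemma elem_tensor_closure:
  fixes a :: "'a::unital_cstar_algebra"
  assumes "compact_operator T"
  shows "elem_tensor a T \<in> imat_closure (Collect fin_mat)"
  unfolding imat_closure_iff
proof (intro allI impI)
  fix \<epsilon> :: real assume e: "\<epsilon> > 0"
  define d where "d = \<epsilon> / (norm a + 1)"
  have a1: "norm a + 1 > 0" using norm_ge_zero[of a] by linarith
  then have d: "d > 0" using e by (simp add: d_def)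
  obtain n q where nq: "bdd_mat (\<lambda>i j. opmat T i j - (if i < n \<and> j < q then opmat T i j else 0)) d"
    using opmat_approx[OF assms d] by blast
  define f where "f i j = (if i < n \<and> j < q then opmat T i j else 0) *\<^sub>C a" for i j
  have "d * (norm a + 1) = \<epsilon>" using a1 by (simp add: d_def)
  then have "d * norm a \<le> \<epsilon>" using d by (simp add: distrib_left)
  from bdd_mat_mono[OF bdd_mat_tensor[OF nq, of a] this]
  have "bdd_mat (\<lambda>i j. (opmat T i j - (if i < n \<and> j < q then opmat T i j else 0)) *\<^sub>C a) \<epsilon>" .
  moreover have "(opmat T i j - (if i < n \<and> j < q then opmat T i j else 0)) *\<^sub>C a = elem_tensor a T i j - f i j" for i j
    by (simp add: elem_tensor_def f_def opmat_def[OF assms])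
  ultimately have "bdd_mat (\<lambda>i j. elem_tensor a T i j - f i j) \<epsilon>" by simp
  moreover have "fin_mat f" by (rule fin_matI[of "max n q"]) (auto simp: f_def)
  ultimately show "\<exists>y\<in>Collect fin_mat. bdd_mat (\<lambda>i j. elem_tensor a T i j - y i j) \<epsilon>" by blast
qed

definition matrix_unit_op :: "nat \<Rightarrow> nat \<Rightarrow> (nat \<Rightarrow> complex) \<Rightarrow> nat \<Rightarrow> complex" where
  "matrix_unit_op p q f = (\<lambda>i. if i = p then f q else 0)"

lemma compact_matrix_unit_op: "compact_operator (matrix_unit_op p q)"
  unfolding compact_operator_def
proof (intro conjI allI ballI impI)
  fix f :: "nat \<Rightarrow> complex"
  show "matrix_unit_op p q f \<in> ell2" by (rule ell2_finite[of "{p}"]) (auto simp: matrix_unit_op_def)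
next
  fix F :: "nat \<Rightarrow> nat \<Rightarrow> complex" assume F: "\<forall>n. F n \<in> ell2 \<and> ell2_norm (F n) \<le> 1"
  have "cmod (F n q) \<le> 1" for n
    using hnorm_le_ell2_norm[of "F n" "{q}"] F by (simp add: hnorm_complex) (meson order_trans)
  then have "\<forall>n. F n q \<in> cball 0 1" by simp
  then obtain c r where r: "strict_mono r" "((\<lambda>n. F n q) \<circ> r) \<longlonglongrightarrow> c"
    using compact_cball[of "0::complex" 1] unfolding compact_def by meson
  define g where "g i = (if i = p then c else 0)" for i
  have "g \<in> ell2" by (rule ell2_finite[of "{p}"]) (auto simp: g_def)
  moreover have "(\<lambda>n. ell2_norm (\<lambda>i. matrix_unit_op p q (F (r n)) i - g i)) \<longlonglongrightarrow> 0"
  proof -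
    have "ell2_norm (\<lambda>i. matrix_unit_op p q (F (r n)) i - g i) = cmod (F (r n) q - c)" for n
    proof -
      have "(\<Sum>i. (cmod (matrix_unit_op p q (F (r n)) i - g i))\<^sup>2) = (\<Sum>i\<in>{p}. (cmod (matrix_unit_op p q (F (r n)) i - g i))\<^sup>2)"
        by (rule suminf_finite) (auto simp: matrix_unit_op_def g_def)
      then show ?thesis by (simp add: ell2_norm_def matrix_unit_op_def g_def)
    qed
    moreover have "(\<lambda>n. cmod (F (r n) q - c)) \<longlonglongrightarrow> 0"
      using r(2) by (simp add: o_def LIM_zero tendsto_norm_zero)
    ultimately show ?thesis by simp
  qed
  ultimately show "\<exists>g\<in>ell2. \<exists>r. strict_mono r \<and> (\<lambda>n. ell2_norm (\<lambda>i. matrix_unit_op p q (F (r n)) i - g i)) \<longlonglongrightarrow> 0"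
    using r(1) by blast
qed (auto simp: matrix_unit_op_def)

lemma fin_mat_algebraic_tensor:
  fixes x :: "'a::unital_cstar_algebra imat"
  assumes "fin_mat x"
  shows "x \<in> algebraic_tensor"
proof -
  obtain n where n: "\<And>i j. i \<ge> n \<or> j \<ge> n \<Longrightarrow> x i j = 0" using assms by (auto simp: fin_mat_def)
  define a where "a l = x (l div n) (l mod n)" for l
  define T where "T l = matrix_unit_op (l div n) (l mod n)" for l
  have "x i j = (\<Sum>l<n * n. elem_tensor (a l) (T l) i j)" for i j
  proof -
    have "(\<Sum>l<n * n. elem_tensor (a l) (T l) i j) = (\<Sum>p<n. \<Sum>q<n. if p = i then (if q = j then x p q else 0) else 0)"
      unfolding sum_blocks
      by (intro sum.cong refl) (auto simp: elem_tensor_def a_def T_def matrix_unit_op_def ell2_basis_def)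
    also have "\<dots> = (\<Sum>p<n. if p = i then (\<Sum>q<n. if q = j then x p q else 0) else 0)"
      by (intro sum.cong refl) auto
    also have "\<dots> = (if i < n \<and> j < n then x i j else 0)" by (simp add: sum.delta)
    also have "\<dots> = x i j" using n[of i j] by auto
    finally show ?thesis by simp
  qed
  then have "x = (\<lambda>i j. \<Sum>l<n * n. elem_tensor (a l) (T l) i j)" by (intro ext)
  moreover have "\<forall>l<n * n. compact_operator (T l)" by (simp add: T_def compact_matrix_unit_op)
  ultimately show ?thesis unfolding algebraic_tensor_def by blast
qed

text \<open>Finite matrices are finite sums of elementary tensors with matrix units, and all elementary tensors
  with compact operators are norm limits of finite matrices.\<close>

theorem tensor_K_elems: "elems (tensor_K :: 'a::unital_cstar_algebra imat star_algebra) = ent ` kset"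
proof -
  have "imat_closure algebraic_tensor = imat_closure (Collect fin_mat :: 'a imat set)"
  proof
    show "imat_closure (Collect fin_mat :: 'a imat set) \<subseteq> imat_closure algebraic_tensor"
      by (intro imat_closure_mono) (auto intro: fin_mat_algebraic_tensor)
    have alg: "x \<in> imat_closure (Collect fin_mat)" if x: "x \<in> algebraic_tensor" for x :: "'a imat"
    proof -
      obtain m :: nat and a T where x: "x = (\<lambda>i j. \<Sum>l<m. elem_tensor (a l) (T l) i j)" "\<forall>l<m. compact_operator (T l)"
        using x unfolding algebraic_tensor_def by blast
      have "\<forall>l. \<exists>y. l < m \<longrightarrow> y \<in> kset \<and> ent y = elem_tensor (a l) (T l)"
        using elem_tensor_closure x(2) unfolding imat_closure_fin_mat by (metis imageE)
      then obtain y where y: "\<And>l. l < m \<Longrightarrow> y l \<in> kset \<and> ent (y l) = elem_tensor (a l) (T l)" by metis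
      have "x = ent (\<Sum>l<m. y l)" unfolding x by (intro ext) (simp add: ent_sum y)
      moreover have "(\<Sum>l<m. y l) \<in> kset" using y by (intro subspace_sum[OF subspace_kset]) auto
      ultimately show ?thesis by (simp add: imat_closure_fin_mat)
    qed
    show "imat_closure algebraic_tensor \<subseteq> imat_closure (Collect fin_mat :: 'a imat set)"
    proof
      fix x :: "'a imat" assume x: "x \<in> imat_closure algebraic_tensor"
      show "x \<in> imat_closure (Collect fin_mat)"
        by (rule imat_closure_closure) (use x alg in \<open>auto simp: imat_closure_iff[of x algebraic_tensor]\<close>)
    qed
  qed
  then show ?thesis by (simp add: tensor_K_def imat_closure_fin_mat)
qed

section \<open>The tensor product as a set of matrices\<close>

lemma tensor_K_simps:
  "add_op tensor_K (ent x) (ent y) = ent (x + y)" "scale_op tensor_K c (ent x) = ent (c *\<^sub>C x)"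
  "mult_op tensor_K (ent x) (ent y) = ent (x * y)" "star_op tensor_K (ent x) = ent (star x)"
  by (simp_all add: tensor_K_def ent_simps times_stab.rep_eq star_stab.rep_eq)

text \<open>The square root of a positive element of the ideal \<open>A \<otimes> K\<close> is again in it.\<close>

lemma tensor_K_pos_eq: "tensor_K_pos = ent ` {k \<in> kset. cpos k}"
proof (intro equalityI subsetI)
  fix x :: "'a imat" assume "x \<in> tensor_K_pos"
  then obtain y where y: "y \<in> kset" "x = imat_mult (imat_star (ent y)) (ent y)"
    unfolding tensor_K_pos_def tensor_K_elems by blast
  then have "x = ent (star y * y)" by (simp add: times_stab.rep_eq star_stab.rep_eq)
  then show "x \<in> ent ` {k \<in> kset. cpos k}" using y(1) by (simp add: cpos_star_mult kset_mult_left)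
next
  fix x :: "'a imat" assume "x \<in> ent ` {k \<in> kset. cpos k}"
  then obtain k where k: "k \<in> kset" "cpos k" "x = ent k" by blast
  show "x \<in> tensor_K_pos"
  proof (rule cpos_root[OF k(2), of 2])
    fix y assume y: "cpos y" "y\<^sup>2 = k"
      and I: "\<And>I. subspace I \<Longrightarrow> closed I \<Longrightarrow> k \<in> I \<Longrightarrow> (\<And>x. x \<in> I \<Longrightarrow> x * k \<in> I) \<Longrightarrow> y \<in> I"
    have "y \<in> kset" by (rule I[OF subspace_kset closed_kset k(1)]) (rule kset_mult_right)
    moreover have "x = imat_mult (imat_star (ent y)) (ent y)"
      using y cpos_star[OF y(1)] by (simp add: k(3) power2_eq_square flip: times_stab.rep_eq star_stab.rep_eq)
    ultimately show ?thesis unfolding tensor_K_pos_def tensor_K_elems by blast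
  qed simp
qed

lemma hereditary_elems:
  assumes "h \<in> kset"
  shows "elems (hereditary (ent h)) = ent ` her h"
proof -
  have "{imat_mult (imat_mult (ent h) x) (ent h) | x. x \<in> elems tensor_K} = ent ` ((\<lambda>x. h * x * h) ` kset)"
  proof -
    have "{imat_mult (imat_mult (ent h) x) (ent h) | x. x \<in> elems tensor_K} = (\<lambda>x. imat_mult (imat_mult (ent h) x) (ent h)) ` (ent ` kset)"
      unfolding tensor_K_elems by blast
    then show ?thesis by (simp add: image_image times_stab.rep_eq)
  qed
  then show ?thesis by (simp add: hereditary_def her_def imat_closure_ent)
qed

lemma hereditary_ops:
  "add_op (hereditary h) = add_op tensor_K" "scale_op (hereditary h) = scale_op tensor_K"
  "mult_op (hereditary h) = mult_op tensor_K" "star_op (hereditary h) = star_op tensor_K"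
  by (simp_all add: hereditary_def)

lemma star_isomorphic_hereditaryD:
  fixes h k :: "'a::unital_cstar_algebra stab"
  assumes "star_isomorphic (hereditary (ent h)) (hereditary (ent k))" "h \<in> kset" "star h = h" "k \<in> kset"
  shows "\<exists>\<phi>. bij_betw \<phi> (her h) (her k) \<and> star_hom_on (her h) \<phi>"
proof -
  obtain \<Phi> where bij: "bij_betw \<Phi> (ent ` her h) (ent ` her k)"
    and hom: "\<forall>x\<in>ent ` her h. \<forall>y\<in>ent ` her h. \<Phi> (add_op tensor_K x y) = add_op tensor_K (\<Phi> x) (\<Phi> y)"
      "\<forall>c. \<forall>x\<in>ent ` her h. \<Phi> (scale_op tensor_K c x) = scale_op tensor_K c (\<Phi> x)"
      "\<forall>x\<in>ent ` her h. \<forall>y\<in>ent ` her h. \<Phi> (mult_op tensor_K x y) = mult_op tensor_K (\<Phi> x) (\<Phi> y)"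
      "\<forall>x\<in>ent ` her h. \<Phi> (star_op tensor_K x) = star_op tensor_K (\<Phi> x)"
    using assms(1) unfolding star_isomorphic_def hereditary_elems[OF assms(2)] hereditary_elems[OF assms(4)] hereditary_ops
    by (-) (elim exE conjE, rule that; assumption)
  have hom': "\<Phi> (ent (x + y)) = add_op tensor_K (\<Phi> (ent x)) (\<Phi> (ent y))"
    "\<Phi> (ent (x * y)) = mult_op tensor_K (\<Phi> (ent x)) (\<Phi> (ent y))"
    "\<Phi> (ent (c *\<^sub>C x)) = scale_op tensor_K c (\<Phi> (ent x))" "\<Phi> (ent (star x)) = star_op tensor_K (\<Phi> (ent x))"
    if "x \<in> her h" "y \<in> her h" for x y c
    using hom(1)[rule_format, OF imageI[OF that(1)] imageI[OF that(2)]]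
      hom(3)[rule_format, OF imageI[OF that(1)] imageI[OF that(2)]]
      hom(2)[rule_format, OF imageI[OF that(1)]] hom(4)[rule_format, OF imageI[OF that(1)]]
    by (simp_all only: tensor_K_simps)
  define \<phi> where "\<phi> x = Abs_stab (\<Phi> (ent x))" for x
  have \<phi>: "ent (\<phi> x) = \<Phi> (ent x)" if "x \<in> her h" for x
  proof -
    have "\<Phi> (ent x) \<in> ent ` her k" using bij that by (auto simp: bij_betw_def)
    then show ?thesis by (auto simp: \<phi>_def ent_inverse)
  qed
  have ei: "bij_betw ent (her h) (ent ` her h)" "bij_betw Abs_stab (ent ` her k) (her k)"
    by (auto simp: bij_betw_def inj_on_def ent_inject ent_inverse image_image)
  have "bij_betw (Abs_stab \<circ> (\<Phi> \<circ> ent)) (her h) (her k)"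
    by (intro bij_betw_trans[OF _ ei(2)] bij_betw_trans[OF ei(1) bij])
  then have "bij_betw \<phi> (her h) (her k)" by (simp add: \<phi>_def[abs_def] o_def)
  moreover have "star_hom_on (her h) \<phi>"
  proof -
    note B = cstar_sub_her[OF assms(2,3)]
    have "\<phi> (x + y) = \<phi> x + \<phi> y" "\<phi> (x * y) = \<phi> x * \<phi> y" if "x \<in> her h" "y \<in> her h" for x y
      using hom'(1,2)[OF that] that
      by (simp_all add: \<phi>[symmetric] tensor_K_simps cstar_subD[OF B] ent_inject)
    moreover have "\<phi> (c *\<^sub>C x) = c *\<^sub>C \<phi> x" "\<phi> (star x) = star (\<phi> x)" if "x \<in> her h" for c x
      using hom'(3,4)[OF that that] that
      by (simp_all add: \<phi>[symmetric] tensor_K_simps cstar_subD[OF B] ent_inject)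
    ultimately show ?thesis by (simp add: star_hom_on_def)
  qed
  ultimately show ?thesis by blast
qed

lemma ent_one_eq: "ent 1 = (\<lambda>i j. if i = j then 1 else 0)"
  by (intro ext) (simp add: ent_one)

lemma imat_power_ent: "imat_power (ent k) n = ent (k ^ n)"
proof -
  have "(imat_mult (ent k) ^^ n) (ent 1) = ent (k ^ n)"
    by (induction n) (simp_all add: times_stab.rep_eq)
  then show ?thesis by (simp add: imat_power_def ent_one_eq)
qed

lemma pos_root_ent:
  assumes h: "h \<in> kset" "cpos h" and k: "cpos k" "k ^ n = h" "n \<ge> 1"
  shows "pos_root n (ent h) = ent k"
  unfolding pos_root_def
proof (rule the_equality)
  have "k \<in> kset" using her_root[OF h k] her_subset_kset[OF h(1)] by blast
  then show "ent k \<in> tensor_K_pos \<and> imat_power (ent k) n = ent h"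
    using k by (simp add: tensor_K_pos_eq imat_power_ent)
next
  fix x assume x: "x \<in> tensor_K_pos \<and> imat_power x n = ent h"
  then obtain q where q: "cpos q" "x = ent q" unfolding tensor_K_pos_eq by blast
  then have "q ^ n = k ^ n" using x k(2) by (simp add: imat_power_ent ent_inject)
  then have "q = k" by (rule cpos_root_unique[OF q(1) k(1,3)])
  then show "x = ent k" by (simp add: q(2))
qed

text \<open>The roots in \<open>A \<otimes> K\<close> are those in its unitization, whose traces converge.\<close>

theorem dim_fun_eq_her_mass:
  assumes tr: "tracial_state \<tau>" and h: "h \<in> kset" "cpos h" "h \<noteq> 0"
  shows "dim_fun \<tau> (ent h) = her_mass \<tau> (her h)"
proof -
  have "\<exists>k. cpos k \<and> k ^ n = h" if "n \<ge> 1" for n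
  proof (rule cpos_root[OF h(2) that])
    fix k assume "cpos k" "k ^ n = h"
    then show ?thesis by blast
  qed
  then obtain k where k: "\<And>n. n \<ge> 1 \<Longrightarrow> cpos (k n) \<and> k n ^ n = h" by metis
  have "\<forall>\<^sub>F n in sequentially. mtr \<tau> (k n) = trace_hat \<tau> (pos_root n (ent h))"
  proof (rule eventually_sequentiallyI[of 1])
    fix n :: nat assume n: "1 \<le> n"
    have "pos_root n (ent h) = ent (k n)" using k[OF n] n by (intro pos_root_ent h) auto
    then show "mtr \<tau> (k n) = trace_hat \<tau> (pos_root n (ent h))" by (simp add: mtr_def[OF tr])
  qed
  from Lim_transform_eventually[OF mtr_root_tendsto[OF tr h k] this]
  show ?thesis unfolding dim_fun_def by (rule limI)
qed

section \<open>Projections\<close>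

lemma cpos_projection: "star q = q \<Longrightarrow> q * q = q \<Longrightarrow> cpos (q::'a::unital_cstar_algebra)"
  using cpos_star_mult[of q] by simp

lemma her_projection:
  assumes q: "star q = q" "q * q = q" "q \<in> kset"
  shows "her q = {y \<in> kset. q * y * q = y}"
proof
  have qq: "q * (q * x) = q * x" for x using q(2) by (simp flip: mult.assoc)
  have "closed {y \<in> kset. q * y * q = y}"
    by (intro closed_Collect_conj closed_Collect_eq continuous_intros) (simp_all add: Collect_mem_eq)
  then show "her q \<subseteq> {y \<in> kset. q * y * q = y}"
    unfolding her_def
    by (intro closure_minimal) (auto simp: mult.assoc qq q(2) kset_mult_left kset_mult_right)
  show "{y \<in> kset. q * y * q = y} \<subseteq> her q"
    using her_hxh[of _ q] by force
qed

text \<open>The projection is the largest positive contraction in its hereditary subalgebra.\<close>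

lemma her_mass_projection:
  assumes tr: "tracial_state \<tau>" and q: "star q = q" "q * q = q" "q \<in> kset"
  shows "her_mass \<tau> (her q) = mtr \<tau> q"
proof (rule antisym)
  show "her_mass \<tau> (her q) \<le> mtr \<tau> q"
    unfolding her_mass_def[OF tr]
  proof (rule SUP_least)
    fix b assume b: "b \<in> {b \<in> her q. cpos b \<and> norm b \<le> 1}"
    then have "q * b * q = b" using her_projection[OF q] by auto
    then have "q - b = star q * (1 - b) * q" by (simp add: q algebra_simps)
    moreover have "cpos (star q * (1 - b) * q)" using b by (intro cpos_conj cpos_one_minus cpos_star) auto
    ultimately have "cpos (q - b)" by simp
    then show "mtr \<tau> b \<le> mtr \<tau> q" using b by (intro mtr_mono[OF tr]) auto
  qed
  have "q \<in> her q" using her_projection[OF q] q by simp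
  then show "mtr \<tau> q \<le> her_mass \<tau> (her q)"
    unfolding her_mass_def[OF tr] using cpos_projection[OF q(1,2)] norm_projection_le[OF q(1,2)]
    by (intro SUP_upper) auto
qed

definition mat_embed :: "nat \<Rightarrow> 'a::unital_cstar_algebra mat \<Rightarrow> 'a stab" where
  "mat_embed n X = Abs_stab (\<lambda>i j. if i < n \<and> j < n then X $$ (i, j) else 0)"

lemma mat_embed_fin: "fin_mat (\<lambda>i j. if i < n \<and> j < n then X $$ (i, j) else (0::'a::unital_cstar_algebra))"
  by (rule fin_matI[of n]) auto

lemma ent_mat_embed: "ent (mat_embed n X) i j = (if i < n \<and> j < n then X $$ (i, j) else 0)"
  by (simp add: mat_embed_def ent_Abs_fin[OF mat_embed_fin])

lemma mat_embed_kset: "mat_embed n X \<in> kset"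
  by (rule subsetD[OF finset_subset_kset])
    (simp add: finset_def mat_embed_def ent_Abs_fin[OF mat_embed_fin] mat_embed_fin)

lemma mat_embed_mult:
  assumes "X \<in> carrier_mat n n" "Y \<in> carrier_mat n n"
  shows "mat_embed n (X * Y) = mat_embed n X * mat_embed n Y"
proof (rule stab_eqI)
  fix i j
  have "ent (mat_embed n X * mat_embed n Y) i j = (\<Sum>k<n. ent (mat_embed n X) i k * ent (mat_embed n Y) k j)"
    by (rule ent_mult_finite) (auto simp: ent_mat_embed)
  also have "\<dots> = (if i < n \<and> j < n then (\<Sum>k<n. X $$ (i, k) * Y $$ (k, j)) else 0)"
    by (auto simp: ent_mat_embed)
  finally show "ent (mat_embed n (X * Y)) i j = ent (mat_embed n X * mat_embed n Y) i j"
    using mat_mult_entry[OF assms] by (simp add: ent_mat_embed)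
qed

lemma mat_embed_star: "X \<in> carrier_mat n n \<Longrightarrow> mat_embed n (mat_star X) = star (mat_embed n X)"
  by (rule stab_eqI) (auto simp: ent_mat_embed ent_star mat_star_def)

lemma mat_star_carrier: "X \<in> carrier_mat n n \<Longrightarrow> mat_star X \<in> carrier_mat n n"
  by (simp add: mat_star_def)

lemma mat_embed_inject:
  assumes "X \<in> carrier_mat n n" "Y \<in> carrier_mat n n" "mat_embed n X = mat_embed n Y"
  shows "X = Y"
proof (rule eq_matI)
  fix i j assume "i < dim_row Y" "j < dim_col Y"
  then show "X $$ (i, j) = Y $$ (i, j)"
    using assms ent_mat_embed[of n X i j] ent_mat_embed[of n Y i j] by simp
qed (use assms in auto)

lemma her_mat_embed:
  assumes "mat_projection n p"
  shows "her (mat_embed n p) = mat_embed n ` {p * X * p | X. X \<in> carrier_mat n n}"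
proof -
  have p: "p \<in> carrier_mat n n" "p * p = p" "mat_star p = p" using assms by (auto simp: mat_projection_def)
  define P where "P = mat_embed n p"
  have P: "star P = P" "P * P = P" "P \<in> kset"
    using mat_embed_star[OF p(1)] mat_embed_mult[OF p(1,1)] by (simp_all add: P_def p(2,3) mat_embed_kset)
  have PXP: "P * mat_embed n X * P = mat_embed n (p * X * p)" if "X \<in> carrier_mat n n" for X
    unfolding P_def mat_embed_mult[OF mult_carrier_mat[OF p(1) that] p(1)] mat_embed_mult[OF p(1) that] ..
  have "y \<in> mat_embed n ` {p * X * p | X. X \<in> carrier_mat n n}" if y: "y \<in> kset" "P * y * P = y" for y
  proof -
    define X where "X = Matrix.mat n n (\<lambda>(i, j). ent y i j)"
    have X: "X \<in> carrier_mat n n" by (simp add: X_def)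
    have PN: "proj n * P = P" "P * proj n = P"
      by (auto intro!: stab_eqI simp: ent_proj_mult ent_mult_proj P_def ent_mat_embed)
    have "proj n * y * proj n = (proj n * P) * y * (P * proj n)"
      by (subst (1) y(2)[symmetric]) (simp add: mult.assoc)
    then have "proj n * y * proj n = y" by (simp add: PN y(2))
    moreover have "proj n * y * proj n = mat_embed n X"
      by (rule stab_eqI) (auto simp: ent_proj_mult ent_mult_proj ent_mat_embed X_def)
    ultimately have "y = mat_embed n X" by simp
    then have "y = mat_embed n (p * X * p)" using y(2) PXP[OF X] by simp
    then show ?thesis using X by blast
  qed
  moreover have "mat_embed n (p * X * p) \<in> her P" if "X \<in> carrier_mat n n" for X
    using her_hxh[OF mat_embed_kset, of P n X] by (simp add: PXP that)
  ultimately show ?thesis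
    unfolding P_def[symmetric] using her_projection[OF P] by auto
qed

text \<open>The corner of a projection over \<open>A\<close> is the hereditary subalgebra generated by the embedded
  projection.\<close>

lemma star_isomorphic_hereditary_unit:
  fixes p :: "'a::unital_cstar_algebra mat"
  assumes p: "mat_projection n p" and iso: "star_isomorphic (mat_corner n p) (whole_algebra :: 'a star_algebra)"
  shows "star_isomorphic (hereditary (ent (mat_embed n p))) (hereditary (ent (unit 0 0 (1::'a))))"
proof -
  let ?C = "{p * X * p | X. X \<in> carrier_mat n n}"
  obtain \<theta> :: "'a mat \<Rightarrow> 'a" where bij: "bij_betw \<theta> ?C UNIV"
    and add: "\<And>x y. x \<in> ?C \<Longrightarrow> y \<in> ?C \<Longrightarrow> \<theta> (x + y) = \<theta> x + \<theta> y"
    and scale: "\<And>c x. x \<in> ?C \<Longrightarrow> \<theta> (map_mat (scaleC c) x) = c *\<^sub>C \<theta> x"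
    and mult: "\<And>x y. x \<in> ?C \<Longrightarrow> y \<in> ?C \<Longrightarrow> \<theta> (x * y) = \<theta> x * \<theta> y"
    and star: "\<And>x. x \<in> ?C \<Longrightarrow> \<theta> (mat_star x) = star (\<theta> x)"
    using iso unfolding star_isomorphic_def mat_corner_def mat_algebra_def whole_algebra_def by auto
  have pc: "p \<in> carrier_mat n n" using p by (simp add: mat_projection_def)
  have Cc: "x \<in> carrier_mat n n" if "x \<in> ?C" for x using that pc by auto
  let ?u = "unit 0 0 :: 'a \<Rightarrow> 'a stab"
  have u: "star (?u 1) = ?u 1" "?u 1 * ?u 1 = ?u 1" "?u 1 \<in> kset"
    by (simp_all add: unit_star unit_mult unit_kset)
  have her_u: "her (?u 1) = range ?u"
  proof
    show "her (?u 1) \<subseteq> range ?u"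
    proof
      fix y assume "y \<in> her (?u 1)"
      then have "?u 1 * y * ?u 1 = y" using her_projection[OF u] by blast
      then show "y \<in> range ?u" unfolding unit_compress by (metis rangeI)
    qed
    show "range ?u \<subseteq> her (?u 1)" unfolding her_projection[OF u] by (auto simp: unit_mult unit_kset)
  qed
  define un where "un x = Matrix.mat n n (\<lambda>(i, j). x i j)" for x :: "'a imat"
  have un: "un (ent (mat_embed n X)) = X" if "X \<in> carrier_mat n n" for X
    using that by (intro eq_matI) (auto simp: un_def ent_mat_embed)
  define \<Phi> where "\<Phi> x = ent (?u (\<theta> (un x)))" for x
  have E1: "elems (hereditary (ent (mat_embed n p))) = (\<lambda>X. ent (mat_embed n X)) ` ?C"
    by (simp only: hereditary_elems[OF mat_embed_kset] her_mat_embed[OF p] image_image)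
  have E2: "elems (hereditary (ent (?u 1))) = (\<lambda>a. ent (?u a)) ` UNIV"
    by (simp only: hereditary_elems[OF u(3)] her_u image_image)
  have \<Phi>: "\<Phi> (ent (mat_embed n X)) = ent (?u (\<theta> X))" if "X \<in> ?C" for X
    by (simp add: \<Phi>_def un Cc[OF that])
  have "bij_betw \<Phi> (elems (hereditary (ent (mat_embed n p)))) (elems (hereditary (ent (?u 1))))"
    unfolding E1 E2
  proof (rule bij_betw_imageI)
    show "inj_on \<Phi> ((\<lambda>X. ent (mat_embed n X)) ` ?C)"
    proof (rule inj_onI)
      fix x y assume "x \<in> (\<lambda>X. ent (mat_embed n X)) ` ?C" "y \<in> (\<lambda>X. ent (mat_embed n X)) ` ?C" and eq: "\<Phi> x = \<Phi> y"
      then obtain X Y where X: "X \<in> ?C" "x = ent (mat_embed n X)" and Y: "Y \<in> ?C" "y = ent (mat_embed n Y)" by blast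
      have "\<theta> X = \<theta> Y" using eq by (simp add: X(2) Y(2) \<Phi>[OF X(1)] \<Phi>[OF Y(1)] ent_inject unit_inject)
      then have "X = Y" using bij X(1) Y(1) unfolding bij_betw_def by (meson inj_onD)
      then show "x = y" by (simp add: X(2) Y(2))
    qed
    have "\<Phi> ` ((\<lambda>X. ent (mat_embed n X)) ` ?C) = (\<lambda>X. ent (?u (\<theta> X))) ` ?C"
      unfolding image_image by (intro image_cong refl \<Phi>)
    also have "\<dots> = (\<lambda>a. ent (?u a)) ` (\<theta> ` ?C)" by (simp only: image_image)
    also have "\<theta> ` ?C = UNIV" using bij by (simp add: bij_betw_def)
    finally show "\<Phi> ` ((\<lambda>X. ent (mat_embed n X)) ` ?C) = (\<lambda>a. ent (?u a)) ` UNIV" .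
  qed
  moreover have "\<Phi> (add_op tensor_K x y) = add_op tensor_K (\<Phi> x) (\<Phi> y) \<and> \<Phi> (mult_op tensor_K x y) = mult_op tensor_K (\<Phi> x) (\<Phi> y)"
    if xy: "x \<in> (\<lambda>X. ent (mat_embed n X)) ` ?C" "y \<in> (\<lambda>X. ent (mat_embed n X)) ` ?C" for x y
  proof -
    obtain X Y where X: "X \<in> ?C" "x = ent (mat_embed n X)" and Y: "Y \<in> ?C" "y = ent (mat_embed n Y)" using xy by blast
    obtain X' Y' where X': "X' \<in> carrier_mat n n" "X = p * X' * p" and Y': "Y' \<in> carrier_mat n n" "Y = p * Y' * p"
      using X(1) Y(1) by blast
    have pX: "p * X' \<in> carrier_mat n n" "p * Y' \<in> carrier_mat n n" using pc X'(1) Y'(1) by auto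
    have XY1: "X + Y = p * (X' + Y') * p"
      using mult_add_distrib_mat[OF pc X'(1) Y'(1)] add_mult_distrib_mat[OF pX pc] by (simp add: X'(2) Y'(2))
    have C1: "X + Y \<in> ?C" unfolding XY1 by (intro CollectI exI[of _ "X' + Y'"] conjI refl add_carrier_mat Y'(1))
    have XY2: "X * Y = p * (X' * p * p * Y') * p"
      using pc X'(1) Y'(1) pX by (simp add: X'(2) Y'(2) assoc_mult_mat[of _ n n _ n _ n])
    have C2: "X * Y \<in> ?C" unfolding XY2
      by (intro CollectI exI[of _ "X' * p * p * Y'"] conjI refl mult_carrier_mat[of _ n n] X'(1) Y'(1) pc)
    have "mat_embed n (X + Y) = mat_embed n X + mat_embed n Y"
      using Cc[OF X(1)] Cc[OF Y(1)] by (intro stab_eqI) (auto simp: ent_mat_embed ent_simps)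
    then show ?thesis
      using \<Phi>[OF C1] \<Phi>[OF C2] mat_embed_mult[OF Cc[OF X(1)] Cc[OF Y(1)]]
      by (simp add: X(2) Y(2) tensor_K_simps \<Phi>[OF X(1)] \<Phi>[OF Y(1)] add[OF X(1) Y(1)] mult[OF X(1) Y(1)] unit_add unit_mult)
  qed
  moreover have "\<Phi> (scale_op tensor_K c x) = scale_op tensor_K c (\<Phi> x) \<and> \<Phi> (star_op tensor_K x) = star_op tensor_K (\<Phi> x)"
    if x: "x \<in> (\<lambda>X. ent (mat_embed n X)) ` ?C" for c x
  proof -
    obtain X where X: "X \<in> ?C" "x = ent (mat_embed n X)" using x by blast
    obtain X' where X': "X' \<in> carrier_mat n n" "X = p * X' * p" using X(1) by blast
    let ?P = "mat_embed n p"
    have inC: "Y \<in> ?C" if Y: "Y \<in> carrier_mat n n" "mat_embed n Y \<in> her ?P" for Y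
    proof -
      obtain Z where "Z \<in> ?C" "mat_embed n Y = mat_embed n Z" using Y(2) her_mat_embed[OF p] by blast
      then show ?thesis using mat_embed_inject[OF Y(1) Cc] by blast
    qed
    have XP: "mat_embed n X \<in> her ?P" using X(1) her_mat_embed[OF p] by blast
    have sP: "star ?P = ?P" using mat_embed_star[OF pc] p by (simp add: mat_projection_def)
    note XC = Cc[OF X(1)]
    have e1: "mat_embed n (map_mat (scaleC c) X) = c *\<^sub>C mat_embed n X"
      using XC by (intro stab_eqI) (auto simp: ent_mat_embed ent_simps)
    have C1: "map_mat (scaleC c) X \<in> ?C"
      using XC her_scaleC[OF XP, of c] by (intro inC) (auto simp: e1)
    have e2: "mat_embed n (mat_star X) = star (mat_embed n X)" by (rule mat_embed_star[OF XC])
    have C2: "mat_star X \<in> ?C"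
      by (rule inC) (use XC her_star[OF sP XP] in \<open>simp_all add: e2 mat_star_carrier\<close>)
    show ?thesis
      using \<Phi>[OF C1] \<Phi>[OF C2]
      by (simp add: X(2) tensor_K_simps \<Phi>[OF X(1)] e1 e2 scale[OF X(1)] star[OF X(1)] unit_scaleC unit_star)
  qed
  ultimately show ?thesis
    unfolding star_isomorphic_def hereditary_ops E1[symmetric] by blast
qed

section \<open>The fundamental group\<close>

text \<open>The constant by which an isomorphism scales the trace is both the quotient of the dimensions and the
  trace of a projection.\<close>

lemma fundamental_group_imp_projection:
  fixes \<tau> :: "'a::unital_cstar_algebra \<Rightarrow> complex"
  assumes simple: "simple_cstar TYPE('a)" and tr: "tracial_state \<tau>"
    and unique: "\<And>\<sigma> :: 'a \<Rightarrow> complex. tracial_state \<sigma> \<Longrightarrow> \<sigma> = \<tau>"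
    and r: "r \<in> fundamental_group \<tau>"
  shows "\<exists>(n::nat) (p :: 'a mat). 1 \<le> n \<and> mat_projection n p \<and>
        star_isomorphic (mat_corner n p) (whole_algebra :: 'a star_algebra) \<and>
        mat_trace \<tau> p = complex_of_real r"
proof -
  have zero: "(\<lambda>i j. 0 :: 'a) = ent 0" by (simp add: zero_stab.rep_eq)
  have r0: "0 < r" using r by (simp add: fundamental_group_def)
  obtain x\<^sub>1 x\<^sub>2 where x: "x\<^sub>1 \<in> tensor_K_pos - {\<lambda>i j. 0}" "x\<^sub>2 \<in> tensor_K_pos - {\<lambda>i j. 0}"
    "star_isomorphic (hereditary x\<^sub>1) (hereditary x\<^sub>2)"
    "dim_fun \<tau> x\<^sub>2 < \<infinity>" "dim_fun \<tau> x\<^sub>1 / dim_fun \<tau> x\<^sub>2 = ennreal r"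
    using r unfolding fundamental_group_def by blast
  obtain h\<^sub>1 where h1: "h\<^sub>1 \<in> kset" "cpos h\<^sub>1" "h\<^sub>1 \<noteq> 0" "x\<^sub>1 = ent h\<^sub>1"
    using x(1) unfolding tensor_K_pos_eq zero by (auto simp: ent_inject)
  obtain h\<^sub>2 where h2: "h\<^sub>2 \<in> kset" "cpos h\<^sub>2" "h\<^sub>2 \<noteq> 0" "x\<^sub>2 = ent h\<^sub>2"
    using x(2) unfolding tensor_K_pos_eq zero by (auto simp: ent_inject)
  have d: "dim_fun \<tau> x\<^sub>1 = her_mass \<tau> (her h\<^sub>1)" "dim_fun \<tau> x\<^sub>2 = her_mass \<tau> (her h\<^sub>2)"
    unfolding h1(4) h2(4) by (intro dim_fun_eq_her_mass tr h1 h2)+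
  have fin1: "her_mass \<tau> (her h\<^sub>1) < \<infinity>"
  proof (rule ccontr)
    assume "\<not> ?thesis"
    then have "her_mass \<tau> (her h\<^sub>1) = \<infinity>" by (simp add: top.not_eq_extremum[symmetric])
    then show False using x(4,5) unfolding d by (simp add: ennreal_top_divide split: if_splits)
  qed
  obtain \<phi> where \<phi>: "bij_betw \<phi> (her h\<^sub>1) (her h\<^sub>2)" "star_hom_on (her h\<^sub>1) \<phi>"
    using star_isomorphic_hereditaryD[OF x(3)[unfolded h1(4) h2(4)] h1(1) cpos_star[OF h1(2)] h2(1)] by blast
  \<comment> \<open>The isomorphism is used in the direction from \<open>h\<^sub>2\<close> to \<open>h\<^sub>1\<close>, so that it scales the trace by \<open>r\<close>.\<close>
  have inv: "bij_betw (inv_into (her h\<^sub>1) \<phi>) (her h\<^sub>2) (her h\<^sub>1)" "star_hom_on (her h\<^sub>2) (inv_into (her h\<^sub>1) \<phi>)"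
    by (rule bij_betw_inv_into[OF \<phi>(1)], rule star_hom_on_inv[OF \<phi>(2,1) cstar_sub_her[OF h1(1) cpos_star[OF h1(2)]]])
  interpret I: her_iso \<tau> h\<^sub>2 h\<^sub>1 "inv_into (her h\<^sub>1) \<phi>"
    by (rule her_iso.intro[OF simple tr unique h2(1,2,3) h1(1,2) inv fin1])
  obtain m :: nat and c where mc: "\<forall>k<m. c k \<in> kset \<and> c k * I.e = c k"
    "(\<Sum>k<m. star (h\<^sub>2 * c k) * (h\<^sub>2 * c k)) = I.e"
    using I.frame_exists by blast
  interpret F: her_iso_frame \<tau> h\<^sub>2 h\<^sub>1 "inv_into (her h\<^sub>1) \<phi>" m c
    by unfold_locales (use mc in auto)
  have scale: "her_mass \<tau> (her h\<^sub>1) = ennreal F.scl * her_mass \<tau> (her h\<^sub>2)" by (rule F.her_mass_scale)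
  have "her_mass \<tau> (her h\<^sub>2) \<noteq> 0" "her_mass \<tau> (her h\<^sub>2) \<noteq> \<infinity>"
    using x(4,5) r0 unfolding d scale by auto
  then have "ennreal F.scl = ennreal r"
    using x(5) unfolding d scale by (simp add: ennreal_mult_divide_eq)
  then have "F.scl = r" using F.scl_pos r0 by simp
  then show ?thesis using F.projection_exists by simp
qed

text \<open>The positive elements witnessing membership are \<open>p\<close> and the unit of the corner \<open>A\<close>, both embedded in
  \<open>A \<otimes> K\<close>.\<close>

lemma projection_imp_fundamental_group:
  fixes \<tau> :: "'a::unital_cstar_algebra \<Rightarrow> complex"
  assumes tr: "tracial_state \<tau>" and t: "0 < t" and p: "mat_projection n p"
    and iso: "star_isomorphic (mat_corner n p) (whole_algebra :: 'a star_algebra)"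
    and trace: "mat_trace \<tau> p = complex_of_real t"
  shows "t \<in> fundamental_group \<tau>"
proof -
  have pc: "p \<in> carrier_mat n n" "p * p = p" "mat_star p = p" using p by (auto simp: mat_projection_def)
  define P where "P = mat_embed n p"
  have P: "star P = P" "P * P = P" "P \<in> kset"
    using mat_embed_star[OF pc(1)] mat_embed_mult[OF pc(1,1)] by (simp_all add: P_def pc(2,3) mat_embed_kset)
  let ?u = "unit 0 0 1 :: 'a stab"
  have u: "star ?u = ?u" "?u * ?u = ?u" "?u \<in> kset"
    by (simp_all add: unit_star unit_mult unit_kset)
  have u0: "?u \<noteq> 0" using ent_unit[of 0 0 "1::'a" 0 0] by (metis zero_stab.rep_eq zero_neq_one)
  have mP: "mtr \<tau> P = ennreal t"
  proof -
    have "mtr \<tau> P = (\<Sum>i<n. ennreal (Re (\<tau> (p $$ (i, i)))))"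
      unfolding mtr_eq[OF tr] P_def
      by (subst suminf_finite[of "{..<n}"]) (auto simp: ent_mat_embed trace_zero[OF tr])
    also have "\<dots> = ennreal (\<Sum>i<n. Re (\<tau> (p $$ (i, i))))"
    proof (rule sum_ennreal)
      fix i assume "i \<in> {..<n}"
      then show "0 \<le> Re (\<tau> (p $$ (i, i)))"
        using diag_nonneg(1)[OF tr cpos_projection[OF P(1,2)], of i] by (simp add: P_def ent_mat_embed)
    qed
    also have "(\<Sum>i<n. Re (\<tau> (p $$ (i, i)))) = Re (mat_trace \<tau> p)" using pc(1) by (simp add: mat_trace_def)
    finally show ?thesis by (simp add: trace)
  qed
  have mu: "mtr \<tau> ?u = 1"
  proof -
    have "mtr \<tau> ?u = (\<Sum>i\<in>{0}. ennreal (Re (\<tau> (ent ?u i i))))"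
      unfolding mtr_eq[OF tr] by (rule suminf_finite) (auto simp: ent_unit trace_zero[OF tr])
    then show ?thesis by (simp add: ent_unit trace_one[OF tr])
  qed
  have P0: "P \<noteq> 0" using mP t by (auto simp: mtr_zero[OF tr])
  have dP: "dim_fun \<tau> (ent P) = ennreal t"
    by (simp add: dim_fun_eq_her_mass[OF tr P(3) cpos_projection[OF P(1,2)] P0] her_mass_projection[OF tr P] mP)
  have du: "dim_fun \<tau> (ent ?u) = 1"
    by (simp add: dim_fun_eq_her_mass[OF tr u(3) cpos_projection[OF u(1,2)] u0] her_mass_projection[OF tr u] mu)
  have pos: "ent x \<in> tensor_K_pos - {\<lambda>i j. 0}" if "star x = x" "x * x = x" "x \<in> kset" "x \<noteq> 0" for x :: "'a stab"
  proof -
    have "ent x \<noteq> ent 0" using that(4) by (simp add: ent_inject)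
    then show ?thesis using that cpos_projection[of x] by (simp add: tensor_K_pos_eq zero_stab.rep_eq)
  qed
  show ?thesis
    unfolding fundamental_group_def mem_Collect_eq
  proof (intro conjI exI)
    show "star_isomorphic (hereditary (ent P)) (hereditary (ent ?u))"
      unfolding P_def by (rule star_isomorphic_hereditary_unit[OF p iso])
    show "dim_fun \<tau> (ent P) / dim_fun \<tau> (ent ?u) = ennreal t"
      using divide_ennreal[of t 1] t by (simp add: dP du)
  qed (use t pos[OF P P0] pos[OF u u0] in \<open>simp_all add: du\<close>)
qed

theorem proposition4p8:
  fixes \<tau> :: "'a::unital_cstar_algebra \<Rightarrow> complex"
  assumes "simple_cstar TYPE('a)"
    and "tracial_state \<tau>"
    and "\<And>\<sigma> :: 'a \<Rightarrow> complex. tracial_state \<sigma> \<Longrightarrow> \<sigma> = \<tau>"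
  shows "fundamental_group \<tau> =
    {t. 0 < t \<and> (\<exists>(n::nat) (p :: 'a mat). 1 \<le> n \<and> mat_projection n p \<and>
        star_isomorphic (mat_corner n p) (whole_algebra :: 'a star_algebra) \<and>
        mat_trace \<tau> p = complex_of_real t)}"
proof (intro equalityI subsetI)
  fix t assume t: "t \<in> fundamental_group \<tau>"
  then have "0 < t" by (simp add: fundamental_group_def)
  with fundamental_group_imp_projection[OF assms t]
  show "t \<in> {t. 0 < t \<and> (\<exists>(n::nat) (p :: 'a mat). 1 \<le> n \<and> mat_projection n p \<and>
        star_isomorphic (mat_corner n p) (whole_algebra :: 'a star_algebra) \<and>
        mat_trace \<tau> p = complex_of_real t)}" by blast
next
  fix t assume "t \<in> {t. 0 < t \<and> (\<exists>(n::nat) (p :: 'a mat). 1 \<le> n \<and> mat_projection n p \<and>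
        star_isomorphic (mat_corner n p) (whole_algebra :: 'a star_algebra) \<and>
        mat_trace \<tau> p = complex_of_real t)}"
  then show "t \<in> fundamental_group \<tau>"
    using projection_imp_fundamental_group[OF assms(2)] by blast
qed

end
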